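(* Let $p\in[1,\infty)$. The pseudometric $d_{\mathrm{TpOT},p}$ on the class $\mathcal{P}$ of measure topological networks induces a metric on the quotient space $\mathcal{P}/{\sim_w}$ of measure topological networks modulo weak isomorphism.
   Context: Diagonal conventions. Let $\Lambda=\{(a,b)\in\mathbb{R}^2: b>a>0\}$ and $\overline{\Lambda}=\Lambda\sqcup\{\partial_\Lambda\}$ (disjoint union topology), where $\partial_\Lambda$ is a virtual point representing the diagonal. For $\lambda=(a,b)$ put $\mathrm{Proj}(\lambda)=((a+b)/2,(a+b)/2)$. For $\lambda,\lambda'\in\Lambda$, $\|\lambda-\lambda'\|_p$ is the $\ell^p$ norm on $\mathbb{R}^2$; $\|\lambda-\partial_\Lambda\|_p=\|\partial_\Lambda-\lambda\|_p:=\|\lambda-\mathrm{Proj}(\lambda)\|_p$ and $\|\partial_\Lambda-\partial_\Lambda\|_p:=0$. Measure persistence diagram: a Radon measure $\sigma$ on $\Lambda$ with $\int_\Lambda\|\lambda-\mathrm{Proj}(\lambda)\|_q^q\,d\sigma(\lambda)<\infty$ for every $q\ge 1$. Measure topological network: a triple $P=((X,k,\mu),(Y,\iota,\nu),\omega)$ where $X$ is a Polish space with a fully supported Borel probability measure $\mu$; $k:X\times X\to\mathbb{R}$ is symmetric, measurable and bounded; $Y$ is a locally compact Polish space with a fully supported Radon measure $\nu$; $\iota:Y\to\Lambda$ is continuous and $\iota_\#\nu$ is a measure persistence diagram; $\omega:X\times Y\to\mathbb{R}$ is non-negative, measurable and bounded. $\mathcal{P}$ is the class of all of these. Let $\overline{Y}=Y\sqcup\{\partial_Y\}$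 (disjoint union topology, $\partial_Y$ an abstract point), and extend $\omega$ and $\iota$ by $\omega(x,\partial_Y)=0$ and $\iota(\partial_Y)=\partial_\Lambda$. Couplings: $\Pi(\mu,\mu')$ is the set of Borel probability measures on $X\times X'$ with marginals $\mu,\mu'$. $\Pi_{\mathrm{adm}}(\nu,\nu')$ is the set of Radon measures $\pi$ on $\overline{Y}\times\overline{Y'}$ that have marginals $\nu$ and $\nu'$, meaning $\pi(A\times\overline{Y'})=\nu(A)$ and $\pi(\overline{Y}\times B)=\nu'(B)$ for all Borel $A\subset Y$, $B\subset Y'$, and that satisfy $\pi(\{(\partial_Y,\partial_{Y'})\})=0$. Distance: for $P=((X,k,\mu),(Y,\iota,\nu),\omega)$ and $P'=((X',k',\mu'),(Y',\iota',\nu'),\omega')$, $$d_{\mathrm{TpOT},p}(P,P')=\inf_{\pi^v\in\Pi(\mu,\mu'),\ \pi^e\in\Pi_{\mathrm{adm}}(\nu,\nu')}\Big(\int_{\overline{Y}\times\overline{Y'}}\|\iota(y)-\iota'(y')\|_p^p\,d\pi^e(y,y')+\int_{(X\times X')^2}|k(x_1,x_2)-k'(x_1',x_2')|^p\,d\pi^v(x_1,x_1')\,d\pi^v(x_2,x_2')+\int_{X\times X'\times\overline{Y}\times\overline{Y'}}|\omega(x,y)-\omega'(x',y')|^p\,d\pi^v(x,x')\,d\pi^e(y,y')\Big)^{1/p}.$$ Weak isomorphism from $P$ to $P'$: a pair of measure-preserving maps $\phi:X\to X'$, $\psi:Y\to Y'$ with $\iota(y)=\iota'(\psi(y))$ for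 $\nu$-a.e. $y$, $\omega(x,y)=\omega'(\phi(x),\psi(y))$ for $\mu\otimes\nu$-a.e. $(x,y)$, and $k(x_1,x_2)=k'(\phi(x_1),\phi(x_2))$ for $\mu\otimes\mu$-a.e. $(x_1,x_2)$. Write $P\sim_w P'$ ($P$ and $P'$ are weakly isomorphic) if there is a measure topological network $Q$ with weak isomorphisms from $Q$ to $P$ and from $Q$ to $P'$; this is the equivalence relation used in the quotient.
   Formalization: "Metric" is proved as an extended metric with values in [0,∞], since the distance can be infinite (ω=1, infinite counting measure on Y, one-point Y'); the intermediate network Q in weak isomorphism has underlying sets of reals, which covers all Polish spaces up to homeomorphism. *)

theory Defs
  imports "HOL-Probability.Probability"
begin

text \<open>Spaces are carried by topologies on subsets of a type, so that spaces on
  different underlying sets (and the empty space, which is allowed for the space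
  \<open>Y\<close> of a network) live in one type.\<close>

definition polish_topology :: "'a topology \<Rightarrow> bool" where
  "polish_topology T \<longleftrightarrow> separable_space T \<and> completely_metrizable_space T"

definition borel_of :: "'a topology \<Rightarrow> 'a measure" where
  "borel_of T = sigma (topspace T) {U. openin T U}"

text \<open>The notion is applied only to locally compact Polish spaces, where finiteness on
  compact sets is equivalent to local finiteness.\<close>

definition radon_measure :: "'a topology \<Rightarrow> 'a measure \<Rightarrow> bool" where
  "radon_measure T M \<longleftrightarrow>
     sets M = sets (borel_of T) \<and>
     (\<forall>K. compactin T K \<longrightarrow> emeasure M K < \<infinity>) \<and>
     (\<forall>B\<in>sets M. emeasure M B = (SUP K\<in>{K. compactin T K \<and> K \<in> sets M \<and> K \<subseteq> B}. emeasure M K))"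

definition fully_supported :: "'a topology \<Rightarrow> 'a measure \<Rightarrow> bool" where
  "fully_supported T M \<longleftrightarrow> (\<forall>U. openin T U \<and> U \<noteq> {} \<longrightarrow> 0 < emeasure M U)"

text \<open>Disjoint union of a space with a single point. The added point is \<^term>\<open>None\<close>.\<close>

definition bar :: "'a topology \<Rightarrow> 'a option topology" where
  "bar T = topology (\<lambda>U. U \<subseteq> insert None (Some ` topspace T) \<and> openin T {y. Some y \<in> U})"

lemma openin_bar:
  "openin (bar T) U \<longleftrightarrow> U \<subseteq> insert None (Some ` topspace T) \<and> openin T {y. Some y \<in> U}"
proof -
  have "istopology (\<lambda>U. U \<subseteq> insert None (Some ` topspace T) \<and> openin T {y. Some y \<in> U})"
    unfolding istopology_def
  proof (intro conjI allI impI)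
    fix S R :: "'a option set"
    assume *: "S \<subseteq> insert None (Some ` topspace T) \<and> openin T {y. Some y \<in> S}"
      "R \<subseteq> insert None (Some ` topspace T) \<and> openin T {y. Some y \<in> R}"
    have "{y. Some y \<in> S \<inter> R} = {y. Some y \<in> S} \<inter> {y. Some y \<in> R}" by auto
    with * show "openin T {y. Some y \<in> S \<inter> R}" by auto
    show "S \<inter> R \<subseteq> insert None (Some ` topspace T)" using * by blast
  next
    fix \<K> :: "'a option set set"
    assume *: "\<forall>K\<in>\<K>. K \<subseteq> insert None (Some ` topspace T) \<and> openin T {y. Some y \<in> K}"
    have "{y. Some y \<in> \<Union>\<K>} = (\<Union>K\<in>\<K>. {y. Some y \<in> K})" by auto
    with * show "openin T {y. Some y \<in> \<Union>\<K>}" by auto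
    show "\<Union>\<K> \<subseteq> insert None (Some ` topspace T)" using * by blast
  qed
  then show ?thesis
    unfolding bar_def by (simp add: topology_inverse')
qed

lemma topspace_bar: "topspace (bar T) = insert None (Some ` topspace T)"
proof -
  have "{y. Some y \<in> insert None (Some ` topspace T)} = topspace T" by auto
  then have "openin (bar T) (insert None (Some ` topspace T))"
    by (simp add: openin_bar)
  then show ?thesis
    by (metis openin_bar openin_subset openin_topspace subset_antisym)
qed

definition Lam :: "(real \<times> real) set" where
  "Lam = {(a, b). b > a \<and> a > 0}"

definition Proj :: "real \<times> real \<Rightarrow> real \<times> real" where
  "Proj l = ((fst l + snd l) / 2, (fst l + snd l) / 2)"

definition lp_norm :: "real \<Rightarrow> real \<times> real \<Rightarrow> real" where
  "lp_norm p v = (\<bar>fst v\<bar> powr p + \<bar>snd v\<bar> powr p) powr (1 / p)"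

text \<open>The distance \<open>\<parallel>l - l'\<parallel>\<^sub>p\<close> on \<^term>\<open>Lam\<close> with the diagonal point \<^term>\<open>None\<close> added.\<close>

fun lam_dist :: "real \<Rightarrow> (real \<times> real) option \<Rightarrow> (real \<times> real) option \<Rightarrow> real" where
  "lam_dist p (Some l) (Some l') = lp_norm p (l - l')"
| "lam_dist p (Some l) None = lp_norm p (l - Proj l)"
| "lam_dist p None (Some l) = lp_norm p (l - Proj l)"
| "lam_dist p None None = 0"

definition measure_pd :: "(real \<times> real) measure \<Rightarrow> bool" where
  "measure_pd \<sigma> \<longleftrightarrow>
     radon_measure (top_of_set Lam) \<sigma> \<and>
     (\<forall>q::real. q \<ge> 1 \<longrightarrow> (\<integral>\<^sup>+ l. ennreal (lp_norm q (l - Proj l) powr q) \<partial>\<sigma>) < \<infinity>)"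

record ('a, 'b) network =
  X_of :: "'a topology"
  k_of :: "'a \<Rightarrow> 'a \<Rightarrow> real"
  mu_of :: "'a measure"
  Y_of :: "'b topology"
  iota_of :: "'b \<Rightarrow> real \<times> real"
  nu_of :: "'b measure"
  omega_of :: "'a \<Rightarrow> 'b \<Rightarrow> real"

definition networks :: "('a, 'b) network set" where
  "networks = {P.
     polish_topology (X_of P) \<and>
     sets (mu_of P) = sets (borel_of (X_of P)) \<and> prob_space (mu_of P) \<and>
     fully_supported (X_of P) (mu_of P) \<and>
     (\<forall>x\<in>topspace (X_of P). \<forall>x'\<in>topspace (X_of P). k_of P x x' = k_of P x' x) \<and>
     (\<lambda>(x, x'). k_of P x x') \<in> borel_measurable (borel_of (prod_topology (X_of P) (X_of P))) \<and>
     (\<exists>C. \<forall>x\<in>topspace (X_of P). \<forall>x'\<in>topspace (X_of P). \<bar>k_of P x x'\<bar> \<le> C) \<and>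
     polish_topology (Y_of P) \<and> locally_compact_space (Y_of P) \<and>
     radon_measure (Y_of P) (nu_of P) \<and> fully_supported (Y_of P) (nu_of P) \<and>
     continuous_map (Y_of P) (top_of_set Lam) (iota_of P) \<and>
     measure_pd (distr (nu_of P) (borel_of (top_of_set Lam)) (iota_of P)) \<and>
     (\<forall>x\<in>topspace (X_of P). \<forall>y\<in>topspace (Y_of P). 0 \<le> omega_of P x y) \<and>
     (\<lambda>(x, y). omega_of P x y) \<in> borel_measurable (borel_of (prod_topology (X_of P) (Y_of P))) \<and>
     (\<exists>C. \<forall>x\<in>topspace (X_of P). \<forall>y\<in>topspace (Y_of P). omega_of P x y \<le> C)}"

definition iota_bar :: "('a, 'b) network \<Rightarrow> 'b option \<Rightarrow> (real \<times> real) option" where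
  "iota_bar P = map_option (iota_of P)"

definition omega_bar :: "('a, 'b) network \<Rightarrow> 'a \<Rightarrow> 'b option \<Rightarrow> real" where
  "omega_bar P x y = (case y of None \<Rightarrow> 0 | Some y' \<Rightarrow> omega_of P x y')"

definition couplings :: "('a, 'b) network \<Rightarrow> ('c, 'd) network \<Rightarrow> ('a \<times> 'c) measure set" where
  "couplings P P' = {\<pi>.
     sets \<pi> = sets (borel_of (prod_topology (X_of P) (X_of P'))) \<and> prob_space \<pi> \<and>
     distr \<pi> (mu_of P) fst = mu_of P \<and> distr \<pi> (mu_of P') snd = mu_of P'}"

definition adm_couplings ::
  "('a, 'b) network \<Rightarrow> ('c, 'd) network \<Rightarrow> ('b option \<times> 'd option) measure set" where
  "adm_couplings P P' = {\<pi>.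
     radon_measure (prod_topology (bar (Y_of P)) (bar (Y_of P'))) \<pi> \<and>
     (\<forall>A\<in>sets (borel_of (Y_of P)).
        emeasure \<pi> (Some ` A \<times> topspace (bar (Y_of P'))) = emeasure (nu_of P) A) \<and>
     (\<forall>B\<in>sets (borel_of (Y_of P')).
        emeasure \<pi> (topspace (bar (Y_of P)) \<times> Some ` B) = emeasure (nu_of P') B) \<and>
     emeasure \<pi> {(None, None)} = 0}"

definition ennreal_root :: "real \<Rightarrow> ennreal \<Rightarrow> ennreal" where
  "ennreal_root p x = (if x = \<infinity> then \<infinity> else ennreal (enn2real x powr (1 / p)))"

definition TpOT_cost ::
  "real \<Rightarrow> ('a, 'b) network \<Rightarrow> ('c, 'd) network \<Rightarrow>
   ('a \<times> 'c) measure \<Rightarrow> ('b option \<times> 'd option) measure \<Rightarrow> ennreal" where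
  "TpOT_cost p P P' \<pi>v \<pi>e =
     (\<integral>\<^sup>+ (y, y'). ennreal (lam_dist p (iota_bar P y) (iota_bar P' y') powr p) \<partial>\<pi>e)
   + (\<integral>\<^sup>+ ((x1, x1'), (x2, x2')). ennreal (\<bar>k_of P x1 x2 - k_of P' x1' x2'\<bar> powr p) \<partial>(\<pi>v \<Otimes>\<^sub>M \<pi>v))
   + (\<integral>\<^sup>+ ((x, x'), (y, y')). ennreal (\<bar>omega_bar P x y - omega_bar P' x' y'\<bar> powr p) \<partial>(\<pi>v \<Otimes>\<^sub>M \<pi>e))"

text \<open>The infimum can be infinite, already for \<open>\<omega> = 1\<close> on an infinite discrete \<open>Y\<close>
  with counting measure and \<open>Y'\<close> empty: then infinite mass is sent to the diagonal point,
  and the last integral diverges. Hence the distance takes values in \<^typ>\<open>ennreal\<close>.\<close>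

definition d_TpOT :: "real \<Rightarrow> ('a, 'b) network \<Rightarrow> ('c, 'd) network \<Rightarrow> ennreal" where
  "d_TpOT p P P' =
     (INF (\<pi>v, \<pi>e) \<in> couplings P P' \<times> adm_couplings P P'.
        ennreal_root p (TpOT_cost p P P' \<pi>v \<pi>e))"

definition extended_metric_on :: "'s set \<Rightarrow> ('s \<Rightarrow> 's \<Rightarrow> ennreal) \<Rightarrow> bool" where
  "extended_metric_on S D \<longleftrightarrow>
     (\<forall>x\<in>S. \<forall>y\<in>S. D x y = 0 \<longleftrightarrow> x = y) \<and>
     (\<forall>x\<in>S. \<forall>y\<in>S. D x y = D y x) \<and>
     (\<forall>x\<in>S. \<forall>y\<in>S. \<forall>z\<in>S. D x z \<le> D x y + D y z)"

definition measure_preserving_map :: "'a measure \<Rightarrow> 'b measure \<Rightarrow> ('a \<Rightarrow> 'b) \<Rightarrow> bool" where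
  "measure_preserving_map M N f \<longleftrightarrow> f \<in> measurable M N \<and> distr M N f = N"

definition is_weak_iso ::
  "('a, 'b) network \<Rightarrow> ('c, 'd) network \<Rightarrow> ('a \<Rightarrow> 'c) \<Rightarrow> ('b \<Rightarrow> 'd) \<Rightarrow> bool" where
  "is_weak_iso P P' \<phi> \<psi> \<longleftrightarrow>
     measure_preserving_map (mu_of P) (mu_of P') \<phi> \<and>
     measure_preserving_map (nu_of P) (nu_of P') \<psi> \<and>
     (AE y in nu_of P. iota_of P y = iota_of P' (\<psi> y)) \<and>
     (AE (x, y) in mu_of P \<Otimes>\<^sub>M nu_of P. omega_of P x y = omega_of P' (\<phi> x) (\<psi> y)) \<and>
     (AE (x1, x2) in mu_of P \<Otimes>\<^sub>M mu_of P. k_of P x1 x2 = k_of P' (\<phi> x1) (\<phi> x2))"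

text \<open>The intermediate network ranges over all networks whose underlying sets are
  sets of reals. This is no restriction: a Polish space has at most the
  cardinality of the continuum, so every network has a copy of this form, related to it
  by homeomorphisms. The types of the two outer networks stay arbitrary.\<close>

definition weakly_isomorphic :: "('a, 'b) network \<Rightarrow> ('c, 'd) network \<Rightarrow> bool" where
  "weakly_isomorphic P P' \<longleftrightarrow>
     (\<exists>Q \<in> (networks :: (real, real) network set).
        (\<exists>\<phi> \<psi>. is_weak_iso Q P \<phi> \<psi>) \<and> (\<exists>\<phi>' \<psi>'. is_weak_iso Q P' \<phi>' \<psi>'))"

definition weak_iso_rel :: "(('a, 'b) network \<times> ('a, 'b) network) set" where
  "weak_iso_rel = {(P, P'). P \<in> networks \<and> P' \<in> networks \<and> weakly_isomorphic P P'}"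

end

theory Submission
  imports Defs
begin

text \<open>Every Polish space is coded by a Borel subset of Cantor space, on which measures are given by
  their weights on cylinders. Disintegrating in this coding glues couplings along a common
  marginal, where an edge coupling is completed at the two diagonal points, and the convexity
  inequality \<open>(a + b)\<^sup>p \<le> s\<^sup>1\<^sup>-\<^sup>p a\<^sup>p + (1 - s)\<^sup>1\<^sup>-\<^sup>p b\<^sup>p\<close> then gives the triangle inequality. Also by
  diagonal extraction over cylinders, couplings of two finite measures have subsequences that
  converge on all measurable rectangles, even though the data of a network are only measurable. Edge
  couplings may be infinite, so they are first weighted by the truncated persistences of both
  coordinates; at cost tending to 0 the limit is concentrated off the diagonal and, once divided
  by the weight, couples the edge measures exactly. Hence distance 0 is attained by a coupling
  along which all data agree almost everywhere, and this coupling, restricted to its support, is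
  a network with weak isomorphisms to both sides. Thus distance 0 is weak isomorphism, and the
  remaining claims follow from the pseudometric properties.\<close>

text \<open>The data of a network need not be continuous, so weak convergence of couplings says
  nothing about them. Convergence on all rectangles is enough: where F < c and F' > d with c < d, a
  small cost forces small mass, and this bound passes to the limit. Such strong convergence comes
  from marginals dominated by one fixed finite measure, which makes countable sums converge
  uniformly along the sequence. Edge couplings may have infinite marginals, and their mass at the
  diagonal points is not controlled. The product of the two truncated persistences cures both: it
  vanishes on the diagonal, and it is at most either factor, which is integrable by the case of
  exponent 1 in the diagram condition. Before the limit the two factors differ, but by at most twice
  the ground distance, which the cost controls. The triangle inequality has its own obstacle, since
  it fails for paths through the diagonal from one proper point to another; the glued coupling must
  avoid them. With s = a / (a + b) the convexity inequality gives exactly (a + b)^p and treats all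
  three integrals alike, though they live on different spaces.\<close>

section \<open>Borel sets of topologies and of Polish spaces\<close>

lemma space_borel_of [simp]: "space (borel_of T) = topspace T"
  unfolding borel_of_def by (rule space_measure_of) (auto dest: openin_subset)

lemma sets_borel_of: "sets (borel_of T) = sigma_sets (topspace T) {U. openin T U}"
  unfolding borel_of_def by (rule sets_measure_of) (auto dest: openin_subset)

lemma openin_borel_of: "openin T U \<Longrightarrow> U \<in> sets (borel_of T)"
  by (simp add: sets_borel_of sigma_sets.Basic)

lemma closedin_borel_of: "closedin T U \<Longrightarrow> U \<in> sets (borel_of T)"
proof -
  assume U: "closedin T U"
  have "topspace T - (topspace T - U) \<in> sets (borel_of T)"
    using openin_borel_of[of T "topspace T - U"] U
    by (metis openin_closedin_eq openin_diff openin_topspace sets.compl_sets space_borel_of)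
  then show ?thesis
    using closedin_subset[OF U] by (simp add: double_diff)
qed

lemma measurable_borel_of:
  assumes "\<And>x. x \<in> space M \<Longrightarrow> f x \<in> topspace T"
    and "\<And>U. openin T U \<Longrightarrow> f -` U \<inter> space M \<in> sets M"
  shows "f \<in> M \<rightarrow>\<^sub>M borel_of T"
  unfolding borel_of_def
  using assms by (intro measurable_sigma_sets[OF _ _ _]) 
    (auto simp: sets_borel_of[unfolded borel_of_def] dest: openin_subset intro!: measurable_measure_of)

lemma continuous_map_measurable:
  assumes "continuous_map S T f"
  shows "f \<in> borel_of S \<rightarrow>\<^sub>M borel_of T"
proof (rule measurable_borel_of)
  fix U assume "openin T U"
  then have "openin S {x \<in> topspace S. f x \<in> U}"
    using assms openin_continuous_map_preimage by blast
  moreover have "{x \<in> topspace S. f x \<in> U} = f -` U \<inter> space (borel_of S)" by auto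
  ultimately show "f -` U \<inter> space (borel_of S) \<in> sets (borel_of S)"
    using openin_borel_of by metis
qed (use assms in \<open>auto simp: continuous_map_def\<close>)

lemma sets_borel_of_euclidean: "sets (borel_of euclidean) = sets borel"
  by (simp add: sets_borel_of borel_def)

lemma sets_borel_of_top_of_set: "S \<in> sets borel \<Longrightarrow> sets (borel_of (top_of_set S)) = sets (restrict_space borel S)"
proof -
  assume "S \<in> sets borel"
  then have "S \<in> sigma_sets UNIV {U. open U}" by (simp add: borel_def)
  then have "sets (restrict_space borel S) = sigma_sets S ((\<inter>) S ` {U. open U})"
    unfolding sets_restrict_space by (subst sigma_sets_Int[symmetric]) (auto simp: borel_def)
  also have "(\<inter>) S ` {U. open U} = {U. openin (top_of_set S) U}"
    by (auto simp: openin_open)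
  finally show ?thesis by (simp add: sets_borel_of)
qed

text \<open>Continuity of the projections gives one inclusion. In the other, second countability is
  decisive: an open set is a countable union of products of basic open sets.\<close>

lemma sets_borel_of_prod:
  assumes "second_countable S" "second_countable T"
  shows "sets (borel_of (prod_topology S T)) = sets (borel_of S \<Otimes>\<^sub>M borel_of T)"
proof
  show "sets (borel_of S \<Otimes>\<^sub>M borel_of T) \<subseteq> sets (borel_of (prod_topology S T))"
  proof -
    have "(\<lambda>x. x) \<in> borel_of (prod_topology S T) \<rightarrow>\<^sub>M borel_of S \<Otimes>\<^sub>M borel_of T"
      by (rule measurable_pair)
        (auto simp: comp_def intro!: continuous_map_measurable continuous_map_fst continuous_map_snd)
    note meas = this
    have "A \<inter> space (borel_of (prod_topology S T)) \<in> sets (borel_of (prod_topology S T))"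
      if "A \<in> sets (borel_of S \<Otimes>\<^sub>M borel_of T)" for A
      using measurable_sets[OF meas that] by (simp add: vimage_def)
    moreover have "A \<subseteq> space (borel_of (prod_topology S T))"
      if "A \<in> sets (borel_of S \<Otimes>\<^sub>M borel_of T)" for A
      using sets.sets_into_space[OF that] by (simp add: space_pair_measure)
    ultimately show ?thesis by (metis inf.absorb1 subsetI)
  qed
  obtain \<A> where A: "countable \<A>" "\<And>V. V \<in> \<A> \<Longrightarrow> openin S V"
    "\<And>U x. openin S U \<Longrightarrow> x \<in> U \<Longrightarrow> \<exists>V\<in>\<A>. x \<in> V \<and> V \<subseteq> U"
    using assms(1) unfolding second_countable_def by metis
  obtain \<B> where B: "countable \<B>" "\<And>V. V \<in> \<B> \<Longrightarrow> openin T V"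
    "\<And>U x. openin T U \<Longrightarrow> x \<in> U \<Longrightarrow> \<exists>V\<in>\<B>. x \<in> V \<and> V \<subseteq> U"
    using assms(2) unfolding second_countable_def by metis
  have "U \<in> sets (borel_of S \<Otimes>\<^sub>M borel_of T)" if U: "openin (prod_topology S T) U" for U
  proof -
    define K where "K = (\<lambda>(a, b). a \<times> b) ` {(a, b) \<in> \<A> \<times> \<B>. a \<times> b \<subseteq> U}"
    have "U = \<Union> K" unfolding K_def
    proof (intro set_eqI iffI)
      fix z assume z: "z \<in> U"
      obtain x y where xy: "z = (x, y)" by fastforce
      obtain V W where VW: "openin S V" "openin T W" "x \<in> V" "y \<in> W" "V \<times> W \<subseteq> U"
        using U z xy unfolding openin_prod_topology_alt by meson
      obtain a where a: "a \<in> \<A>" "x \<in> a" "a \<subseteq> V" using A(3) VW by blast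
      obtain b where b: "b \<in> \<B>" "y \<in> b" "b \<subseteq> W" using B(3) VW by blast
      have "a \<times> b \<subseteq> U" using a b VW(5) by blast
      then show "z \<in> (\<Union>(a, b)\<in>{(a, b) \<in> \<A> \<times> \<B>. a \<times> b \<subseteq> U}. a \<times> b)" using a b xy by blast
    qed auto
    moreover have "countable K" unfolding K_def
      by (intro countable_image countable_subset[OF _ countable_SIGMA[OF A(1) B(1)]]) auto
    moreover have "K \<subseteq> sets (borel_of S \<Otimes>\<^sub>M borel_of T)"
      unfolding K_def using A(2) B(2) by (auto intro!: pair_measureI openin_borel_of)
    ultimately show ?thesis
      using sets.countable_Union[of K "borel_of S \<Otimes>\<^sub>M borel_of T"] by simp
  qed
  then show "sets (borel_of (prod_topology S T)) \<subseteq> sets (borel_of S \<Otimes>\<^sub>M borel_of T)"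
    using sets.sigma_sets_subset[of "{U. openin (prod_topology S T) U}" "borel_of S \<Otimes>\<^sub>M borel_of T"]
    by (auto simp: space_pair_measure sets_borel_of[of "prod_topology S T"])
qed

text \<open>Polish spaces and the one-point extensions \<^const>\<open>bar\<close> both have this property; it
  yields regularity and standard Borel codings at once.\<close>

definition seq_embedding :: "'a topology \<Rightarrow> ('a \<Rightarrow> nat \<Rightarrow> real) \<Rightarrow> bool" where
  "seq_embedding T e \<longleftrightarrow> embedding_map T euclidean e \<and> e ` topspace T \<in> sets borel"

lemma gdelta_in_euclidean_borel: "gdelta_in euclidean S \<Longrightarrow> S \<in> sets borel"
proof -
  assume "gdelta_in euclidean S"
  then obtain U where "countable U" "U \<subseteq> Collect open" "S = \<Inter>U"
    unfolding gdelta_in_def intersection_of_def relative_to_def by auto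
  moreover from this have "(\<Inter>u\<in>U. u) \<in> sets borel"
    by (intro sets.countable_INT'') auto
  ultimately show ?thesis by simp
qed

text \<open>Distances to a dense sequence embed the space in the real sequences. The image is
  completely metrizable, hence a G-delta set in a metrizable space, hence Borel.\<close>

lemma polish_seq_embedding:
  assumes "polish_topology T"
  obtains e where "seq_embedding T e"
proof (cases "topspace T = {}")
  case True
  then have "seq_embedding T (\<lambda>_ _. 0)"
    by (auto simp: seq_embedding_def embedding_map_def homeomorphic_map_def quotient_map_def
      dest: openin_subset)
  then show ?thesis using that by blast
next
  case False
  obtain M d where M: "Metric_space M d" "Metric_space.mcomplete M d" "T = Metric_space.mtopology M d"
    using assms unfolding polish_topology_def completely_metrizable_space_def by blast
  interpret Metric_space M d by fact
  obtain C where C: "countable C" "C \<subseteq> M" "mtopology closure_of C = M"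
    using assms M(3) unfolding polish_topology_def separable_space_def by auto
  have "C \<noteq> {}" using C False M(3) by auto
  then obtain a :: "nat \<Rightarrow> _" where a: "range a = C"
    using C(1) uncountable_def by metis
  have aM: "a n \<in> M" for n using a C(2) by blast
  define e where "e x n = d x (a n)" for x n
  have dense: "\<exists>n. d x (a n) < r" if "x \<in> M" "r > 0" for x r
  proof -
    have "x \<in> mtopology closure_of C" using C that by simp
    then show ?thesis using that a unfolding metric_closure_of by force
  qed
  have cont: "continuous_map T euclidean e"
  proof -
    have "continuous_map mtopology euclidean (\<lambda>x. d x (a n))" for n
      using continuous_map_mdist[of mtopology "metric (M, d)" "\<lambda>x. x" "\<lambda>_. a n"] aM by simp
    then show ?thesis
      unfolding euclidean_product_topology[symmetric] continuous_map_componentwise_UNIV e_def M(3) by blast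
  qed
  have inj: "inj_on e M"
  proof (rule inj_onI, rule ccontr)
    fix x y assume xy: "x \<in> M" "y \<in> M" "e x = e y" "x \<noteq> y"
    then obtain n where "d x (a n) < d x y / 2" using dense[of x "d x y / 2"] by auto
    moreover have "d x (a n) = d y (a n)" using xy(3) unfolding e_def by metis
    ultimately show False using triangle'[of x "a n" y] triangle[of x "a n" y] xy aM commute
      by (smt (verit) field_sum_of_halves)
  qed
  have op: "openin (top_of_set (e ` M)) (e ` U)" if U: "openin T U" for U
  proof -
    have UM: "U \<subseteq> M" using U M(3) openin_mtopology by auto
    \<comment> \<open>Inside the image, \<open>z n < q\<close> says that the point lies in the ball
      of radius \<open>q\<close> about \<open>a n\<close>; by density, the balls of this kind
      contained in \<open>U\<close> cover \<open>U\<close>.\<close>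
    define W where "W = \<Union> {{z. z n < q} | n q. mball (a n) q \<subseteq> U}"
    have "open {z :: nat \<Rightarrow> real. z n < q}" for n q
      by (intro open_Collect_less continuous_intros continuous_on_product_coordinates)
    then have "open W" unfolding W_def by auto
    moreover have "e ` U = e ` M \<inter> W"
    proof (intro set_eqI iffI)
      fix z assume "z \<in> e ` U"
      then obtain x where x: "x \<in> U" "z = e x" by auto
      obtain r where r: "r > 0" "mball x r \<subseteq> U" using U x M(3) openin_mtopology by auto
      obtain n where n: "d x (a n) < r / 2" using dense[of x "r / 2"] x UM r by auto
      have "mball (a n) (r / 2) \<subseteq> mball x r"
        using n x UM aM by (intro mball_subset) (auto simp: commute)
      then have "mball (a n) (r / 2) \<subseteq> U" using r by blast
      moreover have "z n < r / 2" using n x by (simp add: e_def)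
      ultimately show "z \<in> e ` M \<inter> W" using x UM unfolding W_def by blast
    next
      fix z assume "z \<in> e ` M \<inter> W"
      then obtain x n q where "x \<in> M" "z = e x" "mball (a n) q \<subseteq> U" "z n < q"
        unfolding W_def by auto
      then show "z \<in> e ` U" using aM by (auto simp: e_def commute)
    qed
    ultimately show ?thesis by (auto simp: openin_open)
  qed
  have "homeomorphic_map T (subtopology euclidean (e ` topspace T)) e"
    using cont inj op M(3)
    by (intro bijective_open_imp_homeomorphic_map)
      (auto simp: continuous_map_in_subtopology open_map_def)
  then have emb: "embedding_map T euclidean e" unfolding embedding_map_def .
  then have "T homeomorphic_space (top_of_set (e ` topspace T))"
    using embedding_map_imp_homeomorphic_space by blast
  then have "completely_metrizable_space (top_of_set (e ` topspace T))"
    using assms homeomorphic_completely_metrizable_space unfolding polish_topology_def by blast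
  then have "gdelta_in euclidean (e ` topspace T)"
    by (intro completely_metrizable_space_imp_gdelta_in) (auto intro: metrizable_space_euclidean)
  with emb have "seq_embedding T e" unfolding seq_embedding_def using gdelta_in_euclidean_borel by blast
  then show ?thesis using that by blast
qed

lemma second_countable_euclidean: "second_countable (euclidean :: 'a::second_countable_topology topology)"
proof -
  obtain B :: "'a set set" where "countable B" "topological_basis B" using ex_countable_basis by blast
  then show ?thesis unfolding second_countable_def
    by (metis open_openin topological_basisE topological_basis_open)
qed

lemma seq_embedding_second_countable: "seq_embedding T e \<Longrightarrow> second_countable T"
  unfolding seq_embedding_def
  using embedding_map_imp_homeomorphic_space homeomorphic_space_second_countability
    second_countable_euclidean second_countable_subtopology by blast

lemma polish_second_countable: "polish_topology T \<Longrightarrow> second_countable T"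
  using polish_seq_embedding seq_embedding_second_countable by metis

lemma polish_prod:
  assumes "polish_topology S" "polish_topology T"
  shows "polish_topology (prod_topology S T)"
proof -
  obtain \<A> where A: "countable \<A>" "\<And>V. V \<in> \<A> \<Longrightarrow> openin S V"
    "\<And>U x. openin S U \<Longrightarrow> x \<in> U \<Longrightarrow> \<exists>V\<in>\<A>. x \<in> V \<and> V \<subseteq> U"
    using polish_second_countable[OF assms(1)] unfolding second_countable_def by metis
  obtain \<B> where B: "countable \<B>" "\<And>V. V \<in> \<B> \<Longrightarrow> openin T V"
    "\<And>U x. openin T U \<Longrightarrow> x \<in> U \<Longrightarrow> \<exists>V\<in>\<B>. x \<in> V \<and> V \<subseteq> U"
    using polish_second_countable[OF assms(2)] unfolding second_countable_def by metis
  have "second_countable (prod_topology S T)"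
    unfolding second_countable_def
  proof (intro exI[of _ "(\<lambda>(a, b). a \<times> b) ` (\<A> \<times> \<B>)"] conjI allI impI ballI)
    fix U z assume "openin (prod_topology S T) U \<and> z \<in> U"
    then obtain V W where "openin S V" "openin T W" "fst z \<in> V" "snd z \<in> W" "V \<times> W \<subseteq> U"
      unfolding openin_prod_topology_alt by (metis prod.collapse)
    moreover from this obtain a b where "a \<in> \<A>" "fst z \<in> a" "a \<subseteq> V" "b \<in> \<B>" "snd z \<in> b" "b \<subseteq> W"
      using A(3) B(3) by meson
    ultimately show "\<exists>V\<in>(\<lambda>(a, b). a \<times> b) ` (\<A> \<times> \<B>). z \<in> V \<and> V \<subseteq> U"
      by (intro bexI[of _ "a \<times> b"]) (auto simp: mem_Times_iff)
  qed (use A B in \<open>auto simp: openin_prod_Times_iff\<close>)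
  then show ?thesis
    using assms completely_metrizable_space_prod_topology[of S T]
    unfolding polish_topology_def by (blast intro: second_countable_imp_separable_space)
qed

lemma polish_closed_subtopology:
  assumes "polish_topology T" "closedin T S"
  shows "polish_topology (subtopology T S)"
  using assms completely_metrizable_space_closedin polish_second_countable
    second_countable_imp_separable_space second_countable_subtopology
  unfolding polish_topology_def by metis

lemma polish_homeomorphic:
  "S homeomorphic_space T \<Longrightarrow> polish_topology S \<longleftrightarrow> polish_topology T"
  unfolding polish_topology_def
  using homeomorphic_completely_metrizable_space homeomorphic_separable_space by metis

section \<open>The extension by the diagonal point\<close>

lemma continuous_map_bar:
  "continuous_map (bar T) S f \<longleftrightarrow> continuous_map T S (f \<circ> Some) \<and> f None \<in> topspace S"
proof -
  have "{x. Some x \<in> topspace (bar T) \<and> f (Some x) \<in> U} = {x \<in> topspace T. (f \<circ> Some) x \<in> U}" for U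
    by (auto simp: topspace_bar)
  then show ?thesis
    unfolding continuous_map_def openin_bar
    by (auto simp: topspace_bar Pi_iff)
qed

lemma continuous_map_Some: "continuous_map T (bar T) Some"
  unfolding continuous_map_def by (auto simp: topspace_bar openin_bar cong: conj_cong)
     (metis (no_types, lifting) Collect_cong inf.absorb_iff2 Int_def mem_Collect_eq openin_subset subsetD)

text \<open>The extension is modelled on the closed subset \<open>S\<close> of the product of a
  two-point discrete space with \<open>T\<close>: a copy of \<open>T\<close> at \<open>True\<close>
  and a single point at \<open>False\<close>.\<close>

lemma polish_bar:
  assumes T: "polish_topology T"
  shows "polish_topology (bar T)"
proof (cases "topspace T = {}")
  \<comment> \<open>Without a point \<open>y0\<close> to pair with \<open>False\<close>, the
    extension is a discrete one-point space.\<close>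
  case True
  then have "bar T = discrete_topology {None}"
    unfolding topology_eq openin_bar by auto
  then show ?thesis
    by (simp add: polish_topology_def completely_metrizable_space_discrete_topology
        separable_space_discrete_topology)
next
  case False
  then obtain y0 where y0: "y0 \<in> topspace T" by blast
  let ?P = "prod_topology (discrete_topology (UNIV :: bool set)) T"
  define S where "S = ({True} \<times> topspace T) \<union> {(False, y0)}"
  define f where "f = (\<lambda>y. case y of None \<Rightarrow> (False, y0) | Some y \<Rightarrow> (True, y))"
  define g where "g = (\<lambda>(b, y :: 'a). if b then Some y else None)"
  have haus: "Hausdorff_space T"
    using T unfolding polish_topology_def
    by (simp add: completely_metrizable_imp_metrizable_space metrizable_imp_Hausdorff_space)
  have clo: "closedin ?P S"
  proof -
    have "S = {True} \<times> topspace T \<union> {False} \<times> {y0}" unfolding S_def by auto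
    moreover have "closedin T {y0}" using haus y0 by (simp add: Hausdorff_imp_t1_space closedin_t1_singleton)
    moreover from this have "closedin ?P ({True} \<times> topspace T)" "closedin ?P ({False} \<times> {y0})"
      unfolding closedin_prod_Times_iff by simp_all
    ultimately show ?thesis by (metis closedin_Un)
  qed
  have SP: "S \<subseteq> topspace ?P" by (rule closedin_subset[OF clo])
  then have TS: "topspace (subtopology ?P S) = S" by (rule topspace_subtopology_subset)
  have "homeomorphic_maps (bar T) (subtopology ?P S) f g"
    unfolding homeomorphic_maps_def
  proof (intro conjI ballI)
    have "continuous_map T ?P (\<lambda>y. (True, y))"
      by (auto simp: continuous_map_paired)
    then show "continuous_map (bar T) (subtopology ?P S) f"
      unfolding continuous_map_in_subtopology continuous_map_bar
      using y0 by (auto simp: f_def o_def topspace_bar S_def)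
    show "continuous_map (subtopology ?P S) (bar T) g"
      unfolding continuous_map_def
    proof (intro conjI allI impI)
      show "g \<in> topspace (subtopology ?P S) \<rightarrow> topspace (bar T)"
        unfolding TS using y0 by (auto simp: g_def S_def topspace_bar)
      fix U assume U: "openin (bar T) U"
      let ?W = "{True} \<times> {y. Some y \<in> U} \<union> {False} \<times> (if None \<in> U then topspace T else {})"
      have "openin ?P ?W"
        using U unfolding openin_bar by (intro openin_Un) (auto simp: openin_prod_Times_iff)
      then have "openin (subtopology ?P S) (S \<inter> ?W)"
        by (rule openin_subtopology_Int2)
      moreover have "{x \<in> S. g x \<in> U} = S \<inter> ?W"
        unfolding g_def S_def using y0 by (cases "None \<in> U") auto
      ultimately show "openin (subtopology ?P S) {x \<in> topspace (subtopology ?P S). g x \<in> U}"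
        unfolding TS by simp
    qed
    show "g (f x) = x" for x by (auto simp: f_def g_def split: option.splits)
    show "f (g y) = y" if "y \<in> topspace (subtopology ?P S)" for y
      using that unfolding TS by (auto simp: f_def g_def S_def)
  qed
  then have "bar T homeomorphic_space subtopology ?P S"
    unfolding homeomorphic_space_def by blast
  moreover have "polish_topology (discrete_topology (UNIV :: bool set))"
    by (simp add: polish_topology_def completely_metrizable_space_discrete_topology
        separable_space_discrete_topology)
  ultimately show ?thesis
    using polish_homeomorphic polish_closed_subtopology[OF polish_prod[OF _ T] clo] by blast
qed

lemma Some_image_borel_of:
  "A \<in> sets (borel_of T) \<Longrightarrow> Some ` A \<in> sets (borel_of (bar T))"
proof -
  have "openin (bar T) (Some ` topspace T)" by (auto simp: openin_bar image_iff)
  then have 1: "Some ` topspace T \<in> sets (borel_of (bar T))" by (rule openin_borel_of)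
  show "Some ` A \<in> sets (borel_of (bar T))" if "A \<in> sets (borel_of T)"
    using that unfolding sets_borel_of[of T]
  proof induction
    case (Basic a)
    then show ?case by (intro openin_borel_of) (auto simp: openin_bar image_iff dest: openin_subset)
  next
    case (Compl a)
    have "Some ` (topspace T - a) = Some ` topspace T - Some ` a" by auto
    then show ?case using Compl 1 by simp
  next
    case (Union a)
    then show ?case by (simp add: image_UN)
  qed simp
qed

lemma None_borel_of: "{None} \<in> sets (borel_of (bar T))"
  by (rule openin_borel_of) (auto simp: openin_bar)

text \<open>The added point is isolated, so measurability is a matter of the proper points
  alone.\<close>

lemma measurable_bar_iff:
  "f \<in> borel_of (bar T) \<rightarrow>\<^sub>M M \<longleftrightarrow> (f \<circ> Some) \<in> borel_of T \<rightarrow>\<^sub>M M \<and> f None \<in> space M"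
proof
  assume f: "f \<in> borel_of (bar T) \<rightarrow>\<^sub>M M"
  then have "f None \<in> space M" by (rule measurable_space) (simp add: topspace_bar)
  moreover have "f \<circ> Some \<in> borel_of T \<rightarrow>\<^sub>M M"
    using measurable_comp[OF continuous_map_measurable[OF continuous_map_Some] f] .
  ultimately show "(f \<circ> Some) \<in> borel_of T \<rightarrow>\<^sub>M M \<and> f None \<in> space M" by blast
next
  assume f: "(f \<circ> Some) \<in> borel_of T \<rightarrow>\<^sub>M M \<and> f None \<in> space M"
  show "f \<in> borel_of (bar T) \<rightarrow>\<^sub>M M"
  proof (rule measurableI)
    fix x assume "x \<in> space (borel_of (bar T))"
    then show "f x \<in> space M"
      using f measurable_space[of "f \<circ> Some" "borel_of T" M] by (auto simp: topspace_bar)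
  next
    fix A assume A: "A \<in> sets M"
    have "f -` A \<inter> space (borel_of (bar T))
      = Some ` ((f \<circ> Some) -` A \<inter> space (borel_of T)) \<union> (if f None \<in> A then {None} else {})"
      by (auto simp: topspace_bar)
    also have "\<dots> \<in> sets (borel_of (bar T))"
      using f A by (auto intro!: Some_image_borel_of None_borel_of measurable_sets[OF _ A]
          sets.Un[of "{None}", simplified] simp del: space_borel_of)
    finally show "f -` A \<inter> space (borel_of (bar T)) \<in> sets (borel_of (bar T))" .
  qed
qed

text \<open>Carries questions about a Polish space to a Borel set of real sequences, where the
  theory of \<open>borel\<close> applies.\<close>

lemma polish_borel_coordinates:
  assumes "polish_topology T"
  obtains e :: "'a \<Rightarrow> nat \<Rightarrow> real" and g E where "E \<in> sets borel" "homeomorphic_maps T (top_of_set E) e g"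
    "e \<in> borel_of T \<rightarrow>\<^sub>M borel" "g \<in> restrict_space borel E \<rightarrow>\<^sub>M borel_of T"
    "\<And>x. x \<in> topspace T \<Longrightarrow> e x \<in> E \<and> g (e x) = x"
    "\<And>z. z \<in> E \<Longrightarrow> g z \<in> topspace T \<and> e (g z) = z"
proof -
  obtain e where e: "seq_embedding T e" using polish_seq_embedding[OF assms] .
  define E where "E = e ` topspace T"
  have E: "E \<in> sets borel" using e unfolding seq_embedding_def E_def by blast
  obtain g where g: "homeomorphic_maps T (top_of_set E) e g"
    using e unfolding seq_embedding_def embedding_map_def E_def homeomorphic_map_maps by blast
  have ce: "continuous_map T (top_of_set E) e" "continuous_map (top_of_set E) T g"
    using g unfolding homeomorphic_maps_def by auto
  have "continuous_map T euclidean e" using ce(1) continuous_map_in_subtopology by blast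
  then have "e \<in> borel_of T \<rightarrow>\<^sub>M borel_of euclidean" by (rule continuous_map_measurable)
  then have "e \<in> borel_of T \<rightarrow>\<^sub>M borel"
    by (simp cong: measurable_cong_sets add: sets_borel_of_euclidean)
  moreover have "g \<in> restrict_space borel E \<rightarrow>\<^sub>M borel_of T"
    using continuous_map_measurable[OF ce(2)] sets_borel_of_top_of_set[OF E]
    by (simp cong: measurable_cong_sets)
  moreover have "\<And>x. x \<in> topspace T \<Longrightarrow> e x \<in> E \<and> g (e x) = x"
    using g unfolding homeomorphic_maps_def E_def by auto
  moreover have "\<And>z. z \<in> E \<Longrightarrow> g z \<in> topspace T \<and> e (g z) = z"
    using g ce(2) unfolding homeomorphic_maps_def continuous_map_def by auto
  ultimately show ?thesis using that E g by blast
qed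

section \<open>Inner regularity and Radon measures\<close>

lemma compactin_borel_of:
  assumes "polish_topology T" "compactin T K" shows "K \<in> sets (borel_of T)"
  using assms unfolding polish_topology_def
  by (meson closedin_borel_of compactin_imp_closedin completely_metrizable_imp_metrizable_space
      metrizable_imp_Hausdorff_space)

text \<open>The image measure on the real sequences is inner regular, and compact subsets of the
  image of \<open>B\<close> come back as compact sets through the continuous inverse
  \<open>g\<close>.\<close>

lemma polish_inner_regular_finite:
  assumes T: "polish_topology T" and M: "sets M = sets (borel_of T)"
    and fin: "emeasure M (space M) \<noteq> \<infinity>" and B: "B \<in> sets M"
  shows "emeasure M B = (SUP K\<in>{K. compactin T K \<and> K \<subseteq> B}. emeasure M K)"
proof -
  obtain e :: "'a \<Rightarrow> nat \<Rightarrow> real" and g E where eg: "E \<in> sets borel" "homeomorphic_maps T (top_of_set E) e g"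
    "e \<in> borel_of T \<rightarrow>\<^sub>M borel" "g \<in> restrict_space borel E \<rightarrow>\<^sub>M borel_of T"
    "\<And>x. x \<in> topspace T \<Longrightarrow> e x \<in> E \<and> g (e x) = x"
    "\<And>z. z \<in> E \<Longrightarrow> g z \<in> topspace T \<and> e (g z) = z"
    using polish_borel_coordinates[OF T] by metis
  have spM: "space M = topspace T" using sets_eq_imp_space_eq[OF M] by simp
  have BT: "B \<subseteq> topspace T" using sets.sets_into_space[OF B] spM by simp
  have eM[measurable]: "e \<in> M \<rightarrow>\<^sub>M borel" using eg(3) M by (simp cong: measurable_cong_sets)
  define N where "N = distr M borel e"
  have "e ` B = g -` B \<inter> E"
    using eg(5,6) BT by force
  moreover have "g -` B \<inter> space (restrict_space borel E) \<in> sets (restrict_space borel E)"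
    using measurable_sets[OF eg(4)] B M by simp
  ultimately have eB: "e ` B \<in> sets borel"
    using eg(1) by (auto simp: space_restrict_space sets_restrict_space_iff)
  have pre: "e -` e ` B \<inter> space M = B" using eg(5) BT spM by (auto simp: image_iff) (metis subsetD)
  have "emeasure M B = emeasure N (e ` B)"
    unfolding N_def using eB pre by (simp add: emeasure_distr)
  also have "\<dots> = (SUP K\<in>{K. K \<subseteq> e ` B \<and> compact K}. emeasure N K)"
    using eB fin by (intro inner_regular) (auto simp: N_def emeasure_distr)
  also have "\<dots> \<le> (SUP K\<in>{K. compactin T K \<and> K \<subseteq> B}. emeasure M K)"
  proof (rule SUP_least)
    fix K assume K: "K \<in> {K. K \<subseteq> e ` B \<and> compact K}"
    have KE: "K \<subseteq> E" using K eg(5) BT by blast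
    have "compactin (top_of_set E) K" using K KE by (simp add: compactin_subtopology)
    then have "compactin T (g ` K)"
      using eg(2) image_compactin unfolding homeomorphic_maps_def by blast
    moreover have "g ` K \<subseteq> B" using K eg(5) BT by fastforce
    moreover have "e -` K \<inter> space M = g ` K" using KE eg(5,6) spM by (auto simp: image_iff) force+
    then have "emeasure N K = emeasure M (g ` K)"
      unfolding N_def using K by (simp add: emeasure_distr borel_compact)
    ultimately show "emeasure N K \<le> (SUP K\<in>{K. compactin T K \<and> K \<subseteq> B}. emeasure M K)"
      by (auto intro!: SUP_upper2[of "g ` K"])
  qed
  finally have "emeasure M B \<le> (SUP K\<in>{K. compactin T K \<and> K \<subseteq> B}. emeasure M K)" .
  moreover have "(SUP K\<in>{K. compactin T K \<and> K \<subseteq> B}. emeasure M K) \<le> emeasure M B"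
    by (rule SUP_least) (auto intro: emeasure_mono B)
  ultimately show ?thesis by (rule antisym)
qed

text \<open>On a Polish space inner regularity is automatic for a \<sigma>-finite measure: restrict
  to an increasing sequence of sets of finite measure and let the restrictions fill up
  \<open>B\<close>. For constructed measures only finiteness on compact sets remains to be
  checked.\<close>

lemma polish_radon_measureI:
  assumes T: "polish_topology T" and M: "sets M = sets (borel_of T)" and sf: "sigma_finite_measure M"
    and fin: "\<And>K. compactin T K \<Longrightarrow> emeasure M K < \<infinity>"
  shows "radon_measure T M"
  unfolding radon_measure_def
proof (intro conjI allI impI ballI M fin)
  fix B assume B: "B \<in> sets M"
  let ?S = "SUP K\<in>{K. compactin T K \<and> K \<in> sets M \<and> K \<subseteq> B}. emeasure M K"
  interpret sigma_finite_measure M by fact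
  obtain A :: "nat \<Rightarrow> 'a set" where A: "range A \<subseteq> sets M" "(\<Union>i. A i) = space M"
      "\<And>i. emeasure M (A i) \<noteq> \<infinity>" "incseq A"
    by (rule sigma_finite_incseq) blast
  have le: "emeasure M (B \<inter> A i) \<le> ?S" for i
  proof -
    let ?N = "density M (indicator (A i))"
    have Ai[measurable]: "A i \<in> sets M" using A(1) by auto
    have "emeasure M (B \<inter> A i) = emeasure ?N (B \<inter> A i)"
      using B by (simp add: emeasure_restricted Int_ac)
    also have "\<dots> = (SUP K\<in>{K. compactin T K \<and> K \<subseteq> B \<inter> A i}. emeasure ?N K)"
      using B A(3)[of i] Ai[unfolded M] emeasure_restricted[OF Ai sets.top]
      by (intro polish_inner_regular_finite T) (auto simp: M emeasure_restricted)
    also have "\<dots> \<le> ?S"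
    proof (rule SUP_least)
      fix K assume K: "K \<in> {K. compactin T K \<and> K \<subseteq> B \<inter> A i}"
      then have KM: "K \<in> sets M" using compactin_borel_of[OF T] M by auto
      have "emeasure ?N K \<le> emeasure M K"
        using KM by (auto simp: emeasure_restricted intro: emeasure_mono)
      also have "\<dots> \<le> ?S" using K KM by (auto intro!: SUP_upper)
      finally show "emeasure ?N K \<le> ?S" .
    qed
    finally show ?thesis .
  qed
  have "(SUP i. emeasure M (B \<inter> A i)) = emeasure M (\<Union>i. B \<inter> A i)"
    using A B by (intro SUP_emeasure_incseq) (auto simp: incseq_def subset_iff)
  moreover have "(\<Union>i. B \<inter> A i) = B" using A(2) sets.sets_into_space[OF B] by auto
  ultimately have "emeasure M B = (SUP i. emeasure M (B \<inter> A i))" by simp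
  also have "\<dots> \<le> ?S" using le by (intro SUP_least)
  finally have "emeasure M B \<le> ?S" .
  moreover have "?S \<le> emeasure M B" by (rule SUP_least) (auto intro: emeasure_mono B)
  ultimately show "emeasure M B = ?S" by (rule antisym)
qed

subsection \<open>Standard Borel codings\<close>

definition cantor :: "(nat \<Rightarrow> bool) measure" where
  "cantor = Pi\<^sub>M UNIV (\<lambda>_. count_space UNIV)"

text \<open>A measurable section-retraction pair with Cantor space. Every measure on
  \<open>M\<close> is the image under \<open>g\<close> of its image under \<open>f\<close>, so laws
  may be built on codes and decoded afterwards. Since \<open>g\<close> is total, \<open>M\<close>
  cannot be empty.\<close>

definition coded :: "'a measure \<Rightarrow> ('a \<Rightarrow> nat \<Rightarrow> bool) \<Rightarrow> ((nat \<Rightarrow> bool) \<Rightarrow> 'a) \<Rightarrow> bool" where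
  "coded M f g \<longleftrightarrow> f \<in> M \<rightarrow>\<^sub>M cantor \<and> g \<in> cantor \<rightarrow>\<^sub>M M \<and> (\<forall>x\<in>space M. g (f x) = x)"

lemma space_cantor [simp]: "space cantor = UNIV"
  by (simp add: cantor_def space_PiM PiE_def extensional_def)

lemma measurable_cantor_component [measurable]: "(\<lambda>c. c n) \<in> cantor \<rightarrow>\<^sub>M count_space UNIV"
  unfolding cantor_def by measurable

lemma measurable_cantorI:
  "(\<And>n. (\<lambda>x. f x n) \<in> M \<rightarrow>\<^sub>M count_space UNIV) \<Longrightarrow> f \<in> M \<rightarrow>\<^sub>M cantor"
  unfolding cantor_def by (rule measurable_PiM_single') (auto simp: PiE_def extensional_def)

text \<open>Recovers a real from its rational upper cut; the value \<open>top\<close> removes the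
  rationals outside the cut from the infimum.\<close>

lemma INF_rat_cut: "(INF q::rat. if x < of_rat q then ereal (of_rat q) else top) = ereal x"
proof (rule antisym)
  show "ereal x \<le> (INF q::rat. if x < of_rat q then ereal (of_rat q) else top)"
    by (rule INF_greatest) auto
  show "(INF q::rat. if x < of_rat q then ereal (of_rat q) else top) \<le> ereal x"
  proof (rule dense_ge)
    fix y assume "ereal x < y"
    then obtain z where z: "ereal x < ereal z" "ereal z < y" using ereal_dense2 by blast
    then obtain q where q: "x < of_rat q" "of_rat q < z" using of_rat_dense[of x z] by auto
    have "(INF q::rat. if x < of_rat q then ereal (of_rat q) else top) \<le> ereal (of_rat q)"
      using q by (intro INF_lower2[of q]) auto
    also have "\<dots> \<le> y" using q z by (meson ereal_less_eq(3) less_le_not_le order_trans)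
    finally show "(INF q::rat. if x < of_rat q then ereal (of_rat q) else top) \<le> y" .
  qed
qed

text \<open>Each bit answers a question \<open>z i < q\<close> for one pair of an index and a
  rational; decoding takes the infimum of the rationals with answer yes.\<close>

lemma coded_sequences: "\<exists>f g. coded (borel :: (nat \<Rightarrow> real) measure) f g"
proof -
  define f where "f z n = (case from_nat n :: nat \<times> rat of (i, q) \<Rightarrow> z i < of_rat q)" for z :: "nat \<Rightarrow> real" and n
  define g where "g c i = real_of_ereal (INF q::rat. if c (to_nat (i, q)) then ereal (of_rat q) else top)"
    for c and i :: nat
  have "f \<in> borel \<rightarrow>\<^sub>M cantor"
  proof (rule measurable_cantorI)
    fix n
    obtain i q where iq: "from_nat n = (i :: nat, q :: rat)" by fastforce
    have "Measurable.pred borel (\<lambda>z :: nat \<Rightarrow> real. z i < of_rat q)"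
      by (auto simp: pred_def intro!: borel_open open_Collect_less continuous_intros continuous_on_product_coordinates)
    then show "(\<lambda>z. f z n) \<in> borel \<rightarrow>\<^sub>M count_space UNIV" by (simp add: f_def iq)
  qed
  moreover have "g \<in> cantor \<rightarrow>\<^sub>M borel"
    unfolding g_def by (rule measurable_coordinatewise_then_product) measurable
  moreover have "g (f z) = z" for z
    by (rule ext) (simp add: f_def g_def INF_rat_cut del: if_image_distrib)
  ultimately show ?thesis unfolding coded_def by blast
qed

lemma polish_coded:
  assumes T: "polish_topology T" "topspace T \<noteq> {}"
  obtains f g where "coded (borel_of T) f g"
proof -
  obtain e :: "'a \<Rightarrow> nat \<Rightarrow> real" and g E where eg: "E \<in> sets borel" "homeomorphic_maps T (top_of_set E) e g"
    "e \<in> borel_of T \<rightarrow>\<^sub>M borel" "g \<in> restrict_space borel E \<rightarrow>\<^sub>M borel_of T"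
    "\<And>x. x \<in> topspace T \<Longrightarrow> e x \<in> E \<and> g (e x) = x"
    "\<And>z. z \<in> E \<Longrightarrow> g z \<in> topspace T \<and> e (g z) = z"
    using polish_borel_coordinates[OF T(1)] by metis
  obtain f0 g0 where c: "coded (borel :: (nat \<Rightarrow> real) measure) f0 g0" using coded_sequences by blast
  obtain x0 where x0: "x0 \<in> topspace T" using T(2) by blast
  have [measurable]: "f0 \<in> borel \<rightarrow>\<^sub>M cantor" "g0 \<in> cantor \<rightarrow>\<^sub>M borel" "E \<in> sets borel"
    "e \<in> borel_of T \<rightarrow>\<^sub>M borel"
    using c eg unfolding coded_def by auto
  \<comment> \<open>The decoder has to be total: codes that do not come from \<open>E\<close> are
    sent to a fixed point \<open>x0\<close>, which is where nonemptiness enters.\<close>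
  have "(\<lambda>z. if z \<in> E then g z else x0) \<in> borel \<rightarrow>\<^sub>M borel_of T"
    using eg(1,4) x0 by (subst measurable_If_restrict_space_iff) (auto simp: Collect_mem_eq)
  then have [measurable]: "(\<lambda>c. if g0 c \<in> E then g (g0 c) else x0) \<in> cantor \<rightarrow>\<^sub>M borel_of T"
    by measurable
  have "coded (borel_of T) (\<lambda>x. f0 (e x)) (\<lambda>c. if g0 c \<in> E then g (g0 c) else x0)"
    using c eg(5) unfolding coded_def by (auto intro!: measurable_compose[of e _ borel f0])
  then show ?thesis using that by blast
qed

subsection \<open>Measures on Cantor space from weights of cylinders\<close>

text \<open>Prefixes are lists with the most recent bit first.\<close>

primrec pre :: "(nat \<Rightarrow> bool) \<Rightarrow> nat \<Rightarrow> bool list" where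
  "pre c 0 = []"
| "pre c (Suc n) = c n # pre c n"

definition cyl :: "bool list \<Rightarrow> (nat \<Rightarrow> bool) set" where
  "cyl s = {c. pre c (length s) = s}"

lemma length_pre [simp]: "length (pre c n) = n"
  by (induction n) auto

lemma pre_eq_iff: "pre c n = pre d n \<longleftrightarrow> (\<forall>i<n. c i = d i)"
  by (induction n) (auto simp: less_Suc_eq)

lemma measurable_pre [measurable]: "(\<lambda>c. pre c n) \<in> cantor \<rightarrow>\<^sub>M count_space UNIV"
proof (induction n)
  case (Suc n)
  have "(\<lambda>c. (\<lambda>l c. c n # l) (pre c n) c) \<in> cantor \<rightarrow>\<^sub>M count_space UNIV"
    using Suc by (rule measurable_compose_countable[rotated]) measurable
  then show ?case by simp
qed simp

lemma sets_cyl [measurable]: "cyl s \<in> sets cantor"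
proof -
  have "cyl s = (\<lambda>c. pre c (length s)) -` {s} \<inter> space cantor" by (auto simp: cyl_def)
  then show ?thesis using measurable_sets[OF measurable_pre, of "{s}" "length s"] by simp
qed

lemma cyl_Nil [simp]: "cyl [] = UNIV" by (simp add: cyl_def)

lemma cyl_split: "cyl s = cyl (False # s) \<union> cyl (True # s)" "cyl (False # s) \<inter> cyl (True # s) = {}"
  by (auto simp: cyl_def)

lemma pre_mono: "pre c m = pre d m \<Longrightarrow> n \<le> m \<Longrightarrow> pre c n = pre d n"
  by (auto simp: pre_eq_iff)

text \<open>Of two prefixes the longer either extends the shorter or contradicts it.\<close>

lemma cyl_Int: "cyl s \<inter> cyl t = {} \<or> cyl s \<subseteq> cyl t \<or> cyl t \<subseteq> cyl s"
proof (cases "length s \<le> length t")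
  case True
  have "d \<in> cyl s" if "c \<in> cyl s" "c \<in> cyl t" "d \<in> cyl t" for c d
    using that pre_mono[of d "length t" c "length s"] True by (simp add: cyl_def)
  then show ?thesis by blast
next
  case False
  have "d \<in> cyl t" if "c \<in> cyl s" "c \<in> cyl t" "d \<in> cyl s" for c d
    using that pre_mono[of d "length s" c "length t"] False by (simp add: cyl_def)
  then show ?thesis by blast
qed

text \<open>Prefixes are measurable for the \<sigma>-algebra of the cylinders, and the head of the
  prefix of length \<open>Suc n\<close> is bit \<open>n\<close>.\<close>

lemma sets_cantor: "sets cantor = sigma_sets UNIV (range cyl)"
proof
  let ?S = "sigma UNIV (range cyl)"
  have [simp]: "sets ?S = sigma_sets UNIV (range cyl)" "space ?S = UNIV"
    by (simp_all add: sets_measure_of space_measure_of_conv)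
  have "(\<lambda>c. c) \<in> ?S \<rightarrow>\<^sub>M cantor"
  proof (rule measurable_cantorI)
    fix n
    have [measurable]: "(\<lambda>c. pre c (Suc n)) \<in> ?S \<rightarrow>\<^sub>M count_space UNIV"
      unfolding measurable_count_space_eq2_countable
    proof (intro conjI ballI)
      fix s
      have "(\<lambda>c. pre c (Suc n)) -` {s} = (if length s = Suc n then cyl s else {})"
        unfolding cyl_def using length_pre by (force simp del: pre.simps)
      then show "(\<lambda>c. pre c (Suc n)) -` {s} \<inter> space ?S \<in> sets ?S"
        by (simp add: sigma_sets.Empty sigma_sets.Basic del: pre.simps)
    qed simp
    have "(\<lambda>c. hd (pre c (Suc n))) \<in> ?S \<rightarrow>\<^sub>M count_space UNIV" by measurable
    then show "(\<lambda>c. c n) \<in> ?S \<rightarrow>\<^sub>M count_space UNIV" by simp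
  qed
  then show "sets cantor \<subseteq> sigma_sets UNIV (range cyl)"
    by (auto dest!: measurable_sets)
  show "sigma_sets UNIV (range cyl) \<subseteq> sets cantor"
    using sets.sigma_sets_subset[of "range cyl" cantor] by (simp add: image_subset_iff)
qed

text \<open>A point \<open>u\<close> of \<open>[0, w [])\<close> is turned into a bit sequence by bisecting this interval in the
  proportions prescribed by \<open>w\<close>; the points whose sequence starts with \<open>s\<close> form an
  interval of length \<open>w s\<close> with left end \<open>left_end w s\<close>.\<close>

primrec left_end :: "(bool list \<Rightarrow> real) \<Rightarrow> bool list \<Rightarrow> real" where
  "left_end w [] = 0"
| "left_end w (b # s) = left_end w s + (if b then w (False # s) else 0)"

primrec bisect :: "(bool list \<Rightarrow> real) \<Rightarrow> real \<Rightarrow> nat \<Rightarrow> bool list" where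
  "bisect w u 0 = []"
| "bisect w u (Suc n) = (left_end w (bisect w u n) + w (False # bisect w u n) \<le> u) # bisect w u n"

definition sample :: "(bool list \<Rightarrow> real) \<Rightarrow> real \<Rightarrow> nat \<Rightarrow> bool" where
  "sample w u n = hd (bisect w u (Suc n))"

lemma pre_sample: "pre (sample w u) n = bisect w u n"
  by (induction n) (auto simp: sample_def)

text \<open>Additivity over the two one-bit extensions is all that a finite measure on Cantor space
  imposes on its cylinder weights: \<open>sample\<close> turns any such \<open>w\<close> into a
  measure.\<close>

definition consistent :: "(bool list \<Rightarrow> real) \<Rightarrow> bool" where
  "consistent w \<longleftrightarrow> (\<forall>s. 0 \<le> w s \<and> w s = w (False # s) + w (True # s))"

text \<open>The half-open interval of \<open>s\<close> is cut at
  \<open>left_end w s + w (False # s)\<close>; the left piece belongs to \<open>False\<close>, the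
  right one, including the cut, to \<open>True\<close>.\<close>

lemma bisect_eq_iff:
  assumes w: "consistent w" and u: "0 \<le> u" "u < w []"
  shows "bisect w u (length s) = s \<longleftrightarrow> left_end w s \<le> u \<and> u < left_end w s + w s"
proof (induction s)
  case (Cons b s)
  have *: "w s = w (False # s) + w (True # s)" "0 \<le> w (False # s)" "0 \<le> w (True # s)"
    using w unfolding consistent_def by metis+
  have "bisect w u (length (b # s)) = b # s \<longleftrightarrow>
    bisect w u (length s) = s \<and> b = (left_end w s + w (False # s) \<le> u)"
    by auto
  then show ?case using Cons * by (cases b) auto
qed (use u in auto)

lemma left_end_bounds:
  assumes w: "consistent w"
  shows "0 \<le> left_end w s \<and> left_end w s + w s \<le> w []"
proof (induction s)
  case (Cons b s)
  have *: "w s = w (False # s) + w (True # s)" "0 \<le> w (False # s)" "0 \<le> w (True # s)"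
    using w unfolding consistent_def by metis+
  then show ?case using Cons by (cases b) auto
qed simp

lemma sample_cyl:
  assumes w: "consistent w"
  shows "{u \<in> {0..<w []}. sample w u \<in> cyl s} = {left_end w s..<left_end w s + w s}"
  using bisect_eq_iff[OF w] left_end_bounds[OF w, of s] by (auto simp: cyl_def pre_sample)

text \<open>Joint measurability in the parameter and in \<open>u\<close> is what disintegration
  needs. It holds bit by bit, since a prefix takes countably many values and for each of them the
  next bit compares \<open>u\<close> with a measurable threshold.\<close>

lemma measurable_sample:
  assumes w: "\<And>s. (\<lambda>x. w x s) \<in> borel_measurable M"
  shows "(\<lambda>(x, u). sample (w x) u) \<in> M \<Otimes>\<^sub>M borel \<rightarrow>\<^sub>M cantor"
proof -
  have left: "(\<lambda>x. left_end (w x) s) \<in> borel_measurable M" for s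
  proof (induction s)
    case (Cons b s)
    have "(\<lambda>x. left_end (w x) s + w x (False # s)) \<in> borel_measurable M"
      using Cons w by (rule borel_measurable_add)
    then show ?case using Cons by (cases b) (simp_all only: left_end.simps if_True if_False add_0_right)
  qed simp
  have b[measurable]: "(\<lambda>z. bisect (w (fst z)) (snd z) n) \<in> M \<Otimes>\<^sub>M borel \<rightarrow>\<^sub>M count_space UNIV" for n
  proof (induction n)
    case (Suc n)
    have "(\<lambda>z. (\<lambda>l z. (left_end (w (fst z)) l + w (fst z) (False # l) \<le> snd z) # l)
        (bisect (w (fst z)) (snd z) n) z) \<in> M \<Otimes>\<^sub>M borel \<rightarrow>\<^sub>M count_space UNIV"
    proof (rule measurable_compose_countable[where g = "\<lambda>z. bisect (w (fst z)) (snd z) n"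
          and f = "\<lambda>l z. (left_end (w (fst z)) l + w (fst z) (False # l) \<le> snd z) # l", OF _ Suc])
      fix l
      note left[measurable] w[measurable]
      have "Measurable.pred (M \<Otimes>\<^sub>M borel) (\<lambda>z. left_end (w (fst z)) l + w (fst z) (False # l) \<le> snd z)"
        by measurable
      then show "(\<lambda>z. (left_end (w (fst z)) l + w (fst z) (False # l) \<le> snd z) # l)
          \<in> M \<Otimes>\<^sub>M borel \<rightarrow>\<^sub>M count_space UNIV"
        by (rule measurable_compose) simp
    qed
    then show ?case by simp
  qed simp
  show ?thesis
    unfolding case_prod_beta sample_def by (rule measurable_cantorI) (rule measurable_compose[OF b], simp)
qed

subsection \<open>Disintegration and gluing\<close>

definition unif :: "real measure" where
  "unif = density lborel (indicator {0..<1})"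

lemma sets_unif [simp, measurable_cong]: "sets unif = sets borel"
  by (simp add: unif_def)

lemma space_unif [simp]: "space unif = UNIV" by (simp add: unif_def)

lemma prob_space_unif: "prob_space unif"
  by (rule prob_spaceI) (simp add: unif_def emeasure_restricted)

text \<open>Every measure with a \<open>\<sigma>\<close>-finite second marginal is the law of a function of the second
  coordinate and an independent uniform variable. The conditional weights of the cylinders are
  Radon-Nikodym derivatives.\<close>

lemma randomization:
  assumes cod: "coded M f g" and sf: "sigma_finite_measure \<nu>"
    and sets\<pi>: "sets \<pi> = sets (M \<Otimes>\<^sub>M \<nu>)" and marg: "distr \<pi> \<nu> snd = \<nu>"
  obtains G where "G \<in> \<nu> \<Otimes>\<^sub>M unif \<rightarrow>\<^sub>M M"
    "distr (\<nu> \<Otimes>\<^sub>M unif) (M \<Otimes>\<^sub>M \<nu>) (\<lambda>z. (G z, fst z)) = \<pi>"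
proof -
  interpret \<nu>: sigma_finite_measure \<nu> by fact
  interpret U: prob_space unif by (rule prob_space_unif)
  note sets\<pi>[measurable_cong]
  have [measurable]: "f \<in> M \<rightarrow>\<^sub>M cantor" "g \<in> cantor \<rightarrow>\<^sub>M M" and gf: "\<And>x. x \<in> space M \<Longrightarrow> g (f x) = x"
    using cod unfolding coded_def by auto
  have sp\<pi>: "space \<pi> = space M \<times> space \<nu>" using sets_eq_imp_space_eq[OF sets\<pi>] by (simp add: space_pair_measure)
  define C where "C s = {z \<in> space \<pi>. f (fst z) \<in> cyl s}" for s
  have C[measurable]: "C s \<in> sets \<pi>" for s unfolding C_def by measurable
  \<comment> \<open>The part of \<pi> whose first coordinate has its code in the cylinder of
    \<open>s\<close>, projected to the second coordinate; its density with respect to \<nu> is the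
    conditional probability of that cylinder.\<close>
  define m where "m s = distr (density \<pi> (indicator (C s))) \<nu> snd" for s
  have sm[simp, measurable_cong]: "sets (m s) = sets \<nu>" for s by (simp add: m_def)
  have m: "emeasure (m s) B = emeasure \<pi> {z \<in> space \<pi>. f (fst z) \<in> cyl s \<and> snd z \<in> B}"
    if [measurable]: "B \<in> sets \<nu>" for s B
  proof -
    have "C s \<inter> (snd -` B \<inter> space \<pi>) = {z \<in> space \<pi>. f (fst z) \<in> cyl s \<and> snd z \<in> B}"
      by (auto simp: C_def)
    then show ?thesis unfolding m_def by (simp add: emeasure_distr emeasure_restricted)
  qed
  have m_Nil: "m [] = \<nu>"
  proof (rule measure_eqI)
    fix B assume "B \<in> sets (m [])"
    then have [measurable]: "B \<in> sets \<nu>" by simp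
    have "snd -` B \<inter> space \<pi> = {z \<in> space \<pi>. f (fst z) \<in> cyl [] \<and> snd z \<in> B}" by auto
    then have "emeasure (m []) B = emeasure (distr \<pi> \<nu> snd) B"
      by (simp add: m emeasure_distr del: cyl_Nil)
    then show "emeasure (m []) B = emeasure \<nu> B" by (simp add: marg)
  qed simp
  have m_split: "emeasure (m s) B = emeasure (m (False # s)) B + emeasure (m (True # s)) B"
    if [measurable]: "B \<in> sets \<nu>" for s B
  proof -
    have "{z \<in> space \<pi>. f (fst z) \<in> cyl s \<and> snd z \<in> B} =
      {z \<in> space \<pi>. f (fst z) \<in> cyl (False # s) \<and> snd z \<in> B} \<union> {z \<in> space \<pi>. f (fst z) \<in> cyl (True # s) \<and> snd z \<in> B}"
      using cyl_split(1)[of s] by blast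
    then show ?thesis
      using cyl_split(2)[of s] unfolding m[OF that] by (subst plus_emeasure) (auto)
  qed
  have m_le: "emeasure (m s) B \<le> emeasure \<nu> B" if "B \<in> sets \<nu>" for s B
  proof -
    have "emeasure (m s) B \<le> emeasure (m []) B"
      unfolding m[OF that] using that by (intro emeasure_mono) auto
    then show ?thesis by (simp add: m_Nil)
  qed
  have ac: "absolutely_continuous \<nu> (m s)" for s
    unfolding absolutely_continuous_def
  proof
    fix B assume "B \<in> null_sets \<nu>"
    then show "B \<in> null_sets (m s)"
      using m_le[of B s] unfolding null_sets_def by auto
  qed
  define w0 where "w0 s = RN_deriv \<nu> (m s)" for s
  have w0[measurable]: "w0 s \<in> borel_measurable \<nu>" for s unfolding w0_def by measurable
  have dens: "density \<nu> (w0 s) = m s" for s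
    unfolding w0_def by (rule \<nu>.density_RN_deriv[OF ac]) simp
  \<comment> \<open>Conditional probabilities are additive only almost everywhere, by uniqueness of
    Radon-Nikodym derivatives; as there are countably many prefixes, a single null set
    suffices.\<close>
  have split: "AE y in \<nu>. w0 (False # s) y + w0 (True # s) y = w0 s y" for s
    unfolding w0_def[of s]
  proof (rule \<nu>.RN_deriv_unique)
    show "density \<nu> (\<lambda>y. w0 (False # s) y + w0 (True # s) y) = m s"
    proof (rule measure_eqI)
      fix B assume "B \<in> sets (density \<nu> (\<lambda>y. w0 (False # s) y + w0 (True # s) y))"
      then have B[measurable]: "B \<in> sets \<nu>" by simp
      have "emeasure (density \<nu> (\<lambda>y. w0 (False # s) y + w0 (True # s) y)) B
        = emeasure (density \<nu> (w0 (False # s))) B + emeasure (density \<nu> (w0 (True # s))) B"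
        by (simp add: emeasure_density distrib_right nn_integral_add)
      then show "emeasure (density \<nu> (\<lambda>y. w0 (False # s) y + w0 (True # s) y)) B = emeasure (m s) B"
        by (simp only: dens m_split[OF B, of s])
    qed simp
  qed simp
  have nil: "AE y in \<nu>. 1 = w0 [] y"
    unfolding w0_def
    by (rule \<nu>.RN_deriv_unique) (simp_all add: m_Nil density_1)
  define w where "w y s = enn2real (w0 s y)" for y s
  have good: "AE y in \<nu>. consistent (w y) \<and> w y [] = 1 \<and> (\<forall>s. w0 s y = ennreal (w y s))"
  proof -
    have "AE y in \<nu>. \<forall>s. w0 (False # s) y + w0 (True # s) y = w0 s y"
      using split by (simp add: AE_all_countable)
    then show ?thesis using nil
    proof eventually_elim
      case (elim y)
      have le1: "w0 s y \<le> 1" for s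
      proof (induction s)
        case (Cons b s)
        have "w0 (b # s) y \<le> w0 s y" using elim(1) by (metis (full_types) add.commute le_iff_add)
        then show ?case using Cons by (rule order_trans)
      qed (use elim in simp)
      then have fin: "w0 s y < top" for s
        using order_le_less_trans ennreal_one_less_top by blast
      then have 1: "w0 s y = ennreal (w y s)" for s by (simp add: w_def)
      have 2: "w y s = w y (False # s) + w y (True # s)" for s
        using elim(1) fin unfolding w_def by (metis enn2real_plus)
      have 3: "0 \<le> w y s" for s by (simp add: w_def)
      have "consistent (w y)" unfolding consistent_def using 2 3 by blast
      moreover have "w y [] = 1" using elim(2)[symmetric] by (simp add: w_def)
      ultimately show ?case using 1 by blast
    qed
  qed
  \<comment> \<open>\<open>sample\<close> is defined for inconsistent weights too, so the
    exceptional null set calls for no special value.\<close>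
  define T where "T z = sample (w (fst z)) (snd z)" for z
  have T[measurable]: "T \<in> \<nu> \<Otimes>\<^sub>M unif \<rightarrow>\<^sub>M cantor"
  proof -
    have "(\<lambda>(y, u). sample (w y) u) \<in> \<nu> \<Otimes>\<^sub>M borel \<rightarrow>\<^sub>M cantor"
      by (rule measurable_sample) (simp add: w_def)
    then show ?thesis unfolding T_def case_prod_beta
      by (simp cong: measurable_cong_sets sets_pair_measure_cong)
  qed
  have law: "distr (\<nu> \<Otimes>\<^sub>M unif) (cantor \<Otimes>\<^sub>M \<nu>) (\<lambda>z. (T z, fst z))
    = distr \<pi> (cantor \<Otimes>\<^sub>M \<nu>) (\<lambda>z. (f (fst z), snd z))" (is "?L = ?R")
  proof -
    let ?E = "{a \<times> b |a b. a \<in> range cyl \<and> b \<in> sets \<nu>}"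
    obtain A :: "nat \<Rightarrow> 'b set" where A: "range A \<subseteq> sets \<nu>" "(\<Union>i. A i) = space \<nu>"
        "\<And>i. emeasure \<nu> (A i) \<noteq> \<infinity>"
      by (rule \<nu>.sigma_finite_incseq) blast
    \<comment> \<open>Both laws give the product of a cylinder with \<open>B\<close> the mass
      \<open>emeasure (m s) B\<close>, and such products determine a \<sigma>-finite
      measure.\<close>
    have L: "emeasure ?L (cyl s \<times> B) = emeasure (m s) B"
      and R: "emeasure ?R (cyl s \<times> B) = emeasure (m s) B" if B[measurable]: "B \<in> sets \<nu>" for s B
    proof -
      have "(\<lambda>z. (f (fst z), snd z)) -` (cyl s \<times> B) \<inter> space \<pi> = {z \<in> space \<pi>. f (fst z) \<in> cyl s \<and> snd z \<in> B}"
        by auto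
      then show "emeasure ?R (cyl s \<times> B) = emeasure (m s) B"
        by (simp add: emeasure_distr m)
      let ?Z = "{z \<in> space (\<nu> \<Otimes>\<^sub>M unif). T z \<in> cyl s \<and> fst z \<in> B}"
      have "(\<lambda>z. (T z, fst z)) -` (cyl s \<times> B) \<inter> space (\<nu> \<Otimes>\<^sub>M unif) = ?Z"
        by auto
      then have "emeasure ?L (cyl s \<times> B) = emeasure (\<nu> \<Otimes>\<^sub>M unif) ?Z"
        by (simp add: emeasure_distr)
      also have "\<dots> = (\<integral>\<^sup>+ y. emeasure unif (Pair y -` ?Z) \<partial>\<nu>)"
        by (rule U.emeasure_pair_measure_alt) measurable
      also have "\<dots> = (\<integral>\<^sup>+ y. w0 s y * indicator B y \<partial>\<nu>)"
      proof (rule nn_integral_cong_AE)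
        show "AE y in \<nu>. emeasure unif (Pair y -` ?Z) = w0 s y * indicator B y"
          using good AE_space
        proof eventually_elim
          case (elim y)
          let ?I = "{left_end (w y) s..<left_end (w y) s + w y s}"
          show ?case
          proof (cases "y \<in> B")
            case True
            have "Pair y -` ?Z = {u. sample (w y) u \<in> cyl s}"
              using True elim(2) by (auto simp: space_pair_measure T_def)
            moreover have "{u. sample (w y) u \<in> cyl s} \<in> sets borel"
            proof -
              have "sample (w y) \<in> borel \<rightarrow>\<^sub>M cantor"
                using measurable_compose[OF measurable_Pair1'[OF elim(2), of unif] T]
                by (simp add: T_def cong: measurable_cong_sets)
              from measurable_sets[OF this sets_cyl] show ?thesis by (simp add: vimage_def)
            qed
            \<comment> \<open>For fixed \<open>y\<close>, the favourable values of the uniform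
              variable form an interval whose length is the conditional probability
              \<open>w y s\<close>.\<close>
            moreover have "{0..<1} \<inter> {u. sample (w y) u \<in> cyl s} = ?I"
              using sample_cyl[of "w y" s] elim(1) by auto
            ultimately have "emeasure unif (Pair y -` ?Z) = emeasure lborel ?I"
              by (simp add: unif_def emeasure_restricted)
            also have "\<dots> = w0 s y"
            proof -
              have "0 \<le> w y s" "w0 s y = ennreal (w y s)"
                using elim(1) unfolding consistent_def by blast+
              then show ?thesis by simp
            qed
            finally show ?thesis using True by simp
          qed (auto)
        qed
      qed
      also have "\<dots> = emeasure (m s) B"
        by (simp add: dens[symmetric] emeasure_density)
      finally show "emeasure ?L (cyl s \<times> B) = emeasure (m s) B" .
    qed
    have gen: "sets (cantor \<Otimes>\<^sub>M \<nu>) = sigma_sets (UNIV \<times> space \<nu>) ?E"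
    proof -
      have U: "UNIV \<in> range cyl" by (metis cyl_Nil rangeI)
      have E: "?E \<subseteq> Pow (space cantor \<times> space \<nu>)" using sets.space_closed[of \<nu>] by auto
      have "sets (cantor \<Otimes>\<^sub>M \<nu>) = sets (sigma (space cantor \<times> space \<nu>) ?E)"
        by (rule sets_pair_eq[where Ca = "{UNIV}" and Cb = "range A"])
          (use A(1,2) U in \<open>simp_all add: sets_cantor sets.sigma_sets_eq sets.space_closed\<close>)
      also have "\<dots> = sigma_sets (UNIV \<times> space \<nu>) ?E"
        using sets_measure_of[OF E] by simp
      finally show ?thesis .
    qed
    show ?thesis
    proof (rule measure_eqI_generator_eq[of ?E "UNIV \<times> space \<nu>" _ _ "\<lambda>i. cyl [] \<times> A i"])
      show "Int_stable ?E"
        unfolding Int_stable_def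
      proof safe
        fix s t b b' assume bb: "b \<in> sets \<nu>" "b' \<in> sets \<nu>"
        have "cyl s \<times> b \<inter> cyl t \<times> b' = (cyl s \<inter> cyl t) \<times> (b \<inter> b')" by auto
        moreover have "cyl s \<inter> cyl t = {} \<or> cyl s \<inter> cyl t = cyl s \<or> cyl s \<inter> cyl t = cyl t"
          using cyl_Int[of s t] by auto
        ultimately show "\<exists>a b''. cyl s \<times> b \<inter> cyl t \<times> b' = a \<times> b'' \<and> a \<in> range cyl \<and> b'' \<in> sets \<nu>"
          using bb by (metis Sigma_empty1 Sigma_empty2 rangeI sets.Int sets.empty_sets)
      qed
      show "?E \<subseteq> Pow (UNIV \<times> space \<nu>)" using sets.space_closed[of \<nu>] by blast
      show "emeasure ?L X = emeasure ?R X" if "X \<in> ?E" for X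
        using that L R by auto
      show "range (\<lambda>i. cyl [] \<times> A i) \<subseteq> ?E" using A(1) by blast
      show "(\<Union>i. cyl [] \<times> A i) = UNIV \<times> space \<nu>" using A(2) by auto
      show "emeasure ?L (cyl [] \<times> A i) \<noteq> \<infinity>" for i
        using L[of "A i" "[]"] A(1,3) by (auto simp: m_Nil)
    qed (simp_all add: gen)
  qed
  \<comment> \<open>Decoding the sampled code turns the law on codes back into \<pi>, because
    \<open>g\<close> inverts \<open>f\<close> on \<open>M\<close>.\<close>
  define G where "G z = g (T z)" for z
  have "distr (\<nu> \<Otimes>\<^sub>M unif) (M \<Otimes>\<^sub>M \<nu>) (\<lambda>z. (g (T z), fst z))
    = distr (distr (\<nu> \<Otimes>\<^sub>M unif) (cantor \<Otimes>\<^sub>M \<nu>) (\<lambda>z. (T z, fst z))) (M \<Otimes>\<^sub>M \<nu>) (\<lambda>z. (g (fst z), snd z))"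
    by (subst distr_distr) (auto simp: comp_def)
  also have "\<dots> = distr \<pi> (M \<Otimes>\<^sub>M \<nu>) (\<lambda>z. (g (f (fst z)), snd z))"
    unfolding law by (subst distr_distr) (auto simp: comp_def)
  also have "\<dots> = distr \<pi> \<pi> (\<lambda>z. z)"
    by (rule distr_cong) (auto simp: sets\<pi> sp\<pi> gf)
  also have "\<dots> = \<pi>" by (rule distr_id2) simp
  finally have "distr (\<nu> \<Otimes>\<^sub>M unif) (M \<Otimes>\<^sub>M \<nu>) (\<lambda>z. (g (T z), fst z)) = \<pi>" .
  moreover have "(\<lambda>z. g (T z)) \<in> \<nu> \<Otimes>\<^sub>M unif \<rightarrow>\<^sub>M M" by measurable
  ultimately show ?thesis using that[of "\<lambda>z. g (T z)"] by blast
qed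

text \<open>Each coupling is realized over the common coordinate with a uniform variable of its own.
  On the resulting product space \<open>h1\<close>, \<open>fst\<close> and \<open>h3\<close> act as
  three random variables with the prescribed pair laws, the outer two being conditionally
  independent given the middle one.\<close>

lemma gluing:
  assumes cod: "coded M1 f1 g1" "coded M3 f3 g3" and sf: "sigma_finite_measure \<nu>"
    and s12[measurable_cong]: "sets \<pi>12 = sets (M1 \<Otimes>\<^sub>M \<nu>)" and m12: "distr \<pi>12 \<nu> snd = \<nu>"
    and s23[measurable_cong]: "sets \<pi>23 = sets (\<nu> \<Otimes>\<^sub>M M3)" and m23: "distr \<pi>23 \<nu> fst = \<nu>"
  obtains h1 h3 where "h1 \<in> \<nu> \<Otimes>\<^sub>M (unif \<Otimes>\<^sub>M unif) \<rightarrow>\<^sub>M M1" "h3 \<in> \<nu> \<Otimes>\<^sub>M (unif \<Otimes>\<^sub>M unif) \<rightarrow>\<^sub>M M3"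
    "distr (\<nu> \<Otimes>\<^sub>M (unif \<Otimes>\<^sub>M unif)) (M1 \<Otimes>\<^sub>M \<nu>) (\<lambda>z. (h1 z, fst z)) = \<pi>12"
    "distr (\<nu> \<Otimes>\<^sub>M (unif \<Otimes>\<^sub>M unif)) (\<nu> \<Otimes>\<^sub>M M3) (\<lambda>z. (fst z, h3 z)) = \<pi>23"
proof -
  interpret \<nu>: sigma_finite_measure \<nu> by fact
  interpret U: prob_space unif by (rule prob_space_unif)
  interpret UU: pair_prob_space unif unif ..
  obtain G where G[measurable]: "G \<in> \<nu> \<Otimes>\<^sub>M unif \<rightarrow>\<^sub>M M1"
    "distr (\<nu> \<Otimes>\<^sub>M unif) (M1 \<Otimes>\<^sub>M \<nu>) (\<lambda>z. (G z, fst z)) = \<pi>12"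
    using randomization[OF cod(1) sf s12 m12] .
  \<comment> \<open>\<open>randomization\<close> expects the common marginal in second
    position.\<close>
  let ?\<pi>32 = "distr \<pi>23 (M3 \<Otimes>\<^sub>M \<nu>) (\<lambda>z. (snd z, fst z))"
  have m32: "distr ?\<pi>32 \<nu> snd = \<nu>"
    using m23 by (subst distr_distr) (auto simp: comp_def)
  have s32: "sets ?\<pi>32 = sets (M3 \<Otimes>\<^sub>M \<nu>)" by simp
  obtain H where H[measurable]: "H \<in> \<nu> \<Otimes>\<^sub>M unif \<rightarrow>\<^sub>M M3"
    "distr (\<nu> \<Otimes>\<^sub>M unif) (M3 \<Otimes>\<^sub>M \<nu>) (\<lambda>z. (H z, fst z)) = ?\<pi>32"
    using randomization[OF cod(2) sf s32 m32] .
  let ?O = "\<nu> \<Otimes>\<^sub>M (unif \<Otimes>\<^sub>M unif)"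
  have p1: "distr ?O (\<nu> \<Otimes>\<^sub>M unif) (\<lambda>z. (fst z, fst (snd z))) = \<nu> \<Otimes>\<^sub>M unif"
  proof -
    have "distr \<nu> \<nu> (\<lambda>x. x) \<Otimes>\<^sub>M distr (unif \<Otimes>\<^sub>M unif) unif fst
      = distr ?O (\<nu> \<Otimes>\<^sub>M unif) (\<lambda>(x, y). (x, fst y))"
      by (rule pair_measure_distr) (simp_all add: U.distr_pair_fst U.sigma_finite_measure_axioms)
    from this[symmetric] show ?thesis
      unfolding case_prod_beta U.distr_pair_fst by (simp add: distr_id2)
  qed
  have p2: "distr ?O (\<nu> \<Otimes>\<^sub>M unif) (\<lambda>z. (fst z, snd (snd z))) = \<nu> \<Otimes>\<^sub>M unif"
  proof -
    have *: "distr (unif \<Otimes>\<^sub>M unif) unif snd = unif"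
    proof (rule measure_eqI)
      fix A assume "A \<in> sets (distr (unif \<Otimes>\<^sub>M unif) unif snd)"
      then have [measurable]: "A \<in> sets unif" by simp
      have "snd -` A \<inter> space (unif \<Otimes>\<^sub>M unif) = UNIV \<times> A" by (auto simp: space_pair_measure)
      moreover have "emeasure unif UNIV = 1" using U.emeasure_space_1 by simp
      ultimately show "emeasure (distr (unif \<Otimes>\<^sub>M unif) unif snd) A = emeasure unif A"
        using U.emeasure_pair_measure_Times[of UNIV unif A]
        by (simp add: emeasure_distr del: sets_unif)
    qed simp
    have "distr \<nu> \<nu> (\<lambda>x. x) \<Otimes>\<^sub>M distr (unif \<Otimes>\<^sub>M unif) unif snd
      = distr ?O (\<nu> \<Otimes>\<^sub>M unif) (\<lambda>(x, y). (x, snd y))"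
      by (rule pair_measure_distr) (simp_all add: * U.sigma_finite_measure_axioms)
    from this[symmetric] show ?thesis
      unfolding case_prod_beta * by (simp add: distr_id2)
  qed
  show ?thesis
  proof (rule that[of "\<lambda>z. G (fst z, fst (snd z))" "\<lambda>z. H (fst z, snd (snd z))"])
    have "\<pi>12 = distr (distr ?O (\<nu> \<Otimes>\<^sub>M unif) (\<lambda>z. (fst z, fst (snd z)))) (M1 \<Otimes>\<^sub>M \<nu>) (\<lambda>z. (G z, fst z))"
      unfolding p1 G(2) ..
    also have "\<dots> = distr ?O (M1 \<Otimes>\<^sub>M \<nu>) (\<lambda>z. (G (fst z, fst (snd z)), fst z))"
      by (subst distr_distr) (auto simp: comp_def)
    finally show "distr ?O (M1 \<Otimes>\<^sub>M \<nu>) (\<lambda>z. (G (fst z, fst (snd z)), fst z)) = \<pi>12" ..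
    have "distr ?\<pi>32 (\<nu> \<Otimes>\<^sub>M M3) (\<lambda>z. (snd z, fst z)) = distr \<pi>23 (\<nu> \<Otimes>\<^sub>M M3) (\<lambda>z. z)"
      by (subst distr_distr) (auto simp: comp_def)
    also have "\<dots> = \<pi>23" by (rule distr_id2[OF s23[symmetric]])
    finally have 1: "\<pi>23 = distr ?\<pi>32 (\<nu> \<Otimes>\<^sub>M M3) (\<lambda>z. (snd z, fst z))" ..
    have "?\<pi>32 = distr (distr ?O (\<nu> \<Otimes>\<^sub>M unif) (\<lambda>z. (fst z, snd (snd z)))) (M3 \<Otimes>\<^sub>M \<nu>) (\<lambda>z. (H z, fst z))"
      unfolding p2 H(2) ..
    also have "\<dots> = distr ?O (M3 \<Otimes>\<^sub>M \<nu>) (\<lambda>z. (H (fst z, snd (snd z)), fst z))"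
      by (subst distr_distr) (auto simp: comp_def)
    finally have 2: "?\<pi>32 = distr ?O (M3 \<Otimes>\<^sub>M \<nu>) (\<lambda>z. (H (fst z, snd (snd z)), fst z))" .
    have 3: "distr ?\<pi>32 (\<nu> \<Otimes>\<^sub>M M3) (\<lambda>z. (snd z, fst z))
        = distr ?O (\<nu> \<Otimes>\<^sub>M M3) (\<lambda>z. (fst z, H (fst z, snd (snd z))))"
      unfolding 2 by (subst distr_distr) (auto simp: comp_def)
    show "distr ?O (\<nu> \<Otimes>\<^sub>M M3) (\<lambda>z. (fst z, H (fst z, snd (snd z)))) = \<pi>23"
      using trans[OF 1 3] by (rule sym)
  qed measurable
qed

subsection \<open>Setwise limits of measures with dominated marginals\<close>

text \<open>Dynkin induction on \<open>A\<close>. At countable disjoint unions, limit and sum are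
  exchanged by Tannery's theorem, with the dominating series of the
  \<open>measure \<alpha> (A i)\<close>. In the applications \<open>k\<close> is a coordinate
  projection and \<open>B\<close> a fixed strip.\<close>

lemma setwise_convergence:
  fixes \<tau> :: "nat \<Rightarrow> 'a measure"
  assumes fin: "\<And>n. finite_measure (\<tau> n)" "finite_measure \<tau>0" "finite_measure \<alpha>"
    and sets: "\<And>n. sets (\<tau> n) = sets N" "sets \<tau>0 = sets N"
    and k: "k \<in> N \<rightarrow>\<^sub>M \<alpha>" and B: "B \<in> sets N"
    and dom: "\<And>n A. A \<in> sets \<alpha> \<Longrightarrow> measure (\<tau> n) (k -` A \<inter> B) \<le> measure \<alpha> A"
    and G: "Int_stable G" "G \<subseteq> Pow (space \<alpha>)" "sets \<alpha> = sigma_sets (space \<alpha>) G" "space \<alpha> \<in> G"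
    and conv: "\<And>A. A \<in> G \<Longrightarrow> (\<lambda>n. measure (\<tau> n) (k -` A \<inter> B)) \<longlonglongrightarrow> measure \<tau>0 (k -` A \<inter> B)"
    and A: "A \<in> sets \<alpha>"
  shows "(\<lambda>n. measure (\<tau> n) (k -` A \<inter> B)) \<longlonglongrightarrow> measure \<tau>0 (k -` A \<inter> B)"
proof -
  have BN: "B \<subseteq> space N" using sets.sets_into_space[OF B] .
  have sp: "k -` space \<alpha> \<inter> B = B" using BN measurable_space[OF k] by auto
  have mk: "k -` A \<inter> B \<in> sets N" if "A \<in> sets \<alpha>" for A
  proof -
    have "k -` A \<inter> B = (k -` A \<inter> space N) \<inter> B" using BN by auto
    then show ?thesis using measurable_sets[OF k that] B by simp
  qed
  have sig: "A \<in> sets \<alpha>" if "A \<in> sigma_sets (space \<alpha>) G" for A using that G(3) by simp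
  have "A \<in> sigma_sets (space \<alpha>) G" using A G(3) by simp
  with G(1,2) show ?thesis
  proof (induction rule: sigma_sets_induct_disjoint)
    case (basic A)
    then show ?case by (rule conv)
  next
    case empty
    then show ?case by simp
  next
    case (compl A)
    have e: "k -` (space \<alpha> - A) \<inter> B = B - (k -` A \<inter> B)" using sp by auto
    have d: "measure m (k -` (space \<alpha> - A) \<inter> B) = measure m B - measure m (k -` A \<inter> B)"
      if "finite_measure m" "sets m = sets N" for m
      unfolding e using mk[OF sig[OF compl(1)]] B that by (intro finite_measure.finite_measure_Diff) auto
    show ?case
      unfolding d[OF fin(1) sets(1)] d[OF fin(2) sets(2)]
      using conv[OF G(4)] compl(2) unfolding sp by (rule tendsto_diff)
  next
    case (union A)
    have disj: "disjoint_family (\<lambda>i. k -` A i \<inter> B)"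
      using union(1) unfolding disjoint_family_on_def by blast
    have S: "A i \<in> sets \<alpha>" for i using union(2) sig by blast
    have u: "(\<lambda>i. measure m (k -` A i \<inter> B)) sums measure m (k -` (\<Union>i. A i) \<inter> B)"
      if "finite_measure m" "sets m = sets N" for m
    proof -
      have "(\<lambda>i. measure m (k -` A i \<inter> B)) sums measure m (\<Union>i. k -` A i \<inter> B)"
        using mk[OF S] disj that by (intro finite_measure.finite_measure_UNION) auto
      moreover have "(\<Union>i. k -` A i \<inter> B) = k -` (\<Union>i. A i) \<inter> B" by auto
      ultimately show ?thesis by simp
    qed
    have "summable (\<lambda>i. measure \<alpha> (A i))"
      using finite_measure.finite_measure_UNION[OF fin(3) _ union(1)] S by (auto simp: sums_iff)
    then have "(\<lambda>n. \<Sum>i. measure (\<tau> n) (k -` A i \<inter> B)) \<longlonglongrightarrow> (\<Sum>i. measure \<tau>0 (k -` A i \<inter> B))"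
      using tannerys_theorem[of "\<lambda>i n. measure (\<tau> n) (k -` A i \<inter> B)" "\<lambda>i. measure \<tau>0 (k -` A i \<inter> B)"
          sequentially "\<lambda>i. measure \<alpha> (A i)"] union(3) dom[OF S]
      by (simp add: always_eventually)
    then show ?case
      using u[OF fin(1) sets(1)] u[OF fin(2) sets(2)] by (simp add: sums_iff)
  qed
qed

text \<open>Domination of both marginals is packaged with the convergence because it allows
  convergence to be tested on generators, and because it is inherited by products.\<close>

definition rect_conv :: "'a measure \<Rightarrow> 'b measure \<Rightarrow> (nat \<Rightarrow> ('a \<times> 'b) measure) \<Rightarrow> ('a \<times> 'b) measure \<Rightarrow> bool" where
  "rect_conv \<alpha> \<beta> \<tau> \<tau>0 \<longleftrightarrow> finite_measure \<alpha> \<and> finite_measure \<beta> \<and>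
     (\<forall>n. finite_measure (\<tau> n) \<and> sets (\<tau> n) = sets (\<alpha> \<Otimes>\<^sub>M \<beta>)) \<and>
     finite_measure \<tau>0 \<and> sets \<tau>0 = sets (\<alpha> \<Otimes>\<^sub>M \<beta>) \<and>
     (\<forall>n. \<forall>A\<in>sets \<alpha>. emeasure (\<tau> n) (A \<times> space \<beta>) \<le> emeasure \<alpha> A) \<and>
     (\<forall>n. \<forall>B\<in>sets \<beta>. emeasure (\<tau> n) (space \<alpha> \<times> B) \<le> emeasure \<beta> B) \<and>
     (\<forall>A\<in>sets \<alpha>. \<forall>B\<in>sets \<beta>. (\<lambda>n. measure (\<tau> n) (A \<times> B)) \<longlonglongrightarrow> measure \<tau>0 (A \<times> B))"

text \<open>\<open>setwise_convergence\<close> is applied to one coordinate after the other: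
  \<open>A\<close> is extended beyond \<open>G\<close> while \<open>B\<close> is still in
  \<open>H\<close>, then \<open>B\<close> is extended with \<open>A\<close> already
  arbitrary.\<close>

lemma rect_convI:
  fixes \<tau> :: "nat \<Rightarrow> ('a \<times> 'b) measure"
  assumes fin: "finite_measure \<alpha>" "finite_measure \<beta>" "finite_measure \<tau>0"
    and sets: "\<And>n. sets (\<tau> n) = sets (\<alpha> \<Otimes>\<^sub>M \<beta>)" "sets \<tau>0 = sets (\<alpha> \<Otimes>\<^sub>M \<beta>)"
    and dom1: "\<And>n A. A \<in> sets \<alpha> \<Longrightarrow> emeasure (\<tau> n) (A \<times> space \<beta>) \<le> emeasure \<alpha> A"
    and dom2: "\<And>n B. B \<in> sets \<beta> \<Longrightarrow> emeasure (\<tau> n) (space \<alpha> \<times> B) \<le> emeasure \<beta> B"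
    and G: "Int_stable G" "G \<subseteq> Pow (space \<alpha>)" "sets \<alpha> = sigma_sets (space \<alpha>) G" "space \<alpha> \<in> G"
    and H: "Int_stable H" "H \<subseteq> Pow (space \<beta>)" "sets \<beta> = sigma_sets (space \<beta>) H" "space \<beta> \<in> H"
    and conv: "\<And>A B. A \<in> G \<Longrightarrow> B \<in> H \<Longrightarrow> (\<lambda>n. measure (\<tau> n) (A \<times> B)) \<longlonglongrightarrow> measure \<tau>0 (A \<times> B)"
  shows "rect_conv \<alpha> \<beta> \<tau> \<tau>0"
proof -
  have fin\<tau>: "finite_measure (\<tau> n)" for n
  proof (rule finite_measureI)
    have "emeasure (\<tau> n) (space (\<tau> n)) \<le> emeasure \<alpha> (space \<alpha>)"
      using dom1[of "space \<alpha>" n] sets_eq_imp_space_eq[OF sets(1)[of n]] by (simp add: space_pair_measure)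
    then show "emeasure (\<tau> n) (space (\<tau> n)) \<noteq> \<infinity>"
      using finite_measure.emeasure_finite[OF fin(1), of "space \<alpha>"] by (auto simp: top_unique)
  qed
  have GS: "A \<in> sets \<alpha>" if "A \<in> G" for A using that G(3) by (simp add: sigma_sets.Basic)
  have HS: "A \<in> sets \<beta>" if "A \<in> H" for A using that H(3) by (simp add: sigma_sets.Basic)
  have d1: "measure (\<tau> n) (A \<times> B) \<le> measure \<alpha> A" if "A \<in> sets \<alpha>" "B \<in> sets \<beta>" for n A B
  proof -
    have "emeasure (\<tau> n) (A \<times> B) \<le> emeasure (\<tau> n) (A \<times> space \<beta>)"
      using that sets.sets_into_space[OF that(2)] sets(1) by (intro emeasure_mono) auto
    also note dom1[OF that(1)]
    finally show ?thesis
      using finite_measure.emeasure_eq_measure[OF fin\<tau>] finite_measure.emeasure_eq_measure[OF fin(1)] by simp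
  qed
  have d2: "measure (\<tau> n) (A \<times> B) \<le> measure \<beta> B" if "A \<in> sets \<alpha>" "B \<in> sets \<beta>" for n A B
  proof -
    have "emeasure (\<tau> n) (A \<times> B) \<le> emeasure (\<tau> n) (space \<alpha> \<times> B)"
      using that sets.sets_into_space[OF that(1)] sets(1) by (intro emeasure_mono) auto
    also note dom2[OF that(2)]
    finally show ?thesis
      using finite_measure.emeasure_eq_measure[OF fin\<tau>] finite_measure.emeasure_eq_measure[OF fin(2)] by simp
  qed
  have e1: "fst -` A \<inter> (space \<alpha> \<times> B) = A \<times> B" if "A \<in> sets \<alpha>" for A :: "'a set" and B :: "'b set"
    using sets.sets_into_space[OF that] by auto
  have e2: "snd -` B \<inter> (A \<times> space \<beta>) = A \<times> B" if "B \<in> sets \<beta>" for A :: "'a set" and B :: "'b set"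
    using sets.sets_into_space[OF that] by auto
  have c1: "(\<lambda>n. measure (\<tau> n) (A \<times> B)) \<longlonglongrightarrow> measure \<tau>0 (A \<times> B)" if "A \<in> sets \<alpha>" "B \<in> H" for A B
  proof -
    have "(\<lambda>n. measure (\<tau> n) (fst -` A \<inter> (space \<alpha> \<times> B))) \<longlonglongrightarrow> measure \<tau>0 (fst -` A \<inter> (space \<alpha> \<times> B))"
    proof (rule setwise_convergence[where N = "\<alpha> \<Otimes>\<^sub>M \<beta>" and G = G and \<alpha> = \<alpha>, OF fin\<tau> fin(3,1) sets
          measurable_fst _ _ G _ that(1)])
      show "space \<alpha> \<times> B \<in> sets (\<alpha> \<Otimes>\<^sub>M \<beta>)" using HS[OF that(2)] by simp
      show "measure (\<tau> n) (fst -` A' \<inter> space \<alpha> \<times> B) \<le> measure \<alpha> A'" if "A' \<in> sets \<alpha>" for n A'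
        using d1[OF that HS[OF \<open>B \<in> H\<close>]] e1[OF that] by simp
      show "(\<lambda>n. measure (\<tau> n) (fst -` A' \<inter> space \<alpha> \<times> B)) \<longlonglongrightarrow> measure \<tau>0 (fst -` A' \<inter> space \<alpha> \<times> B)"
        if "A' \<in> G" for A'
        using conv[OF that \<open>B \<in> H\<close>] e1[OF GS[OF that]] by simp
    qed
    then show ?thesis using that by (simp add: e1)
  qed
  have "(\<lambda>n. measure (\<tau> n) (A \<times> B)) \<longlonglongrightarrow> measure \<tau>0 (A \<times> B)" if "A \<in> sets \<alpha>" "B \<in> sets \<beta>" for A B
  proof -
    have "(\<lambda>n. measure (\<tau> n) (snd -` B \<inter> (A \<times> space \<beta>))) \<longlonglongrightarrow> measure \<tau>0 (snd -` B \<inter> (A \<times> space \<beta>))"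
    proof (rule setwise_convergence[where N = "\<alpha> \<Otimes>\<^sub>M \<beta>" and G = H and \<alpha> = \<beta>, OF fin\<tau> fin(3,2) sets
          measurable_snd _ _ H _ that(2)])
      show "A \<times> space \<beta> \<in> sets (\<alpha> \<Otimes>\<^sub>M \<beta>)" using that(1) by simp
      show "measure (\<tau> n) (snd -` B' \<inter> A \<times> space \<beta>) \<le> measure \<beta> B'" if "B' \<in> sets \<beta>" for n B'
        using d2[OF \<open>A \<in> sets \<alpha>\<close> that] e2[OF that] by simp
      show "(\<lambda>n. measure (\<tau> n) (snd -` B' \<inter> A \<times> space \<beta>)) \<longlonglongrightarrow> measure \<tau>0 (snd -` B' \<inter> A \<times> space \<beta>)"
        if "B' \<in> H" for B'
        using c1[OF \<open>A \<in> sets \<alpha>\<close> that] e2[OF HS[OF that]] by simp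
    qed
    then show ?thesis using that by (simp add: e2)
  qed
  then show ?thesis
    unfolding rect_conv_def by (intro conjI allI ballI fin fin\<tau> sets dom1 dom2)
qed

section \<open>Compactness of couplings\<close>

text \<open>Bounded weights on countably many cylinders have a pointwise convergent subsequence.
  Additivity over the two extensions passes to the limit, and every consistent family of weights is
  a measure, so no tightness has to be proved.\<close>

lemma cantor_limit:
  fixes m :: "nat \<Rightarrow> (nat \<Rightarrow> bool) measure"
  assumes fin: "\<And>n. finite_measure (m n)" and sets: "\<And>n. sets (m n) = sets cantor"
    and bd: "\<And>n. measure (m n) UNIV \<le> c"
  obtains r \<rho> where "strict_mono r" "finite_measure \<rho>" "sets \<rho> = sets cantor"
    "\<And>s. (\<lambda>n. measure (m (r n)) (cyl s)) \<longlonglongrightarrow> measure \<rho> (cyl s)"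
proof -
  have le: "measure (m n) (cyl s) \<le> c" for n s
  proof -
    have "space (m n) = UNIV" using sets_eq_imp_space_eq[OF sets] by simp
    then have "measure (m n) (cyl s) \<le> measure (m n) UNIV"
      using finite_measure.bounded_measure[OF fin, of n "cyl s"] by simp
    then show ?thesis using bd[of n] by simp
  qed
  define F where "F n i = measure (m n) (cyl (from_nat i))" for n i :: nat
  have "compactin (product_topology (\<lambda>_::nat. euclideanreal) UNIV) (PiE UNIV (\<lambda>_. {0..c}))"
    unfolding compactin_PiE by simp
  then have "compact (PiE (UNIV :: nat set) (\<lambda>_. {0..c}))"
    by (simp add: euclidean_product_topology)
  then have "seq_compact (PiE (UNIV :: nat set) (\<lambda>_. {0..c}))"
    by (rule compact_imp_seq_compact)
  moreover have "\<forall>n. F n \<in> PiE UNIV (\<lambda>_. {0..c})" by (auto simp: F_def le)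
  ultimately obtain l r where r: "strict_mono r" "(F \<circ> r) \<longlonglongrightarrow> l" "l \<in> PiE UNIV (\<lambda>_. {0..c})"
    by (rule seq_compactE) blast
  define w where "w s = l (to_nat s)" for s :: "bool list"
  have lim: "(\<lambda>n. measure (m (r n)) (cyl s)) \<longlonglongrightarrow> w s" for s
  proof -
    have "continuous_on UNIV (\<lambda>z :: nat \<Rightarrow> real. z (to_nat s))"
      by (rule continuous_on_product_coordinates)
    from continuous_on_tendsto_compose[OF this r(2)]
    show ?thesis by (simp add: F_def w_def)
  qed
  have w: "consistent w"
    unfolding consistent_def
  proof (intro allI conjI)
    fix s
    show "0 \<le> w s" using lim by (rule LIMSEQ_le_const) auto
    have "measure (m (r n)) (cyl s) = measure (m (r n)) (cyl (False # s)) + measure (m (r n)) (cyl (True # s))" for n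
      unfolding cyl_split(1)[of s]
      by (rule finite_measure.finite_measure_Union[OF fin]) (simp_all add: sets cyl_split(2))
    then have "(\<lambda>n. measure (m (r n)) (cyl s)) \<longlonglongrightarrow> w (False # s) + w (True # s)"
      using tendsto_add[OF lim lim] by simp
    with lim show "w s = w (False # s) + w (True # s)" by (rule LIMSEQ_unique)
  qed
  \<comment> \<open>Lebesgue measure on an interval of length \<open>w []\<close>, pushed forward by
    \<open>sample w\<close>, has the limit weights.\<close>
  define D where "D = density lborel (indicator {0..<w []})"
  have [measurable_cong]: "sets D = sets borel" by (simp add: D_def)
  \<comment> \<open>The weights are fixed here, so the parameter space of
    \<open>measurable_sample\<close> is a single point.\<close>
  have "(\<lambda>(x :: unit, u). sample w u) \<in> count_space UNIV \<Otimes>\<^sub>M borel \<rightarrow>\<^sub>M cantor"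
    by (rule measurable_sample) simp
  then have [measurable]: "sample w \<in> borel \<rightarrow>\<^sub>M cantor"
    using measurable_compose[OF measurable_Pair1'[of "()" "count_space UNIV" borel]] by fastforce
  define \<rho> where "\<rho> = distr D cantor (sample w)"
  have em: "emeasure \<rho> (cyl s) = ennreal (w s)" for s
  proof -
    have "sample w -` cyl s \<in> sets borel"
      using measurable_sets[of "sample w" borel cantor "cyl s"] by simp
    moreover have "{0..<w []} \<inter> sample w -` cyl s = {left_end w s..<left_end w s + w s}"
      unfolding sample_cyl[OF w, of s, symmetric] by auto
    moreover have "0 \<le> w s" using w unfolding consistent_def by blast
    ultimately show ?thesis
      by (simp add: \<rho>_def emeasure_distr D_def emeasure_restricted)
  qed
  have w0: "0 \<le> w s" for s using w unfolding consistent_def by blast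
  show ?thesis
  proof (rule that[OF r(1)])
    show "finite_measure \<rho>" using em[of "[]"] by (intro finite_measureI) (simp add: \<rho>_def)
    show "(\<lambda>n. measure (m (r n)) (cyl s)) \<longlonglongrightarrow> measure \<rho> (cyl s)" for s
      using lim[of s] em[of s] w0[of s] by (simp add: measure_def)
  qed (simp add: \<rho>_def)
qed

text \<open>The sets decided by finitely many bits. They are preferred to the cylinders as a
  generator because they are closed under intersection, whereas two disjoint cylinders meet in the
  empty set, which is no cylinder.\<close>

definition clopen :: "(nat \<Rightarrow> bool) set \<Rightarrow> bool" where
  "clopen A \<longleftrightarrow> (\<exists>N. \<forall>c d. pre c N = pre d N \<longrightarrow> (c \<in> A \<longleftrightarrow> d \<in> A))"

lemma clopen_finite_Union:
  assumes "clopen A"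
  obtains S where "finite S" "A = (\<Union>s\<in>S. cyl s)" "disjoint_family_on cyl S"
proof -
  obtain N where N: "\<And>c d. pre c N = pre d N \<Longrightarrow> c \<in> A \<longleftrightarrow> d \<in> A"
    using assms unfolding clopen_def by blast
  let ?S = "(\<lambda>c. pre c N) ` A"
  show ?thesis
  proof (rule that[of ?S])
    have "?S \<subseteq> {s. set s \<subseteq> UNIV \<and> length s = N}" by auto
    then show "finite ?S" using finite_lists_length_eq[of "UNIV :: bool set" N] finite_subset by auto
    have "(\<Union>s\<in>?S. cyl s) = {c. \<exists>d\<in>A. pre c N = pre d N}" by (auto simp: cyl_def)
    then show "A = (\<Union>s\<in>?S. cyl s)" using N by blast
    show "disjoint_family_on cyl ?S" by (auto simp: disjoint_family_on_def cyl_def)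
  qed
qed

lemma clopen_sets: "clopen A \<Longrightarrow> A \<in> sets cantor"
  by (metis clopen_finite_Union sets.finite_UN sets_cyl)

lemma clopen_Int: "clopen A \<Longrightarrow> clopen B \<Longrightarrow> clopen (A \<inter> B)"
proof -
  assume "clopen A" "clopen B"
  then obtain N M where "\<And>c d. pre c N = pre d N \<Longrightarrow> c \<in> A \<longleftrightarrow> d \<in> A"
    "\<And>c d. pre c M = pre d M \<Longrightarrow> c \<in> B \<longleftrightarrow> d \<in> B"
    unfolding clopen_def by metis
  then have "\<forall>c d. pre c (max N M) = pre d (max N M) \<longrightarrow> (c \<in> A \<inter> B \<longleftrightarrow> d \<in> A \<inter> B)"
    by (metis Int_iff max.cobounded1 max.cobounded2 pre_mono)
  then show ?thesis unfolding clopen_def by blast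
qed

lemma clopen_UNIV: "clopen UNIV"
  by (auto simp: clopen_def)

lemma clopen_cyl: "clopen (cyl s)"
  unfolding clopen_def cyl_def by (intro exI[of _ "length s"]) auto

lemma sets_cantor_clopen: "sets cantor = sigma_sets UNIV (Collect clopen)"
proof
  show "sets cantor \<subseteq> sigma_sets UNIV (Collect clopen)"
    unfolding sets_cantor by (rule sigma_sets_mono) (auto intro: sigma_sets.Basic clopen_cyl)
  show "sigma_sets UNIV (Collect clopen) \<subseteq> sets cantor"
    using sets.sigma_sets_subset[of "Collect clopen" cantor] clopen_sets by auto
qed

text \<open>The first \<open>N\<close> bits of the even and of the odd subsequence can be read off
  the first \<open>2 * N\<close> bits.\<close>

lemma clopen_interleave:
  assumes "clopen A" "clopen B"
  shows "clopen {c. (\<lambda>i. c (2 * i)) \<in> A \<and> (\<lambda>i. c (2 * i + 1)) \<in> B}"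
proof -
  have *: "clopen {c. (\<lambda>i. c (2 * i + k)) \<in> A}" if clA: "clopen A" and k1: "k \<le> 1" for k A
  proof -
    obtain N where N: "\<And>c d. pre c N = pre d N \<Longrightarrow> c \<in> A \<longleftrightarrow> d \<in> A"
      using clA unfolding clopen_def by blast
    have "pre (\<lambda>i. c (2 * i + k)) N = pre (\<lambda>i. d (2 * i + k)) N" if "pre c (2 * N) = pre d (2 * N)" for c d
      using that k1 by (auto simp: pre_eq_iff)
    then show ?thesis unfolding clopen_def using N by (intro exI[of _ "2 * N"]) blast
  qed
  show ?thesis
    using clopen_Int[OF *[OF assms(1), of 0] *[OF assms(2), of 1]] by (simp add: Collect_conj_eq)
qed

text \<open>Interleaving the codes of the two coordinates makes a single Cantor space out of the
  product; cylinders of the interleaved code are rectangles.\<close>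

lemma rect_conv_subsequence:
  fixes \<tau> :: "nat \<Rightarrow> ('a \<times> 'b) measure"
  assumes cod: "coded \<alpha> f g" "coded \<beta> f' g'" and fin: "finite_measure \<alpha>" "finite_measure \<beta>"
    and sets: "\<And>n. sets (\<tau> n) = sets (\<alpha> \<Otimes>\<^sub>M \<beta>)"
    and dom1: "\<And>n A. A \<in> sets \<alpha> \<Longrightarrow> emeasure (\<tau> n) (A \<times> space \<beta>) \<le> emeasure \<alpha> A"
    and dom2: "\<And>n B. B \<in> sets \<beta> \<Longrightarrow> emeasure (\<tau> n) (space \<alpha> \<times> B) \<le> emeasure \<beta> B"
  obtains r \<tau>0 where "strict_mono r" "rect_conv \<alpha> \<beta> (\<lambda>n. \<tau> (r n)) \<tau>0"
proof -
  note sets[measurable_cong]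
  have f[measurable]: "f \<in> \<alpha> \<rightarrow>\<^sub>M cantor" "g \<in> cantor \<rightarrow>\<^sub>M \<alpha>" "f' \<in> \<beta> \<rightarrow>\<^sub>M cantor" "g' \<in> cantor \<rightarrow>\<^sub>M \<beta>"
    and gf: "\<And>x. x \<in> space \<alpha> \<Longrightarrow> g (f x) = x" "\<And>y. y \<in> space \<beta> \<Longrightarrow> g' (f' y) = y"
    using cod unfolding coded_def by auto
  have sp: "space (\<tau> n) = space \<alpha> \<times> space \<beta>" for n
    using sets_eq_imp_space_eq[OF sets] by (simp add: space_pair_measure)
  have bd: "emeasure (\<tau> n) (space (\<tau> n)) \<le> emeasure \<alpha> (space \<alpha>)" for n
    using dom1[of "space \<alpha>" n] sp by simp
  have fin\<tau>: "finite_measure (\<tau> n)" for n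
    using bd[of n] finite_measure.emeasure_finite[OF fin(1), of "space \<alpha>"]
    by (intro finite_measureI) (auto simp: top_unique)
  define F where "F z i = (if even i then f (fst z) (i div 2) else f' (snd z) (i div 2))"
    for z :: "'a \<times> 'b" and i
  have Fm[measurable]: "F \<in> \<alpha> \<Otimes>\<^sub>M \<beta> \<rightarrow>\<^sub>M cantor"
  proof (rule measurable_cantorI)
    fix i
    have "(\<lambda>z. f (fst z) (i div 2)) \<in> \<alpha> \<Otimes>\<^sub>M \<beta> \<rightarrow>\<^sub>M count_space UNIV"
      "(\<lambda>z. f' (snd z) (i div 2)) \<in> \<alpha> \<Otimes>\<^sub>M \<beta> \<rightarrow>\<^sub>M count_space UNIV" by measurable
    then show "(\<lambda>z. F z i) \<in> \<alpha> \<Otimes>\<^sub>M \<beta> \<rightarrow>\<^sub>M count_space UNIV"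
      unfolding F_def by (cases "even i") simp_all
  qed
  define m where "m n = distr (\<tau> n) cantor F" for n :: nat
  have Fp: "F -` A \<inter> space (\<tau> n) \<in> sets (\<tau> n)" if "A \<in> sets cantor" for A n
    using that by measurable
  obtain r \<rho> where r: "strict_mono r" and \<rho>: "finite_measure \<rho>" "sets \<rho> = sets cantor"
    and lim: "\<And>s. (\<lambda>n. measure (m (r n)) (cyl s)) \<longlonglongrightarrow> measure \<rho> (cyl s)"
  proof (rule cantor_limit[of m "measure \<alpha> (space \<alpha>)"])
    show "finite_measure (m n)" for n
      unfolding m_def by (rule finite_measure.finite_measure_distr[OF fin\<tau>]) measurable
    show "measure (m n) UNIV \<le> measure \<alpha> (space \<alpha>)" for n
      using bd[of n] sets.top[of cantor] finite_measure.emeasure_eq_measure[OF fin\<tau>] finite_measure.emeasure_eq_measure[OF fin(1)]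
      by (simp add: m_def measure_distr)
  qed (simp_all add: m_def)
  have finm: "finite_measure (m n)" for n
    unfolding m_def by (rule finite_measure.finite_measure_distr[OF fin\<tau>]) measurable
  have limc: "(\<lambda>n. measure (m (r n)) A) \<longlonglongrightarrow> measure \<rho> A" if A: "clopen A" for A
  proof -
    obtain S where S: "finite S" "A = (\<Union>s\<in>S. cyl s)" "disjoint_family_on cyl S"
      using clopen_finite_Union[OF A] .
    have fs: "measure M A = (\<Sum>s\<in>S. measure M (cyl s))" if M: "finite_measure M" "sets M = sets cantor" for M
    proof -
      have "cyl ` S \<subseteq> sets M" by (rule image_subsetI) (simp only: M(2) sets_cyl)
      from finite_measure.finite_measure_finite_Union[OF M(1) S(1) this S(3)] show ?thesis
        unfolding S(2)[symmetric] .
    qed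
    have "(\<lambda>n. \<Sum>s\<in>S. measure (m (r n)) (cyl s)) \<longlonglongrightarrow> (\<Sum>s\<in>S. measure \<rho> (cyl s))"
      by (intro tendsto_sum lim)
    then show ?thesis
      unfolding fs[OF \<rho>] fs[OF finm, of "r _", unfolded m_def sets_distr, OF refl, folded m_def] .
  qed
  note \<rho>(2)[measurable_cong]
  define ev where "ev c i = c (2 * i)" for c :: "nat \<Rightarrow> bool" and i :: nat
  define od where "od c i = c (2 * i + 1)" for c :: "nat \<Rightarrow> bool" and i :: nat
  have [measurable]: "ev \<in> cantor \<rightarrow>\<^sub>M cantor" "od \<in> cantor \<rightarrow>\<^sub>M cantor"
    by (auto intro!: measurable_cantorI simp: ev_def od_def)
  have evF: "ev (F z) = f (fst z)" "od (F z) = f' (snd z)" for z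
    by (auto simp: ev_def od_def F_def)
  \<comment> \<open>The codes of the two coordinates get marginals \<alpha>' and \<beta>' of their
    own, so that convergence can be proved on the product of two Cantor spaces before
    decoding.\<close>
  define \<alpha>' where "\<alpha>' = distr \<alpha> cantor f"
  define \<beta>' where "\<beta>' = distr \<beta> cantor f'"
  have s': "sets \<alpha>' = sets cantor" "sets \<beta>' = sets cantor" "space \<alpha>' = UNIV" "space \<beta>' = UNIV"
    by (simp_all add: \<alpha>'_def \<beta>'_def)
  note s'(1,2)[measurable_cong]
  define \<sigma> where "\<sigma> n = distr (\<tau> n) (\<alpha>' \<Otimes>\<^sub>M \<beta>') (\<lambda>z. (f (fst z), f' (snd z)))" for n :: nat
  define \<sigma>0 where "\<sigma>0 = distr \<rho> (\<alpha>' \<Otimes>\<^sub>M \<beta>') (\<lambda>c. (ev c, od c))"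
  have \<sigma>m: "\<sigma> n = distr (m n) (\<alpha>' \<Otimes>\<^sub>M \<beta>') (\<lambda>c. (ev c, od c))" for n
    unfolding \<sigma>_def m_def by (subst distr_distr) (auto simp: comp_def evF)
  have rc: "rect_conv \<alpha>' \<beta>' (\<lambda>n. \<sigma> (r n)) \<sigma>0"
  proof (rule rect_convI[where G = "Collect clopen" and H = "Collect clopen"])
    show "finite_measure \<alpha>'" "finite_measure \<beta>'" "finite_measure \<sigma>0"
      unfolding \<alpha>'_def \<beta>'_def \<sigma>0_def
      by (rule finite_measure.finite_measure_distr; (rule fin \<rho> | measurable))+
    show "Int_stable (Collect clopen)" "Int_stable (Collect clopen)"
      by (auto simp: Int_stable_def clopen_Int)
    show "emeasure (\<sigma> (r n)) (A \<times> space \<beta>') \<le> emeasure \<alpha>' A" if "A \<in> sets \<alpha>'" for n A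
    proof -
      have [measurable]: "A \<in> sets cantor" using that s' by simp
      have "(\<lambda>z. (f (fst z), f' (snd z))) -` (A \<times> UNIV) \<inter> space (\<tau> (r n)) = (f -` A \<inter> space \<alpha>) \<times> space \<beta>"
        by (auto simp: sp)
      moreover have "A \<times> UNIV \<in> sets (\<alpha>' \<Otimes>\<^sub>M \<beta>')" using that s' sets.top[of \<beta>'] by simp
      ultimately have "emeasure (\<sigma> (r n)) (A \<times> UNIV) = emeasure (\<tau> (r n)) ((f -` A \<inter> space \<alpha>) \<times> space \<beta>)"
        unfolding \<sigma>_def by (subst emeasure_distr) simp_all
      moreover have "emeasure \<alpha>' A = emeasure \<alpha> (f -` A \<inter> space \<alpha>)"
        by (simp add: \<alpha>'_def emeasure_distr)
      ultimately show ?thesis using dom1[of "f -` A \<inter> space \<alpha>" "r n"] by (simp add: s')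
    qed
    show "emeasure (\<sigma> (r n)) (space \<alpha>' \<times> B) \<le> emeasure \<beta>' B" if "B \<in> sets \<beta>'" for n B
    proof -
      have [measurable]: "B \<in> sets cantor" using that s' by simp
      have "(\<lambda>z. (f (fst z), f' (snd z))) -` (UNIV \<times> B) \<inter> space (\<tau> (r n)) = space \<alpha> \<times> (f' -` B \<inter> space \<beta>)"
        by (auto simp: sp)
      moreover have "UNIV \<times> B \<in> sets (\<alpha>' \<Otimes>\<^sub>M \<beta>')" using that s' sets.top[of \<alpha>'] by simp
      ultimately have "emeasure (\<sigma> (r n)) (UNIV \<times> B) = emeasure (\<tau> (r n)) (space \<alpha> \<times> (f' -` B \<inter> space \<beta>))"
        unfolding \<sigma>_def by (subst emeasure_distr) simp_all
      moreover have "emeasure \<beta>' B = emeasure \<beta> (f' -` B \<inter> space \<beta>)"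
        by (simp add: \<beta>'_def emeasure_distr)
      ultimately show ?thesis using dom2[of "f' -` B \<inter> space \<beta>" "r n"] by (simp add: s')
    qed
    show "(\<lambda>n. measure (\<sigma> (r n)) (A \<times> B)) \<longlonglongrightarrow> measure \<sigma>0 (A \<times> B)"
      if "A \<in> Collect clopen" "B \<in> Collect clopen" for A B
    proof -
      have [measurable]: "A \<in> sets cantor" "B \<in> sets cantor" using that clopen_sets by auto
      \<comment> \<open>A rectangle of clopen sets is clopen for the interleaved code, so its mass
        converges by \<open>limc\<close>.\<close>
      let ?C = "{c. ev c \<in> A \<and> od c \<in> B}"
      have "clopen ?C" using clopen_interleave[of A B] that unfolding ev_def od_def by simp
      from limc[OF this] have "(\<lambda>n. measure (m (r n)) ?C) \<longlonglongrightarrow> measure \<rho> ?C" .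
      moreover have "measure (distr M (\<alpha>' \<Otimes>\<^sub>M \<beta>') (\<lambda>c. (ev c, od c))) (A \<times> B) = measure M ?C"
        if [measurable_cong]: "sets M = sets cantor" for M
      proof -
        have "(\<lambda>c. (ev c, od c)) -` (A \<times> B) \<inter> space M = ?C"
          using sets_eq_imp_space_eq[OF that] by auto
        moreover have "A \<times> B \<in> sets (\<alpha>' \<Otimes>\<^sub>M \<beta>')" by measurable
        ultimately show ?thesis by (simp add: measure_distr)
      qed
      ultimately show ?thesis
        unfolding \<sigma>m \<sigma>0_def using \<rho>(2) by (simp add: m_def)
    qed
  qed (auto simp: s' \<sigma>_def \<sigma>0_def sets_cantor_clopen clopen_UNIV)
  \<comment> \<open>The decoders pull rectangles back to rectangles, and a rectangle pulled back by
    the decoders and then by the codes is unchanged; hence convergence transfers to all measurable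
    rectangles.\<close>
  define \<tau>0 where "\<tau>0 = distr \<sigma>0 (\<alpha> \<Otimes>\<^sub>M \<beta>) (\<lambda>z. (g (fst z), g' (snd z)))"
  have s0[measurable_cong]: "sets \<sigma>0 = sets (\<alpha>' \<Otimes>\<^sub>M \<beta>')" by (simp add: \<sigma>0_def)
  have "rect_conv \<alpha> \<beta> (\<lambda>n. \<tau> (r n)) \<tau>0"
    unfolding rect_conv_def
  proof (intro conjI allI ballI fin fin\<tau> sets dom1 dom2)
    show "finite_measure \<tau>0" unfolding \<tau>0_def
      using rc unfolding rect_conv_def by (intro finite_measure.finite_measure_distr) auto
    show "sets \<tau>0 = sets (\<alpha> \<Otimes>\<^sub>M \<beta>)" by (simp add: \<tau>0_def)
    fix A B assume [measurable]: "A \<in> sets \<alpha>" "B \<in> sets \<beta>"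
    let ?A = "g -` A" and ?B = "g' -` B"
    have m1: "?A \<in> sets cantor" "?B \<in> sets cantor"
      using measurable_sets[OF f(2), of A] measurable_sets[OF f(4), of B] by simp_all
    have "(\<lambda>n. measure (\<sigma> (r n)) (?A \<times> ?B)) \<longlonglongrightarrow> measure \<sigma>0 (?A \<times> ?B)"
      using rc m1 s' unfolding rect_conv_def by simp
    moreover have "measure (\<sigma> n) (?A \<times> ?B) = measure (\<tau> n) (A \<times> B)" for n
    proof -
      have "(\<lambda>z. (f (fst z), f' (snd z))) -` (?A \<times> ?B) \<inter> space (\<tau> n) = A \<times> B"
        using gf sets.sets_into_space[of A \<alpha>] sets.sets_into_space[of B \<beta>] by (auto simp: sp subset_iff)
      moreover have "?A \<times> ?B \<in> sets (\<alpha>' \<Otimes>\<^sub>M \<beta>')" using m1 s' by simp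
      ultimately show ?thesis by (simp add: \<sigma>_def measure_distr)
    qed
    moreover have "measure \<sigma>0 (?A \<times> ?B) = measure \<tau>0 (A \<times> B)"
    proof -
      have "(\<lambda>z. (g (fst z), g' (snd z))) -` (A \<times> B) \<inter> space \<sigma>0 = ?A \<times> ?B"
        using sets_eq_imp_space_eq[OF s0] s' by (auto simp: space_pair_measure)
      then show ?thesis by (simp add: \<tau>0_def measure_distr)
    qed
    ultimately show "(\<lambda>n. measure (\<tau> (r n)) (A \<times> B)) \<longlonglongrightarrow> measure \<tau>0 (A \<times> B)" by simp
  qed
  then show ?thesis using that r by blast
qed


section \<open>Products of convergent couplings\<close>

lemma emeasure_pair_mono:
  assumes "finite_measure N" "finite_measure N'" "sets M = sets M'" "sets N = sets N'"
    and M: "\<And>A. A \<in> sets M \<Longrightarrow> emeasure M A \<le> emeasure M' A"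
    and N: "\<And>A. A \<in> sets N \<Longrightarrow> emeasure N A \<le> emeasure N' A"
    and A: "A \<in> sets (M \<Otimes>\<^sub>M N)"
  shows "emeasure (M \<Otimes>\<^sub>M N) A \<le> emeasure (M' \<Otimes>\<^sub>M N') A"
proof -
  interpret N: finite_measure N by fact
  interpret N': finite_measure N' by fact
  have A': "A \<in> sets (M' \<Otimes>\<^sub>M N')" using A assms(3,4) sets_pair_measure_cong by blast
  have "emeasure (M \<Otimes>\<^sub>M N) A = (\<integral>\<^sup>+x. emeasure N (Pair x -` A) \<partial>M)"
    using A by (rule N.emeasure_pair_measure_alt)
  also have "\<dots> \<le> (\<integral>\<^sup>+x. emeasure N' (Pair x -` A) \<partial>M)"
    by (intro nn_integral_mono N sets_Pair1[OF A])
  also have "\<dots> \<le> (\<integral>\<^sup>+x. emeasure N' (Pair x -` A) \<partial>M')"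
    using M assms(3) by (intro nn_integral_mono_measure) (auto simp: le_measure)
  also have "\<dots> = emeasure (M' \<Otimes>\<^sub>M N') A"
    using A' by (rule N'.emeasure_pair_measure_alt[symmetric])
  finally show ?thesis .
qed

text \<open>Groups four points by network instead of by coupling, so that the two functions to be
  compared depend on separate coordinates.\<close>

definition middle_swap :: "('a \<times> 'b) \<times> ('c \<times> 'd) \<Rightarrow> ('a \<times> 'c) \<times> ('b \<times> 'd)" where
  "middle_swap z = ((fst (fst z), fst (snd z)), (snd (fst z), snd (snd z)))"

lemma measurable_middle_swap [measurable]:
  "middle_swap \<in> (A \<Otimes>\<^sub>M B) \<Otimes>\<^sub>M (C \<Otimes>\<^sub>M D) \<rightarrow>\<^sub>M (A \<Otimes>\<^sub>M C) \<Otimes>\<^sub>M (B \<Otimes>\<^sub>M D)"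
  unfolding middle_swap_def by measurable

lemma Int_stable_Times: "Int_stable {A \<times> B | A B. A \<in> sets M \<and> B \<in> sets N}"
  unfolding Int_stable_def by (auto simp: Times_Int_Times) blast

text \<open>On a product of rectangles the regrouped product measure factorizes, so the limit is a
  product of two limits, and such sets generate. In this way functions of two points, such as
  \<open>k_of\<close> and \<open>omega_bar\<close>, are covered.\<close>

lemma rect_conv_pair:
  assumes \<tau>: "rect_conv \<alpha> \<beta> \<tau> \<tau>0" and \<sigma>: "rect_conv \<gamma> \<delta> \<sigma> \<sigma>0"
  defines "S \<equiv> (\<alpha> \<Otimes>\<^sub>M \<gamma>) \<Otimes>\<^sub>M (\<beta> \<Otimes>\<^sub>M \<delta>)"
  shows "rect_conv (\<alpha> \<Otimes>\<^sub>M \<gamma>) (\<beta> \<Otimes>\<^sub>M \<delta>) (\<lambda>n. distr (\<tau> n \<Otimes>\<^sub>M \<sigma> n) S middle_swap) (distr (\<tau>0 \<Otimes>\<^sub>M \<sigma>0) S middle_swap)"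
proof -
  have fin: "finite_measure \<alpha>" "finite_measure \<beta>" "finite_measure \<gamma>" "finite_measure \<delta>"
    "finite_measure \<tau>0" "finite_measure \<sigma>0" "\<And>n. finite_measure (\<tau> n)" "\<And>n. finite_measure (\<sigma> n)"
    and sets[measurable_cong]: "\<And>n. sets (\<tau> n) = sets (\<alpha> \<Otimes>\<^sub>M \<beta>)" "sets \<tau>0 = sets (\<alpha> \<Otimes>\<^sub>M \<beta>)"
     "\<And>n. sets (\<sigma> n) = sets (\<gamma> \<Otimes>\<^sub>M \<delta>)" "sets \<sigma>0 = sets (\<gamma> \<Otimes>\<^sub>M \<delta>)"
    and dom: "\<And>n A. A \<in> sets \<alpha> \<Longrightarrow> emeasure (\<tau> n) (A \<times> space \<beta>) \<le> emeasure \<alpha> A"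
     "\<And>n A. A \<in> sets \<beta> \<Longrightarrow> emeasure (\<tau> n) (space \<alpha> \<times> A) \<le> emeasure \<beta> A"
     "\<And>n A. A \<in> sets \<gamma> \<Longrightarrow> emeasure (\<sigma> n) (A \<times> space \<delta>) \<le> emeasure \<gamma> A"
     "\<And>n A. A \<in> sets \<delta> \<Longrightarrow> emeasure (\<sigma> n) (space \<gamma> \<times> A) \<le> emeasure \<delta> A"
    and conv: "\<And>A B. A \<in> sets \<alpha> \<Longrightarrow> B \<in> sets \<beta> \<Longrightarrow> (\<lambda>n. measure (\<tau> n) (A \<times> B)) \<longlonglongrightarrow> measure \<tau>0 (A \<times> B)"
     "\<And>A B. A \<in> sets \<gamma> \<Longrightarrow> B \<in> sets \<delta> \<Longrightarrow> (\<lambda>n. measure (\<sigma> n) (A \<times> B)) \<longlonglongrightarrow> measure \<sigma>0 (A \<times> B)"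
    using \<tau> \<sigma> unfolding rect_conv_def by auto
  have sp: "space (\<tau> n) = space \<alpha> \<times> space \<beta>" "space (\<sigma> n) = space \<gamma> \<times> space \<delta>"
    "space \<tau>0 = space \<alpha> \<times> space \<beta>" "space \<sigma>0 = space \<gamma> \<times> space \<delta>" for n
    using sets[THEN sets_eq_imp_space_eq] by (simp_all add: space_pair_measure)
  have prod: "emeasure (\<tau>' \<Otimes>\<^sub>M \<sigma>') (A \<times> B) = emeasure \<tau>' A * emeasure \<sigma>' B"
    if "finite_measure \<sigma>'" "A \<in> sets \<tau>'" "B \<in> sets \<sigma>'" for A B and \<tau>' :: "('a \<times> 'b) measure" and \<sigma>' :: "('c \<times> 'd) measure"
    using that by (intro sigma_finite_measure.emeasure_pair_measure_Times)
       (auto simp: finite_measure.sigma_finite_measure)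
  have finp: "finite_measure (M \<Otimes>\<^sub>M N)" if "finite_measure M" "finite_measure N" for M :: "'x measure" and N :: "'y measure"
  proof (rule finite_measureI)
    have "emeasure (M \<Otimes>\<^sub>M N) (space M \<times> space N) = emeasure M (space M) * emeasure N (space N)"
      using that by (intro sigma_finite_measure.emeasure_pair_measure_Times)
         (auto simp: finite_measure.sigma_finite_measure)
    then show "emeasure (M \<Otimes>\<^sub>M N) (space (M \<Otimes>\<^sub>M N)) \<noteq> \<infinity>"
      using finite_measure.emeasure_finite[OF that(1), of "space M"] finite_measure.emeasure_finite[OF that(2), of "space N"]
      by (simp add: space_pair_measure ennreal_mult_eq_top_iff)
  qed
  show ?thesis
  proof (rule rect_convI[where G = "{A \<times> B | A B. A \<in> sets \<alpha> \<and> B \<in> sets \<gamma>}" and H = "{A \<times> B | A B. A \<in> sets \<beta> \<and> B \<in> sets \<delta>}"])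
    show "finite_measure (\<alpha> \<Otimes>\<^sub>M \<gamma>)" "finite_measure (\<beta> \<Otimes>\<^sub>M \<delta>)" using finp fin by blast+
    have "finite_measure (\<tau>0 \<Otimes>\<^sub>M \<sigma>0)" using finp[OF fin(5,6)] .
    then show "finite_measure (distr (\<tau>0 \<Otimes>\<^sub>M \<sigma>0) S middle_swap)"
      by (rule finite_measure.finite_measure_distr) (simp add: S_def)
    show "sets (distr (\<tau> n \<Otimes>\<^sub>M \<sigma> n) S middle_swap) = sets ((\<alpha> \<Otimes>\<^sub>M \<gamma>) \<Otimes>\<^sub>M (\<beta> \<Otimes>\<^sub>M \<delta>))" for n
      by (simp add: S_def)
    show "sets (distr (\<tau>0 \<Otimes>\<^sub>M \<sigma>0) S middle_swap) = sets ((\<alpha> \<Otimes>\<^sub>M \<gamma>) \<Otimes>\<^sub>M (\<beta> \<Otimes>\<^sub>M \<delta>))"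
      by (simp add: S_def)
    show "emeasure (distr (\<tau> n \<Otimes>\<^sub>M \<sigma> n) S middle_swap) (A \<times> space (\<beta> \<Otimes>\<^sub>M \<delta>)) \<le> emeasure (\<alpha> \<Otimes>\<^sub>M \<gamma>) A"
      if A[measurable]: "A \<in> sets (\<alpha> \<Otimes>\<^sub>M \<gamma>)" for n A
    proof -
      let ?f = "\<lambda>z. (fst (fst z), fst (snd z))"
      have "emeasure (distr (\<tau> n \<Otimes>\<^sub>M \<sigma> n) S middle_swap) (A \<times> space (\<beta> \<Otimes>\<^sub>M \<delta>))
        = emeasure (\<tau> n \<Otimes>\<^sub>M \<sigma> n) (?f -` A \<inter> space (\<tau> n \<Otimes>\<^sub>M \<sigma> n))"
        unfolding S_def by (subst emeasure_distr)
          (auto intro!: arg_cong2[where f = emeasure] simp: middle_swap_def space_pair_measure sp)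
      also have "\<dots> = emeasure (distr (\<tau> n \<Otimes>\<^sub>M \<sigma> n) (\<alpha> \<Otimes>\<^sub>M \<gamma>) (\<lambda>(x, y). (fst x, fst y))) A"
        unfolding case_prod_beta by (subst emeasure_distr) auto
      \<comment> \<open>The marginal of the regrouped product is the product of the marginals, each
        of which is dominated.\<close>
      also have "distr (\<tau> n \<Otimes>\<^sub>M \<sigma> n) (\<alpha> \<Otimes>\<^sub>M \<gamma>) (\<lambda>(x, y). (fst x, fst y)) = distr (\<tau> n) \<alpha> fst \<Otimes>\<^sub>M distr (\<sigma> n) \<gamma> fst"
        using fin by (intro pair_measure_distr[symmetric])
          (auto intro!: finite_measure.sigma_finite_measure finite_measure.finite_measure_distr)
      also have "emeasure \<dots> A \<le> emeasure (\<alpha> \<Otimes>\<^sub>M \<gamma>) A"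
      proof (rule emeasure_pair_mono)
        show "emeasure (distr (\<tau> n) \<alpha> fst) B \<le> emeasure \<alpha> B" if "B \<in> sets (distr (\<tau> n) \<alpha> fst)" for B
        proof -
          have "fst -` B \<inter> space (\<tau> n) = B \<times> space \<beta>"
            using sets.sets_into_space[of B \<alpha>] that by (auto simp: sp)
          then show ?thesis using dom(1)[of B n] that by (simp add: emeasure_distr)
        qed
        show "emeasure (distr (\<sigma> n) \<gamma> fst) B \<le> emeasure \<gamma> B" if "B \<in> sets (distr (\<sigma> n) \<gamma> fst)" for B
        proof -
          have "fst -` B \<inter> space (\<sigma> n) = B \<times> space \<delta>"
            using sets.sets_into_space[of B \<gamma>] that by (auto simp: sp)
          then show ?thesis using dom(3)[of B n] that by (simp add: emeasure_distr)
        qed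
      qed (auto intro!: finite_measure.finite_measure_distr fin)
      finally show ?thesis .
    qed
    show "emeasure (distr (\<tau> n \<Otimes>\<^sub>M \<sigma> n) S middle_swap) (space (\<alpha> \<Otimes>\<^sub>M \<gamma>) \<times> A) \<le> emeasure (\<beta> \<Otimes>\<^sub>M \<delta>) A"
      if A[measurable]: "A \<in> sets (\<beta> \<Otimes>\<^sub>M \<delta>)" for n A
    proof -
      let ?f = "\<lambda>z. (snd (fst z), snd (snd z))"
      have "emeasure (distr (\<tau> n \<Otimes>\<^sub>M \<sigma> n) S middle_swap) (space (\<alpha> \<Otimes>\<^sub>M \<gamma>) \<times> A)
        = emeasure (\<tau> n \<Otimes>\<^sub>M \<sigma> n) (?f -` A \<inter> space (\<tau> n \<Otimes>\<^sub>M \<sigma> n))"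
        unfolding S_def by (subst emeasure_distr)
          (auto intro!: arg_cong2[where f = emeasure] simp: middle_swap_def space_pair_measure sp)
      also have "\<dots> = emeasure (distr (\<tau> n \<Otimes>\<^sub>M \<sigma> n) (\<beta> \<Otimes>\<^sub>M \<delta>) (\<lambda>(x, y). (snd x, snd y))) A"
        unfolding case_prod_beta by (subst emeasure_distr) auto
      also have "distr (\<tau> n \<Otimes>\<^sub>M \<sigma> n) (\<beta> \<Otimes>\<^sub>M \<delta>) (\<lambda>(x, y). (snd x, snd y)) = distr (\<tau> n) \<beta> snd \<Otimes>\<^sub>M distr (\<sigma> n) \<delta> snd"
        using fin by (intro pair_measure_distr[symmetric])
          (auto intro!: finite_measure.sigma_finite_measure finite_measure.finite_measure_distr)
      also have "emeasure \<dots> A \<le> emeasure (\<beta> \<Otimes>\<^sub>M \<delta>) A"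
      proof (rule emeasure_pair_mono)
        show "emeasure (distr (\<tau> n) \<beta> snd) B \<le> emeasure \<beta> B" if "B \<in> sets (distr (\<tau> n) \<beta> snd)" for B
        proof -
          have "snd -` B \<inter> space (\<tau> n) = space \<alpha> \<times> B"
            using sets.sets_into_space[of B \<beta>] that by (auto simp: sp)
          then show ?thesis using dom(2)[of B n] that by (simp add: emeasure_distr)
        qed
        show "emeasure (distr (\<sigma> n) \<delta> snd) B \<le> emeasure \<delta> B" if "B \<in> sets (distr (\<sigma> n) \<delta> snd)" for B
        proof -
          have "snd -` B \<inter> space (\<sigma> n) = space \<gamma> \<times> B"
            using sets.sets_into_space[of B \<delta>] that by (auto simp: sp)
          then show ?thesis using dom(4)[of B n] that by (simp add: emeasure_distr)
        qed
      qed (auto intro!: finite_measure.finite_measure_distr fin)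
      finally show ?thesis .
    qed
    show "(\<lambda>n. measure (distr (\<tau> n \<Otimes>\<^sub>M \<sigma> n) S middle_swap) (U \<times> V)) \<longlonglongrightarrow> measure (distr (\<tau>0 \<Otimes>\<^sub>M \<sigma>0) S middle_swap) (U \<times> V)"
      if UV: "U \<in> {A \<times> B | A B. A \<in> sets \<alpha> \<and> B \<in> sets \<gamma>}" "V \<in> {A \<times> B | A B. A \<in> sets \<beta> \<and> B \<in> sets \<delta>}" for U V
    proof -
      obtain A C B D where U: "U = A \<times> C" "A \<in> sets \<alpha>" "C \<in> sets \<gamma>" and V: "V = B \<times> D" "B \<in> sets \<beta>" "D \<in> sets \<delta>"
        using UV by blast
      note [measurable] = U(2,3) V(2,3)
      have eq: "measure (distr (\<tau>' \<Otimes>\<^sub>M \<sigma>') S middle_swap) (U \<times> V) = measure \<tau>' (A \<times> B) * measure \<sigma>' (C \<times> D)"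
        if [measurable_cong]: "sets \<tau>' = sets (\<alpha> \<Otimes>\<^sub>M \<beta>)" "sets \<sigma>' = sets (\<gamma> \<Otimes>\<^sub>M \<delta>)" and f: "finite_measure \<sigma>'"
        for \<tau>' \<sigma>'
      proof -
        have "middle_swap -` (U \<times> V) \<inter> space (\<tau>' \<Otimes>\<^sub>M \<sigma>') = (A \<times> B) \<times> (C \<times> D)"
          using U V sets.sets_into_space[OF U(2)] sets.sets_into_space[OF U(3)]
            sets.sets_into_space[OF V(2)] sets.sets_into_space[OF V(3)]
            sets_eq_imp_space_eq[OF that(1)] sets_eq_imp_space_eq[OF that(2)]
          by (auto simp: middle_swap_def space_pair_measure)
        moreover have "U \<times> V \<in> sets S" unfolding S_def U(1) V(1) by measurable
        ultimately have "emeasure (distr (\<tau>' \<Otimes>\<^sub>M \<sigma>') S middle_swap) (U \<times> V) = emeasure \<tau>' (A \<times> B) * emeasure \<sigma>' (C \<times> D)"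
          using that unfolding S_def by (subst emeasure_distr) (auto simp: prod)
        then show ?thesis by (simp add: measure_def enn2real_mult)
      qed
      show ?thesis
        unfolding eq[OF sets(1,3) fin(8)] eq[OF sets(2,4) fin(6)]
        by (intro tendsto_mult conv U V)
    qed
    show "sets (\<alpha> \<Otimes>\<^sub>M \<gamma>) = sigma_sets (space (\<alpha> \<Otimes>\<^sub>M \<gamma>)) {A \<times> B | A B. A \<in> sets \<alpha> \<and> B \<in> sets \<gamma>}"
      "sets (\<beta> \<Otimes>\<^sub>M \<delta>) = sigma_sets (space (\<beta> \<Otimes>\<^sub>M \<delta>)) {A \<times> B | A B. A \<in> sets \<beta> \<and> B \<in> sets \<delta>}"
      by (simp_all add: sets_pair_measure space_pair_measure)
    show "{A \<times> B | A B. A \<in> sets \<alpha> \<and> B \<in> sets \<gamma>} \<subseteq> Pow (space (\<alpha> \<Otimes>\<^sub>M \<gamma>))"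
      "{A \<times> B | A B. A \<in> sets \<beta> \<and> B \<in> sets \<delta>} \<subseteq> Pow (space (\<beta> \<Otimes>\<^sub>M \<delta>))"
      by (auto simp: space_pair_measure dest: sets.sets_into_space)
    show "space (\<alpha> \<Otimes>\<^sub>M \<gamma>) \<in> {A \<times> B | A B. A \<in> sets \<alpha> \<and> B \<in> sets \<gamma>}"
      "space (\<beta> \<Otimes>\<^sub>M \<delta>) \<in> {A \<times> B | A B. A \<in> sets \<beta> \<and> B \<in> sets \<delta>}"
      unfolding space_pair_measure using sets.top by blast+
  qed (rule Int_stable_Times)+
qed

text \<open>On the rectangle where F < q and F' > r with q < r, the integrand is at least (r - q)^p.
  Markov's inequality bounds the mass by a null sequence, so the limit gives it mass 0. Countably
  many such rectangles and their mirror images cover the points where the two values differ;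
  measurability of the level sets is all that this asks of the functions.\<close>

lemma rect_conv_AE_eq:
  fixes F :: "'a \<Rightarrow> real" and F' :: "'b \<Rightarrow> real"
  assumes rc: "rect_conv \<alpha> \<beta> \<tau> \<tau>0" and [measurable]: "F \<in> borel_measurable \<alpha>" "F' \<in> borel_measurable \<beta>"
    and p: "p > 0" and c: "c \<longlonglongrightarrow> 0" and c0: "\<And>n. 0 \<le> c n"
    and le: "\<And>n. (\<integral>\<^sup>+ z. ennreal (\<bar>F (fst z) - F' (snd z)\<bar> powr p) \<partial>\<tau> n) \<le> ennreal (c n)"
  shows "AE z in \<tau>0. F (fst z) = F' (snd z)"
proof -
  have fin: "finite_measure \<tau>0" "\<And>n. finite_measure (\<tau> n)"
    and sets[measurable_cong]: "\<And>n. sets (\<tau> n) = sets (\<alpha> \<Otimes>\<^sub>M \<beta>)" "sets \<tau>0 = sets (\<alpha> \<Otimes>\<^sub>M \<beta>)"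
    and conv: "\<And>A B. A \<in> sets \<alpha> \<Longrightarrow> B \<in> sets \<beta> \<Longrightarrow> (\<lambda>n. measure (\<tau> n) (A \<times> B)) \<longlonglongrightarrow> measure \<tau>0 (A \<times> B)"
    using rc unfolding rect_conv_def by auto
  have space\<tau>0: "space \<tau>0 = space \<alpha> \<times> space \<beta>"
    using sets_eq_imp_space_eq[OF sets(2)] by (simp add: space_pair_measure)
  have null: "emeasure \<tau>0 (A \<times> B) = 0" if A[measurable]: "A \<in> sets \<alpha>" and B[measurable]: "B \<in> sets \<beta>" and e: "e > 0"
    and sep: "\<And>x y. x \<in> A \<Longrightarrow> y \<in> B \<Longrightarrow> e \<le> \<bar>F x - F' y\<bar>" for A B e
  proof -
    have "measure (\<tau> n) (A \<times> B) \<le> c n / e powr p" for n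
    proof -
      have "ennreal (e powr p) * emeasure (\<tau> n) (A \<times> B) = (\<integral>\<^sup>+ z. ennreal (e powr p) * indicator (A \<times> B) z \<partial>\<tau> n)"
        by (simp add: nn_integral_cmult_indicator)
      also have "\<dots> \<le> (\<integral>\<^sup>+ z. ennreal (\<bar>F (fst z) - F' (snd z)\<bar> powr p) \<partial>\<tau> n)"
        using sep e p by (intro nn_integral_mono) (auto simp: indicator_def intro!: ennreal_leI powr_mono2)
      also have "\<dots> \<le> ennreal (c n)" by (rule le)
      finally have "ennreal (e powr p * measure (\<tau> n) (A \<times> B)) \<le> ennreal (c n)"
        using finite_measure.emeasure_eq_measure[OF fin(2)] by (simp add: ennreal_mult)
      then have "e powr p * measure (\<tau> n) (A \<times> B) \<le> c n" using c0 by (simp add: ennreal_le_iff)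
      then show ?thesis using e by (simp add: pos_le_divide_eq mult.commute)
    qed
    then have "measure \<tau>0 (A \<times> B) \<le> 0"
      using LIMSEQ_le[OF conv[OF A B] tendsto_divide[OF c tendsto_const[of "e powr p"]]] e by auto
    then show ?thesis
      using finite_measure.emeasure_eq_measure[OF fin(1)] by (simp add: measure_le_0_iff)
  qed
  have "AE z in \<tau>0. \<not> (F (fst z) < of_rat q \<and> of_rat r < F' (snd z))" if "q < r" for q r
  proof -
    have "emeasure \<tau>0 ({x \<in> space \<alpha>. F x < of_rat q} \<times> {y \<in> space \<beta>. of_rat r < F' y}) = 0"
      using that by (intro null[of _ _ "of_rat r - of_rat q"]) (auto simp: of_rat_less)
    then show ?thesis
      by (intro AE_I'[OF null_setsI]) (auto simp: space\<tau>0)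
  qed
  moreover have "AE z in \<tau>0. \<not> (F' (snd z) < of_rat q \<and> of_rat r < F (fst z))" if "q < r" for q r
  proof -
    have "emeasure \<tau>0 ({x \<in> space \<alpha>. of_rat r < F x} \<times> {y \<in> space \<beta>. F' y < of_rat q}) = 0"
      using that by (intro null[of _ _ "of_rat r - of_rat q"]) (auto simp: of_rat_less)
    then show ?thesis
      by (intro AE_I'[OF null_setsI]) (auto simp: space\<tau>0)
  qed
  ultimately have "AE z in \<tau>0. \<forall>q r. q < r \<longrightarrow> \<not> (F (fst z) < of_rat q \<and> of_rat r < F' (snd z)) \<and>
      \<not> (F' (snd z) < of_rat q \<and> of_rat r < F (fst z))"
    by (simp add: AE_all_countable)
  then show ?thesis
  proof eventually_elim
    case (elim z)
    have no: "\<exists>q r. q < r \<and> a < of_rat q \<and> of_rat r < b" if ab: "a < b" for a b :: real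
    proof -
      obtain q where q: "a < of_rat q" "of_rat q < b" using of_rat_dense[OF ab] by blast
      obtain r where "of_rat q < (of_rat r :: real)" "of_rat r < b" using of_rat_dense[OF q(2)] by blast
      then show ?thesis using q(1) of_rat_less by blast
    qed
    show ?case
      using elim no[of "F (fst z)" "F' (snd z)"] no[of "F' (snd z)" "F (fst z)"]
      by (meson linorder_cases)
  qed
qed

subsection \<open>The ground distance\<close>

lemma lp_norm_powr: "p > 0 \<Longrightarrow> lp_norm p v powr p = \<bar>fst v\<bar> powr p + \<bar>snd v\<bar> powr p"
  by (simp add: lp_norm_def powr_powr powr_one')

lemma lam_dist_Some_None_powr:
  "p > 0 \<Longrightarrow> lp_norm p (l - Proj l) powr p = 2 * \<bar>(fst l - snd l) / 2\<bar> powr p"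
proof -
  assume p: "p > 0"
  have "fst (l - Proj l) = (fst l - snd l) / 2" "snd (l - Proj l) = - ((fst l - snd l) / 2)"
    by (simp_all add: Proj_def field_simps)
  then show ?thesis by (simp only: lp_norm_powr[OF p] abs_minus_cancel)
qed

lemma one_le_powr_neg: "0 < s \<Longrightarrow> s < 1 \<Longrightarrow> 1 \<le> p \<Longrightarrow> 1 \<le> s powr (1 - p)" for s :: real
  using powr_mono2'[of "1 - p" s 1] by simp

text \<open>Convexity of the p-th power at |x| / s and |y| / (1 - s), with weights \<open>s\<close>
  and \<open>1 - s\<close>.\<close>

lemma powr_add_le:
  fixes x y s p :: real
  assumes p: "1 \<le> p" and s: "0 < s" "s < 1"
  shows "\<bar>x + y\<bar> powr p \<le> s powr (1 - p) * \<bar>x\<bar> powr p + (1 - s) powr (1 - p) * \<bar>y\<bar> powr p"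
\<comment> \<open>Convexity is applied at positive arguments; if \<open>x\<close> or
  \<open>y\<close> vanishes, the claim is direct because both coefficients are at least 1.\<close>
proof (cases "x = 0 \<or> y = 0")
  case True
  have "1 * \<bar>x\<bar> powr p \<le> s powr (1 - p) * \<bar>x\<bar> powr p"
    using one_le_powr_neg[OF s p] by (intro mult_right_mono) auto
  moreover have "1 * \<bar>y\<bar> powr p \<le> (1 - s) powr (1 - p) * \<bar>y\<bar> powr p"
    using one_le_powr_neg[of "1 - s" p] s p by (intro mult_right_mono) auto
  moreover have "\<bar>x + y\<bar> powr p = 1 * \<bar>x\<bar> powr p + 1 * \<bar>y\<bar> powr p"
    using True by auto
  ultimately show ?thesis by linarith
next
  case False
  have c: "r * (\<bar>z\<bar> / r) powr p = r powr (1 - p) * \<bar>z\<bar> powr p" if "0 < r" for r z :: real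
    using that by (simp add: powr_divide powr_diff)
  have "\<bar>x + y\<bar> powr p \<le> (\<bar>x\<bar> + \<bar>y\<bar>) powr p"
    using p by (intro powr_mono2) auto
  also have "\<bar>x\<bar> + \<bar>y\<bar> = (1 - (1 - s)) *\<^sub>R (\<bar>x\<bar> / s) + (1 - s) *\<^sub>R (\<bar>y\<bar> / (1 - s))"
    using s by simp
  also have "\<dots> powr p \<le> (1 - (1 - s)) * (\<bar>x\<bar> / s) powr p + (1 - s) * (\<bar>y\<bar> / (1 - s)) powr p"
    using s False by (intro convex_onD[OF powr_convex[OF p]]) auto
  also have "\<dots> = s powr (1 - p) * \<bar>x\<bar> powr p + (1 - s) powr (1 - p) * \<bar>y\<bar> powr p"
    using c[of s x] c[of "1 - s" y] s by simp
  finally show ?thesis .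
qed

lemma powr_mean_le: "1 \<le> p \<Longrightarrow> 2 * \<bar>(x + y) / 2\<bar> powr p \<le> \<bar>x\<bar> powr p + \<bar>y\<bar> powr p" for x y p :: real
proof -
  assume p: "1 \<le> p"
  have c: "2 * ((1 / 2) powr (1 - p) * \<bar>z / 2\<bar> powr p) = \<bar>z\<bar> powr p" for z :: real
    by (simp add: powr_divide powr_diff powr_one)
  show ?thesis
    using powr_add_le[OF p, of "1 / 2" "x / 2" "y / 2"] c[of x] c[of y] by (simp add: add_divide_distrib)
qed

text \<open>The hypothesis on \<open>b\<close> excludes paths from \<open>a\<close> to \<open>c\<close> through the diagonal, along which
  the triangle inequality fails.\<close>

lemma lam_dist_triangle_powr:
  assumes p: "1 \<le> p" and s: "0 < s" "s < 1" and b: "b = None \<Longrightarrow> a = None \<or> c = None"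
  shows "lam_dist p a c powr p \<le> s powr (1 - p) * lam_dist p a b powr p + (1 - s) powr (1 - p) * lam_dist p b c powr p"
proof -
  have p0: "p > 0" using p by simp
  have K: "1 \<le> s powr (1 - p)" "1 \<le> (1 - s) powr (1 - p)"
    using one_le_powr_neg s p by auto
  have up: "r \<le> s powr (1 - p) * r" "r \<le> (1 - s) powr (1 - p) * r" if "0 \<le> r" for r
    using K that by (auto simp: mult_le_cancel_right1)
  note tri = powr_add_le[OF p s]
  \<comment> \<open>Up to sign, half the length of the bar \<open>l\<close> is half the length of
    \<open>l'\<close> plus half the difference of the two coordinates of \<open>l - l'\<close>; the
    latter is controlled by \<open>powr_mean_le\<close>.\<close>
  have half: "2 * \<bar>(fst l - snd l) / 2\<bar> powr p
      \<le> s powr (1 - p) * (\<bar>fst (l - l')\<bar> powr p + \<bar>snd (l - l')\<bar> powr p) + (1 - s) powr (1 - p) * (2 * \<bar>(fst l' - snd l') / 2\<bar> powr p)"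
    if s: "0 < s" "s < 1" for l l' :: "real \<times> real" and s
  proof -
    have "\<bar>(fst l - snd l) / 2\<bar> powr p = \<bar>(fst (l - l') + (- snd (l - l'))) / 2 + (fst l' - snd l') / 2\<bar> powr p"
      by (simp add: field_simps)
    also have "\<dots> \<le> s powr (1 - p) * \<bar>(fst (l - l') + (- snd (l - l'))) / 2\<bar> powr p + (1 - s) powr (1 - p) * \<bar>(fst l' - snd l') / 2\<bar> powr p"
      by (rule powr_add_le[OF p s])
    finally have "2 * \<bar>(fst l - snd l) / 2\<bar> powr p \<le> s powr (1 - p) * (2 * \<bar>(fst (l - l') + (- snd (l - l'))) / 2\<bar> powr p)
       + (1 - s) powr (1 - p) * (2 * \<bar>(fst l' - snd l') / 2\<bar> powr p)" by simp
    also have "\<dots> \<le> s powr (1 - p) * (\<bar>fst (l - l')\<bar> powr p + \<bar>- snd (l - l')\<bar> powr p) + (1 - s) powr (1 - p) * (2 * \<bar>(fst l' - snd l') / 2\<bar> powr p)"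
      by (intro add_right_mono mult_left_mono powr_mean_le p) auto
    finally show ?thesis by (simp only: abs_minus_cancel)
  qed
  show ?thesis
  proof (cases a; cases b; cases c)
    fix l l' l'' assume e: "a = Some l" "b = Some l'" "c = Some l''"
    have "\<bar>fst (l - l'')\<bar> powr p \<le> s powr (1 - p) * \<bar>fst (l - l')\<bar> powr p + (1 - s) powr (1 - p) * \<bar>fst (l' - l'')\<bar> powr p"
      using tri[of "fst (l - l')" "fst (l' - l'')"] by simp
    moreover have "\<bar>snd (l - l'')\<bar> powr p \<le> s powr (1 - p) * \<bar>snd (l - l')\<bar> powr p + (1 - s) powr (1 - p) * \<bar>snd (l' - l'')\<bar> powr p"
      using tri[of "snd (l - l')" "snd (l' - l'')"] by simp
    ultimately show ?thesis
      unfolding e lam_dist.simps lp_norm_powr[OF p0] distrib_left by linarith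
  next
    fix l l' assume e: "a = Some l" "b = Some l'" "c = None"
    show ?thesis
      unfolding e lam_dist.simps unfolding lam_dist_Some_None_powr[OF p0] unfolding lp_norm_powr[OF p0] by (rule half[OF s])
  next
    fix l' l'' assume e: "a = None" "b = Some l'" "c = Some l''"
    show ?thesis
      unfolding e lam_dist.simps unfolding lam_dist_Some_None_powr[OF p0] unfolding lp_norm_powr[OF p0]
      using half[of "1 - s" l'' l'] s by (simp add: abs_minus_commute add.commute)
  qed (use b up p0 in \<open>auto simp: add_nonneg_nonneg\<close>)
qed

lemma lam_dist_commute: "lam_dist p a b = lam_dist p b a"
  by (cases a; cases b) (auto simp: lp_norm_def abs_minus_commute)

lemma abs_fst_le_lp_norm: "1 \<le> p \<Longrightarrow> \<bar>fst v\<bar> \<le> lp_norm p v"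
  and abs_snd_le_lp_norm: "1 \<le> p \<Longrightarrow> \<bar>snd v\<bar> \<le> lp_norm p v"
proof -
  assume p: "1 \<le> p"
  have "\<bar>fst v\<bar> = (\<bar>fst v\<bar> powr p) powr (1 / p)" "\<bar>snd v\<bar> = (\<bar>snd v\<bar> powr p) powr (1 / p)"
    using p by (simp_all add: powr_powr powr_one')
  moreover have "(\<bar>fst v\<bar> powr p) powr (1 / p) \<le> lp_norm p v" "(\<bar>snd v\<bar> powr p) powr (1 / p) \<le> lp_norm p v"
    unfolding lp_norm_def using p by (intro powr_mono2; simp)+
  ultimately show "\<bar>fst v\<bar> \<le> lp_norm p v" "\<bar>snd v\<bar> \<le> lp_norm p v" by simp_all
qed

lemma measurable_lp_norm [measurable]: "lp_norm p \<in> borel_measurable borel"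
  unfolding lp_norm_def by (simp add: borel_prod[symmetric])

lemma measurable_Proj [measurable]: "Proj \<in> borel \<rightarrow>\<^sub>M borel"
  unfolding Proj_def by (simp add: borel_prod[symmetric])

subsection \<open>Networks\<close>

abbreviation Yb :: "('a, 'b) network \<Rightarrow> 'b option measure" where
  "Yb P \<equiv> borel_of (bar (Y_of P))"

text \<open>The sets where n times \<open>t\<close> is at least 1 have finite measure by Markov's
  inequality and exhaust the space because \<open>t\<close> is positive.\<close>

lemma sigma_finite_measureI_nn_integral:
  assumes [measurable]: "t \<in> borel_measurable M" and pos: "\<And>x. x \<in> space M \<Longrightarrow> 0 < t x"
    and fin: "(\<integral>\<^sup>+ x. t x \<partial>M) < \<infinity>"
  shows "sigma_finite_measure M"
proof
  define A where "A n = {x \<in> space M. 1 \<le> of_nat n * t x}" for n :: nat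
  have "emeasure M (A n) \<le> of_nat n * (\<integral>\<^sup>+ x. t x * indicator (space M) x \<partial>M)" for n
    unfolding A_def by (rule nn_integral_Markov_inequality) auto
  moreover have "(\<integral>\<^sup>+ x. t x * indicator (space M) x \<partial>M) = (\<integral>\<^sup>+ x. t x \<partial>M)"
    by (intro nn_integral_cong) auto
  ultimately have "emeasure M (A n) < \<infinity>" for n
    using fin by (metis ennreal_mult_less_top infinity_ennreal_def le_less_trans of_nat_less_top)
  moreover have "(\<Union>n. A n) = space M"
  proof (intro set_eqI iffI)
    fix x assume x: "x \<in> space M"
    have "\<exists>n. 1 \<le> of_nat n * t x"
    proof (cases "t x = top")
      case True
      then show ?thesis by (intro exI[of _ 1]) simp
    next
      case False
      then obtain r where r: "t x = ennreal r" "0 < r" using pos[OF x] by (cases "t x") auto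
      obtain n :: nat where "1 / r < n" using reals_Archimedean2 by blast
      then have "1 \<le> ennreal (n * r)" using r by (simp add: pos_divide_less_eq)
      then show ?thesis using r by (intro exI[of _ n]) (simp add: ennreal_mult ennreal_of_nat_eq_real_of_nat)
    qed
    then show "x \<in> (\<Union>n. A n)" using x by (auto simp: A_def)
  qed (auto simp: A_def)
  moreover have "A n \<in> sets M" for n unfolding A_def by measurable
  ultimately show "\<exists>A. countable A \<and> A \<subseteq> sets M \<and> \<Union> A = space M \<and> (\<forall>a\<in>A. emeasure M a \<noteq> \<infinity>)"
    by (intro exI[of _ "range A"]) (auto simp: less_top)
qed

text \<open>Length of the bar, death minus birth; this is its distance to the diagonal for the norm
  with p = 1, hence 0 at the diagonal point.\<close>

definition pers :: "('a, 'b) network \<Rightarrow> 'b option \<Rightarrow> real" where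
  "pers P y = (case y of None \<Rightarrow> 0 | Some y \<Rightarrow> snd (iota_of P y) - fst (iota_of P y))"

locale net =
  fixes P :: "('a, 'b) network"
  assumes P: "P \<in> networks"
begin

lemma polish: "polish_topology (X_of P)" "polish_topology (Y_of P)" "polish_topology (bar (Y_of P))"
  using P by (auto simp: networks_def polish_bar)

lemma sets_mu [measurable_cong]: "sets (mu_of P) = sets (borel_of (X_of P))"
  using P by (simp add: networks_def)

lemma prob_mu: "prob_space (mu_of P)"
  using P by (simp add: networks_def)

lemma sets_nu [measurable_cong]: "sets (nu_of P) = sets (borel_of (Y_of P))"
  using P by (simp add: networks_def radon_measure_def)

lemma space_mu: "space (mu_of P) = topspace (X_of P)"
  using sets_eq_imp_space_eq[OF sets_mu] by simp

lemma space_nu: "space (nu_of P) = topspace (Y_of P)"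
  using sets_eq_imp_space_eq[OF sets_nu] by simp

lemma iota_Lam: "y \<in> topspace (Y_of P) \<Longrightarrow> iota_of P y \<in> Lam"
  using P by (auto simp: networks_def continuous_map_def Pi_iff)

lemma iota_measurable: "iota_of P \<in> borel_of (Y_of P) \<rightarrow>\<^sub>M borel_of (top_of_set Lam)"
  using P by (auto simp: networks_def intro: continuous_map_measurable)

lemma Lam_borel: "Lam \<in> sets borel"
proof -
  have "Lam = {l :: real \<times> real. fst l < snd l} \<inter> {l. 0 < fst l}" by (auto simp: Lam_def)
  moreover have "open {l :: real \<times> real. fst l < snd l}" "open {l :: real \<times> real. 0 < fst l}"
    by (intro open_Collect_less continuous_intros)+
  ultimately show ?thesis by (metis borel_open open_Int)
qed

lemma iota_borel [measurable]: "iota_of P \<in> borel_of (Y_of P) \<rightarrow>\<^sub>M borel"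
proof -
  have "continuous_map (Y_of P) euclidean (iota_of P)"
    using P by (auto simp: networks_def continuous_map_in_subtopology)
  from continuous_map_measurable[OF this] show ?thesis
    by (simp add: sets_borel_of_euclidean cong: measurable_cong_sets)
qed

lemma pers_measurable [measurable]: "pers P \<in> borel_measurable (Yb P)"
proof -
  have [measurable]: "(\<lambda>y. fst (iota_of P y)) \<in> borel_measurable (borel_of (Y_of P))"
    "(\<lambda>y. snd (iota_of P y)) \<in> borel_measurable (borel_of (Y_of P))"
    using iota_borel by (auto simp: borel_prod[symmetric] intro: measurable_compose[of _ _ "borel \<Otimes>\<^sub>M borel"])
  show ?thesis unfolding measurable_bar_iff by (simp add: pers_def comp_def)
qed

lemma pers_pos: "y \<in> topspace (Y_of P) \<Longrightarrow> 0 < pers P (Some y)"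
  using iota_Lam[of y] by (auto simp: pers_def Lam_def)

text \<open>The case q = 1 of the condition on persistence diagrams. Together with positivity it
  makes a possibly infinite \<open>nu_of P\<close> \<sigma>-finite.\<close>

lemma pers_integrable: "(\<integral>\<^sup>+ y. ennreal (pers P (Some y)) \<partial>nu_of P) < \<infinity>"
proof -
  define h where "h l = ennreal (lp_norm 1 (l - Proj l) powr 1)" for l
  have [measurable]: "h \<in> borel_measurable (borel_of (top_of_set Lam))"
  proof -
    have "h \<in> borel_measurable (restrict_space borel Lam)"
      unfolding h_def by (rule measurable_restrict_space1) measurable
    then show ?thesis by (simp add: sets_borel_of_top_of_set[OF Lam_borel] cong: measurable_cong_sets)
  qed
  have "(\<integral>\<^sup>+ l. h l \<partial>distr (nu_of P) (borel_of (top_of_set Lam)) (iota_of P)) < \<infinity>"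
  proof -
    have "measure_pd (distr (nu_of P) (borel_of (top_of_set Lam)) (iota_of P))"
      using P by (simp add: networks_def)
    from this[unfolded measure_pd_def, THEN conjunct2, rule_format, of 1] show ?thesis by (simp add: h_def)
  qed
  also have "(\<integral>\<^sup>+ l. h l \<partial>distr (nu_of P) (borel_of (top_of_set Lam)) (iota_of P)) = (\<integral>\<^sup>+ y. h (iota_of P y) \<partial>nu_of P)"
    using iota_measurable by (intro nn_integral_distr) (simp_all add: sets_nu cong: measurable_cong_sets)
  also have "\<dots> = (\<integral>\<^sup>+ y. ennreal (pers P (Some y)) \<partial>nu_of P)"
  proof (rule nn_integral_cong)
    fix y assume "y \<in> space (nu_of P)"
    then have "iota_of P y \<in> Lam" using iota_Lam space_nu by simp
    then show "h (iota_of P y) = ennreal (pers P (Some y))"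
      unfolding h_def lam_dist_Some_None_powr[OF zero_less_one] by (auto simp: pers_def Lam_def)
  qed
  finally show ?thesis .
qed

lemma sigma_finite_nu: "sigma_finite_measure (nu_of P)"
proof (rule sigma_finite_measureI_nn_integral)
  show "(\<lambda>y. ennreal (pers P (Some y))) \<in> borel_measurable (nu_of P)"
    using pers_measurable unfolding measurable_bar_iff by (simp add: comp_def sets_nu cong: measurable_cong_sets)
qed (use pers_pos pers_integrable space_nu in auto)

end

lemma pred_eq_None: "Measurable.pred (borel_of (bar T)) (\<lambda>y. y = None)"
proof -
  have "{y \<in> space (borel_of (bar T)). y = None} = {None}" by (auto simp: topspace_bar)
  then show ?thesis using None_borel_of by (simp add: pred_def)
qed

lemma measurable_the_bar:
  "(\<lambda>z. (fst z, the (snd z))) \<in> restrict_space (M \<Otimes>\<^sub>M borel_of (bar T)) {z. snd z \<noteq> None} \<rightarrow>\<^sub>M M \<Otimes>\<^sub>M borel_of T"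
proof (rule measurable_Pair)
  let ?R = "restrict_space (M \<Otimes>\<^sub>M borel_of (bar T)) {z. snd z \<noteq> None}"
  have sp: "space ?R = {z \<in> space M \<times> topspace (bar T). snd z \<noteq> None}"
    by (auto simp: space_restrict_space space_pair_measure)
  have snd: "snd \<in> ?R \<rightarrow>\<^sub>M borel_of (bar T)"
    by (rule measurable_restrict_space1) measurable
  show "fst \<in> ?R \<rightarrow>\<^sub>M M"
    by (rule measurable_restrict_space1) measurable
  show "(\<lambda>z. the (snd z)) \<in> ?R \<rightarrow>\<^sub>M borel_of T"
  proof (rule measurableI)
    fix x assume "x \<in> space ?R"
    then show "the (snd x) \<in> space (borel_of T)" unfolding sp by (auto simp: topspace_bar)
  next
    fix A assume A: "A \<in> sets (borel_of T)"
    have "(\<lambda>z. the (snd z)) -` A \<inter> space ?R = snd -` (Some ` A) \<inter> space ?R"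
      unfolding sp by auto
    also have "\<dots> \<in> sets ?R" using measurable_sets[OF snd Some_image_borel_of[OF A]] .
    finally show "(\<lambda>z. the (snd z)) -` A \<inter> space ?R \<in> sets ?R" .
  qed
qed

lemma measurable_bar_pair:
  assumes 1: "(\<lambda>z. h (fst z) (Some (snd z))) \<in> M \<Otimes>\<^sub>M borel_of T \<rightarrow>\<^sub>M N"
    and 2: "(\<lambda>x. h x None) \<in> M \<rightarrow>\<^sub>M N"
  shows "(\<lambda>z. h (fst z) (snd z)) \<in> M \<Otimes>\<^sub>M borel_of (bar T) \<rightarrow>\<^sub>M N"
proof -
  let ?B = "M \<Otimes>\<^sub>M borel_of (bar T)"
  have [measurable]: "{None} \<in> sets (borel_of (bar T))" by (rule None_borel_of)
  have S: "{z \<in> space ?B. snd z \<noteq> None} \<in> sets ?B"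
  proof -
    have "{z \<in> space ?B. snd z \<noteq> None} = space ?B - {z \<in> space ?B. snd z \<in> {None}}" by auto
    also have "\<dots> \<in> sets ?B" by measurable
    finally show ?thesis .
  qed
  have "(\<lambda>z. if snd z \<noteq> None then h (fst z) (Some (the (snd z))) else h (fst z) None) \<in> ?B \<rightarrow>\<^sub>M N"
  proof (rule measurable_If_restrict_space_iff[THEN iffD2, OF S], intro conjI)
    show "(\<lambda>z. h (fst z) (Some (the (snd z)))) \<in> restrict_space ?B {z. snd z \<noteq> None} \<rightarrow>\<^sub>M N"
      using measurable_comp[OF measurable_the_bar 1] by (simp add: comp_def)
    show "(\<lambda>z. h (fst z) None) \<in> restrict_space ?B {z. \<not> snd z \<noteq> None} \<rightarrow>\<^sub>M N"
      by (rule measurable_restrict_space1) (rule measurable_compose[OF measurable_fst 2])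
  qed
  moreover have "(\<lambda>z. if snd z \<noteq> None then h (fst z) (Some (the (snd z))) else h (fst z) None) = (\<lambda>z. h (fst z) (snd z))"
    by auto
  ultimately show ?thesis by simp
qed

context net
begin

lemma sets_pair_bar: 
  assumes "net P'"
  shows "sets (borel_of (prod_topology (bar (Y_of P)) (bar (Y_of P')))) = sets (Yb P \<Otimes>\<^sub>M Yb P')"
  by (rule sets_borel_of_prod[OF polish_second_countable[OF polish(3)] polish_second_countable[OF net.polish(3)[OF assms]]])

lemma sets_pair_mu:
  assumes "net P'"
  shows "sets (borel_of (prod_topology (X_of P) (X_of P'))) = sets (mu_of P \<Otimes>\<^sub>M mu_of P')"
proof -
  have "sets (borel_of (prod_topology (X_of P) (X_of P'))) = sets (borel_of (X_of P) \<Otimes>\<^sub>M borel_of (X_of P'))"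
    by (rule sets_borel_of_prod[OF polish_second_countable[OF polish(1)] polish_second_countable[OF net.polish(1)[OF assms]]])
  then show ?thesis
    using sets_pair_measure_cong[OF sets_mu net.sets_mu[OF assms]] by simp
qed

lemma k_measurable [measurable]: "(\<lambda>z. k_of P (fst z) (snd z)) \<in> borel_measurable (mu_of P \<Otimes>\<^sub>M mu_of P)"
proof -
  have "(\<lambda>(x, x'). k_of P x x') \<in> borel_measurable (borel_of (prod_topology (X_of P) (X_of P)))"
    using P by (simp add: networks_def)
  then show ?thesis
    unfolding case_prod_beta by (simp add: sets_pair_mu net_axioms cong: measurable_cong_sets)
qed

lemma omega_measurable [measurable]:
  "(\<lambda>z. omega_of P (fst z) (snd z)) \<in> borel_measurable (mu_of P \<Otimes>\<^sub>M borel_of (Y_of P))"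
proof -
  have "(\<lambda>(x, x'). omega_of P x x') \<in> borel_measurable (borel_of (prod_topology (X_of P) (Y_of P)))"
    using P by (simp add: networks_def)
  moreover have "sets (borel_of (prod_topology (X_of P) (Y_of P))) = sets (mu_of P \<Otimes>\<^sub>M borel_of (Y_of P))"
    using sets_borel_of_prod[of "X_of P" "Y_of P"] polish polish_second_countable
      sets_pair_measure_cong[OF sets_mu refl] by metis
  ultimately show ?thesis
    unfolding case_prod_beta by (simp cong: measurable_cong_sets)
qed

lemma omega_bar_measurable [measurable]:
  "(\<lambda>z. omega_bar P (fst z) (snd z)) \<in> borel_measurable (mu_of P \<Otimes>\<^sub>M Yb P)"
  by (rule measurable_bar_pair) (simp_all add: omega_bar_def)

lemma bar_borel_measurable:
  fixes f :: "real \<times> real \<Rightarrow> 'z :: topological_space"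
  assumes "f \<in> borel_measurable borel"
  shows "(\<lambda>y. case y of None \<Rightarrow> c | Some y \<Rightarrow> f (iota_of P y)) \<in> borel_measurable (Yb P)"
  unfolding measurable_bar_iff comp_def option.case using measurable_compose[OF iota_borel assms] by simp

lemma lam_dist_measurable [measurable]:
  assumes P': "net P'"
  shows "(\<lambda>z. lam_dist p (iota_bar P (fst z)) (iota_bar P' (snd z))) \<in> borel_measurable (Yb P \<Otimes>\<^sub>M Yb P')"
proof -
  interpret P': net P' by fact
  have [measurable]: "{None} \<in> sets (Yb P)" "{None} \<in> sets (Yb P')" by (rule None_borel_of)+
  have [measurable]: "Measurable.pred (Yb P) (\<lambda>y. y = None)" "Measurable.pred (Yb P') (\<lambda>y. y = None)"
    by (rule pred_eq_None)+
  \<comment> \<open>The value at \<open>None\<close> is a placeholder: the case distinction below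
    reads \<open>?i\<close> only at proper points.\<close>
  let ?i = "\<lambda>P y. case y of None \<Rightarrow> (0, 0) | Some y \<Rightarrow> iota_of P y"
  have [measurable]: "?i P \<in> Yb P \<rightarrow>\<^sub>M borel" "?i P' \<in> Yb P' \<rightarrow>\<^sub>M borel"
    using bar_borel_measurable[of "\<lambda>l. l" "(0, 0)"] P'.bar_borel_measurable[of "\<lambda>l. l" "(0, 0)"] by simp_all
  have "lam_dist p (iota_bar P y) (iota_bar P' y') =
     (if y = None then if y' = None then 0 else lp_norm p (?i P' y' - Proj (?i P' y'))
      else if y' = None then lp_norm p (?i P y - Proj (?i P y)) else lp_norm p (?i P y - ?i P' y'))" for y y'
    by (cases y; cases y') (auto simp: iota_bar_def)
  then show ?thesis by simp
qed

lemma nu_compact_finite: "compactin (Y_of P) K \<Longrightarrow> emeasure (nu_of P) K < \<infinity>"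
  using P by (simp add: networks_def radon_measure_def)

lemma bar_None_sets [measurable]: "{None} \<in> sets (Yb P)" by (rule None_borel_of)

lemma top_nonempty: "topspace (X_of P) \<noteq> {}"
  using prob_space.not_empty[OF prob_mu] by (simp add: space_mu)

lemma coded_mu: obtains f g where "coded (mu_of P) f g"
proof -
  obtain f g where "coded (borel_of (X_of P)) f g"
    using polish_coded[OF polish(1) top_nonempty] .
  then have "coded (mu_of P) f g"
    unfolding coded_def using sets_mu space_mu by (simp cong: measurable_cong_sets)
  then show ?thesis using that by blast
qed

lemma coded_Yb: obtains f g where "coded (Yb P) f g"
  using polish_coded[OF polish(3)] topspace_bar[of "Y_of P"] by (metis insert_not_empty topspace_discrete_topology)

end

text \<open>The proper points form a closed subset of the extension, on which \<open>the\<close> is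
  continuous.\<close>

lemma compactin_bar_Some:
  assumes K: "compactin (bar T) K"
  shows "compactin T {y. Some y \<in> K}"
proof -
  have sub: "K \<subseteq> topspace (bar T)" using compactin_subset_topspace[OF K] .
  have cl: "closedin (bar T) (Some ` topspace T)"
    unfolding closedin_def by (auto simp: topspace_bar openin_bar)
  have "compactin (bar T) (Some ` topspace T \<inter> K)"
    by (rule closed_Int_compactin[OF cl K])
  then have c: "compactin (subtopology (bar T) (Some ` topspace T)) (Some ` topspace T \<inter> K)"
    by (simp add: compactin_subtopology)
  have "continuous_map (subtopology (bar T) (Some ` topspace T)) T the"
    unfolding continuous_map_def
  proof (intro conjI allI impI)
    show "the \<in> topspace (subtopology (bar T) (Some ` topspace T)) \<rightarrow> topspace T"
      by (auto simp: topspace_bar)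
    fix U assume U: "openin T U"
    have "{x \<in> topspace (subtopology (bar T) (Some ` topspace T)). the x \<in> U} = Some ` U \<inter> Some ` topspace T"
      using openin_subset[OF U] by (auto simp: topspace_bar)
    moreover have "openin (bar T) (Some ` U)"
      using U openin_subset[OF U] by (auto simp: openin_bar image_iff)
    ultimately show "openin (subtopology (bar T) (Some ` topspace T)) {x \<in> topspace (subtopology (bar T) (Some ` topspace T)). the x \<in> U}"
      unfolding openin_subtopology by blast
  qed
  from image_compactin[OF c this] have "compactin T (the ` (Some ` topspace T \<inter> K))" .
  moreover have "the ` (Some ` topspace T \<inter> K) = {y. Some y \<in> K}"
    using sub by (force simp: topspace_bar)
  ultimately show ?thesis by simp
qed

section \<open>Admissible couplings of two networks\<close>

locale net2 = P: net P + P': net P' for P :: "('a, 'b) network" and P' :: "('c, 'd) network"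
begin

lemma sets_bar: "sets (borel_of (prod_topology (bar (Y_of P)) (bar (Y_of P')))) = sets (Yb P \<Otimes>\<^sub>M Yb P')"
  by (rule P.sets_pair_bar[OF P'.net_axioms])

lemma couplingsD:
  assumes "\<pi> \<in> couplings P P'"
  shows "sets \<pi> = sets (mu_of P \<Otimes>\<^sub>M mu_of P')" "prob_space \<pi>"
    "distr \<pi> (mu_of P) fst = mu_of P" "distr \<pi> (mu_of P') snd = mu_of P'"
  using assms P.sets_pair_mu[OF P'.net_axioms] by (auto simp: couplings_def)

lemma couplingsI:
  assumes "sets \<pi> = sets (mu_of P \<Otimes>\<^sub>M mu_of P')" "prob_space \<pi>"
    "distr \<pi> (mu_of P) fst = mu_of P" "distr \<pi> (mu_of P') snd = mu_of P'"
  shows "\<pi> \<in> couplings P P'"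
  using assms P.sets_pair_mu[OF P'.net_axioms] by (auto simp: couplings_def)

text \<open>Admissibility with the Radon condition replaced by the choice of the \<sigma>-algebra;
  \<open>adm_couplings_iff\<close> recovers it, so that constructed couplings only have to satisfy
  the equations for the marginals.\<close>

definition adm :: "('b option \<times> 'd option) measure \<Rightarrow> bool" where
  "adm \<pi> \<longleftrightarrow> sets \<pi> = sets (Yb P \<Otimes>\<^sub>M Yb P') \<and>
     (\<forall>A\<in>sets (borel_of (Y_of P)). emeasure \<pi> (Some ` A \<times> space (Yb P')) = emeasure (nu_of P) A) \<and>
     (\<forall>B\<in>sets (borel_of (Y_of P')). emeasure \<pi> (space (Yb P) \<times> Some ` B) = emeasure (nu_of P') B) \<and>
     emeasure \<pi> {(None, None)} = 0"

text \<open>Strips over sets of finite measure in either factor, together with the null point at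
  both diagonals, cover the product.\<close>

lemma adm_sigma_finite:
  assumes "adm \<pi>" shows "sigma_finite_measure \<pi>"
proof -
  have s[measurable_cong]: "sets \<pi> = sets (Yb P \<Otimes>\<^sub>M Yb P')"
    and m1: "\<And>A. A \<in> sets (borel_of (Y_of P)) \<Longrightarrow> emeasure \<pi> (Some ` A \<times> space (Yb P')) = emeasure (nu_of P) A"
    and m2: "\<And>B. B \<in> sets (borel_of (Y_of P')) \<Longrightarrow> emeasure \<pi> (space (Yb P) \<times> Some ` B) = emeasure (nu_of P') B"
    and m0: "emeasure \<pi> {(None, None)} = 0"
    using assms by (auto simp: adm_def)
  have sp: "space \<pi> = space (Yb P) \<times> space (Yb P')"
    using sets_eq_imp_space_eq[OF s] by (simp add: space_pair_measure)
  obtain A :: "nat \<Rightarrow> 'b set" where A: "range A \<subseteq> sets (nu_of P)" "(\<Union>i. A i) = space (nu_of P)"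
      "\<And>i. emeasure (nu_of P) (A i) \<noteq> \<infinity>"
    by (rule sigma_finite_measure.sigma_finite_incseq[OF P.sigma_finite_nu]) blast
  obtain B :: "nat \<Rightarrow> 'd set" where B: "range B \<subseteq> sets (nu_of P')" "(\<Union>i. B i) = space (nu_of P')"
      "\<And>i. emeasure (nu_of P') (B i) \<noteq> \<infinity>"
    by (rule sigma_finite_measure.sigma_finite_incseq[OF P'.sigma_finite_nu]) blast
  have A': "A i \<in> sets (borel_of (Y_of P))" and B': "B i \<in> sets (borel_of (Y_of P'))" for i
    using A B P.sets_nu P'.sets_nu by auto
  let ?C = "range (\<lambda>i. Some ` A i \<times> space (Yb P')) \<union> range (\<lambda>i. space (Yb P) \<times> Some ` B i) \<union> {{None} \<times> {None}}"
  show ?thesis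
  proof
    have u: "\<Union> ?C = space \<pi>"
    proof -
      have "(\<Union>i. Some ` A i) = Some ` topspace (Y_of P)" "(\<Union>i. Some ` B i) = Some ` topspace (Y_of P')"
        unfolding image_UN[symmetric] A(2) B(2) P.space_nu P'.space_nu by (rule refl)+
      moreover have "\<Union> ?C = (\<Union>i. Some ` A i) \<times> space (Yb P') \<union> space (Yb P) \<times> (\<Union>i. Some ` B i) \<union> {None} \<times> {None}"
      proof -
        have 1: "(\<Union>i. Some ` A i \<times> space (Yb P')) = (\<Union>i. Some ` A i) \<times> space (Yb P')" by auto
        have 2: "(\<Union>i. space (Yb P) \<times> Some ` B i) = space (Yb P) \<times> (\<Union>i. Some ` B i)" by auto
        show ?thesis unfolding Union_Un_distrib 1 2 by simp
      qed
      ultimately show ?thesis unfolding sp space_borel_of topspace_bar by auto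
    qed
    have v: "?C \<subseteq> sets \<pi>"
      unfolding s using Some_image_borel_of[OF A'] Some_image_borel_of[OF B']
        pair_measureI[OF None_borel_of None_borel_of, of "Y_of P" "Y_of P'"]
      by (auto intro!: pair_measureI simp del: space_borel_of)
    have w: "emeasure \<pi> a \<noteq> \<infinity>" if "a \<in> ?C" for a
      using that m1[OF A'] m2[OF B'] m0 A(3) B(3) by auto
    have c: "countable ?C" by auto
    show "\<exists>A. countable A \<and> A \<subseteq> sets \<pi> \<and> \<Union> A = space \<pi> \<and> (\<forall>a\<in>A. emeasure \<pi> a \<noteq> \<infinity>)"
      by (intro exI[of _ ?C] conjI ballI c v u w)
  qed
qed

text \<open>A compact set has compact projections. Apart from the point at both diagonals it lies in
  the strips over their proper parts, whose masses are finite as \<nu>-masses of compact sets; inner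
  regularity then comes from \<open>polish_radon_measureI\<close>.\<close>

lemma adm_couplings_iff: "\<pi> \<in> adm_couplings P P' \<longleftrightarrow> adm \<pi>"
proof
  assume "\<pi> \<in> adm_couplings P P'"
  then show "adm \<pi>"
    unfolding adm_couplings_def adm_def radon_measure_def using sets_bar by auto
next
  assume a: "adm \<pi>"
  let ?T = "prod_topology (bar (Y_of P)) (bar (Y_of P'))"
  have s[measurable_cong]: "sets \<pi> = sets (Yb P \<Otimes>\<^sub>M Yb P')"
    and m1: "\<And>A. A \<in> sets (borel_of (Y_of P)) \<Longrightarrow> emeasure \<pi> (Some ` A \<times> space (Yb P')) = emeasure (nu_of P) A"
    and m2: "\<And>B. B \<in> sets (borel_of (Y_of P')) \<Longrightarrow> emeasure \<pi> (space (Yb P) \<times> Some ` B) = emeasure (nu_of P') B"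
    and m0: "emeasure \<pi> {(None, None)} = 0"
    using a by (auto simp: adm_def)
  have "radon_measure ?T \<pi>"
  proof (rule polish_radon_measureI)
    show "polish_topology ?T" by (intro polish_prod P.polish P'.polish)
    show "sets \<pi> = sets (borel_of ?T)" using s sets_bar by simp
    show "sigma_finite_measure \<pi>" by (rule adm_sigma_finite[OF a])
    fix K assume K: "compactin ?T K"
    let ?A = "{y. Some y \<in> fst ` K}" and ?B = "{y. Some y \<in> snd ` K}"
    have c: "compactin (Y_of P) ?A" "compactin (Y_of P') ?B"
      using image_compactin[OF K continuous_map_fst] image_compactin[OF K continuous_map_snd]
      by (auto intro: compactin_bar_Some)
    have AB: "?A \<in> sets (borel_of (Y_of P))" "?B \<in> sets (borel_of (Y_of P'))"
      using c compactin_borel_of P.polish P'.polish by auto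
    have "K \<subseteq> (Some ` ?A \<times> space (Yb P')) \<union> (space (Yb P) \<times> Some ` ?B) \<union> {(None, None)}"
    proof
      fix z assume z: "z \<in> K"
      then have "z \<in> space (Yb P) \<times> space (Yb P')"
        using compactin_subset_topspace[OF K] by auto
      then show "z \<in> (Some ` ?A \<times> space (Yb P')) \<union> (space (Yb P) \<times> Some ` ?B) \<union> {(None, None)}"
        using z by (cases "fst z"; cases "snd z"; cases z) (force simp: image_iff)+
    qed
    moreover have m: "Some ` ?A \<times> space (Yb P') \<in> sets \<pi>" "space (Yb P) \<times> Some ` ?B \<in> sets \<pi>" "{(None, None)} \<in> sets \<pi>"
      unfolding s using AB None_borel_of[of "Y_of P"] None_borel_of[of "Y_of P'"] pair_measureI[of "{None}" "Yb P" "{None}" "Yb P'"]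
      by (auto intro!: pair_measureI Some_image_borel_of simp del: space_borel_of)
    ultimately have "emeasure \<pi> K \<le> emeasure \<pi> ((Some ` ?A \<times> space (Yb P')) \<union> (space (Yb P) \<times> Some ` ?B) \<union> {(None, None)})"
      by (intro emeasure_mono sets.Un)
    also have "\<dots> \<le> emeasure \<pi> (Some ` ?A \<times> space (Yb P')) + emeasure \<pi> (space (Yb P) \<times> Some ` ?B) + emeasure \<pi> {(None, None)}"
      using m by (intro order_trans[OF emeasure_subadditive] add_right_mono emeasure_subadditive sets.Un) auto
    also have "\<dots> < \<infinity>"
      using m1[OF AB(1)] m2[OF AB(2)] m0 P.nu_compact_finite[OF c(1)] P'.nu_compact_finite[OF c(2)] by simp
    finally show "emeasure \<pi> K < \<infinity>" .
  qed
  then show "\<pi> \<in> adm_couplings P P'"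
    unfolding adm_couplings_def using m1 m2 m0 by simp
qed

end

subsection \<open>The pseudometric\<close>

text \<open>Serves to assemble a coupling from the part that can be glued and the two parts that end
  on the diagonal.\<close>

definition madd :: "'a measure \<Rightarrow> 'a measure \<Rightarrow> 'a measure" where
  "madd M N = measure_of (space M) (sets M) (\<lambda>A. emeasure M A + emeasure N A)"

lemma sets_madd [simp, measurable_cong]: "sets (madd M N) = sets M"
  by (simp add: madd_def)

lemma space_madd [simp]: "space (madd M N) = space M"
  by (simp add: madd_def)

lemma emeasure_madd:
  assumes N: "sets N = sets M" and A: "A \<in> sets M"
  shows "emeasure (madd M N) A = emeasure M A + emeasure N A"
  unfolding madd_def
proof (rule emeasure_measure_of_sigma)
  show "sigma_algebra (space M) (sets M)" ..
  show "positive (sets M) (\<lambda>A. emeasure M A + emeasure N A)" by (simp add: positive_def)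
  show "countably_additive (sets M) (\<lambda>A. emeasure M A + emeasure N A)"
    unfolding countably_additive_def
  proof (intro allI impI)
    fix A :: "nat \<Rightarrow> 'a set" assume A: "range A \<subseteq> sets M" "disjoint_family A"
    have "(\<Sum>i. emeasure M (A i) + emeasure N (A i)) = (\<Sum>i. emeasure M (A i)) + (\<Sum>i. emeasure N (A i))"
      by (intro suminf_add[symmetric]) auto
    then show "(\<Sum>i. emeasure M (A i) + emeasure N (A i)) = emeasure M (\<Union>i. A i) + emeasure N (\<Union>i. A i)"
      using A N by (simp add: suminf_emeasure)
  qed
qed fact

lemma nn_integral_madd:
  assumes N[measurable_cong]: "sets N = sets M" and f: "f \<in> borel_measurable M"
  shows "(\<integral>\<^sup>+ x. f x \<partial>madd M N) = (\<integral>\<^sup>+ x. f x \<partial>M) + (\<integral>\<^sup>+ x. f x \<partial>N)"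
  using f
proof induction
  case (cong f g)
  have "space N = space M" using sets_eq_imp_space_eq[OF N] .
  then have "integral\<^sup>N N f = integral\<^sup>N N g" "integral\<^sup>N M f = integral\<^sup>N M g"
    "integral\<^sup>N (madd M N) f = integral\<^sup>N (madd M N) g"
    using cong(3) by (auto intro!: nn_integral_cong)
  then show ?case using cong by simp
next
  case (set A)
  then show ?case using N by (simp add: emeasure_madd)
next
  case (mult u c)
  then show ?case by (simp add: nn_integral_cmult distrib_left)
next
  case (add u v)
  then show ?case by (simp add: nn_integral_add ac_simps)
next
  case (seq U)
  have "(\<integral>\<^sup>+ x. (SUP i. U i x) \<partial>M') = (SUP i. \<integral>\<^sup>+ x. U i x \<partial>M')" if [measurable_cong]: "sets M' = sets M" for M'
    using seq by (intro nn_integral_monotone_convergence_SUP) auto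
  note S = this[OF sets_madd] this[OF refl] this[OF N]
  have "incseq (\<lambda>i. \<integral>\<^sup>+ x. U i x \<partial>M)" "incseq (\<lambda>i. \<integral>\<^sup>+ x. U i x \<partial>N)"
    using seq(3) by (auto simp: incseq_def le_fun_def intro!: nn_integral_mono)
  then have "(SUP i. (\<integral>\<^sup>+ x. U i x \<partial>M) + (\<integral>\<^sup>+ x. U i x \<partial>N)) = (SUP i. \<integral>\<^sup>+ x. U i x \<partial>M) + (SUP i. \<integral>\<^sup>+ x. U i x \<partial>N)"
    by (intro ennreal_SUP_add) auto
  then show ?case using S seq by (simp add: image_comp)
qed

text \<open>Gluing is possible where the middle coordinate is a proper point, since there both
  couplings restrict to the marginal \<open>nu_of P2\<close>; the mass at the middle diagonal point
  is not prescribed. Mass that \<pi>12 sends to the diagonal stays there in \<pi>13, and mass that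
  \<pi>23 takes from the diagonal still comes from it. No path then runs from a proper point through
  the diagonal to a proper point, which is why the integrands have to be compared only under the
  condition on \<open>y2\<close>. They are quantified after \<pi>13, so that the glued coupling does
  not depend on the cost.\<close>

lemma adm_gluing:
  assumes n: "net P1" "net P2" "net P3" and a12: "net2.adm P1 P2 \<pi>12" and a23: "net2.adm P2 P3 \<pi>23"
  obtains \<pi>13 where "net2.adm P1 P3 \<pi>13"
    "\<And>F12 F23 F13 :: _ \<Rightarrow> ennreal.
       F12 \<in> borel_measurable (Yb P1 \<Otimes>\<^sub>M Yb P2) \<Longrightarrow> F23 \<in> borel_measurable (Yb P2 \<Otimes>\<^sub>M Yb P3) \<Longrightarrow>
       F13 \<in> borel_measurable (Yb P1 \<Otimes>\<^sub>M Yb P3) \<Longrightarrow> F12 (None, None) = 0 \<Longrightarrow> F23 (None, None) = 0 \<Longrightarrow>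
       (\<And>y1 y2 y3. y1 \<in> space (Yb P1) \<Longrightarrow> y2 \<in> space (Yb P2) \<Longrightarrow> y3 \<in> space (Yb P3) \<Longrightarrow>
         (y2 = None \<Longrightarrow> y1 = None \<or> y3 = None) \<Longrightarrow> F13 (y1, y3) \<le> F12 (y1, y2) + F23 (y2, y3)) \<Longrightarrow>
       (\<integral>\<^sup>+ z. F13 z \<partial>\<pi>13) \<le> (\<integral>\<^sup>+ z. F12 z \<partial>\<pi>12) + (\<integral>\<^sup>+ z. F23 z \<partial>\<pi>23)"
proof -
  interpret P1: net P1 by fact
  interpret P2: net P2 by fact
  interpret P3: net P3 by fact
  interpret N12: net2 P1 P2 ..
  interpret N23: net2 P2 P3 ..
  interpret N13: net2 P1 P3 ..
  have s12[measurable_cong]: "sets \<pi>12 = sets (Yb P1 \<Otimes>\<^sub>M Yb P2)"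
    and m12: "\<And>A. A \<in> sets (borel_of (Y_of P1)) \<Longrightarrow> emeasure \<pi>12 (Some ` A \<times> space (Yb P2)) = emeasure (nu_of P1) A"
     "\<And>A. A \<in> sets (borel_of (Y_of P2)) \<Longrightarrow> emeasure \<pi>12 (space (Yb P1) \<times> Some ` A) = emeasure (nu_of P2) A"
    using a12 unfolding N12.adm_def by auto
  have s23[measurable_cong]: "sets \<pi>23 = sets (Yb P2 \<Otimes>\<^sub>M Yb P3)"
    and m23: "\<And>A. A \<in> sets (borel_of (Y_of P2)) \<Longrightarrow> emeasure \<pi>23 (Some ` A \<times> space (Yb P3)) = emeasure (nu_of P2) A"
     "\<And>A. A \<in> sets (borel_of (Y_of P3)) \<Longrightarrow> emeasure \<pi>23 (space (Yb P2) \<times> Some ` A) = emeasure (nu_of P3) A"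
    using a23 unfolding N23.adm_def by auto
  have sp12: "space \<pi>12 = space (Yb P1) \<times> space (Yb P2)" and sp23: "space \<pi>23 = space (Yb P2) \<times> space (Yb P3)"
    using sets_eq_imp_space_eq[OF s12] sets_eq_imp_space_eq[OF s23] by (simp_all add: space_pair_measure)
  note [measurable] = pred_eq_None
  have SomeN2[measurable]: "Some \<in> nu_of P2 \<rightarrow>\<^sub>M Yb P2"
    using continuous_map_measurable[OF continuous_map_Some] by (simp add: P2.sets_nu cong: measurable_cong_sets)
  define \<nu> where "\<nu> = distr (nu_of P2) (Yb P2) Some"
  have s\<nu>[measurable_cong]: "sets \<nu> = sets (Yb P2)" by (simp add: \<nu>_def)
  have sp\<nu>: "space \<nu> = space (Yb P2)" by (simp add: \<nu>_def)
  have em\<nu>: "emeasure \<nu> B = emeasure (nu_of P2) (Some -` B \<inter> space (nu_of P2))" if "B \<in> sets (Yb P2)" for B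
    using that by (simp add: \<nu>_def emeasure_distr)
  have sf\<nu>: "sigma_finite_measure \<nu>"
  proof (rule sigma_finite_measureI_nn_integral)
    \<comment> \<open>The value 1 at \<open>None\<close> only secures positivity; \<nu> has no mass
      there.\<close>
    let ?t = "\<lambda>y. if y = None then 1 else ennreal (pers P2 y)"
    show m: "?t \<in> borel_measurable \<nu>" by measurable
    show "0 < ?t y" if "y \<in> space \<nu>" for y
      using that P2.pers_pos by (cases y) (auto simp: sp\<nu> topspace_bar)
    have "(\<integral>\<^sup>+ y. ?t y \<partial>\<nu>) = (\<integral>\<^sup>+ y. ennreal (pers P2 (Some y)) \<partial>nu_of P2)"
      unfolding \<nu>_def using m by (subst nn_integral_distr) (simp_all add: s\<nu> cong: measurable_cong_sets)
    then show "(\<integral>\<^sup>+ y. ?t y \<partial>\<nu>) < \<infinity>" using P2.pers_integrable by simp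
  qed
  \<comment> \<open>\<open>C12\<close> and \<open>C23\<close> hold the pairs with a proper middle
    coordinate, \<open>D12\<close> and \<open>D23\<close> those with only the outer coordinate
    proper; what is left is the null point at both diagonals.\<close>
  define C12 where "C12 = {z \<in> space \<pi>12. snd z \<noteq> None}"
  define D12 where "D12 = {z \<in> space \<pi>12. fst z \<noteq> None \<and> snd z = None}"
  define C23 where "C23 = {z \<in> space \<pi>23. fst z \<noteq> None}"
  define D23 where "D23 = {z \<in> space \<pi>23. fst z = None \<and> snd z \<noteq> None}"
  have [measurable]: "C12 \<in> sets \<pi>12" "D12 \<in> sets \<pi>12" "C23 \<in> sets \<pi>23" "D23 \<in> sets \<pi>23"
    unfolding C12_def D12_def C23_def D23_def by measurable
  define q12 where "q12 = density \<pi>12 (indicator C12)"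
  define q23 where "q23 = density \<pi>23 (indicator C23)"
  have sq[measurable_cong]: "sets q12 = sets (Yb P1 \<Otimes>\<^sub>M \<nu>)" "sets q23 = sets (\<nu> \<Otimes>\<^sub>M Yb P3)"
    unfolding q12_def q23_def sets_density s12 s23 sets_pair_measure_cong[OF refl s\<nu>] sets_pair_measure_cong[OF s\<nu> refl]
    by (rule refl)+
  have mq12: "distr q12 \<nu> snd = \<nu>"
  proof (rule measure_eqI)
    fix B assume "B \<in> sets (distr q12 \<nu> snd)"
    then have B[measurable]: "B \<in> sets (Yb P2)" by (simp add: s\<nu>)
    let ?B = "Some -` B \<inter> space (nu_of P2)"
    have B': "?B \<in> sets (borel_of (Y_of P2))"
      using measurable_sets[OF SomeN2 B] P2.sets_nu by simp
    have "emeasure (distr q12 \<nu> snd) B = emeasure q12 (snd -` B \<inter> space q12)"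
      by (intro emeasure_distr) (simp_all add: s\<nu>)
    also have "\<dots> = emeasure \<pi>12 (C12 \<inter> (snd -` B \<inter> space \<pi>12))"
      unfolding q12_def by (subst emeasure_restricted) simp_all
    also have "C12 \<inter> (snd -` B \<inter> space \<pi>12) = space (Yb P1) \<times> Some ` ?B"
      using sets.sets_into_space[OF B] by (auto simp: C12_def sp12 topspace_bar P2.space_nu)
    finally show "emeasure (distr q12 \<nu> snd) B = emeasure \<nu> B"
      using m12(2)[OF B'] em\<nu>[OF B] by simp
  qed simp
  have mq23: "distr q23 \<nu> fst = \<nu>"
  proof (rule measure_eqI)
    fix B assume "B \<in> sets (distr q23 \<nu> fst)"
    then have B[measurable]: "B \<in> sets (Yb P2)" by (simp add: s\<nu>)
    let ?B = "Some -` B \<inter> space (nu_of P2)"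
    have B': "?B \<in> sets (borel_of (Y_of P2))"
      using measurable_sets[OF SomeN2 B] P2.sets_nu by simp
    have "emeasure (distr q23 \<nu> fst) B = emeasure q23 (fst -` B \<inter> space q23)"
      by (intro emeasure_distr) (simp_all add: s\<nu>)
    also have "\<dots> = emeasure \<pi>23 (C23 \<inter> (fst -` B \<inter> space \<pi>23))"
      unfolding q23_def by (subst emeasure_restricted) simp_all
    also have "C23 \<inter> (fst -` B \<inter> space \<pi>23) = Some ` ?B \<times> space (Yb P3)"
      using sets.sets_into_space[OF B] by (auto simp: C23_def sp23 topspace_bar P2.space_nu)
    finally show "emeasure (distr q23 \<nu> fst) B = emeasure \<nu> B"
      using m23(1)[OF B'] em\<nu>[OF B] by simp
  qed simp
  obtain f1 g1 where c1: "coded (Yb P1) f1 g1" by (rule P1.coded_Yb)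
  obtain f3 g3 where c3: "coded (Yb P3) f3 g3" by (rule P3.coded_Yb)
  define \<Omega> where "\<Omega> = \<nu> \<Otimes>\<^sub>M (unif \<Otimes>\<^sub>M unif)"
  obtain h1 h3 where h[measurable]: "h1 \<in> \<Omega> \<rightarrow>\<^sub>M Yb P1" "h3 \<in> \<Omega> \<rightarrow>\<^sub>M Yb P3"
    and l12: "distr \<Omega> (Yb P1 \<Otimes>\<^sub>M \<nu>) (\<lambda>z. (h1 z, fst z)) = q12"
    and l23: "distr \<Omega> (\<nu> \<Otimes>\<^sub>M Yb P3) (\<lambda>z. (fst z, h3 z)) = q23"
    unfolding \<Omega>_def by (rule gluing[OF c1 c3 sf\<nu> sq(1) mq12 sq(2) mq23]) blast
  have fst\<Omega>[measurable]: "fst \<in> \<Omega> \<rightarrow>\<^sub>M \<nu>" unfolding \<Omega>_def by measurable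
  have fst\<Omega>'[measurable]: "fst \<in> \<Omega> \<rightarrow>\<^sub>M Yb P2"
    using fst\<Omega> measurable_cong_sets[OF refl s\<nu>] by blast
  have sec: "AE z in \<Omega>. fst z \<noteq> None"
  proof -
    have "AE z in q12. snd z \<noteq> None"
    proof -
      have "(indicator C12 :: _ \<Rightarrow> ennreal) \<in> borel_measurable \<pi>12" by simp
      from AE_density[OF this] show ?thesis
        unfolding q12_def by (auto simp: C12_def indicator_def intro!: AE_I2)
    qed
    then show ?thesis
      unfolding l12[symmetric] by (drule_tac AE_distrD[rotated]) simp_all
  qed
  define M13 where "M13 = Yb P1 \<Otimes>\<^sub>M Yb P3"
  \<comment> \<open>\<open>m0\<close> comes from gluing; \<open>m1\<close> and \<open>m2\<close> are
    the diagonal parts sent on unchanged.\<close>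
  define m0 where "m0 = distr \<Omega> M13 (\<lambda>z. (h1 z, h3 z))"
  define m1 where "m1 = distr (density \<pi>12 (indicator D12)) M13 (\<lambda>z. (fst z, None))"
  define m2 where "m2 = distr (density \<pi>23 (indicator D23)) M13 (\<lambda>z. (None, snd z))"
  define m where "m = madd (madd m0 m1) m2"
  have sm[measurable_cong]: "sets m0 = sets M13" "sets m1 = sets M13" "sets m2 = sets M13" "sets m = sets M13"
    by (simp_all add: m_def m0_def m1_def m2_def)
  have None_in: "None \<in> space (Yb P)" for P :: "('x, 'y) network" by (simp add: topspace_bar)
  have meas[measurable]: "(\<lambda>z. (h1 z, h3 z)) \<in> \<Omega> \<rightarrow>\<^sub>M M13" "(\<lambda>z. (fst z, None)) \<in> density \<pi>12 (indicator D12) \<rightarrow>\<^sub>M M13"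
    "(\<lambda>z. (None, snd z)) \<in> density \<pi>23 (indicator D23) \<rightarrow>\<^sub>M M13"
    unfolding M13_def using None_in[of P1] None_in[of P3] by measurable
  \<comment> \<open>The glued part may charge the point at both diagonals, namely where a middle
    point is matched to the diagonal on both sides. Admissibility requires the removal of this mass,
    which affects the marginals at no proper point.\<close>
  define E where "E = {z \<in> space m. z \<noteq> (None, None)}"
  have spM13: "space M13 = space (Yb P1) \<times> space (Yb P3)" by (simp add: M13_def space_pair_measure)
  have NN: "{(None, None)} \<in> sets M13"
    using pair_measureI[OF None_borel_of None_borel_of, of "Y_of P1" "Y_of P3"] by (simp add: M13_def)
  have spm: "space m = space M13" using sets_eq_imp_space_eq[OF sm(4)] .
  have E[measurable]: "E \<in> sets m"
  proof -
    have "E = space m - {(None, None)}" by (auto simp: E_def)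
    then show ?thesis using NN sm(4) by (metis sets.Diff sets.top)
  qed
  have E13: "E \<in> sets M13" using E sm(4) by simp
  define \<pi>13 where "\<pi>13 = density m (indicator E)"
  have em: "emeasure \<pi>13 X = emeasure m0 X + emeasure m1 X + emeasure m2 X" if "X \<in> sets M13" "(None, None) \<notin> X" for X
  proof -
    have "E \<inter> X = X" using that sets.sets_into_space[OF that(1)] by (auto simp: E_def spm)
    then have "emeasure \<pi>13 X = emeasure m X"
      using that E13 unfolding \<pi>13_def by (subst emeasure_restricted) (simp_all add: sm)
    then show ?thesis using that by (simp add: m_def emeasure_madd sm)
  qed
  show ?thesis
  proof (rule that[of \<pi>13])
    show "N13.adm \<pi>13"
      unfolding N13.adm_def
    proof (intro conjI ballI)
      show "sets \<pi>13 = sets (Yb P1 \<Otimes>\<^sub>M Yb P3)" by (simp add: \<pi>13_def sm M13_def)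
      have "E \<inter> {(None, None)} = {}" by (auto simp: E_def)
      then show "emeasure \<pi>13 {(None, None)} = 0"
        unfolding \<pi>13_def using NN E13 by (subst emeasure_restricted) (simp_all add: sm)
    next
      fix A assume A: "A \<in> sets (borel_of (Y_of P1))"
      have SA[measurable]: "Some ` A \<in> sets (Yb P1)" by (rule Some_image_borel_of[OF A])
      let ?X = "Some ` A \<times> space (Yb P3)"
      have X: "?X \<in> sets M13" unfolding M13_def by measurable
      have X12[measurable]: "Some ` A \<times> space (Yb P2) \<in> sets \<pi>12"
        unfolding s12 by (intro pair_measureI SA sets.top)
      have "emeasure m0 ?X = emeasure q12 (Some ` A \<times> space \<nu>)"
      proof -
        have "(\<lambda>z. (h1 z, h3 z)) -` ?X \<inter> space \<Omega> = (\<lambda>z. (h1 z, fst z)) -` (Some ` A \<times> space \<nu>) \<inter> space \<Omega>"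
          using measurable_space[OF h(2)] by (auto simp: \<Omega>_def space_pair_measure)
        moreover have "Some ` A \<times> space \<nu> \<in> sets (Yb P1 \<Otimes>\<^sub>M \<nu>)" by measurable
        ultimately show ?thesis
          unfolding m0_def l12[symmetric] using X by (subst (1 2) emeasure_distr) simp_all
      qed
      also have "\<dots> = emeasure \<pi>12 (C12 \<inter> (Some ` A \<times> space (Yb P2)))"
        unfolding q12_def sp\<nu> using X12 by (subst emeasure_restricted) (simp_all del: space_borel_of)
      finally have 0: "emeasure m0 ?X = emeasure \<pi>12 (C12 \<inter> (Some ` A \<times> space (Yb P2)))" .
      have 1: "emeasure m1 ?X = emeasure \<pi>12 (D12 \<inter> (Some ` A \<times> space (Yb P2)))"
      proof -
        have "(\<lambda>z. (fst z, None)) -` ?X \<inter> space (density \<pi>12 (indicator D12)) = Some ` A \<times> space (Yb P2)"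
          using None_in[of P3] sets.sets_into_space[OF SA] by (auto simp: sp12)
        then show ?thesis
          unfolding m1_def using X X12 by (subst emeasure_distr) (simp_all add: emeasure_restricted del: space_borel_of)
      qed
      have 2: "emeasure m2 ?X = 0"
      proof -
        have "(\<lambda>z. (None, snd z)) -` ?X \<inter> space (density \<pi>23 (indicator D23)) = {}" by auto
        from this show ?thesis unfolding m2_def emeasure_distr[OF meas(3) X] by (simp only: emeasure_empty)
      qed
      have "emeasure \<pi>13 ?X = emeasure \<pi>12 (C12 \<inter> (Some ` A \<times> space (Yb P2))) + emeasure \<pi>12 (D12 \<inter> (Some ` A \<times> space (Yb P2)))"
        using em[OF X] 0 1 2 by auto
      also have "\<dots> = emeasure \<pi>12 (Some ` A \<times> space (Yb P2))"
      proof (subst plus_emeasure)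
        show "emeasure \<pi>12 (C12 \<inter> (Some ` A \<times> space (Yb P2)) \<union> D12 \<inter> (Some ` A \<times> space (Yb P2))) = emeasure \<pi>12 (Some ` A \<times> space (Yb P2))"
          using sets.sets_into_space[OF SA] by (intro arg_cong2[where f = emeasure]) (auto simp: C12_def D12_def sp12)
        show "C12 \<inter> (Some ` A \<times> space (Yb P2)) \<in> sets \<pi>12" "D12 \<inter> (Some ` A \<times> space (Yb P2)) \<in> sets \<pi>12"
          using X12 by (auto intro!: sets.Int simp del: space_borel_of)
        show "C12 \<inter> (Some ` A \<times> space (Yb P2)) \<inter> (D12 \<inter> (Some ` A \<times> space (Yb P2))) = {}" by (auto simp: C12_def D12_def)
      qed
      also have "\<dots> = emeasure (nu_of P1) A" by (rule m12(1)[OF A])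
      finally show "emeasure \<pi>13 ?X = emeasure (nu_of P1) A" .
    next
      fix A assume A: "A \<in> sets (borel_of (Y_of P3))"
      have SA[measurable]: "Some ` A \<in> sets (Yb P3)" by (rule Some_image_borel_of[OF A])
      let ?X = "space (Yb P1) \<times> Some ` A"
      have X: "?X \<in> sets M13" unfolding M13_def by measurable
      have X23[measurable]: "space (Yb P2) \<times> Some ` A \<in> sets \<pi>23"
        unfolding s23 by (intro pair_measureI SA sets.top)
      have "emeasure m0 ?X = emeasure q23 (space \<nu> \<times> Some ` A)"
      proof -
        have "(\<lambda>z. (h1 z, h3 z)) -` ?X \<inter> space \<Omega> = (\<lambda>z. (fst z, h3 z)) -` (space \<nu> \<times> Some ` A) \<inter> space \<Omega>"
          using measurable_space[OF h(1)] by (auto simp: \<Omega>_def space_pair_measure)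
        moreover have "space \<nu> \<times> Some ` A \<in> sets (\<nu> \<Otimes>\<^sub>M Yb P3)" by measurable
        ultimately show ?thesis
          unfolding m0_def l23[symmetric] using X by (subst (1 2) emeasure_distr) simp_all
      qed
      also have "\<dots> = emeasure \<pi>23 (C23 \<inter> (space (Yb P2) \<times> Some ` A))"
        unfolding q23_def sp\<nu> using X23 by (subst emeasure_restricted) (simp_all del: space_borel_of)
      finally have 0: "emeasure m0 ?X = emeasure \<pi>23 (C23 \<inter> (space (Yb P2) \<times> Some ` A))" .
      have 1: "emeasure m2 ?X = emeasure \<pi>23 (D23 \<inter> (space (Yb P2) \<times> Some ` A))"
      proof -
        have "(\<lambda>z. (None, snd z)) -` ?X \<inter> space (density \<pi>23 (indicator D23)) = space (Yb P2) \<times> Some ` A"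
          using None_in[of P1] sets.sets_into_space[OF SA] by (auto simp: sp23)
        then show ?thesis
          unfolding m2_def using X X23 by (subst emeasure_distr) (simp_all add: emeasure_restricted del: space_borel_of)
      qed
      have 2: "emeasure m1 ?X = 0"
      proof -
        have "(\<lambda>z. (fst z, None)) -` ?X \<inter> space (density \<pi>12 (indicator D12)) = {}" by auto
        from this show ?thesis unfolding m1_def emeasure_distr[OF meas(2) X] by (simp only: emeasure_empty)
      qed
      have "emeasure \<pi>13 ?X = emeasure \<pi>23 (C23 \<inter> (space (Yb P2) \<times> Some ` A)) + emeasure \<pi>23 (D23 \<inter> (space (Yb P2) \<times> Some ` A))"
        using em[OF X] 0 1 2 by auto
      also have "\<dots> = emeasure \<pi>23 (space (Yb P2) \<times> Some ` A)"
      proof (subst plus_emeasure)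
        show "emeasure \<pi>23 (C23 \<inter> (space (Yb P2) \<times> Some ` A) \<union> D23 \<inter> (space (Yb P2) \<times> Some ` A)) = emeasure \<pi>23 (space (Yb P2) \<times> Some ` A)"
          using sets.sets_into_space[OF SA] by (intro arg_cong2[where f = emeasure]) (auto simp: C23_def D23_def sp23)
        show "C23 \<inter> (space (Yb P2) \<times> Some ` A) \<in> sets \<pi>23" "D23 \<inter> (space (Yb P2) \<times> Some ` A) \<in> sets \<pi>23"
          using X23 by (auto intro!: sets.Int simp del: space_borel_of)
        show "C23 \<inter> (space (Yb P2) \<times> Some ` A) \<inter> (D23 \<inter> (space (Yb P2) \<times> Some ` A)) = {}" by (auto simp: C23_def D23_def)
      qed
      also have "\<dots> = emeasure (nu_of P3) A" by (rule m23(2)[OF A])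
      finally show "emeasure \<pi>13 ?X = emeasure (nu_of P3) A" .
    qed
  next
    fix F12 F23 F13 :: "_ \<Rightarrow> ennreal"
    assume F: "F12 \<in> borel_measurable (Yb P1 \<Otimes>\<^sub>M Yb P2)" "F23 \<in> borel_measurable (Yb P2 \<Otimes>\<^sub>M Yb P3)"
       "F13 \<in> borel_measurable (Yb P1 \<Otimes>\<^sub>M Yb P3)" and z: "F12 (None, None) = 0" "F23 (None, None) = 0"
       and tri: "\<And>y1 y2 y3. y1 \<in> space (Yb P1) \<Longrightarrow> y2 \<in> space (Yb P2) \<Longrightarrow> y3 \<in> space (Yb P3) \<Longrightarrow>
         (y2 = None \<Longrightarrow> y1 = None \<or> y3 = None) \<Longrightarrow> F13 (y1, y3) \<le> F12 (y1, y2) + F23 (y2, y3)"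
    note [measurable] = F
    have F13'[measurable]: "F13 \<in> borel_measurable M13" unfolding M13_def by measurable
    have "(\<integral>\<^sup>+ z. F13 z \<partial>\<pi>13) = (\<integral>\<^sup>+ z. indicator E z * F13 z \<partial>m)"
      unfolding \<pi>13_def by (subst nn_integral_density) simp_all
    also have "\<dots> \<le> (\<integral>\<^sup>+ z. F13 z \<partial>m)"
      by (intro nn_integral_mono) (auto simp: indicator_def)
    also have "\<dots> = (\<integral>\<^sup>+ z. F13 z \<partial>m0) + (\<integral>\<^sup>+ z. F13 z \<partial>m1) + (\<integral>\<^sup>+ z. F13 z \<partial>m2)"
      unfolding m_def by (simp add: nn_integral_madd sm)
    finally have I: "(\<integral>\<^sup>+ z. F13 z \<partial>\<pi>13) \<le> (\<integral>\<^sup>+ z. F13 z \<partial>m0) + (\<integral>\<^sup>+ z. F13 z \<partial>m1) + (\<integral>\<^sup>+ z. F13 z \<partial>m2)" .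
    have "(\<integral>\<^sup>+ z. F13 z \<partial>m0) = (\<integral>\<^sup>+ z. F13 (h1 z, h3 z) \<partial>\<Omega>)"
      unfolding m0_def by (rule nn_integral_distr) simp_all
    also have "\<dots> \<le> (\<integral>\<^sup>+ z. F12 (h1 z, fst z) + F23 (fst z, h3 z) \<partial>\<Omega>)"
    proof (rule nn_integral_mono_AE)
      show "AE z in \<Omega>. F13 (h1 z, h3 z) \<le> F12 (h1 z, fst z) + F23 (fst z, h3 z)"
        using sec AE_space
      proof eventually_elim
        case (elim z)
        then show ?case
          using measurable_space[OF h(1)] measurable_space[OF h(2)] measurable_space[OF fst\<Omega>'] by (intro tri) auto
      qed
    qed
    also have "\<dots> = (\<integral>\<^sup>+ z. F12 (h1 z, fst z) \<partial>\<Omega>) + (\<integral>\<^sup>+ z. F23 (fst z, h3 z) \<partial>\<Omega>)"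
      by (rule nn_integral_add) (rule measurable_compose[OF _ F(1)] measurable_compose[OF _ F(2)], measurable)+
    also have "(\<integral>\<^sup>+ z. F12 (h1 z, fst z) \<partial>\<Omega>) = (\<integral>\<^sup>+ z. F12 z \<partial>q12)"
      unfolding l12[symmetric] by (subst nn_integral_distr) simp_all
    also have "(\<integral>\<^sup>+ z. F23 (fst z, h3 z) \<partial>\<Omega>) = (\<integral>\<^sup>+ z. F23 z \<partial>q23)"
      unfolding l23[symmetric] by (subst nn_integral_distr) simp_all
    also have "(\<integral>\<^sup>+ z. F12 z \<partial>q12) = (\<integral>\<^sup>+ z. indicator C12 z * F12 z \<partial>\<pi>12)"
      unfolding q12_def by (subst nn_integral_density) simp_all
    also have "(\<integral>\<^sup>+ z. F23 z \<partial>q23) = (\<integral>\<^sup>+ z. indicator C23 z * F23 z \<partial>\<pi>23)"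
      unfolding q23_def by (subst nn_integral_density) simp_all
    finally have I0: "(\<integral>\<^sup>+ z. F13 z \<partial>m0) \<le> (\<integral>\<^sup>+ z. indicator C12 z * F12 z \<partial>\<pi>12) + (\<integral>\<^sup>+ z. indicator C23 z * F23 z \<partial>\<pi>23)" .
    have "(\<integral>\<^sup>+ z. F13 z \<partial>m1) = (\<integral>\<^sup>+ z. indicator D12 z * F13 (fst z, None) \<partial>\<pi>12)"
      unfolding m1_def by (subst nn_integral_distr) (simp_all add: nn_integral_density)
    also have "\<dots> \<le> (\<integral>\<^sup>+ z. indicator D12 z * F12 z \<partial>\<pi>12)"
    proof (rule nn_integral_mono)
      fix x assume "x \<in> space \<pi>12"
      then show "indicator D12 x * F13 (fst x, None) \<le> indicator D12 x * F12 x"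
        \<comment> \<open>The triangle condition with the middle and the last coordinate on the
          diagonal, where \<open>F23\<close> vanishes.\<close>
        using tri[of "fst x" None None] z None_in by (cases x) (auto simp: indicator_def D12_def sp12)
    qed
    finally have I1: "(\<integral>\<^sup>+ z. F13 z \<partial>m1) \<le> (\<integral>\<^sup>+ z. indicator D12 z * F12 z \<partial>\<pi>12)" .
    have "(\<integral>\<^sup>+ z. F13 z \<partial>m2) = (\<integral>\<^sup>+ z. indicator D23 z * F13 (None, snd z) \<partial>\<pi>23)"
      unfolding m2_def by (subst nn_integral_distr) (simp_all add: nn_integral_density)
    also have "\<dots> \<le> (\<integral>\<^sup>+ z. indicator D23 z * F23 z \<partial>\<pi>23)"
    proof (rule nn_integral_mono)
      fix x assume "x \<in> space \<pi>23"
      then show "indicator D23 x * F13 (None, snd x) \<le> indicator D23 x * F23 x"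
        using tri[of None None "snd x"] z None_in by (cases x) (auto simp: indicator_def D23_def sp23)
    qed
    finally have I2: "(\<integral>\<^sup>+ z. F13 z \<partial>m2) \<le> (\<integral>\<^sup>+ z. indicator D23 z * F23 z \<partial>\<pi>23)" .
    have J1: "(\<integral>\<^sup>+ z. indicator C12 z * F12 z \<partial>\<pi>12) + (\<integral>\<^sup>+ z. indicator D12 z * F12 z \<partial>\<pi>12) \<le> (\<integral>\<^sup>+ z. F12 z \<partial>\<pi>12)"
    proof -
      have "(\<integral>\<^sup>+ z. indicator C12 z * F12 z \<partial>\<pi>12) + (\<integral>\<^sup>+ z. indicator D12 z * F12 z \<partial>\<pi>12)
        = (\<integral>\<^sup>+ z. indicator C12 z * F12 z + indicator D12 z * F12 z \<partial>\<pi>12)"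
        by (rule nn_integral_add[symmetric]) measurable
      also have "\<dots> \<le> (\<integral>\<^sup>+ z. F12 z \<partial>\<pi>12)"
        by (rule nn_integral_mono) (auto simp: indicator_def C12_def D12_def)
      finally show ?thesis .
    qed
    have J2: "(\<integral>\<^sup>+ z. indicator C23 z * F23 z \<partial>\<pi>23) + (\<integral>\<^sup>+ z. indicator D23 z * F23 z \<partial>\<pi>23) \<le> (\<integral>\<^sup>+ z. F23 z \<partial>\<pi>23)"
    proof -
      have "(\<integral>\<^sup>+ z. indicator C23 z * F23 z \<partial>\<pi>23) + (\<integral>\<^sup>+ z. indicator D23 z * F23 z \<partial>\<pi>23)
        = (\<integral>\<^sup>+ z. indicator C23 z * F23 z + indicator D23 z * F23 z \<partial>\<pi>23)"
        by (rule nn_integral_add[symmetric]) measurable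
      also have "\<dots> \<le> (\<integral>\<^sup>+ z. F23 z \<partial>\<pi>23)"
        by (rule nn_integral_mono) (auto simp: indicator_def C23_def D23_def)
      finally show ?thesis .
    qed
    have "(\<integral>\<^sup>+ z. F13 z \<partial>\<pi>13) \<le>
       ((\<integral>\<^sup>+ z. indicator C12 z * F12 z \<partial>\<pi>12) + (\<integral>\<^sup>+ z. indicator C23 z * F23 z \<partial>\<pi>23))
       + (\<integral>\<^sup>+ z. indicator D12 z * F12 z \<partial>\<pi>12) + (\<integral>\<^sup>+ z. indicator D23 z * F23 z \<partial>\<pi>23)"
      using I by (rule order_trans) (intro add_mono I0 I1 I2)
    also have "\<dots> = ((\<integral>\<^sup>+ z. indicator C12 z * F12 z \<partial>\<pi>12) + (\<integral>\<^sup>+ z. indicator D12 z * F12 z \<partial>\<pi>12)) +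
       ((\<integral>\<^sup>+ z. indicator C23 z * F23 z \<partial>\<pi>23) + (\<integral>\<^sup>+ z. indicator D23 z * F23 z \<partial>\<pi>23))"
      by (simp add: ac_simps)
    also have "\<dots> \<le> (\<integral>\<^sup>+ z. F12 z \<partial>\<pi>12) + (\<integral>\<^sup>+ z. F23 z \<partial>\<pi>23)"
      by (intro add_mono J1 J2)
    finally show "(\<integral>\<^sup>+ z. F13 z \<partial>\<pi>13) \<le> (\<integral>\<^sup>+ z. F12 z \<partial>\<pi>12) + (\<integral>\<^sup>+ z. F23 z \<partial>\<pi>23)" .
  qed
qed

context net2
begin

text \<open>The cost of a single edge pair when \<pi>v is fixed, with the \<open>omega\<close> term
  integrated over the vertices first. The total cost is then one integral over \<pi>e plus
  \<open>kcost\<close>, the form in which gluing and limits handle it.\<close>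

definition Phi :: "real \<Rightarrow> ('a \<times> 'c) measure \<Rightarrow> 'b option \<times> 'd option \<Rightarrow> ennreal" where
  "Phi p \<pi>v z = ennreal (lam_dist p (iota_bar P (fst z)) (iota_bar P' (snd z)) powr p)
     + (\<integral>\<^sup>+ x. ennreal (\<bar>omega_bar P (fst x) (fst z) - omega_bar P' (snd x) (snd z)\<bar> powr p) \<partial>\<pi>v)"

definition kcost :: "real \<Rightarrow> ('a \<times> 'c) measure \<Rightarrow> ennreal" where
  "kcost p \<pi>v = (\<integral>\<^sup>+ w. ennreal (\<bar>k_of P (fst (fst w)) (fst (snd w)) - k_of P' (snd (fst w)) (snd (snd w))\<bar> powr p)
     \<partial>(\<pi>v \<Otimes>\<^sub>M \<pi>v))"

lemma lam_measurable [measurable]: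
  "(\<lambda>z. lam_dist p (iota_bar P (fst z)) (iota_bar P' (snd z))) \<in> borel_measurable (Yb P \<Otimes>\<^sub>M Yb P')"
  by (rule P.lam_dist_measurable[OF P'.net_axioms])

lemma omega_diff_measurable [measurable]:
  "(\<lambda>w. omega_bar P (fst (fst w)) (fst (snd w)) - omega_bar P' (snd (fst w)) (snd (snd w)))
    \<in> borel_measurable ((mu_of P \<Otimes>\<^sub>M mu_of P') \<Otimes>\<^sub>M (Yb P \<Otimes>\<^sub>M Yb P'))"
proof -
  have "(\<lambda>w. (\<lambda>z. omega_bar P (fst z) (snd z)) (fst (fst w), fst (snd w)))
      \<in> borel_measurable ((mu_of P \<Otimes>\<^sub>M mu_of P') \<Otimes>\<^sub>M (Yb P \<Otimes>\<^sub>M Yb P'))"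
    by (rule measurable_compose[OF _ P.omega_bar_measurable]) measurable
  moreover have "(\<lambda>w. (\<lambda>z. omega_bar P' (fst z) (snd z)) (snd (fst w), snd (snd w)))
      \<in> borel_measurable ((mu_of P \<Otimes>\<^sub>M mu_of P') \<Otimes>\<^sub>M (Yb P \<Otimes>\<^sub>M Yb P'))"
    by (rule measurable_compose[OF _ P'.omega_bar_measurable]) measurable
  ultimately show ?thesis by simp
qed

lemma k_diff_measurable [measurable]:
  "(\<lambda>w. k_of P (fst (fst w)) (fst (snd w)) - k_of P' (snd (fst w)) (snd (snd w)))
    \<in> borel_measurable ((mu_of P \<Otimes>\<^sub>M mu_of P') \<Otimes>\<^sub>M (mu_of P \<Otimes>\<^sub>M mu_of P'))"
proof -
  have "(\<lambda>w. (\<lambda>z. k_of P (fst z) (snd z)) (fst (fst w), fst (snd w)))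
      \<in> borel_measurable ((mu_of P \<Otimes>\<^sub>M mu_of P') \<Otimes>\<^sub>M (mu_of P \<Otimes>\<^sub>M mu_of P'))"
    by (rule measurable_compose[OF _ P.k_measurable]) measurable
  moreover have "(\<lambda>w. (\<lambda>z. k_of P' (fst z) (snd z)) (snd (fst w), snd (snd w)))
      \<in> borel_measurable ((mu_of P \<Otimes>\<^sub>M mu_of P') \<Otimes>\<^sub>M (mu_of P \<Otimes>\<^sub>M mu_of P'))"
    by (rule measurable_compose[OF _ P'.k_measurable]) measurable
  ultimately show ?thesis by simp
qed

lemma Phi_measurable:
  assumes s[measurable_cong]: "sets \<pi>v = sets (mu_of P \<Otimes>\<^sub>M mu_of P')" and "prob_space \<pi>v"
  shows "Phi p \<pi>v \<in> borel_measurable (Yb P \<Otimes>\<^sub>M Yb P')"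
proof -
  interpret prob_space \<pi>v by fact
  have "(\<lambda>w. omega_bar P (fst (snd w)) (fst (fst w)) - omega_bar P' (snd (snd w)) (snd (fst w)))
      \<in> borel_measurable ((Yb P \<Otimes>\<^sub>M Yb P') \<Otimes>\<^sub>M \<pi>v)"
  proof -
    have "(\<lambda>w. (snd w, fst w)) \<in> (Yb P \<Otimes>\<^sub>M Yb P') \<Otimes>\<^sub>M \<pi>v \<rightarrow>\<^sub>M (mu_of P \<Otimes>\<^sub>M mu_of P') \<Otimes>\<^sub>M (Yb P \<Otimes>\<^sub>M Yb P')"
      by measurable
    from measurable_compose[OF this omega_diff_measurable] show ?thesis by simp
  qed
  then have [measurable]: "(\<lambda>(z, x). ennreal (\<bar>omega_bar P (fst x) (fst z) - omega_bar P' (snd x) (snd z)\<bar> powr p))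
      \<in> borel_measurable ((Yb P \<Otimes>\<^sub>M Yb P') \<Otimes>\<^sub>M \<pi>v)"
    unfolding case_prod_beta by measurable
  have "(\<lambda>z. \<integral>\<^sup>+ x. ennreal (\<bar>omega_bar P (fst x) (fst z) - omega_bar P' (snd x) (snd z)\<bar> powr p) \<partial>\<pi>v)
      \<in> borel_measurable (Yb P \<Otimes>\<^sub>M Yb P')"
    by (rule borel_measurable_nn_integral) measurable
  then show ?thesis unfolding Phi_def by measurable
qed

lemma Phi_None: "Phi p \<pi>v (None, None) = 0"
  by (simp add: Phi_def iota_bar_def omega_bar_def)

text \<open>Tonelli's theorem applies because admissible couplings are \<sigma>-finite.\<close>

lemma cost_eq:
  assumes v: "\<pi>v \<in> couplings P P'" and e: "adm \<pi>e"
  shows "TpOT_cost p P P' \<pi>v \<pi>e = (\<integral>\<^sup>+ z. Phi p \<pi>v z \<partial>\<pi>e) + kcost p \<pi>v"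
proof -
  note sv[measurable_cong] = couplingsD(1)[OF v]
  interpret V: prob_space \<pi>v by (rule couplingsD(2)[OF v])
  interpret E: sigma_finite_measure \<pi>e by (rule adm_sigma_finite[OF e])
  interpret VE: pair_sigma_finite \<pi>v \<pi>e ..
  have se[measurable_cong]: "sets \<pi>e = sets (Yb P \<Otimes>\<^sub>M Yb P')" using e by (simp add: adm_def)
  let ?f = "\<lambda>w. ennreal (\<bar>omega_bar P (fst (fst w)) (fst (snd w)) - omega_bar P' (snd (fst w)) (snd (snd w))\<bar> powr p)"
  have m[measurable]: "?f \<in> borel_measurable (\<pi>v \<Otimes>\<^sub>M \<pi>e)" by measurable
  have "(\<integral>\<^sup>+ w. ?f w \<partial>(\<pi>v \<Otimes>\<^sub>M \<pi>e)) = (\<integral>\<^sup>+ z. \<integral>\<^sup>+ x. ?f (x, z) \<partial>\<pi>v \<partial>\<pi>e)"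
    using VE.nn_integral_snd[OF m] by simp
  moreover have "(\<integral>\<^sup>+ z. Phi p \<pi>v z \<partial>\<pi>e) =
     (\<integral>\<^sup>+ z. ennreal (lam_dist p (iota_bar P (fst z)) (iota_bar P' (snd z)) powr p) \<partial>\<pi>e) + (\<integral>\<^sup>+ z. \<integral>\<^sup>+ x. ?f (x, z) \<partial>\<pi>v \<partial>\<pi>e)"
    unfolding Phi_def fst_conv snd_conv
  proof (rule nn_integral_add)
    show "(\<lambda>z. ennreal (lam_dist p (iota_bar P (fst z)) (iota_bar P' (snd z)) powr p)) \<in> borel_measurable \<pi>e"
      by measurable
    have "(\<lambda>(z, x). ?f (x, z)) \<in> borel_measurable (\<pi>e \<Otimes>\<^sub>M \<pi>v)"
      using measurable_compose[OF measurable_pair_swap' m] by (simp add: case_prod_beta)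
    then show "(\<lambda>z. \<integral>\<^sup>+ x. ennreal (\<bar>omega_bar P (fst x) (fst z) - omega_bar P' (snd x) (snd z)\<bar> powr p) \<partial>\<pi>v) \<in> borel_measurable \<pi>e"
      using V.borel_measurable_nn_integral[of "\<lambda>z x. ?f (x, z)" \<pi>e] by simp
  qed
  ultimately show ?thesis
    unfolding TpOT_cost_def case_prod_beta kcost_def by (simp add: ac_simps)
qed

lemma d_TpOT_le:
  assumes "\<pi>v \<in> couplings P P'" "adm \<pi>e"
  shows "d_TpOT p P P' \<le> ennreal_root p (TpOT_cost p P P' \<pi>v \<pi>e)"
  unfolding d_TpOT_def using assms adm_couplings_iff by (intro INF_lower2[of "(\<pi>v, \<pi>e)"]) auto

end

lemma ennreal_root_le:
  assumes "0 < p" "0 \<le> a" "x \<le> ennreal (a powr p)"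
  shows "ennreal_root p x \<le> ennreal a"
proof -
  have "x \<noteq> \<infinity>" using assms(3) by (auto simp: top_unique)
  moreover have "enn2real x \<le> a powr p"
    using assms(3) by (metis enn2real_le powr_ge_zero ennreal_enn2real enn2real_ennreal enn2real_mono ennreal_less_top)
  then have "enn2real x powr (1 / p) \<le> (a powr p) powr (1 / p)"
    using assms(1) by (intro powr_mono2) auto
  ultimately show ?thesis
    using assms by (simp add: ennreal_root_def powr_powr powr_one' ennreal_leI)
qed

lemma ennreal_root_less:
  assumes p: "0 < p" and a: "0 < a" and "ennreal_root p x < ennreal a"
  shows "x \<le> ennreal (a powr p)"
proof -
  have x: "x \<noteq> \<infinity>" using assms(3) by (auto simp: ennreal_root_def)
  then have "enn2real x powr (1 / p) < a" using assms(3) by (simp add: ennreal_root_def ennreal_less_iff)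
  then have "(enn2real x powr (1 / p)) powr p \<le> a powr p" using p by (intro powr_mono2) auto
  then have "enn2real x \<le> a powr p" using p by (simp add: powr_powr powr_one')
  then show ?thesis using x by (metis ennreal_enn2real_if ennreal_leI infinity_ennreal_def)
qed

lemma d_TpOT_less_obtain:
  assumes n: "net P" "net P'" and p: "0 < p" and a: "0 < a" and d: "d_TpOT p P P' < ennreal a"
  obtains \<pi>v \<pi>e where "\<pi>v \<in> couplings P P'" "net2.adm P P' \<pi>e" "TpOT_cost p P P' \<pi>v \<pi>e \<le> ennreal (a powr p)"
proof -
  interpret net2 P P' using n by (simp add: net2_def)
  obtain z where z: "z \<in> couplings P P' \<times> adm_couplings P P'"
     "(case z of (\<pi>v, \<pi>e) \<Rightarrow> ennreal_root p (TpOT_cost p P P' \<pi>v \<pi>e)) < ennreal a"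
    using d unfolding d_TpOT_def INF_less_iff by blast
  then show ?thesis
    using that ennreal_root_less[OF p a] adm_couplings_iff by (cases z) auto
qed

text \<open>Exchanging the coordinates turns couplings in one order into couplings in the other with
  the same cost.\<close>

lemma d_TpOT_commute_le:
  assumes n: "net P" "net P'" and p: "1 \<le> p"
  shows "d_TpOT p P P' \<le> d_TpOT p P' P"
proof -
  interpret A: net2 P P' using n by (simp add: net2_def)
  interpret B: net2 P' P using n by (simp add: net2_def)
  have "d_TpOT p P P' \<le> ennreal_root p (TpOT_cost p P' P \<pi>v \<pi>e)" if v: "\<pi>v \<in> couplings P' P" and "\<pi>e \<in> adm_couplings P' P" for \<pi>v \<pi>e
  proof -
    have e: "B.adm \<pi>e" using that B.adm_couplings_iff by simp
    note sv[measurable_cong] = B.couplingsD(1)[OF v]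
    interpret V: prob_space \<pi>v by (rule B.couplingsD(2)[OF v])
    have se[measurable_cong]: "sets \<pi>e = sets (Yb P' \<Otimes>\<^sub>M Yb P)" using e by (simp add: B.adm_def)
    define \<rho>v where "\<rho>v = distr \<pi>v (mu_of P \<Otimes>\<^sub>M mu_of P') (\<lambda>z. (snd z, fst z))"
    define \<rho>e where "\<rho>e = distr \<pi>e (Yb P \<Otimes>\<^sub>M Yb P') (\<lambda>z. (snd z, fst z))"
    have cv: "\<rho>v \<in> couplings P P'"
    proof (rule A.couplingsI)
      show "prob_space \<rho>v" unfolding \<rho>v_def by (rule V.prob_space_distr) measurable
      show "distr \<rho>v (mu_of P) fst = mu_of P" "distr \<rho>v (mu_of P') snd = mu_of P'"
        unfolding \<rho>v_def using B.couplingsD(3,4)[OF v] by (subst distr_distr; simp add: comp_def)+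
    qed (simp add: \<rho>v_def)
    have spe: "space \<pi>e = space (Yb P') \<times> space (Yb P)"
      using sets_eq_imp_space_eq[OF se] by (simp add: space_pair_measure)
    have ce: "A.adm \<rho>e"
    proof -
      have em: "emeasure \<rho>e (X \<times> Y) = emeasure \<pi>e (Y \<times> X)" if "X \<in> sets (Yb P)" "Y \<in> sets (Yb P')" for X Y
      proof -
        have "(\<lambda>z. (snd z, fst z)) -` (X \<times> Y) \<inter> space \<pi>e = Y \<times> X"
          using sets.sets_into_space[OF that(1)] sets.sets_into_space[OF that(2)] by (auto simp: spe)
        then show ?thesis unfolding \<rho>e_def using that by (subst emeasure_distr) simp_all
      qed
      have "emeasure \<rho>e ({None} \<times> {None}) = emeasure \<pi>e ({None} \<times> {None})"
        by (intro em None_borel_of)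
      then show ?thesis
        using e em[OF Some_image_borel_of sets.top] em[OF sets.top Some_image_borel_of]
        unfolding A.adm_def B.adm_def by (simp add: \<rho>e_def del: space_borel_of)
    qed
    have "A.kcost p \<rho>v = B.kcost p \<pi>v"
    proof -
      have "\<rho>v \<Otimes>\<^sub>M \<rho>v = distr (\<pi>v \<Otimes>\<^sub>M \<pi>v) ((mu_of P \<Otimes>\<^sub>M mu_of P') \<Otimes>\<^sub>M (mu_of P \<Otimes>\<^sub>M mu_of P')) (\<lambda>(x, y). ((snd x, fst x), (snd y, fst y)))"
        unfolding \<rho>v_def
        by (rule pair_measure_distr) (auto intro!: finite_measure.sigma_finite_measure V.finite_measure_distr)
      then show ?thesis
        unfolding A.kcost_def B.kcost_def
        by (simp add: nn_integral_distr case_prod_beta abs_minus_commute)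
    qed
    moreover have "(\<integral>\<^sup>+ z. A.Phi p \<rho>v z \<partial>\<rho>e) = (\<integral>\<^sup>+ z. B.Phi p \<pi>v z \<partial>\<pi>e)"
    proof -
      have [measurable]: "A.Phi p \<rho>v \<in> borel_measurable (Yb P \<Otimes>\<^sub>M Yb P')"
        using A.couplingsD[OF cv] by (intro A.Phi_measurable)
      have "(\<integral>\<^sup>+ z. A.Phi p \<rho>v z \<partial>\<rho>e) = (\<integral>\<^sup>+ z. A.Phi p \<rho>v (snd z, fst z) \<partial>\<pi>e)"
        unfolding \<rho>e_def by (rule nn_integral_distr) measurable
      also have "\<dots> = (\<integral>\<^sup>+ z. B.Phi p \<pi>v z \<partial>\<pi>e)"
      proof (rule nn_integral_cong)
        fix z assume z: "z \<in> space \<pi>e"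
        then have "(snd z, fst z) \<in> space (Yb P \<Otimes>\<^sub>M Yb P')" by (auto simp: spe space_pair_measure)
        then have "(\<lambda>x. (x, (snd z, fst z))) \<in> mu_of P \<Otimes>\<^sub>M mu_of P' \<rightarrow>\<^sub>M (mu_of P \<Otimes>\<^sub>M mu_of P') \<Otimes>\<^sub>M (Yb P \<Otimes>\<^sub>M Yb P')"
          by measurable
        from measurable_compose[OF this A.omega_diff_measurable]
        have "(\<lambda>x. ennreal (\<bar>omega_bar P (fst x) (snd z) - omega_bar P' (snd x) (fst z)\<bar> powr p)) \<in> borel_measurable (mu_of P \<Otimes>\<^sub>M mu_of P')"
          by simp
        then show "A.Phi p \<rho>v (snd z, fst z) = B.Phi p \<pi>v z"
          unfolding A.Phi_def B.Phi_def \<rho>v_def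
          by (subst nn_integral_distr) (simp_all add: lam_dist_commute abs_minus_commute)
      qed
      finally show ?thesis .
    qed
    ultimately have "TpOT_cost p P P' \<rho>v \<rho>e = TpOT_cost p P' P \<pi>v \<pi>e"
      using A.cost_eq[OF cv ce] B.cost_eq[OF v e] by simp
    then show ?thesis using A.d_TpOT_le[OF cv ce, of p] by argo
  qed
  then show ?thesis unfolding d_TpOT_def[of p P' P] by (intro INF_greatest) auto
qed

lemma d_TpOT_commute:
  "net P \<Longrightarrow> net P' \<Longrightarrow> 1 \<le> p \<Longrightarrow> d_TpOT p P P' = d_TpOT p P' P"
  by (intro antisym d_TpOT_commute_le)

lemma d_TpOT_triangle:
  assumes n: "net P1" "net P2" "net P3" and p: "1 \<le> p"
  shows "d_TpOT p P1 P3 \<le> d_TpOT p P1 P2 + d_TpOT p P2 P3"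
proof -
  interpret A: net2 P1 P2 using n by (simp add: net2_def)
  interpret B: net2 P2 P3 using n by (simp add: net2_def)
  interpret C: net2 P1 P3 using n by (simp add: net2_def)
  \<comment> \<open>Strict upper bounds \<open>a\<close> and \<open>b\<close> are positive even when
    a distance is 0, so that \<open>s\<close> below lies strictly between 0 and 1.\<close>
  have key: "d_TpOT p P1 P3 \<le> ennreal (a + b)"
    if a: "0 < a" "d_TpOT p P1 P2 < ennreal a" and b: "0 < b" "d_TpOT p P2 P3 < ennreal b" for a b
  proof -
    have p0: "0 < p" using p by simp
    obtain v12 e12 where 12: "v12 \<in> couplings P1 P2" "A.adm e12" "TpOT_cost p P1 P2 v12 e12 \<le> ennreal (a powr p)"
      using d_TpOT_less_obtain[OF n(1,2) p0 a] .
    obtain v23 e23 where 23: "v23 \<in> couplings P2 P3" "B.adm e23" "TpOT_cost p P2 P3 v23 e23 \<le> ennreal (b powr p)"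
      using d_TpOT_less_obtain[OF n(2,3) p0 b] .
    note s12[measurable_cong] = A.couplingsD(1)[OF 12(1)] and s23[measurable_cong] = B.couplingsD(1)[OF 23(1)]
    obtain f1 g1 where c1: "coded (mu_of P1) f1 g1" by (rule A.P.coded_mu)
    obtain f3 g3 where c3: "coded (mu_of P3) f3 g3" by (rule B.P'.coded_mu)
    interpret M2: prob_space "mu_of P2" by (rule A.P'.prob_mu)
    interpret U: prob_space unif by (rule prob_space_unif)
    interpret UU: pair_prob_space unif unif ..
    define \<Omega> where "\<Omega> = mu_of P2 \<Otimes>\<^sub>M (unif \<Otimes>\<^sub>M unif)"
    interpret MU: pair_prob_space "mu_of P2" "unif \<Otimes>\<^sub>M unif" ..
    interpret O: prob_space \<Omega> unfolding \<Omega>_def by (rule MU.prob_space_axioms)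
    obtain h1 h3 where h[measurable]: "h1 \<in> \<Omega> \<rightarrow>\<^sub>M mu_of P1" "h3 \<in> \<Omega> \<rightarrow>\<^sub>M mu_of P3"
      and l12: "distr \<Omega> (mu_of P1 \<Otimes>\<^sub>M mu_of P2) (\<lambda>z. (h1 z, fst z)) = v12"
      and l23: "distr \<Omega> (mu_of P2 \<Otimes>\<^sub>M mu_of P3) (\<lambda>z. (fst z, h3 z)) = v23"
      unfolding \<Omega>_def
      by (rule gluing[OF c1 c3 M2.sigma_finite_measure_axioms s12 A.couplingsD(4)[OF 12(1)] s23 B.couplingsD(3)[OF 23(1)]]) blast
    have h2[measurable]: "fst \<in> \<Omega> \<rightarrow>\<^sub>M mu_of P2" unfolding \<Omega>_def by measurable
    define v13 where "v13 = distr \<Omega> (mu_of P1 \<Otimes>\<^sub>M mu_of P3) (\<lambda>z. (h1 z, h3 z))"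
    have v13: "v13 \<in> couplings P1 P3"
    proof (rule C.couplingsI)
      show "prob_space v13" unfolding v13_def by (rule O.prob_space_distr) measurable
      have "distr v13 (mu_of P1) fst = distr v12 (mu_of P1) fst"
        unfolding v13_def l12[symmetric] by (subst (1 2) distr_distr) (simp_all add: comp_def)
      then show "distr v13 (mu_of P1) fst = mu_of P1" using A.couplingsD(3)[OF 12(1)] by simp
      have "distr v13 (mu_of P3) snd = distr v23 (mu_of P3) snd"
        unfolding v13_def l23[symmetric] by (subst (1 2) distr_distr) (simp_all add: comp_def)
      then show "distr v13 (mu_of P3) snd = mu_of P3" using B.couplingsD(4)[OF 23(1)] by simp
    qed (simp add: v13_def)
    \<comment> \<open>A minimizer of K a^p + L b^p, with \<open>K\<close> and \<open>L\<close> as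
      defined next; the minimal value is (a + b)^p.\<close>
    define s where "s = a / (a + b)"
    have s: "0 < s" "s < 1" using a b by (auto simp: s_def)
    define K where "K = s powr (1 - p)"
    define L where "L = (1 - s) powr (1 - p)"
    have KL: "0 \<le> K" "0 \<le> L" by (auto simp: K_def L_def)
    have tri: "ennreal (\<bar>x - z\<bar> powr p) \<le> ennreal K * ennreal (\<bar>x - y\<bar> powr p) + ennreal L * ennreal (\<bar>y - z\<bar> powr p)" for x y z :: real
    proof -
      have "\<bar>x - z\<bar> powr p \<le> K * \<bar>x - y\<bar> powr p + L * \<bar>y - z\<bar> powr p"
        using powr_add_le[OF p s, of "x - y" "y - z"] by (simp add: K_def L_def)
      then show ?thesis using KL by (simp flip: ennreal_mult ennreal_plus add: ennreal_leI)
    qed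
    have k: "C.kcost p v13 \<le> ennreal K * A.kcost p v12 + ennreal L * B.kcost p v23"
    proof -
      have pd: "distr \<Omega> S f \<Otimes>\<^sub>M distr \<Omega> S f = distr (\<Omega> \<Otimes>\<^sub>M \<Omega>) (S \<Otimes>\<^sub>M S) (\<lambda>(x, y). (f x, f y))"
        if [measurable]: "f \<in> \<Omega> \<rightarrow>\<^sub>M S" for f :: "_ \<Rightarrow> 'z" and S
        by (rule pair_measure_distr) (auto intro!: finite_measure.sigma_finite_measure O.finite_measure_distr)
      \<comment> \<open>All three vertex costs become integrals over the same space, so that the
        pointwise inequality can be integrated.\<close>
      have k13: "C.kcost p v13 = (\<integral>\<^sup>+ w. ennreal (\<bar>k_of P1 (h1 (fst w)) (h1 (snd w)) - k_of P3 (h3 (fst w)) (h3 (snd w))\<bar> powr p) \<partial>(\<Omega> \<Otimes>\<^sub>M \<Omega>))"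
        unfolding C.kcost_def v13_def by (simp add: pd nn_integral_distr case_prod_beta)
      have k12: "A.kcost p v12 = (\<integral>\<^sup>+ w. ennreal (\<bar>k_of P1 (h1 (fst w)) (h1 (snd w)) - k_of P2 (fst (fst w)) (fst (snd w))\<bar> powr p) \<partial>(\<Omega> \<Otimes>\<^sub>M \<Omega>))"
        unfolding A.kcost_def l12[symmetric] by (simp add: pd nn_integral_distr case_prod_beta)
      have k23: "B.kcost p v23 = (\<integral>\<^sup>+ w. ennreal (\<bar>k_of P2 (fst (fst w)) (fst (snd w)) - k_of P3 (h3 (fst w)) (h3 (snd w))\<bar> powr p) \<partial>(\<Omega> \<Otimes>\<^sub>M \<Omega>))"
        unfolding B.kcost_def l23[symmetric] by (simp add: pd nn_integral_distr case_prod_beta)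
      have [measurable]: "(\<lambda>w. k_of P1 (h1 (fst w)) (h1 (snd w))) \<in> borel_measurable (\<Omega> \<Otimes>\<^sub>M \<Omega>)"
        "(\<lambda>w. k_of P2 (fst (fst w)) (fst (snd w))) \<in> borel_measurable (\<Omega> \<Otimes>\<^sub>M \<Omega>)"
        "(\<lambda>w. k_of P3 (h3 (fst w)) (h3 (snd w))) \<in> borel_measurable (\<Omega> \<Otimes>\<^sub>M \<Omega>)"
        using measurable_compose[OF _ A.P.k_measurable, of "\<lambda>w. (h1 (fst w), h1 (snd w))" "\<Omega> \<Otimes>\<^sub>M \<Omega>"]
          measurable_compose[OF _ A.P'.k_measurable, of "\<lambda>w. (fst (fst w), fst (snd w))" "\<Omega> \<Otimes>\<^sub>M \<Omega>"]
          measurable_compose[OF _ B.P'.k_measurable, of "\<lambda>w. (h3 (fst w), h3 (snd w))" "\<Omega> \<Otimes>\<^sub>M \<Omega>"] by simp_all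
      show ?thesis
        unfolding k13 k12 k23
        by (subst (1 2) nn_integral_cmult[symmetric], measurable, subst nn_integral_add[symmetric])
          (auto intro!: nn_integral_mono tri)
    qed
    obtain e13 where e13: "C.adm e13" and e13_le:
      "\<And>F12 F23 F13 :: _ \<Rightarrow> ennreal.
       F12 \<in> borel_measurable (Yb P1 \<Otimes>\<^sub>M Yb P2) \<Longrightarrow> F23 \<in> borel_measurable (Yb P2 \<Otimes>\<^sub>M Yb P3) \<Longrightarrow>
       F13 \<in> borel_measurable (Yb P1 \<Otimes>\<^sub>M Yb P3) \<Longrightarrow> F12 (None, None) = 0 \<Longrightarrow> F23 (None, None) = 0 \<Longrightarrow>
       (\<And>y1 y2 y3. y1 \<in> space (Yb P1) \<Longrightarrow> y2 \<in> space (Yb P2) \<Longrightarrow> y3 \<in> space (Yb P3) \<Longrightarrow>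
         (y2 = None \<Longrightarrow> y1 = None \<or> y3 = None) \<Longrightarrow> F13 (y1, y3) \<le> F12 (y1, y2) + F23 (y2, y3)) \<Longrightarrow>
       (\<integral>\<^sup>+ z. F13 z \<partial>e13) \<le> (\<integral>\<^sup>+ z. F12 z \<partial>e12) + (\<integral>\<^sup>+ z. F23 z \<partial>e23)"
      by (rule adm_gluing[OF n 12(2) 23(2)]) blast
    have e: "(\<integral>\<^sup>+ z. C.Phi p v13 z \<partial>e13) \<le> ennreal K * (\<integral>\<^sup>+ z. A.Phi p v12 z \<partial>e12) + ennreal L * (\<integral>\<^sup>+ z. B.Phi p v23 z \<partial>e23)"
    proof -
      have m12[measurable]: "A.Phi p v12 \<in> borel_measurable (Yb P1 \<Otimes>\<^sub>M Yb P2)"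
        using A.couplingsD[OF 12(1)] by (intro A.Phi_measurable)
      have m23[measurable]: "B.Phi p v23 \<in> borel_measurable (Yb P2 \<Otimes>\<^sub>M Yb P3)"
        using B.couplingsD[OF 23(1)] by (intro B.Phi_measurable)
      have m13[measurable]: "C.Phi p v13 \<in> borel_measurable (Yb P1 \<Otimes>\<^sub>M Yb P3)"
        using C.couplingsD[OF v13] by (intro C.Phi_measurable)
      have "(\<integral>\<^sup>+ z. C.Phi p v13 z \<partial>e13) \<le> (\<integral>\<^sup>+ z. ennreal K * A.Phi p v12 z \<partial>e12) + (\<integral>\<^sup>+ z. ennreal L * B.Phi p v23 z \<partial>e23)"
      \<comment> \<open>For fixed edges the \<open>omega\<close> terms are again integrals over
        \<Omega>; adding the ground distances gives the pointwise condition of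
        \<open>adm_gluing\<close> for the integrands multiplied by \<open>K\<close> and
        \<open>L\<close>.\<close>
      proof (rule e13_le)
        fix y1 y2 y3 assume y: "y1 \<in> space (Yb P1)" "y2 \<in> space (Yb P2)" "y3 \<in> space (Yb P3)"
          and None: "y2 = None \<Longrightarrow> y1 = None \<or> y3 = None"
        have "lam_dist p (iota_bar P1 y1) (iota_bar P3 y3) powr p
          \<le> K * lam_dist p (iota_bar P1 y1) (iota_bar P2 y2) powr p + L * lam_dist p (iota_bar P2 y2) (iota_bar P3 y3) powr p"
          unfolding K_def L_def using None by (intro lam_dist_triangle_powr p s) (auto simp: iota_bar_def)
        then have lam: "ennreal (lam_dist p (iota_bar P1 y1) (iota_bar P3 y3) powr p)
          \<le> ennreal K * ennreal (lam_dist p (iota_bar P1 y1) (iota_bar P2 y2) powr p) + ennreal L * ennreal (lam_dist p (iota_bar P2 y2) (iota_bar P3 y3) powr p)"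
          using KL by (simp flip: ennreal_mult ennreal_plus add: ennreal_leI)
        have o[measurable]: "(\<lambda>x. omega_bar P1 x y1) \<in> borel_measurable (mu_of P1)"
          "(\<lambda>x. omega_bar P2 x y2) \<in> borel_measurable (mu_of P2)"
          "(\<lambda>x. omega_bar P3 x y3) \<in> borel_measurable (mu_of P3)"
          using measurable_compose[OF measurable_Pair2'[OF y(1)] A.P.omega_bar_measurable]
            measurable_compose[OF measurable_Pair2'[OF y(2)] A.P'.omega_bar_measurable]
            measurable_compose[OF measurable_Pair2'[OF y(3)] B.P'.omega_bar_measurable] by simp_all
        let ?f = "\<lambda>x y. ennreal (\<bar>x - y\<bar> powr p)"
        have o13: "(\<integral>\<^sup>+ x. ?f (omega_bar P1 (fst x) y1) (omega_bar P3 (snd x) y3) \<partial>v13) = (\<integral>\<^sup>+ z. ?f (omega_bar P1 (h1 z) y1) (omega_bar P3 (h3 z) y3) \<partial>\<Omega>)"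
          unfolding v13_def by (subst nn_integral_distr) simp_all
        have o12: "(\<integral>\<^sup>+ x. ?f (omega_bar P1 (fst x) y1) (omega_bar P2 (snd x) y2) \<partial>v12) = (\<integral>\<^sup>+ z. ?f (omega_bar P1 (h1 z) y1) (omega_bar P2 (fst z) y2) \<partial>\<Omega>)"
          unfolding l12[symmetric] by (subst nn_integral_distr) simp_all
        have o23: "(\<integral>\<^sup>+ x. ?f (omega_bar P2 (fst x) y2) (omega_bar P3 (snd x) y3) \<partial>v23) = (\<integral>\<^sup>+ z. ?f (omega_bar P2 (fst z) y2) (omega_bar P3 (h3 z) y3) \<partial>\<Omega>)"
          unfolding l23[symmetric] by (subst nn_integral_distr) simp_all
        have "(\<integral>\<^sup>+ z. ?f (omega_bar P1 (h1 z) y1) (omega_bar P3 (h3 z) y3) \<partial>\<Omega>)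
          \<le> (\<integral>\<^sup>+ z. ennreal K * ?f (omega_bar P1 (h1 z) y1) (omega_bar P2 (fst z) y2) + ennreal L * ?f (omega_bar P2 (fst z) y2) (omega_bar P3 (h3 z) y3) \<partial>\<Omega>)"
          by (intro nn_integral_mono tri)
        also have "\<dots> = (\<integral>\<^sup>+ z. ennreal K * ?f (omega_bar P1 (h1 z) y1) (omega_bar P2 (fst z) y2) \<partial>\<Omega>) + (\<integral>\<^sup>+ z. ennreal L * ?f (omega_bar P2 (fst z) y2) (omega_bar P3 (h3 z) y3) \<partial>\<Omega>)"
          by (rule nn_integral_add) measurable
        also have "\<dots> = ennreal K * (\<integral>\<^sup>+ z. ?f (omega_bar P1 (h1 z) y1) (omega_bar P2 (fst z) y2) \<partial>\<Omega>) + ennreal L * (\<integral>\<^sup>+ z. ?f (omega_bar P2 (fst z) y2) (omega_bar P3 (h3 z) y3) \<partial>\<Omega>)"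
          by (simp add: nn_integral_cmult)
        finally have om: "(\<integral>\<^sup>+ z. ?f (omega_bar P1 (h1 z) y1) (omega_bar P3 (h3 z) y3) \<partial>\<Omega>)
          \<le> ennreal K * (\<integral>\<^sup>+ z. ?f (omega_bar P1 (h1 z) y1) (omega_bar P2 (fst z) y2) \<partial>\<Omega>) + ennreal L * (\<integral>\<^sup>+ z. ?f (omega_bar P2 (fst z) y2) (omega_bar P3 (h3 z) y3) \<partial>\<Omega>)" .
        show "C.Phi p v13 (y1, y3) \<le> ennreal K * A.Phi p v12 (y1, y2) + ennreal L * B.Phi p v23 (y2, y3)"
          unfolding A.Phi_def B.Phi_def C.Phi_def fst_conv snd_conv o12 o13 o23
          using add_mono[OF lam om] by (simp add: distrib_left ac_simps)
      qed (simp_all add: A.Phi_None B.Phi_None)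
      also have "\<dots> = ennreal K * (\<integral>\<^sup>+ z. A.Phi p v12 z \<partial>e12) + ennreal L * (\<integral>\<^sup>+ z. B.Phi p v23 z \<partial>e23)"
        using 12(2) 23(2) m12 m23 unfolding A.adm_def B.adm_def
        by (subst (1 2) nn_integral_cmult) (simp_all cong: measurable_cong_sets)
      finally show ?thesis .
    qed
    have "TpOT_cost p P1 P3 v13 e13 \<le> ennreal K * TpOT_cost p P1 P2 v12 e12 + ennreal L * TpOT_cost p P2 P3 v23 e23"
      unfolding C.cost_eq[OF v13 e13] A.cost_eq[OF 12(1,2)] B.cost_eq[OF 23(1,2)]
      using add_mono[OF e k] by (simp add: distrib_left ac_simps)
    also have "\<dots> \<le> ennreal K * ennreal (a powr p) + ennreal L * ennreal (b powr p)"
      by (intro add_mono mult_left_mono 12 23) auto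
    also have "\<dots> = ennreal (K * a powr p + L * b powr p)"
      using KL by (simp add: ennreal_mult ennreal_plus)
    also have "K * a powr p + L * b powr p = (a + b) powr p"
    proof -
      have c: "(x / c) powr (1 - p) * x powr p = x * c powr (p - 1)" if "0 < x" "0 < c" for x c :: real
      proof -
        have "(x / c) powr (1 - p) * x powr p = (x powr (1 - p) * x powr p) * (1 / c powr (1 - p))"
          using that by (simp add: powr_divide)
        also have "x powr (1 - p) * x powr p = x" using that by (simp flip: powr_add)
        also have "1 / c powr (1 - p) = c powr (p - 1)" using powr_minus_divide[of c "1 - p"] by simp
        finally show ?thesis .
      qed
      have "1 - s = b / (a + b)" using a b by (simp add: s_def field_simps)
      then have "K * a powr p + L * b powr p = (a + b) powr 1 * (a + b) powr (p - 1)"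
        using c[of a "a + b"] c[of b "a + b"] a b by (simp add: K_def L_def s_def distrib_right)
      also have "\<dots> = (a + b) powr p" unfolding powr_add[symmetric] by simp
      finally show ?thesis .
    qed
    finally have "TpOT_cost p P1 P3 v13 e13 \<le> ennreal ((a + b) powr p)" .
    then have "ennreal_root p (TpOT_cost p P1 P3 v13 e13) \<le> ennreal (a + b)"
      using a b p0 by (intro ennreal_root_le) auto
    then show ?thesis using C.d_TpOT_le[OF v13 e13, of p] by (rule order_trans[rotated])
  qed
  show ?thesis
  proof (cases "d_TpOT p P1 P2 = \<infinity> \<or> d_TpOT p P2 P3 = \<infinity>")
    case False
    then obtain x y where x: "d_TpOT p P1 P2 = ennreal x" "0 \<le> x" and y: "d_TpOT p P2 P3 = ennreal y" "0 \<le> y"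
      by (metis ennreal_cases infinity_ennreal_def)
    \<comment> \<open>Half of \<open>e\<close> is added to each distance, which also makes both
      bounds positive.\<close>
    have le: "d_TpOT p P1 P3 \<le> ennreal (x + y) + ennreal e" if e: "0 < e" for e
    proof -
      have "d_TpOT p P1 P3 \<le> ennreal ((x + e / 2) + (y + e / 2))"
        using x y e by (intro key) (auto simp: ennreal_less_iff)
      also have "\<dots> = ennreal (x + y) + ennreal e" using x y e by (simp flip: ennreal_plus)
      finally show ?thesis .
    qed
    have "d_TpOT p P1 P3 \<le> ennreal (x + y)" by (rule ennreal_le_epsilon) (rule le)
    then show ?thesis using x y by (simp add: ennreal_plus)
  qed auto
qed

subsection \<open>Weak isomorphisms\<close>

text \<open>The images of the measures of \<open>Q\<close> under both weak isomorphisms at once are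
  couplings without mass on the diagonal, and along them all integrands vanish almost
  everywhere.\<close>

lemma weak_iso_d_zero:
  assumes n: "net Q" "net P" "net P'" and p: "1 \<le> p"
    and w: "is_weak_iso Q P \<phi> \<psi>" and w': "is_weak_iso Q P' \<phi>' \<psi>'"
  shows "d_TpOT p P P' = 0"
proof -
  interpret Q: net Q by fact
  interpret A: net2 P P' using n by (simp add: net2_def)
  interpret MQ: prob_space "mu_of Q" by (rule Q.prob_mu)
  interpret NQ: sigma_finite_measure "nu_of Q" by (rule Q.sigma_finite_nu)
  have m[measurable]: "\<phi> \<in> mu_of Q \<rightarrow>\<^sub>M mu_of P" "\<psi> \<in> nu_of Q \<rightarrow>\<^sub>M nu_of P"
    "\<phi>' \<in> mu_of Q \<rightarrow>\<^sub>M mu_of P'" "\<psi>' \<in> nu_of Q \<rightarrow>\<^sub>M nu_of P'"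
    and d: "distr (mu_of Q) (mu_of P) \<phi> = mu_of P" "distr (nu_of Q) (nu_of P) \<psi> = nu_of P"
    "distr (mu_of Q) (mu_of P') \<phi>' = mu_of P'" "distr (nu_of Q) (nu_of P') \<psi>' = nu_of P'"
    and io: "AE y in nu_of Q. iota_of Q y = iota_of P (\<psi> y)" "AE y in nu_of Q. iota_of Q y = iota_of P' (\<psi>' y)"
    and om: "AE z in mu_of Q \<Otimes>\<^sub>M nu_of Q. omega_of Q (fst z) (snd z) = omega_of P (\<phi> (fst z)) (\<psi> (snd z))"
      "AE z in mu_of Q \<Otimes>\<^sub>M nu_of Q. omega_of Q (fst z) (snd z) = omega_of P' (\<phi>' (fst z)) (\<psi>' (snd z))"
    and k: "AE z in mu_of Q \<Otimes>\<^sub>M mu_of Q. k_of Q (fst z) (snd z) = k_of P (\<phi> (fst z)) (\<phi> (snd z))"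
      "AE z in mu_of Q \<Otimes>\<^sub>M mu_of Q. k_of Q (fst z) (snd z) = k_of P' (\<phi>' (fst z)) (\<phi>' (snd z))"
    using w w' unfolding is_weak_iso_def measure_preserving_map_def case_prod_beta by auto
  define f where "f x = (\<phi> x, \<phi>' x)" for x
  define g where "g y = (Some (\<psi> y), Some (\<psi>' y))" for y
  have fm[measurable]: "f \<in> mu_of Q \<rightarrow>\<^sub>M mu_of P \<Otimes>\<^sub>M mu_of P'" unfolding f_def by measurable
  have Som: "Some \<in> nu_of P \<rightarrow>\<^sub>M Yb P" "Some \<in> nu_of P' \<rightarrow>\<^sub>M Yb P'"
    using continuous_map_measurable[OF continuous_map_Some, of "Y_of P"] continuous_map_measurable[OF continuous_map_Some, of "Y_of P'"]
    by (simp_all add: A.P.sets_nu A.P'.sets_nu cong: measurable_cong_sets)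
  note [measurable] = Som
  have gm[measurable]: "g \<in> nu_of Q \<rightarrow>\<^sub>M Yb P \<Otimes>\<^sub>M Yb P'" unfolding g_def by measurable
  define v where "v = distr (mu_of Q) (mu_of P \<Otimes>\<^sub>M mu_of P') f"
  define e where "e = distr (nu_of Q) (Yb P \<Otimes>\<^sub>M Yb P') g"
  have v: "v \<in> couplings P P'"
  proof (rule A.couplingsI)
    show "prob_space v" unfolding v_def by (rule MQ.prob_space_distr) measurable
    show "distr v (mu_of P) fst = mu_of P" "distr v (mu_of P') snd = mu_of P'"
      unfolding v_def using d by (subst distr_distr; simp add: comp_def f_def)+
  qed (simp add: v_def)
  have spg: "\<psi> y \<in> topspace (Y_of P)" "\<psi>' y \<in> topspace (Y_of P')" if "y \<in> space (nu_of Q)" for y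
    using measurable_space[OF m(2) that] measurable_space[OF m(4) that] A.P.space_nu A.P'.space_nu by auto
  have e: "A.adm e"
    unfolding A.adm_def
  proof (intro conjI ballI)
    show "sets e = sets (Yb P \<Otimes>\<^sub>M Yb P')" by (simp add: e_def)
    show "emeasure e {(None, None)} = 0"
    proof -
      have "g -` ({None} \<times> {None}) \<inter> space (nu_of Q) = {}" by (auto simp: g_def)
      moreover have "{None} \<times> {None} \<in> sets (Yb P \<Otimes>\<^sub>M Yb P')" by (intro pair_measureI None_borel_of)
      ultimately have "emeasure e ({None} \<times> {None}) = 0" unfolding e_def by (subst emeasure_distr) simp_all
      then show ?thesis by simp
    qed
  next
    fix B assume B: "B \<in> sets (borel_of (Y_of P))"
    have "g -` (Some ` B \<times> space (Yb P')) \<inter> space (nu_of Q) = \<psi> -` B \<inter> space (nu_of Q)"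
      using spg by (auto simp: g_def topspace_bar)
    moreover have "Some ` B \<times> space (Yb P') \<in> sets (Yb P \<Otimes>\<^sub>M Yb P')" by (intro pair_measureI sets.top Some_image_borel_of B)
    ultimately have "emeasure e (Some ` B \<times> space (Yb P')) = emeasure (nu_of Q) (\<psi> -` B \<inter> space (nu_of Q))"
      unfolding e_def by (subst emeasure_distr) simp_all
    also have "\<dots> = emeasure (distr (nu_of Q) (nu_of P) \<psi>) B"
      using B A.P.sets_nu by (subst emeasure_distr) simp_all
    finally show "emeasure e (Some ` B \<times> space (Yb P')) = emeasure (nu_of P) B" by (simp add: d)
  next
    fix B assume B: "B \<in> sets (borel_of (Y_of P'))"
    have "g -` (space (Yb P) \<times> Some ` B) \<inter> space (nu_of Q) = \<psi>' -` B \<inter> space (nu_of Q)"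
      using spg by (auto simp: g_def topspace_bar)
    moreover have "space (Yb P) \<times> Some ` B \<in> sets (Yb P \<Otimes>\<^sub>M Yb P')" by (intro pair_measureI sets.top Some_image_borel_of B)
    ultimately have "emeasure e (space (Yb P) \<times> Some ` B) = emeasure (nu_of Q) (\<psi>' -` B \<inter> space (nu_of Q))"
      unfolding e_def by (subst emeasure_distr) simp_all
    also have "\<dots> = emeasure (distr (nu_of Q) (nu_of P') \<psi>') B"
      using B A.P'.sets_nu by (subst emeasure_distr) simp_all
    finally show "emeasure e (space (Yb P) \<times> Some ` B) = emeasure (nu_of P') B" by (simp add: d)
  qed
  have c1: "(\<integral>\<^sup>+ z. ennreal (lam_dist p (iota_bar P (fst z)) (iota_bar P' (snd z)) powr p) \<partial>e) = 0"
  proof -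
    have "(\<integral>\<^sup>+ z. ennreal (lam_dist p (iota_bar P (fst z)) (iota_bar P' (snd z)) powr p) \<partial>e)
      = (\<integral>\<^sup>+ y. ennreal (lam_dist p (iota_bar P (fst (g y))) (iota_bar P' (snd (g y))) powr p) \<partial>nu_of Q)"
      unfolding e_def by (rule nn_integral_distr) measurable
    also have "\<dots> = (\<integral>\<^sup>+ y. 0 \<partial>nu_of Q)"
    proof (rule nn_integral_cong_AE)
      show "AE y in nu_of Q. ennreal (lam_dist p (iota_bar P (fst (g y))) (iota_bar P' (snd (g y))) powr p) = 0"
        using io by eventually_elim (simp add: g_def iota_bar_def lp_norm_def)
    qed
    finally show ?thesis by simp
  qed
  have c2: "A.kcost p v = 0"
  proof -
    have "v \<Otimes>\<^sub>M v = distr (mu_of Q \<Otimes>\<^sub>M mu_of Q) ((mu_of P \<Otimes>\<^sub>M mu_of P') \<Otimes>\<^sub>M (mu_of P \<Otimes>\<^sub>M mu_of P')) (\<lambda>(x, y). (f x, f y))"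
      unfolding v_def by (rule pair_measure_distr) (auto intro!: finite_measure.sigma_finite_measure MQ.finite_measure_distr)
    then have "A.kcost p v = (\<integral>\<^sup>+ w. ennreal (\<bar>k_of P (fst (f (fst w))) (fst (f (snd w))) - k_of P' (snd (f (fst w))) (snd (f (snd w)))\<bar> powr p)
        \<partial>(mu_of Q \<Otimes>\<^sub>M mu_of Q))"
      unfolding A.kcost_def by (simp add: nn_integral_distr case_prod_beta)
    also have "\<dots> = (\<integral>\<^sup>+ w. 0 \<partial>(mu_of Q \<Otimes>\<^sub>M mu_of Q))"
    proof (rule nn_integral_cong_AE)
      show "AE w in mu_of Q \<Otimes>\<^sub>M mu_of Q. ennreal (\<bar>k_of P (fst (f (fst w))) (fst (f (snd w))) - k_of P' (snd (f (fst w))) (snd (f (snd w)))\<bar> powr p) = 0"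
        using k by eventually_elim (simp add: f_def)
    qed
    finally show ?thesis by simp
  qed
  have c3: "(\<integral>\<^sup>+ w. ennreal (\<bar>omega_bar P (fst (fst w)) (fst (snd w)) - omega_bar P' (snd (fst w)) (snd (snd w))\<bar> powr p) \<partial>(v \<Otimes>\<^sub>M e)) = 0"
  proof -
    have "v \<Otimes>\<^sub>M e = distr (mu_of Q \<Otimes>\<^sub>M nu_of Q) ((mu_of P \<Otimes>\<^sub>M mu_of P') \<Otimes>\<^sub>M (Yb P \<Otimes>\<^sub>M Yb P')) (\<lambda>(x, y). (f x, g y))"
      using A.adm_sigma_finite[OF e] unfolding v_def e_def by (intro pair_measure_distr) measurable
    then have "(\<integral>\<^sup>+ w. ennreal (\<bar>omega_bar P (fst (fst w)) (fst (snd w)) - omega_bar P' (snd (fst w)) (snd (snd w))\<bar> powr p) \<partial>(v \<Otimes>\<^sub>M e))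
      = (\<integral>\<^sup>+ w. ennreal (\<bar>omega_bar P (fst (f (fst w))) (fst (g (snd w))) - omega_bar P' (snd (f (fst w))) (snd (g (snd w)))\<bar> powr p) \<partial>(mu_of Q \<Otimes>\<^sub>M nu_of Q))"
      by (simp add: nn_integral_distr case_prod_beta)
    also have "\<dots> = (\<integral>\<^sup>+ w. 0 \<partial>(mu_of Q \<Otimes>\<^sub>M nu_of Q))"
    proof (rule nn_integral_cong_AE)
      show "AE w in mu_of Q \<Otimes>\<^sub>M nu_of Q. ennreal (\<bar>omega_bar P (fst (f (fst w))) (fst (g (snd w))) - omega_bar P' (snd (f (fst w))) (snd (g (snd w)))\<bar> powr p) = 0"
        using om by eventually_elim (simp add: f_def g_def omega_bar_def)
    qed
    finally show ?thesis by simp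
  qed
  have "TpOT_cost p P P' v e = 0"
    using c1 c2 c3 unfolding TpOT_cost_def A.kcost_def case_prod_beta by simp
  then have "d_TpOT p P P' \<le> ennreal_root p 0" using A.d_TpOT_le[OF v e, of p] by simp
  then show ?thesis by (simp add: ennreal_root_def)
qed

text \<open>A code is a set of naturals, and these sets biject with the reals. The map is merely a
  labelling; the topology is transported along it later.\<close>

lemma polish_inj_real:
  assumes "polish_topology T"
  obtains j :: "'a \<Rightarrow> real" where "inj_on j (topspace T)"
proof (cases "topspace T = {}")
  case True
  then show ?thesis using that[of "\<lambda>_. 0"] by simp
next
  case False
  obtain f g where c: "coded (borel_of T) f g" using polish_coded[OF assms False] .
  obtain b :: "nat set \<Rightarrow> real" where b: "bij b"
    using nat_sets_eqpoll_reals unfolding eqpoll_def by blast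
  have "inj_on (\<lambda>x. b {n. f x n}) (topspace T)"
  proof (rule inj_onI)
    fix x y assume xy: "x \<in> topspace T" "y \<in> topspace T" "b {n. f x n} = b {n. f y n}"
    then have "{n. f x n} = {n. f y n}" using b by (meson bij_is_inj injD)
    then have "f x = f y" by (auto simp: set_eq_iff)
    then show "x = y" using c xy unfolding coded_def by (metis space_borel_of)
  qed
  then show ?thesis using that by blast
qed

text \<open>The intermediate network of a weak isomorphism is fully supported and lives on the reals.\<close>

lemma real_copy_of_support:
  assumes T: "polish_topology T" and sm: "sets m = sets (borel_of T)" and sf: "sigma_finite_measure m"
  obtains R :: "real topology" and e r where "polish_topology R" "continuous_map R T e"
    "sets r = sets (borel_of R)" "fully_supported R r" "distr r (borel_of T) e = m" "sigma_finite_measure r"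
    "locally_compact_space T \<Longrightarrow> locally_compact_space R"
proof -
  have spm: "space m = topspace T" using sets_eq_imp_space_eq[OF sm] by simp
  obtain \<B> where B: "countable \<B>" "\<And>V. V \<in> \<B> \<Longrightarrow> openin T V"
    "\<And>U x. openin T U \<Longrightarrow> x \<in> U \<Longrightarrow> \<exists>V\<in>\<B>. x \<in> V \<and> V \<subseteq> U"
    using polish_second_countable[OF T] unfolding second_countable_def by metis
  \<comment> \<open>The complement of the support: it is null because there are countably many basic
    open sets.\<close>
  define N where "N = \<Union> {V \<in> \<B>. emeasure m V = 0}"
  define S where "S = topspace T - N"
  have Nopen: "openin T N" unfolding N_def using B(2) by auto
  have "N \<in> null_sets m"
  proof -
    have "(\<Union>V\<in>{V \<in> \<B>. emeasure m V = 0}. V) \<in> null_sets m"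
      using B(1,2) sm openin_borel_of by (intro null_sets_UN') (auto simp: null_sets_def)
    then show ?thesis by (simp add: N_def)
  qed
  have Ssets: "S \<in> sets m"
    unfolding S_def using openin_borel_of[OF Nopen] sm spm by (metis sets.compl_sets)
  have mS: "emeasure m (A \<inter> S) = emeasure m A" if A: "A \<in> sets m" for A
  proof -
    have "A \<inter> S = A - N" using sets.sets_into_space[OF A] spm by (auto simp: S_def)
    then show ?thesis using emeasure_Diff_null_set[OF \<open>N \<in> null_sets m\<close> A] by simp
  qed
  have clS: "closedin T S" unfolding S_def using Nopen by (intro closedin_diff closedin_topspace)
  have ST: "S \<subseteq> topspace T" by (auto simp: S_def)
  obtain j0 :: "'a \<Rightarrow> real" where j0: "inj_on j0 (topspace T)" using polish_inj_real[OF T] .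
  then have j: "inj_on j0 S" using ST inj_on_subset by blast
  define e where "e = inv_into S j0"
  have ej: "e (j0 x) = x" if "x \<in> S" for x using that j by (simp add: e_def)
  \<comment> \<open>\<open>e\<close> inverts \<open>j0\<close> on \<open>S\<close>; pulling the
    topology back along it makes the set of labels a homeomorphic copy of the closed set
    \<open>S\<close>.\<close>
  define R where "R = pullback_topology (j0 ` S) e T"
  have tR: "topspace R = j0 ` S"
    unfolding R_def topspace_pullback_topology using ej ST by auto
  have eS: "e y \<in> S" if "y \<in> topspace R" for y using that ej tR by auto
  have ce: "continuous_map R T e"
    using continuous_map_pullback[OF continuous_map_id, of "j0 ` S" e T] by (simp add: R_def)
  have hom: "homeomorphic_maps R (subtopology T S) e j0"
    unfolding homeomorphic_maps_def
  proof (intro conjI ballI)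
    show "continuous_map R (subtopology T S) e"
      using ce eS by (auto simp: continuous_map_in_subtopology)
    have "continuous_map (subtopology T S) T (e \<circ> j0)"
    proof (rule continuous_map_eq)
      show "continuous_map (subtopology T S) T id" by (simp add: continuous_map_from_subtopology)
      show "\<And>x. x \<in> topspace (subtopology T S) \<Longrightarrow> id x = (e \<circ> j0) x" using ej by auto
    qed
    then show "continuous_map (subtopology T S) R j0"
      unfolding R_def by (rule continuous_map_pullback') auto
    show "j0 (e x) = x" if "x \<in> topspace R" for x using that ej tR by auto
    show "e (j0 y) = y" if "y \<in> topspace (subtopology T S)" for y using that ej by auto
  qed
  then have hs: "R homeomorphic_space subtopology T S" unfolding homeomorphic_space_def by blast
  have pR: "polish_topology R"
    using polish_homeomorphic[OF hs] polish_closed_subtopology[OF T clS] by blast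
  have pre: "j0 -` V \<inter> S = U \<inter> S" if V: "V = e -` U \<inter> j0 ` S" for U V
  proof -
    have "j0 x \<in> V \<longleftrightarrow> x \<in> U" if "x \<in> S" for x unfolding V using that ej[OF that] by simp
    then show ?thesis by auto
  qed
  have spr: "space (restrict_space m S) = S" using ST by (auto simp: space_restrict_space spm)
  have [measurable]: "j0 \<in> restrict_space m S \<rightarrow>\<^sub>M borel_of R"
  proof (rule measurable_borel_of)
    show "j0 x \<in> topspace R" if "x \<in> space (restrict_space m S)" for x using that by (auto simp: spr tR)
    fix V assume "openin R V"
    then obtain U where U: "openin T U" "V = e -` U \<inter> j0 ` S"
      unfolding R_def openin_pullback_topology by blast
    have "U \<inter> S \<in> sets m" using openin_borel_of[OF U(1)] Ssets sm by auto
    then show "j0 -` V \<inter> space (restrict_space m S) \<in> sets (restrict_space m S)"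
      unfolding spr pre[OF U(2)] using Ssets by (subst sets_restrict_space_iff) (auto simp: spm Int_absorb2[OF ST])
  qed
  \<comment> \<open>The support carries all the mass, so the restricted measure transported by
    \<open>j0\<close> is mapped back onto \<open>m\<close> by \<open>e\<close>.\<close>
  define r where "r = distr (restrict_space m S) (borel_of R) j0"
  have er: "e \<in> borel_of R \<rightarrow>\<^sub>M borel_of T" by (rule continuous_map_measurable[OF ce])
  have dr: "distr r (borel_of T) e = m"
  proof (rule measure_eqI)
    fix A assume "A \<in> sets (distr r (borel_of T) e)"
    then have A: "A \<in> sets (borel_of T)" by simp
    then have Am: "A \<in> sets m" using sm by simp
    have "emeasure (distr r (borel_of T) e) A = emeasure r (e -` A \<inter> space r)"
      using A er by (subst emeasure_distr) (simp_all add: r_def)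
    also have "\<dots> = emeasure (restrict_space m S) (j0 -` (e -` A \<inter> topspace R) \<inter> S)"
      unfolding r_def using measurable_sets[OF er A] by (subst emeasure_distr) (simp_all add: spr)
    also have "j0 -` (e -` A \<inter> topspace R) \<inter> S = A \<inter> S"
    proof -
      have "j0 x \<in> e -` A \<inter> topspace R \<longleftrightarrow> x \<in> A" if "x \<in> S" for x
        using ej[OF that] that by (simp add: tR)
      then show ?thesis by auto
    qed
    also have "emeasure (restrict_space m S) (A \<inter> S) = emeasure m (A \<inter> S)"
      using Ssets by (intro emeasure_restrict_space) auto
    also have "\<dots> = emeasure m A" by (rule mS[OF Am])
    finally show "emeasure (distr r (borel_of T) e) A = emeasure m A" .
  qed (simp add: sm)
  show ?thesis
  proof (rule that[OF pR ce _ _ dr])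
    show "sets r = sets (borel_of R)" by (simp add: r_def)
    show "fully_supported R r"
      unfolding fully_supported_def
    proof (intro allI impI)
      fix V assume V: "openin R V \<and> V \<noteq> {}"
      then obtain U where U: "openin T U" "V = e -` U \<inter> j0 ` S"
        unfolding R_def openin_pullback_topology by blast
      have Um: "U \<in> sets m" using openin_borel_of[OF U(1)] sm by simp
      obtain x where x: "x \<in> U" "x \<in> S" using V U(2) ej by auto
      obtain W where W: "W \<in> \<B>" "x \<in> W" "W \<subseteq> U" using B(3)[OF U(1) x(1)] by blast
      have "emeasure m W \<noteq> 0" using x(2) W unfolding S_def N_def by blast
      moreover have "emeasure m W \<le> emeasure m U" using W Um by (intro emeasure_mono) auto
      ultimately have "0 < emeasure m U" by (metis le_zero_eq not_gr_zero)
      moreover have "emeasure r V = emeasure m U"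
      proof -
        have "emeasure r V = emeasure (restrict_space m S) (U \<inter> S)"
          unfolding r_def using V openin_borel_of[of R V] pre[OF U(2)] by (subst emeasure_distr) (simp_all add: spr)
        also have "\<dots> = emeasure m (U \<inter> S)" using Ssets by (intro emeasure_restrict_space) auto
        finally show ?thesis using mS[OF Um] by simp
      qed
      ultimately show "0 < emeasure r V" by simp
    qed
    show "sigma_finite_measure r"
    proof -
      interpret sigma_finite_measure m by fact
      obtain A :: "nat \<Rightarrow> 'a set" where A: "range A \<subseteq> sets m" "(\<Union>i. A i) = space m" "\<And>i. emeasure m (A i) \<noteq> \<infinity>"
        by (rule sigma_finite_incseq) blast
      have AT: "A i \<in> sets (borel_of T)" for i using A(1) sm by auto
      let ?A = "\<lambda>i. e -` A i \<inter> space r"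
      have [simp]: "space r = topspace R" by (simp add: r_def)
      have em: "emeasure r (?A i) = emeasure m (A i)" for i
        using AT[of i] er unfolding dr[symmetric] by (subst emeasure_distr) (simp_all add: r_def)
      have 1: "range ?A \<subseteq> sets r" using measurable_sets[OF er AT] by (auto simp: r_def)
      have 2: "\<Union> (range ?A) = space r"
      proof -
        have "\<Union> (range ?A) = e -` (\<Union>i. A i) \<inter> space r" by auto
        moreover have "e -` topspace T \<inter> space r = space r" using eS ST by auto
        ultimately show ?thesis using A(2) spm by simp
      qed
      show ?thesis
        by standard (use 1 2 em A(3) in \<open>intro exI[of _ "range ?A"], auto\<close>)
    qed
    show "locally_compact_space R" if "locally_compact_space T"
      using that clS homeomorphic_locally_compact_space[OF hs] locally_compact_space_closed_subset by blast
  qed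
qed


lemma AE_of_distr: "distr M N f = N' \<Longrightarrow> f \<in> M \<rightarrow>\<^sub>M N \<Longrightarrow> AE x in N'. Q x \<Longrightarrow> AE x in M. Q (f x)"
  using AE_distrD by blast

text \<open>The coupled pairs, restricted to their support, form the intermediate network, with all
  data read from \<open>P\<close> through the first projections. Towards \<open>P\<close> the
  equations hold everywhere; towards \<open>P'\<close> they hold almost everywhere by the three
  assumptions on the data.\<close>

lemma weakly_isomorphicI:
  assumes n: "net P" "net P'" and v: "v \<in> couplings P P'"
    and s\<kappa>[measurable_cong]: "sets \<kappa> = sets (nu_of P \<Otimes>\<^sub>M nu_of P')"
    and d1: "distr \<kappa> (nu_of P) fst = nu_of P" and d2: "distr \<kappa> (nu_of P') snd = nu_of P'"
    and k: "AE w in v \<Otimes>\<^sub>M v. k_of P (fst (fst w)) (fst (snd w)) = k_of P' (snd (fst w)) (snd (snd w))"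
    and io: "AE z in \<kappa>. iota_of P (fst z) = iota_of P' (snd z)"
    and om: "AE w in v \<Otimes>\<^sub>M \<kappa>. omega_of P (fst (fst w)) (fst (snd w)) = omega_of P' (snd (fst w)) (snd (snd w))"
  shows "weakly_isomorphic P P'"
proof -
  interpret A: net2 P P' using n by (simp add: net2_def)
  note sv[measurable_cong] = A.couplingsD(1)[OF v]
  interpret V: prob_space v by (rule A.couplingsD(2)[OF v])
  let ?X = "prod_topology (X_of P) (X_of P')" and ?Y = "prod_topology (Y_of P) (Y_of P')"
  have pX: "polish_topology ?X" and pY: "polish_topology ?Y"
    by (intro polish_prod A.P.polish A.P'.polish)+
  have sX: "sets (borel_of ?X) = sets (mu_of P \<Otimes>\<^sub>M mu_of P')" by (rule A.P.sets_pair_mu[OF n(2)])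
  have sY: "sets (borel_of ?Y) = sets (nu_of P \<Otimes>\<^sub>M nu_of P')"
    using sets_borel_of_prod[of "Y_of P" "Y_of P'"] A.P.polish A.P'.polish polish_second_countable
      sets_pair_measure_cong[OF A.P.sets_nu A.P'.sets_nu] by metis
  have sf\<kappa>: "sigma_finite_measure \<kappa>"
  proof -
    interpret N: sigma_finite_measure "nu_of P" by (rule A.P.sigma_finite_nu)
    obtain B :: "nat \<Rightarrow> _ set" where B: "range B \<subseteq> sets (nu_of P)" "(\<Union>i. B i) = space (nu_of P)" "\<And>i. emeasure (nu_of P) (B i) \<noteq> \<infinity>"
      by (rule N.sigma_finite_incseq) blast
    let ?B = "\<lambda>i. fst -` B i \<inter> space \<kappa>"
    have em: "emeasure \<kappa> (?B i) = emeasure (nu_of P) (B i)" for i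
    proof -
      have "emeasure (distr \<kappa> (nu_of P) fst) (B i) = emeasure \<kappa> (?B i)"
        using B(1) by (intro emeasure_distr) auto
      then show ?thesis by (simp add: d1)
    qed
    have 1: "range ?B \<subseteq> sets \<kappa>" using B(1) by (auto intro!: measurable_sets[of fst \<kappa> "nu_of P"])
    have "\<Union> (range ?B) = fst -` (\<Union>i. B i) \<inter> space \<kappa>" by auto
    also have "\<dots> = space \<kappa>" using B(2) sets_eq_imp_space_eq[OF s\<kappa>] by (auto simp: space_pair_measure)
    finally have 2: "\<Union> (range ?B) = space \<kappa>" .
    show ?thesis by standard (use 1 2 em B(3) in \<open>intro exI[of _ "range ?B"], auto\<close>)
  qed
  obtain R1 :: "real topology" and e1 r1 where R1: "polish_topology R1" "continuous_map R1 ?X e1"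
    "sets r1 = sets (borel_of R1)" "fully_supported R1 r1" "distr r1 (borel_of ?X) e1 = v" "sigma_finite_measure r1"
    by (rule real_copy_of_support[OF pX, of v]) (use sv sX V.sigma_finite_measure_axioms in auto)
  obtain R2 :: "real topology" and e2 r2 where R2: "polish_topology R2" "continuous_map R2 ?Y e2"
    "sets r2 = sets (borel_of R2)" "fully_supported R2 r2" "distr r2 (borel_of ?Y) e2 = \<kappa>" "sigma_finite_measure r2"
    "locally_compact_space ?Y \<Longrightarrow> locally_compact_space R2"
    by (rule real_copy_of_support[OF pY, of \<kappa>]) (use s\<kappa> sY sf\<kappa> in auto)
  note [measurable_cong] = R1(3) R2(3)
  have e1[measurable]: "e1 \<in> r1 \<rightarrow>\<^sub>M mu_of P \<Otimes>\<^sub>M mu_of P'"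
    using continuous_map_measurable[OF R1(2)] measurable_cong_sets[OF R1(3) sX[symmetric]] by blast
  have e2[measurable]: "e2 \<in> r2 \<rightarrow>\<^sub>M nu_of P \<Otimes>\<^sub>M nu_of P'"
    using continuous_map_measurable[OF R2(2)] measurable_cong_sets[OF R2(3) sY[symmetric]] by blast
  have dv: "distr r1 (mu_of P \<Otimes>\<^sub>M mu_of P') e1 = v"
    unfolding R1(5)[symmetric] by (rule distr_cong) (simp_all add: sX)
  have d\<kappa>: "distr r2 (nu_of P \<Otimes>\<^sub>M nu_of P') e2 = \<kappa>"
    unfolding R2(5)[symmetric] by (rule distr_cong) (simp_all add: sY)
  have sp1: "space r1 = topspace R1" and sp2: "space r2 = topspace R2"
    using sets_eq_imp_space_eq[OF R1(3)] sets_eq_imp_space_eq[OF R2(3)] by simp_all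
  define \<phi> where "\<phi> x = fst (e1 x)" for x
  define \<phi>' where "\<phi>' x = snd (e1 x)" for x
  define \<psi> where "\<psi> x = fst (e2 x)" for x
  define \<psi>' where "\<psi>' x = snd (e2 x)" for x
  have [measurable]: "\<phi> \<in> r1 \<rightarrow>\<^sub>M mu_of P" "\<phi>' \<in> r1 \<rightarrow>\<^sub>M mu_of P'" "\<psi> \<in> r2 \<rightarrow>\<^sub>M nu_of P" "\<psi>' \<in> r2 \<rightarrow>\<^sub>M nu_of P'"
    unfolding \<phi>_def \<phi>'_def \<psi>_def \<psi>'_def by measurable
  have mp: "distr r1 (mu_of P) \<phi> = mu_of P" "distr r1 (mu_of P') \<phi>' = mu_of P'"
  proof -
    have "distr r1 (mu_of P) \<phi> = distr (distr r1 (mu_of P \<Otimes>\<^sub>M mu_of P') e1) (mu_of P) fst"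
      by (subst distr_distr) (simp_all add: comp_def \<phi>_def[abs_def])
    then show "distr r1 (mu_of P) \<phi> = mu_of P" unfolding dv A.couplingsD(3)[OF v] .
    have "distr r1 (mu_of P') \<phi>' = distr (distr r1 (mu_of P \<Otimes>\<^sub>M mu_of P') e1) (mu_of P') snd"
      by (subst distr_distr) (simp_all add: comp_def \<phi>'_def[abs_def])
    then show "distr r1 (mu_of P') \<phi>' = mu_of P'" unfolding dv A.couplingsD(4)[OF v] .
  qed
  have np: "distr r2 (nu_of P) \<psi> = nu_of P" "distr r2 (nu_of P') \<psi>' = nu_of P'"
  proof -
    have "distr r2 (nu_of P) \<psi> = distr (distr r2 (nu_of P \<Otimes>\<^sub>M nu_of P') e2) (nu_of P) fst"
      by (subst distr_distr) (simp_all add: comp_def \<psi>_def[abs_def])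
    then show "distr r2 (nu_of P) \<psi> = nu_of P" unfolding d\<kappa> d1 .
    have "distr r2 (nu_of P') \<psi>' = distr (distr r2 (nu_of P \<Otimes>\<^sub>M nu_of P') e2) (nu_of P') snd"
      by (subst distr_distr) (simp_all add: comp_def \<psi>'_def[abs_def])
    then show "distr r2 (nu_of P') \<psi>' = nu_of P'" unfolding d\<kappa> d2 .
  qed
  have inX: "\<phi> x \<in> topspace (X_of P)" if "x \<in> topspace R1" for x
    using that R1(2) unfolding continuous_map_def \<phi>_def by (auto simp: Pi_iff mem_Times_iff)
  have inY: "\<psi> x \<in> topspace (Y_of P)" if "x \<in> topspace R2" for x
    using that R2(2) unfolding continuous_map_def \<psi>_def by (auto simp: Pi_iff mem_Times_iff)
  have c\<psi>: "continuous_map R2 (Y_of P) \<psi>"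
    using continuous_map_compose[OF R2(2) continuous_map_fst] by (simp add: comp_def \<psi>_def[abs_def])
  define Q :: "(real, real) network" where
    "Q = \<lparr>X_of = R1, k_of = (\<lambda>x y. k_of P (\<phi> x) (\<phi> y)), mu_of = r1, Y_of = R2,
      iota_of = (\<lambda>y. iota_of P (\<psi> y)), nu_of = r2, omega_of = (\<lambda>x y. omega_of P (\<phi> x) (\<psi> y))\<rparr>"
  have "Q \<in> networks"
    unfolding networks_def mem_Collect_eq Q_def network.simps
  proof (intro conjI)
    show "prob_space r1"
    proof (rule prob_spaceI)
      have "emeasure v (space v) = emeasure r1 (e1 -` space v \<inter> space r1)"
        unfolding dv[symmetric] by (simp add: emeasure_distr)
      moreover have "e1 -` space v \<inter> space r1 = space r1"
        using measurable_space[OF e1] sets_eq_imp_space_eq[OF sv] by auto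
      ultimately show "emeasure r1 (space r1) = 1" using V.emeasure_space_1 by simp
    qed
    show "\<forall>x\<in>topspace R1. \<forall>x'\<in>topspace R1. k_of P (\<phi> x) (\<phi> x') = k_of P (\<phi> x') (\<phi> x)"
      using A.P.P inX by (simp add: networks_def)
    have "sets (borel_of (prod_topology R1 R1)) = sets (r1 \<Otimes>\<^sub>M r1)"
      using sets_borel_of_prod[of R1 R1] R1(1) polish_second_countable sets_pair_measure_cong[OF R1(3) R1(3)] by metis
    moreover have "(\<lambda>z. k_of P (\<phi> (fst z)) (\<phi> (snd z))) \<in> borel_measurable (r1 \<Otimes>\<^sub>M r1)"
      using measurable_compose[OF _ A.P.k_measurable, of "\<lambda>z. (\<phi> (fst z), \<phi> (snd z))" "r1 \<Otimes>\<^sub>M r1"] by simp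
    ultimately show "(\<lambda>(x, x'). k_of P (\<phi> x) (\<phi> x')) \<in> borel_measurable (borel_of (prod_topology R1 R1))"
      unfolding case_prod_beta using measurable_cong_sets by blast
    have "sets (borel_of (prod_topology R1 R2)) = sets (r1 \<Otimes>\<^sub>M r2)"
      using sets_borel_of_prod[of R1 R2] R1(1) R2(1) polish_second_countable sets_pair_measure_cong[OF R1(3) R2(3)] by metis
    moreover have "(\<lambda>z. omega_of P (\<phi> (fst z)) (\<psi> (snd z))) \<in> borel_measurable (r1 \<Otimes>\<^sub>M r2)"
    proof -
      have "(\<lambda>z. omega_of P (fst z) (snd z)) \<in> borel_measurable (mu_of P \<Otimes>\<^sub>M nu_of P)"
        using A.P.omega_measurable measurable_cong_sets[OF sets_pair_measure_cong[OF refl A.P.sets_nu] refl] by blast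
      from measurable_compose[OF _ this, of "\<lambda>z. (\<phi> (fst z), \<psi> (snd z))" "r1 \<Otimes>\<^sub>M r2"] show ?thesis by simp
    qed
    ultimately show "(\<lambda>(x, y). omega_of P (\<phi> x) (\<psi> y)) \<in> borel_measurable (borel_of (prod_topology R1 R2))"
      unfolding case_prod_beta using measurable_cong_sets by blast
    obtain C where "\<forall>x\<in>topspace (X_of P). \<forall>x'\<in>topspace (X_of P). \<bar>k_of P x x'\<bar> \<le> C"
      using A.P.P by (auto simp: networks_def)
    then show "\<exists>C. \<forall>x\<in>topspace R1. \<forall>x'\<in>topspace R1. \<bar>k_of P (\<phi> x) (\<phi> x')\<bar> \<le> C"
      using inX by blast
    obtain C where "\<forall>x\<in>topspace (X_of P). \<forall>x'\<in>topspace (Y_of P). omega_of P x x' \<le> C"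
      using A.P.P by (auto simp: networks_def)
    then show "\<exists>C. \<forall>x\<in>topspace R1. \<forall>x'\<in>topspace R2. omega_of P (\<phi> x) (\<psi> x') \<le> C"
      using inX inY by blast
    show "\<forall>x\<in>topspace R1. \<forall>x'\<in>topspace R2. 0 \<le> omega_of P (\<phi> x) (\<psi> x')"
      using A.P.P inX inY by (simp add: networks_def)
    show "locally_compact_space R2"
      using A.P.P A.P'.P by (intro R2(7)) (auto simp: networks_def locally_compact_space_prod_topology)
    \<comment> \<open>A compact set lies in the preimage of its compact image in
      \<open>Y_of P\<close>, and the mass of this preimage is the finite \<nu>-mass of the
      image.\<close>
    show "radon_measure R2 r2"
    proof (rule polish_radon_measureI[OF R2(1,3,6)])
      fix K assume K: "compactin R2 K"
      have cK: "compactin (Y_of P) (\<psi> ` K)" by (rule image_compactin[OF K c\<psi>])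
      then have S: "\<psi> ` K \<in> sets (nu_of P)" using compactin_borel_of A.P.polish A.P.sets_nu by blast
      have "emeasure r2 K \<le> emeasure r2 (\<psi> -` (\<psi> ` K) \<inter> space r2)"
        using compactin_subset_topspace[OF K] sp2 by (intro emeasure_mono measurable_sets[OF _ S]) auto
      also have "\<dots> = emeasure (distr r2 (nu_of P) \<psi>) (\<psi> ` K)"
        using S by (subst emeasure_distr) auto
      also have "\<dots> < \<infinity>" unfolding np(1) by (rule A.P.nu_compact_finite[OF cK])
      finally show "emeasure r2 K < \<infinity>" .
    qed
    have ci: "continuous_map (Y_of P) (top_of_set Lam) (iota_of P)" using A.P.P by (simp add: networks_def)
    show "continuous_map R2 (top_of_set Lam) (\<lambda>y. iota_of P (\<psi> y))"
      using continuous_map_compose[OF c\<psi> ci] by (simp add: comp_def)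
    have im: "iota_of P \<in> nu_of P \<rightarrow>\<^sub>M borel_of (top_of_set Lam)"
      using A.P.iota_measurable measurable_cong_sets[OF A.P.sets_nu refl] by blast
    have "distr r2 (borel_of (top_of_set Lam)) (\<lambda>y. iota_of P (\<psi> y)) = distr (distr r2 (nu_of P) \<psi>) (borel_of (top_of_set Lam)) (iota_of P)"
      using im by (subst distr_distr) (simp_all add: comp_def)
    then show "measure_pd (distr r2 (borel_of (top_of_set Lam)) (\<lambda>y. iota_of P (\<psi> y)))"
      using A.P.P np by (simp add: networks_def)
  qed (use R1 R2 in auto)
  moreover have "is_weak_iso Q P \<phi> \<psi>"
    unfolding is_weak_iso_def measure_preserving_map_def Q_def by (simp add: mp np)
  moreover have "is_weak_iso Q P' \<phi>' \<psi>'"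
  proof -
    have 1: "AE y in r2. iota_of P (\<psi> y) = iota_of P' (\<psi>' y)"
      using AE_of_distr[OF d\<kappa> e2 io] by (simp add: \<psi>_def \<psi>'_def)
    have "sigma_finite_measure (distr r1 (mu_of P \<Otimes>\<^sub>M mu_of P') e1)"
      unfolding dv by (rule V.sigma_finite_measure_axioms)
    from pair_measure_distr[OF e1 e1 this]
    have vv: "distr (r1 \<Otimes>\<^sub>M r1) ((mu_of P \<Otimes>\<^sub>M mu_of P') \<Otimes>\<^sub>M (mu_of P \<Otimes>\<^sub>M mu_of P')) (\<lambda>(x, y). (e1 x, e1 y)) = v \<Otimes>\<^sub>M v"
      by (simp add: dv)
    have 2: "AE z in r1 \<Otimes>\<^sub>M r1. k_of P (\<phi> (fst z)) (\<phi> (snd z)) = k_of P' (\<phi>' (fst z)) (\<phi>' (snd z))"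
      using AE_of_distr[OF vv _ k] by (simp add: case_prod_beta \<phi>_def \<phi>'_def)
    have "sigma_finite_measure (distr r2 (nu_of P \<Otimes>\<^sub>M nu_of P') e2)"
      unfolding d\<kappa> by (rule sf\<kappa>)
    from pair_measure_distr[OF e1 e2 this]
    have v\<kappa>: "distr (r1 \<Otimes>\<^sub>M r2) ((mu_of P \<Otimes>\<^sub>M mu_of P') \<Otimes>\<^sub>M (nu_of P \<Otimes>\<^sub>M nu_of P')) (\<lambda>(x, y). (e1 x, e2 y)) = v \<Otimes>\<^sub>M \<kappa>"
      by (simp add: dv d\<kappa>)
    have 3: "AE z in r1 \<Otimes>\<^sub>M r2. omega_of P (\<phi> (fst z)) (\<psi> (snd z)) = omega_of P' (\<phi>' (fst z)) (\<psi>' (snd z))"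
      using AE_of_distr[OF v\<kappa> _ om] by (simp add: case_prod_beta \<phi>_def \<phi>'_def \<psi>_def \<psi>'_def)
    show ?thesis
      unfolding is_weak_iso_def measure_preserving_map_def Q_def network.simps case_prod_beta
      by (intro conjI mp np 1 2 3) measurable
  qed
  ultimately show ?thesis unfolding weakly_isomorphic_def by blast
qed

subsection \<open>Couplings of cost zero\<close>

lemma rect_conv_subseq:
  assumes "rect_conv \<alpha> \<beta> \<tau> \<tau>0" "strict_mono r"
  shows "rect_conv \<alpha> \<beta> (\<lambda>n. \<tau> (r n)) \<tau>0"
proof -
  have "(\<lambda>n. measure (\<tau> (r n)) (A \<times> B)) \<longlonglongrightarrow> measure \<tau>0 (A \<times> B)" if "A \<in> sets \<alpha>" "B \<in> sets \<beta>" for A B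
    using LIMSEQ_subseq_LIMSEQ[OF _ assms(2), of "\<lambda>n. measure (\<tau> n) (A \<times> B)"] assms(1) that
    unfolding rect_conv_def comp_def by blast
  then show ?thesis using assms(1) unfolding rect_conv_def by simp
qed

text \<open>The comparison is additive in both directions, so that it makes sense for extended
  reals; subtraction takes place only after the passage to real values.\<close>

lemma real_limit_unique:
  assumes x: "\<And>n. x n \<noteq> top" and I: "I \<noteq> top" and d: "\<delta> \<longlonglongrightarrow> 0" "\<And>n. 0 \<le> \<delta> n"
    and le: "\<And>n. x n \<le> I + ennreal (\<delta> n)" "\<And>n. I \<le> x n + ennreal (\<delta> n)"
    and lim: "(\<lambda>n. enn2real (x n)) \<longlonglongrightarrow> l"
  shows "l = enn2real I"
proof -
  have "\<bar>enn2real (x n) - enn2real I\<bar> \<le> \<delta> n" for n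
  proof -
    obtain a b where a: "x n = ennreal a" "0 \<le> a" and b: "I = ennreal b" "0 \<le> b"
      using x[of n] I by (metis ennreal_cases)
    have "a \<le> b + \<delta> n" "b \<le> a + \<delta> n"
      using le[of n] a b d(2)[of n] by (simp_all flip: ennreal_plus)
    then show ?thesis using a b by simp
  qed
  then have "(\<lambda>n. enn2real (x n) - enn2real I) \<longlonglongrightarrow> 0"
    by (intro Lim_null_comparison[OF _ d(1)] always_eventually allI) (simp add: real_norm_def)
  then have "(\<lambda>n. enn2real (x n)) \<longlonglongrightarrow> enn2real I" by (rule LIM_zero_cancel)
  with lim show ?thesis by (rule LIMSEQ_unique)
qed

text \<open>Truncated persistence, the weight that makes the edge couplings finite.\<close>

definition am :: "('a, 'b) network \<Rightarrow> 'b option \<Rightarrow> real" where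
  "am P y = max 0 (min 1 (pers P y))"

lemma am_bounds: "0 \<le> am P y" "am P y \<le> 1" and am_None [simp]: "am P None = 0"
  by (auto simp: am_def pers_def)

text \<open>Truncation is a contraction, and the length is a difference of two coordinates each
  bounded by the norm, hence the factor 2. Against the diagonal the length is, up to sign, exactly
  twice a coordinate of \<open>l - Proj l\<close>.\<close>

lemma am_diff_le:
  assumes p: "1 \<le> p"
  shows "\<bar>am P y - am P' y'\<bar> \<le> 2 * lam_dist p (iota_bar P y) (iota_bar P' y')"
proof -
  have "\<bar>am P y - am P' y'\<bar> \<le> \<bar>pers P y - pers P' y'\<bar>"
    unfolding am_def by linarith
  also have "\<dots> \<le> 2 * lam_dist p (iota_bar P y) (iota_bar P' y')"
  proof -
    have h: "\<bar>snd l - fst l\<bar> \<le> 2 * lp_norm p (l - Proj l)" for l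
      using abs_fst_le_lp_norm[OF p, of "l - Proj l"] by (simp add: Proj_def field_simps)
    have g: "\<bar>(snd l - fst l) - (snd l' - fst l')\<bar> \<le> 2 * lp_norm p (l - l')" for l l'
      using abs_fst_le_lp_norm[OF p, of "l - l'"] abs_snd_le_lp_norm[OF p, of "l - l'"] by auto
    show ?thesis using h g by (cases y; cases y') (auto simp: pers_def iota_bar_def abs_minus_commute)
  qed
  finally show ?thesis .
qed

section \<open>Weighting the edge couplings\<close>

context net
begin

lemma am_measurable [measurable]: "am P \<in> borel_measurable (Yb P)"
  unfolding am_def[abs_def] by measurable

lemma am_pos: "y \<in> topspace (Y_of P) \<Longrightarrow> 0 < am P (Some y)"
  using pers_pos by (auto simp: am_def)

definition nuh :: "'b option measure" where
  "nuh = distr (nu_of P) (Yb P) Some"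

lemma sets_nuh [simp, measurable_cong]: "sets nuh = sets (Yb P)"
  by (simp add: nuh_def)

lemma space_nuh: "space nuh = space (Yb P)"
  by (simp add: nuh_def)

lemma Some_nu [measurable]: "Some \<in> nu_of P \<rightarrow>\<^sub>M Yb P"
  using continuous_map_measurable[OF continuous_map_Some] measurable_cong_sets[OF sets_nu refl] by blast

lemma am_integrable: "(\<integral>\<^sup>+ y. ennreal (am P y) \<partial>nuh) < \<infinity>"
proof -
  have "(\<integral>\<^sup>+ y. ennreal (am P y) \<partial>nuh) = (\<integral>\<^sup>+ y. ennreal (am P (Some y)) \<partial>nu_of P)"
    unfolding nuh_def by (rule nn_integral_distr) measurable
  also have "\<dots> \<le> (\<integral>\<^sup>+ y. ennreal (pers P (Some y)) \<partial>nu_of P)"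
    using pers_pos space_nu by (intro nn_integral_mono ennreal_leI) (auto simp: am_def less_imp_le)
  also have "\<dots> < \<infinity>" by (rule pers_integrable)
  finally show ?thesis .
qed

lemma AE_nuh: "AE y in nuh. y \<noteq> None"
proof (rule AE_I'[OF null_setsI])
  have "Some -` {None} \<inter> space (nu_of P) = {}" by auto
  then show "emeasure nuh {None} = 0"
    unfolding nuh_def using bar_None_sets by (subst emeasure_distr) simp_all
qed (auto intro: None_borel_of)

text \<open>The finite measure that dominates the marginals of all weighted edge couplings, see
  \<open>wt_dominated\<close>.\<close>

definition aw :: "'b option measure" where
  "aw = density nuh (\<lambda>y. ennreal (am P y))"

lemma sets_aw [simp, measurable_cong]: "sets aw = sets (Yb P)"
  by (simp add: aw_def)

lemma space_aw: "space aw = space (Yb P)"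
  by (simp add: aw_def space_nuh)

lemma finite_aw: "finite_measure aw"
proof (rule finite_measureI)
  have "emeasure aw (space aw) = (\<integral>\<^sup>+ y. ennreal (am P y) * indicator (space (Yb P)) y \<partial>nuh)"
    unfolding space_aw unfolding aw_def using sets.top[of "Yb P"] by (intro emeasure_density) (simp_all del: space_borel_of)
  also have "\<dots> = (\<integral>\<^sup>+ y. ennreal (am P y) \<partial>nuh)"
    by (rule nn_integral_cong) (simp add: space_nuh)
  finally show "emeasure aw (space aw) \<noteq> \<infinity>" using am_integrable by simp
qed

lemma coded_aw: obtains f g where "coded aw f g"
proof -
  obtain f g where "coded (Yb P) f g" by (rule coded_Yb)
  then have "coded aw f g"
    unfolding coded_def space_aw using measurable_cong_sets[OF sets_aw refl, of cantor] measurable_cong_sets[OF refl sets_aw, of cantor] by blast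
  then show ?thesis using that by blast
qed

end

context net2
begin

text \<open>Admissibility prescribes the first marginal on proper points and allows arbitrary, even
  infinite, mass over the diagonal point; the condition \<open>g None = 0\<close> keeps that mass
  out of the integral.\<close>

lemma adm_fst:
  assumes e: "adm \<pi>" and g[measurable]: "g \<in> borel_measurable (Yb P)" and g0: "g None = 0"
  shows "(\<integral>\<^sup>+ z. g (fst z) \<partial>\<pi>) = (\<integral>\<^sup>+ y. g y \<partial>P.nuh)"
proof -
  have s[measurable_cong]: "sets \<pi> = sets (Yb P \<Otimes>\<^sub>M Yb P')"
    and m1: "\<And>A. A \<in> sets (borel_of (Y_of P)) \<Longrightarrow> emeasure \<pi> (Some ` A \<times> space (Yb P')) = emeasure (nu_of P) A"
    using e by (auto simp: adm_def)
  have sp: "space \<pi> = space (Yb P) \<times> space (Yb P')" using sets_eq_imp_space_eq[OF s] by (simp add: space_pair_measure)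
  note [measurable] = pred_eq_None
  define C where "C = {z \<in> space \<pi>. fst z \<noteq> None}"
  have C[measurable]: "C \<in> sets \<pi>" unfolding C_def by measurable
  have "distr (density \<pi> (indicator C)) (Yb P) fst = P.nuh"
  proof (rule measure_eqI)
    fix B assume "B \<in> sets (distr (density \<pi> (indicator C)) (Yb P) fst)"
    then have B[measurable]: "B \<in> sets (Yb P)" by simp
    let ?B = "Some -` B \<inter> space (nu_of P)"
    have B': "?B \<in> sets (borel_of (Y_of P))" using measurable_sets[OF P.Some_nu B] P.sets_nu by simp
    have "emeasure (distr (density \<pi> (indicator C)) (Yb P) fst) B = emeasure (density \<pi> (indicator C)) (fst -` B \<inter> space \<pi>)"
      by (subst emeasure_distr) simp_all
    also have "\<dots> = emeasure \<pi> (C \<inter> (fst -` B \<inter> space \<pi>))"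
      by (rule emeasure_restricted) simp_all
    also have "C \<inter> (fst -` B \<inter> space \<pi>) = Some ` ?B \<times> space (Yb P')"
      using sets.sets_into_space[OF B] by (auto simp: C_def sp topspace_bar P.space_nu)
    finally show "emeasure (distr (density \<pi> (indicator C)) (Yb P) fst) B = emeasure P.nuh B"
      using m1[OF B'] by (simp add: P.nuh_def emeasure_distr)
  qed simp
  then have "(\<integral>\<^sup>+ y. g y \<partial>P.nuh) = (\<integral>\<^sup>+ y. g y \<partial>distr (density \<pi> (indicator C)) (Yb P) fst)" by simp
  also have "\<dots> = (\<integral>\<^sup>+ z. indicator C z * g (fst z) \<partial>\<pi>)"
    by (subst nn_integral_distr) (simp_all add: nn_integral_density)
  also have "\<dots> = (\<integral>\<^sup>+ z. g (fst z) \<partial>\<pi>)"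
    using g0 by (intro nn_integral_cong) (auto simp: C_def indicator_def)
  finally show ?thesis by simp
qed

lemma adm_snd:
  assumes e: "adm \<pi>" and g[measurable]: "g \<in> borel_measurable (Yb P')" and g0: "g None = 0"
  shows "(\<integral>\<^sup>+ z. g (snd z) \<partial>\<pi>) = (\<integral>\<^sup>+ y. g y \<partial>P'.nuh)"
proof -
  have s[measurable_cong]: "sets \<pi> = sets (Yb P \<Otimes>\<^sub>M Yb P')"
    and m1: "\<And>A. A \<in> sets (borel_of (Y_of P')) \<Longrightarrow> emeasure \<pi> (space (Yb P) \<times> Some ` A) = emeasure (nu_of P') A"
    using e by (auto simp: adm_def)
  have sp: "space \<pi> = space (Yb P) \<times> space (Yb P')" using sets_eq_imp_space_eq[OF s] by (simp add: space_pair_measure)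
  note [measurable] = pred_eq_None
  define C where "C = {z \<in> space \<pi>. snd z \<noteq> None}"
  have C[measurable]: "C \<in> sets \<pi>" unfolding C_def by measurable
  have "distr (density \<pi> (indicator C)) (Yb P') snd = P'.nuh"
  proof (rule measure_eqI)
    fix B assume "B \<in> sets (distr (density \<pi> (indicator C)) (Yb P') snd)"
    then have B[measurable]: "B \<in> sets (Yb P')" by simp
    let ?B = "Some -` B \<inter> space (nu_of P')"
    have B': "?B \<in> sets (borel_of (Y_of P'))" using measurable_sets[OF P'.Some_nu B] P'.sets_nu by simp
    have "emeasure (distr (density \<pi> (indicator C)) (Yb P') snd) B = emeasure (density \<pi> (indicator C)) (snd -` B \<inter> space \<pi>)"
      by (subst emeasure_distr) simp_all
    also have "\<dots> = emeasure \<pi> (C \<inter> (snd -` B \<inter> space \<pi>))"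
      by (rule emeasure_restricted) simp_all
    also have "C \<inter> (snd -` B \<inter> space \<pi>) = space (Yb P) \<times> Some ` ?B"
      using sets.sets_into_space[OF B] by (auto simp: C_def sp topspace_bar P'.space_nu)
    finally show "emeasure (distr (density \<pi> (indicator C)) (Yb P') snd) B = emeasure P'.nuh B"
      using m1[OF B'] by (simp add: P'.nuh_def emeasure_distr)
  qed simp
  then have "(\<integral>\<^sup>+ y. g y \<partial>P'.nuh) = (\<integral>\<^sup>+ y. g y \<partial>distr (density \<pi> (indicator C)) (Yb P') snd)" by simp
  also have "\<dots> = (\<integral>\<^sup>+ z. indicator C z * g (snd z) \<partial>\<pi>)"
    by (subst nn_integral_distr) (simp_all add: nn_integral_density)
  also have "\<dots> = (\<integral>\<^sup>+ z. g (snd z) \<partial>\<pi>)"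
    using g0 by (intro nn_integral_cong) (auto simp: C_def indicator_def)
  finally show ?thesis by simp
qed

text \<open>Off the diagonal, \<open>r \<le> \<epsilon> + \<epsilon>\<^sup>1\<^sup>-\<^sup>p r\<^sup>p\<close> bounds the first power of the ground distance.\<close>

lemma am_diff_integral_le:
  assumes p: "1 \<le> p" and e: "adm \<pi>" and eps: "0 < \<epsilon>" "\<epsilon> \<le> 1"
    and c: "(\<integral>\<^sup>+ z. ennreal (lam_dist p (iota_bar P (fst z)) (iota_bar P' (snd z)) powr p) \<partial>\<pi>) \<le> ennreal (\<epsilon> powr p)"
  shows "(\<integral>\<^sup>+ z. ennreal ((am P (fst z) + am P' (snd z)) * \<bar>am P (fst z) - am P' (snd z)\<bar>) \<partial>\<pi>)
    \<le> ennreal (2 * \<epsilon>) * ((\<integral>\<^sup>+ y. ennreal (am P y) \<partial>P.nuh) + (\<integral>\<^sup>+ y. ennreal (am P' y) \<partial>P'.nuh) + 2)"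
proof -
  have s[measurable_cong]: "sets \<pi> = sets (Yb P \<Otimes>\<^sub>M Yb P')" using e by (auto simp: adm_def)
  let ?l = "\<lambda>z. lam_dist p (iota_bar P (fst z)) (iota_bar P' (snd z))"
  have pw: "ennreal ((am P (fst z) + am P' (snd z)) * \<bar>am P (fst z) - am P' (snd z)\<bar>)
     \<le> ennreal (2 * \<epsilon>) * (ennreal (am P (fst z)) + ennreal (am P' (snd z))) + ennreal (4 * \<epsilon> powr (1 - p)) * ennreal (?l z powr p)" for z
  proof -
    define a b l where "a = am P (fst z)" and "b = am P' (snd z)" and "l = ?l z"
    have ab: "0 \<le> a" "a \<le> 1" "0 \<le> b" "b \<le> 1" using am_bounds by (auto simp: a_def b_def)
    have "0 \<le> 2 * l" unfolding l_def by (rule order_trans[OF abs_ge_zero am_diff_le[OF p]])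
    then have l0: "0 \<le> l" by simp
    have "l \<le> \<epsilon> + \<epsilon> powr (1 - p) * l powr p"
    proof (cases "l \<le> \<epsilon>")
      case True
      then show ?thesis by (simp add: add_increasing2)
    next
      case False
      have "l = l powr (1 - p) * l powr p" using False eps by (simp flip: powr_add)
      also have "\<dots> \<le> \<epsilon> powr (1 - p) * l powr p"
        using False eps p by (intro mult_right_mono powr_mono2') auto
      finally show ?thesis using eps by simp
    qed
    then have "(a + b) * \<bar>a - b\<bar> \<le> (a + b) * (2 * (\<epsilon> + \<epsilon> powr (1 - p) * l powr p))"
      using am_diff_le[OF p, of P "fst z" P' "snd z"] ab unfolding a_def[symmetric] b_def[symmetric] l_def[symmetric]
      by (intro mult_left_mono) auto
    also have "\<dots> = 2 * \<epsilon> * (a + b) + (a + b) * (2 * \<epsilon> powr (1 - p) * l powr p)"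
      by (simp add: algebra_simps)
    \<comment> \<open>The factor \<open>a + b\<close> is replaced by 2 in the second term only; in
      the first it has to stay, because a constant need not be integrable for a possibly infinite
      \<pi>.\<close>
    also have "\<dots> \<le> 2 * \<epsilon> * (a + b) + 2 * (2 * \<epsilon> powr (1 - p) * l powr p)"
      using ab by (intro add_left_mono mult_right_mono) auto
    finally have "(a + b) * \<bar>a - b\<bar> \<le> 2 * \<epsilon> * (a + b) + 4 * \<epsilon> powr (1 - p) * l powr p" by simp
    then show ?thesis
      unfolding a_def[symmetric] b_def[symmetric] l_def[symmetric]
      using ab eps by (simp flip: ennreal_plus ennreal_mult add: ennreal_leI)
  qed
  have "(\<integral>\<^sup>+ z. ennreal ((am P (fst z) + am P' (snd z)) * \<bar>am P (fst z) - am P' (snd z)\<bar>) \<partial>\<pi>)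
    \<le> (\<integral>\<^sup>+ z. ennreal (2 * \<epsilon>) * (ennreal (am P (fst z)) + ennreal (am P' (snd z))) + ennreal (4 * \<epsilon> powr (1 - p)) * ennreal (?l z powr p) \<partial>\<pi>)"
    by (intro nn_integral_mono pw)
  also have "\<dots> = ennreal (2 * \<epsilon>) * ((\<integral>\<^sup>+ z. ennreal (am P (fst z)) \<partial>\<pi>) + (\<integral>\<^sup>+ z. ennreal (am P' (snd z)) \<partial>\<pi>))
      + ennreal (4 * \<epsilon> powr (1 - p)) * (\<integral>\<^sup>+ z. ennreal (?l z powr p) \<partial>\<pi>)"
    by (simp add: nn_integral_add nn_integral_cmult)
  also have "(\<integral>\<^sup>+ z. ennreal (am P (fst z)) \<partial>\<pi>) = (\<integral>\<^sup>+ y. ennreal (am P y) \<partial>P.nuh)"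
    by (rule adm_fst[OF e]) simp_all
  also have "(\<integral>\<^sup>+ z. ennreal (am P' (snd z)) \<partial>\<pi>) = (\<integral>\<^sup>+ y. ennreal (am P' y) \<partial>P'.nuh)"
    by (rule adm_snd[OF e]) simp_all
  also have "ennreal (4 * \<epsilon> powr (1 - p)) * (\<integral>\<^sup>+ z. ennreal (?l z powr p) \<partial>\<pi>) \<le> ennreal (4 * \<epsilon> powr (1 - p)) * ennreal (\<epsilon> powr p)"
    by (intro mult_left_mono c) simp
  \<comment> \<open>The powers of \<epsilon> combine to 4 \<epsilon>, which accounts for the summand
    2 in the bound.\<close>
  also have "\<dots> = ennreal (2 * \<epsilon>) * 2"
  proof -
    have "4 * \<epsilon> powr (1 - p) * \<epsilon> powr p = 4 * \<epsilon>" using eps by (simp flip: powr_add)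
    then show ?thesis using eps by (simp flip: ennreal_mult ennreal_numeral)
  qed
  finally show ?thesis by (simp add: distrib_left add_mono)
qed

end

context net
begin

text \<open>The weight is positive at proper points, so its square cancels against the density
  there.\<close>

lemma inverse_weight_integral:
  assumes h: "h \<in> \<rho> \<rightarrow>\<^sub>M Yb P" and d: "distr \<rho> (Yb P) h = density nuh (\<lambda>y. ennreal ((am P y)\<^sup>2))"
    and A: "A \<in> sets (borel_of (Y_of P))"
  shows "(\<integral>\<^sup>+ z. ennreal (1 / (am P (h z))\<^sup>2) * indicator (Some ` A) (h z) \<partial>\<rho>) = emeasure (nu_of P) A"
proof -
  have SA[measurable]: "Some ` A \<in> sets (Yb P)" by (rule Some_image_borel_of[OF A])
  have "(\<integral>\<^sup>+ z. ennreal (1 / (am P (h z))\<^sup>2) * indicator (Some ` A) (h z) \<partial>\<rho>)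
    = (\<integral>\<^sup>+ y. ennreal (1 / (am P y)\<^sup>2) * indicator (Some ` A) y \<partial>distr \<rho> (Yb P) h)"
    using h by (intro nn_integral_distr[symmetric]) simp_all
  also have "\<dots> = (\<integral>\<^sup>+ y. ennreal ((am P y)\<^sup>2) * (ennreal (1 / (am P y)\<^sup>2) * indicator (Some ` A) y) \<partial>nuh)"
    unfolding d by (rule nn_integral_density) simp_all
  also have "\<dots> = (\<integral>\<^sup>+ y. indicator (Some ` A) y \<partial>nuh)"
  proof (rule nn_integral_cong)
    fix y assume y: "y \<in> space nuh"
    show "ennreal ((am P y)\<^sup>2) * (ennreal (1 / (am P y)\<^sup>2) * indicator (Some ` A) y) = indicator (Some ` A) y"
    proof (cases "y \<in> Some ` A")
      case True
      then have "0 < am P y" using am_pos sets.sets_into_space[OF A] by auto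
      then have "ennreal ((am P y)\<^sup>2) * ennreal (1 / (am P y)\<^sup>2) = 1" by (simp flip: ennreal_mult)
      then show ?thesis using True by simp
    qed simp
  qed
  also have "\<dots> = emeasure nuh (Some ` A)" by simp
  also have "\<dots> = emeasure (nu_of P) (Some -` Some ` A \<inter> space (nu_of P))"
    unfolding nuh_def by (rule emeasure_distr) simp_all
  also have "Some -` Some ` A \<inter> space (nu_of P) = A"
    using sets.sets_into_space[OF A] by (auto simp: space_nu)
  finally show ?thesis .
qed

end

context net2
begin

lemma marginal_measures:
  assumes v: "v \<in> couplings P P'" and A: "A \<in> sets (mu_of P)" and B: "B \<in> sets (mu_of P')"
  shows "emeasure v (A \<times> space (mu_of P')) = emeasure (mu_of P) A"
    "emeasure v (space (mu_of P) \<times> B) = emeasure (mu_of P') B"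
proof -
  note s[measurable_cong] = couplingsD(1)[OF v]
  have sp: "space v = space (mu_of P) \<times> space (mu_of P')"
    using sets_eq_imp_space_eq[OF s] by (simp add: space_pair_measure)
  have "fst -` A \<inter> space v = A \<times> space (mu_of P')" "snd -` B \<inter> space v = space (mu_of P) \<times> B"
    using sets.sets_into_space[OF A] sets.sets_into_space[OF B] by (auto simp: sp)
  moreover have "emeasure (distr v (mu_of P) fst) A = emeasure v (fst -` A \<inter> space v)"
    "emeasure (distr v (mu_of P') snd) B = emeasure v (snd -` B \<inter> space v)"
    using A B by (auto intro!: emeasure_distr)
  ultimately show "emeasure v (A \<times> space (mu_of P')) = emeasure (mu_of P) A"
    "emeasure v (space (mu_of P) \<times> B) = emeasure (mu_of P') B"
    by (simp_all add: couplingsD(3,4)[OF v])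
qed

text \<open>The mass of a strip is the same for all couplings, hence also in the limit.\<close>

lemma coupling_limit:
  assumes v: "\<And>n. v n \<in> couplings P P'" and rc: "rect_conv (mu_of P) (mu_of P') v v0"
  shows "v0 \<in> couplings P P'"
proof -
  interpret M: prob_space "mu_of P" by (rule P.prob_mu)
  interpret M': prob_space "mu_of P'" by (rule P'.prob_mu)
  have s[measurable_cong]: "sets v0 = sets (mu_of P \<Otimes>\<^sub>M mu_of P')" and fin: "finite_measure v0"
    and lim: "\<And>A B. A \<in> sets (mu_of P) \<Longrightarrow> B \<in> sets (mu_of P') \<Longrightarrow> (\<lambda>n. measure (v n) (A \<times> B)) \<longlonglongrightarrow> measure v0 (A \<times> B)"
    using rc unfolding rect_conv_def by auto
  have sp: "space v0 = space (mu_of P) \<times> space (mu_of P')"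
    using sets_eq_imp_space_eq[OF s] by (simp add: space_pair_measure)
  have m1: "emeasure v0 (A \<times> space (mu_of P')) = emeasure (mu_of P) A" if A: "A \<in> sets (mu_of P)" for A
  proof -
    have "(\<lambda>n. measure (v n) (A \<times> space (mu_of P'))) \<longlonglongrightarrow> measure v0 (A \<times> space (mu_of P'))"
      by (rule lim[OF A sets.top])
    moreover have "measure (v n) (A \<times> space (mu_of P')) = measure (mu_of P) A" for n
      using marginal_measures(1)[OF v A sets.top] by (simp add: measure_def)
    ultimately have "measure v0 (A \<times> space (mu_of P')) = measure (mu_of P) A"
      by (simp add: LIMSEQ_const_iff)
    then show ?thesis by (simp add: finite_measure.emeasure_eq_measure[OF fin] M.emeasure_eq_measure)
  qed
  have m2: "emeasure v0 (space (mu_of P) \<times> B) = emeasure (mu_of P') B" if B: "B \<in> sets (mu_of P')" for B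
  proof -
    have "(\<lambda>n. measure (v n) (space (mu_of P) \<times> B)) \<longlonglongrightarrow> measure v0 (space (mu_of P) \<times> B)"
      by (rule lim[OF sets.top B])
    moreover have "measure (v n) (space (mu_of P) \<times> B) = measure (mu_of P') B" for n
      using marginal_measures(2)[OF v sets.top B] by (simp add: measure_def)
    ultimately have "measure v0 (space (mu_of P) \<times> B) = measure (mu_of P') B"
      by (simp add: LIMSEQ_const_iff)
    then show ?thesis by (simp add: finite_measure.emeasure_eq_measure[OF fin] M'.emeasure_eq_measure)
  qed
  show ?thesis
  proof (rule couplingsI[OF s])
    show "prob_space v0"
      using m1[OF sets.top] M.emeasure_space_1 by (intro prob_spaceI) (simp add: sp)
    show "distr v0 (mu_of P) fst = mu_of P"
    proof (rule measure_eqI)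
      fix A assume "A \<in> sets (distr v0 (mu_of P) fst)"
      then have A: "A \<in> sets (mu_of P)" by simp
      have "fst -` A \<inter> space v0 = A \<times> space (mu_of P')" using sets.sets_into_space[OF A] by (auto simp: sp)
      then show "emeasure (distr v0 (mu_of P) fst) A = emeasure (mu_of P) A"
        using A m1[OF A] by (simp add: emeasure_distr)
    qed simp
    show "distr v0 (mu_of P') snd = mu_of P'"
    proof (rule measure_eqI)
      fix A assume "A \<in> sets (distr v0 (mu_of P') snd)"
      then have A: "A \<in> sets (mu_of P')" by simp
      have "snd -` A \<inter> space v0 = space (mu_of P) \<times> A" using sets.sets_into_space[OF A] by (auto simp: sp)
      then show "emeasure (distr v0 (mu_of P') snd) A = emeasure (mu_of P') A"
        using A m2[OF A] by (simp add: emeasure_distr)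
    qed simp
  qed
qed

text \<open>A product, so that it vanishes as soon as one coordinate is on the diagonal, and so that
  each factor, being at most 1, leaves the other as a bound: both marginals are dominated.\<close>

definition wt :: "'b option \<times> 'd option \<Rightarrow> real" where
  "wt z = am P (fst z) * am P' (snd z)"

lemma wt_bounds: "0 \<le> wt z" "wt z \<le> 1"
  unfolding wt_def using am_bounds(1)[of P "fst z"] am_bounds(2)[of P "fst z"] am_bounds(1)[of P' "snd z"] am_bounds(2)[of P' "snd z"]
  by (auto intro: mult_le_one)

lemma wt_measurable [measurable]: "wt \<in> borel_measurable (Yb P \<Otimes>\<^sub>M Yb P')"
  unfolding wt_def[abs_def] by measurable

lemma wt_dominated:
  assumes e: "adm \<pi>"
  defines "\<rho> \<equiv> density \<pi> (\<lambda>z. ennreal (wt z))"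
  shows "A \<in> sets (Yb P) \<Longrightarrow> emeasure \<rho> (A \<times> space (Yb P')) \<le> emeasure P.aw A"
    and "B \<in> sets (Yb P') \<Longrightarrow> emeasure \<rho> (space (Yb P) \<times> B) \<le> emeasure P'.aw B"
proof -
  have s[measurable_cong]: "sets \<pi> = sets (Yb P \<Otimes>\<^sub>M Yb P')" using e by (auto simp: adm_def)
  show "emeasure \<rho> (A \<times> space (Yb P')) \<le> emeasure P.aw A" if A[measurable]: "A \<in> sets (Yb P)" for A
  proof -
    have "emeasure \<rho> (A \<times> space (Yb P')) = (\<integral>\<^sup>+ z. ennreal (wt z) * indicator (A \<times> space (Yb P')) z \<partial>\<pi>)"
      unfolding \<rho>_def using pair_measureI[OF A sets.top, of "Yb P'"] by (intro emeasure_density) (simp_all add: s del: space_borel_of)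
    also have "\<dots> \<le> (\<integral>\<^sup>+ z. ennreal (am P (fst z)) * indicator A (fst z) \<partial>\<pi>)"
      by (intro nn_integral_mono) (auto simp: wt_def indicator_def am_bounds intro!: ennreal_leI mult_left_le)
    also have "\<dots> = (\<integral>\<^sup>+ y. ennreal (am P y) * indicator A y \<partial>P.nuh)"
      by (rule adm_fst[OF e]) simp_all
    also have "\<dots> = emeasure P.aw A" unfolding P.aw_def by (rule emeasure_density[symmetric]) simp_all
    finally show ?thesis .
  qed
  show "emeasure \<rho> (space (Yb P) \<times> B) \<le> emeasure P'.aw B" if B[measurable]: "B \<in> sets (Yb P')" for B
  proof -
    have "emeasure \<rho> (space (Yb P) \<times> B) = (\<integral>\<^sup>+ z. ennreal (wt z) * indicator (space (Yb P) \<times> B) z \<partial>\<pi>)"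
      unfolding \<rho>_def using pair_measureI[OF sets.top B, of "Yb P"] by (intro emeasure_density) (simp_all add: s del: space_borel_of)
    also have "\<dots> \<le> (\<integral>\<^sup>+ z. ennreal (am P' (snd z)) * indicator B (snd z) \<partial>\<pi>)"
      by (intro nn_integral_mono) (auto simp: wt_def indicator_def am_bounds intro!: ennreal_leI mult_left_le_one_le)
    also have "\<dots> = (\<integral>\<^sup>+ y. ennreal (am P' y) * indicator B y \<partial>P'.nuh)"
      by (rule adm_snd[OF e]) simp_all
    also have "\<dots> = emeasure P'.aw B" unfolding P'.aw_def by (rule emeasure_density[symmetric]) simp_all
    finally show ?thesis .
  qed
qed

text \<open>The first marginal of the weighted measure differs from \<open>am\<^sup>2 d\<nu>\<close> by at most the integral
  estimated in \<open>am_diff_integral_le\<close>, and so does the second.\<close>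

lemma wt_marginals:
  assumes e: "adm \<pi>"
  defines "\<rho> \<equiv> density \<pi> (\<lambda>z. ennreal (wt z))"
    and "J \<equiv> (\<integral>\<^sup>+ z. ennreal ((am P (fst z) + am P' (snd z)) * \<bar>am P (fst z) - am P' (snd z)\<bar>) \<partial>\<pi>)"
  shows "A \<in> sets (Yb P) \<Longrightarrow> emeasure \<rho> (A \<times> space (Yb P')) \<le> emeasure (density P.nuh (\<lambda>y. ennreal ((am P y)\<^sup>2))) A + J"
    "A \<in> sets (Yb P) \<Longrightarrow> emeasure (density P.nuh (\<lambda>y. ennreal ((am P y)\<^sup>2))) A \<le> emeasure \<rho> (A \<times> space (Yb P')) + J"
    "B \<in> sets (Yb P') \<Longrightarrow> emeasure \<rho> (space (Yb P) \<times> B) \<le> emeasure (density P'.nuh (\<lambda>y. ennreal ((am P' y)\<^sup>2))) B + J"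
    "B \<in> sets (Yb P') \<Longrightarrow> emeasure (density P'.nuh (\<lambda>y. ennreal ((am P' y)\<^sup>2))) B \<le> emeasure \<rho> (space (Yb P) \<times> B) + J"
proof -
  have s[measurable_cong]: "sets \<pi> = sets (Yb P \<Otimes>\<^sub>M Yb P')" using e by (auto simp: adm_def)
  have sp: "space \<pi> = space (Yb P) \<times> space (Yb P')" using sets_eq_imp_space_eq[OF s] by (simp add: space_pair_measure)
  let ?j = "\<lambda>z. ennreal ((am P (fst z) + am P' (snd z)) * \<bar>am P (fst z) - am P' (snd z)\<bar>)"
  \<comment> \<open>Replacing one factor of a b by the other changes the product by at most the
    larger of \<open>a\<close> and \<open>b\<close> times |a - b|.\<close>
  have j: "a * b \<le> a\<^sup>2 + (a + b) * \<bar>a - b\<bar>" "a\<^sup>2 \<le> a * b + (a + b) * \<bar>a - b\<bar>"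
    "a * b \<le> b\<^sup>2 + (a + b) * \<bar>a - b\<bar>" "b\<^sup>2 \<le> a * b + (a + b) * \<bar>a - b\<bar>" if "0 \<le> a" "0 \<le> b" for a b :: real
  proof -
    have c: "x * y \<le> (a + b) * \<bar>a - b\<bar>" if "x = a \<or> x = b" "y \<le> \<bar>a - b\<bar>" for x y
    proof -
      have "x * y \<le> x * \<bar>a - b\<bar>" using that \<open>0 \<le> a\<close> \<open>0 \<le> b\<close> by (intro mult_left_mono) auto
      also have "\<dots> \<le> (a + b) * \<bar>a - b\<bar>" using that \<open>0 \<le> a\<close> \<open>0 \<le> b\<close> by (intro mult_right_mono) auto
      finally show ?thesis .
    qed
    have "a * b = a\<^sup>2 + a * (b - a)" "a\<^sup>2 = a * b + a * (a - b)" "a * b = b\<^sup>2 + b * (a - b)" "b\<^sup>2 = a * b + b * (b - a)"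
      by (simp_all add: power2_eq_square algebra_simps)
    then show "a * b \<le> a\<^sup>2 + (a + b) * \<bar>a - b\<bar>" "a\<^sup>2 \<le> a * b + (a + b) * \<bar>a - b\<bar>"
      "a * b \<le> b\<^sup>2 + (a + b) * \<bar>a - b\<bar>" "b\<^sup>2 \<le> a * b + (a + b) * \<bar>a - b\<bar>"
      using c[of a "b - a"] c[of a "a - b"] c[of b "a - b"] c[of b "b - a"]
      by (metis abs_ge_self abs_minus_commute add_left_mono)+
  qed
  have add: "(\<integral>\<^sup>+ z. f z \<partial>\<pi>) \<le> (\<integral>\<^sup>+ z. g z \<partial>\<pi>) + J"
    if [measurable]: "g \<in> borel_measurable \<pi>" and le: "\<And>z. f z \<le> g z + ?j z" for f g
  proof -
    have "(\<integral>\<^sup>+ z. f z \<partial>\<pi>) \<le> (\<integral>\<^sup>+ z. g z + ?j z \<partial>\<pi>)" by (intro nn_integral_mono le)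
    also have "\<dots> = (\<integral>\<^sup>+ z. g z \<partial>\<pi>) + J" unfolding J_def by (rule nn_integral_add) measurable
    finally show ?thesis .
  qed
  note jj = j[OF am_bounds(1)[of P] am_bounds(1)[of P']]
  have lift: "ennreal x * indicator S z \<le> ennreal y * indicator S z + ennreal w"
    if "x \<le> y + w" "0 \<le> y" "0 \<le> w" for x y w and z :: 'z and S
    using that by (cases "z \<in> S") (simp_all flip: ennreal_plus add: ennreal_leI)
  have wt0: "0 \<le> am P y * am P' y'" "0 \<le> (am P y + am P' y') * \<bar>am P y - am P' y'\<bar>" for y y'
    by (simp_all add: am_bounds)
  {
    fix A assume A[measurable]: "A \<in> sets (Yb P)"
    have "emeasure \<rho> (A \<times> space (Yb P')) = (\<integral>\<^sup>+ z. ennreal (wt z) * indicator (A \<times> space (Yb P')) z \<partial>\<pi>)"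
      unfolding \<rho>_def using pair_measureI[OF A sets.top, of "Yb P'"] by (intro emeasure_density) (simp_all add: s del: space_borel_of)
    also have "\<dots> = (\<integral>\<^sup>+ z. ennreal (am P (fst z) * am P' (snd z)) * indicator A (fst z) \<partial>\<pi>)"
      by (intro nn_integral_cong) (auto simp: wt_def indicator_def sp)
    finally have 1: "emeasure \<rho> (A \<times> space (Yb P')) = (\<integral>\<^sup>+ z. ennreal (am P (fst z) * am P' (snd z)) * indicator A (fst z) \<partial>\<pi>)" .
    have "emeasure (density P.nuh (\<lambda>y. ennreal ((am P y)\<^sup>2))) A = (\<integral>\<^sup>+ y. ennreal ((am P y)\<^sup>2) * indicator A y \<partial>P.nuh)"
      by (rule emeasure_density) simp_all
    also have "\<dots> = (\<integral>\<^sup>+ z. ennreal ((am P (fst z))\<^sup>2) * indicator A (fst z) \<partial>\<pi>)"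
      by (rule adm_fst[OF e, symmetric]) simp_all
    finally have 2: "emeasure (density P.nuh (\<lambda>y. ennreal ((am P y)\<^sup>2))) A = (\<integral>\<^sup>+ z. ennreal ((am P (fst z))\<^sup>2) * indicator A (fst z) \<partial>\<pi>)" .
    show "emeasure \<rho> (A \<times> space (Yb P')) \<le> emeasure (density P.nuh (\<lambda>y. ennreal ((am P y)\<^sup>2))) A + J"
      unfolding 1 2 by (rule add) (measurable, rule lift, rule jj, simp_all add: wt0)
    show "emeasure (density P.nuh (\<lambda>y. ennreal ((am P y)\<^sup>2))) A \<le> emeasure \<rho> (A \<times> space (Yb P')) + J"
      unfolding 1 2 by (rule add) (measurable, rule lift, rule jj, simp_all add: wt0)
  next
    fix B assume B[measurable]: "B \<in> sets (Yb P')"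
    have "emeasure \<rho> (space (Yb P) \<times> B) = (\<integral>\<^sup>+ z. ennreal (wt z) * indicator (space (Yb P) \<times> B) z \<partial>\<pi>)"
      unfolding \<rho>_def using pair_measureI[OF sets.top B, of "Yb P"] by (intro emeasure_density) (simp_all add: s del: space_borel_of)
    also have "\<dots> = (\<integral>\<^sup>+ z. ennreal (am P (fst z) * am P' (snd z)) * indicator B (snd z) \<partial>\<pi>)"
      by (intro nn_integral_cong) (auto simp: wt_def indicator_def sp)
    finally have 1: "emeasure \<rho> (space (Yb P) \<times> B) = (\<integral>\<^sup>+ z. ennreal (am P (fst z) * am P' (snd z)) * indicator B (snd z) \<partial>\<pi>)" .
    have "emeasure (density P'.nuh (\<lambda>y. ennreal ((am P' y)\<^sup>2))) B = (\<integral>\<^sup>+ y. ennreal ((am P' y)\<^sup>2) * indicator B y \<partial>P'.nuh)"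
      by (rule emeasure_density) simp_all
    also have "\<dots> = (\<integral>\<^sup>+ z. ennreal ((am P' (snd z))\<^sup>2) * indicator B (snd z) \<partial>\<pi>)"
      by (rule adm_snd[OF e, symmetric]) simp_all
    finally have 2: "emeasure (density P'.nuh (\<lambda>y. ennreal ((am P' y)\<^sup>2))) B = (\<integral>\<^sup>+ z. ennreal ((am P' (snd z))\<^sup>2) * indicator B (snd z) \<partial>\<pi>)" .
    show "emeasure \<rho> (space (Yb P) \<times> B) \<le> emeasure (density P'.nuh (\<lambda>y. ennreal ((am P' y)\<^sup>2))) B + J"
      unfolding 1 2 by (rule add) (measurable, rule lift, rule jj, simp_all add: wt0)
    show "emeasure (density P'.nuh (\<lambda>y. ennreal ((am P' y)\<^sup>2))) B \<le> emeasure \<rho> (space (Yb P) \<times> B) + J"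
      unfolding 1 2 by (rule add) (measurable, rule lift, rule jj, simp_all add: wt0)
  }
qed

text \<open>Dividing the limit of the weighted edge couplings by the weight, on which both coordinates
  agree almost everywhere, restores the marginals.\<close>

lemma unweight:
  assumes s[measurable_cong]: "sets \<rho> = sets (Yb P \<Otimes>\<^sub>M Yb P')" and fin: "finite_measure \<rho>"
    and d1: "distr \<rho> (Yb P) fst = density P.nuh (\<lambda>y. ennreal ((am P y)\<^sup>2))"
    and d2: "distr \<rho> (Yb P') snd = density P'.nuh (\<lambda>y. ennreal ((am P' y)\<^sup>2))"
    and ae: "AE z in \<rho>. am P (fst z) = am P' (snd z)"
  obtains \<kappa> where "sets \<kappa> = sets (nu_of P \<Otimes>\<^sub>M nu_of P')"
    "distr \<kappa> (nu_of P) fst = nu_of P" "distr \<kappa> (nu_of P') snd = nu_of P'"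
    "distr \<kappa> (Yb P \<Otimes>\<^sub>M Yb P') (\<lambda>z. (Some (fst z), Some (snd z))) = density \<rho> (\<lambda>z. ennreal (1 / (am P (fst z))\<^sup>2))"
proof -
  have sp: "space \<rho> = space (Yb P) \<times> space (Yb P')" using sets_eq_imp_space_eq[OF s] by (simp add: space_pair_measure)
  \<comment> \<open>Where the two factors of \<open>wt\<close> agree, \<open>wt\<close> is the
    square of either; this is the weight that is divided out.\<close>
  define D where "D = density \<rho> (\<lambda>z. ennreal (1 / (am P (fst z))\<^sup>2))"
  have sD[measurable_cong]: "sets D = sets (Yb P \<Otimes>\<^sub>M Yb P')" by (simp add: D_def s)
  have spD: "space D = space (Yb P) \<times> space (Yb P')" by (simp add: D_def sp)
  \<comment> \<open>Agreement of the two factors lets the same measure be read with the factor of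
    the second coordinate, which the computation of the second marginal requires.\<close>
  have D': "D = density \<rho> (\<lambda>z. ennreal (1 / (am P' (snd z))\<^sup>2))"
    unfolding D_def by (rule density_cong) (use ae in \<open>measurable, auto elim: eventually_mono\<close>)
  note [measurable] = pred_eq_None
  have nn: "AE z in \<rho>. fst z \<noteq> None \<and> snd z \<noteq> None"
  proof -
    have "AE y in density P.nuh (\<lambda>y. ennreal ((am P y)\<^sup>2)). y \<noteq> None"
      by (subst AE_density) (use P.AE_nuh in \<open>measurable, auto elim: eventually_mono\<close>)
    from AE_of_distr[OF d1 _ this] have 1: "AE z in \<rho>. fst z \<noteq> None" by simp
    have "AE y in density P'.nuh (\<lambda>y. ennreal ((am P' y)\<^sup>2)). y \<noteq> None"
      by (subst AE_density) (use P'.AE_nuh in \<open>measurable, auto elim: eventually_mono\<close>)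
    from AE_of_distr[OF d2 _ this] have 2: "AE z in \<rho>. snd z \<noteq> None" by simp
    show ?thesis using 1 2 by eventually_elim simp
  qed
  \<comment> \<open>\<open>D\<close> charges only pairs of proper points, so \<open>Some\<close> can
    be stripped from both coordinates.\<close>
  define S where "S = {z \<in> space D. fst z \<noteq> None \<and> snd z \<noteq> None}"
  have S[measurable]: "S \<in> sets D" unfolding S_def by measurable
  have DS: "emeasure D (X \<inter> S) = emeasure D X" if X[measurable]: "X \<in> sets D" for X
  proof -
    have "AE z in D. z \<in> X \<inter> S \<longleftrightarrow> z \<in> X"
    proof -
      have "AE z in D. fst z \<noteq> None \<and> snd z \<noteq> None"
        unfolding D_def by (subst AE_density) (use nn in \<open>measurable, auto elim: eventually_mono\<close>)
      then show ?thesis using AE_space by eventually_elim (auto simp: S_def)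
    qed
    then show ?thesis by (intro emeasure_eq_AE) auto
  qed
  let ?t = "\<lambda>z. (the (fst z), the (snd z))"
  have spR: "space (restrict_space D S) = S" by (auto simp: space_restrict_space S_def)
  have tR[measurable]: "?t \<in> restrict_space D S \<rightarrow>\<^sub>M nu_of P \<Otimes>\<^sub>M nu_of P'"
  proof (rule measurable_Pair)
    show "(\<lambda>z. the (fst z)) \<in> restrict_space D S \<rightarrow>\<^sub>M nu_of P"
    proof (rule measurableI)
      fix z assume "z \<in> space (restrict_space D S)"
      then show "the (fst z) \<in> space (nu_of P)" unfolding spR by (auto simp: S_def spD topspace_bar P.space_nu)
    next
      fix A assume A: "A \<in> sets (nu_of P)"
      then have "Some ` A \<in> sets (Yb P)" using Some_image_borel_of P.sets_nu by blast
      then have "fst -` (Some ` A) \<inter> space D \<in> sets D" by measurable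
      moreover have "(\<lambda>z. the (fst z)) -` A \<inter> space (restrict_space D S) = S \<inter> (fst -` (Some ` A) \<inter> space D)"
        unfolding spR by (auto simp: S_def)
      ultimately show "(\<lambda>z. the (fst z)) -` A \<inter> space (restrict_space D S) \<in> sets (restrict_space D S)"
        by (auto simp: sets_restrict_space)
    qed
    show "(\<lambda>z. the (snd z)) \<in> restrict_space D S \<rightarrow>\<^sub>M nu_of P'"
    proof (rule measurableI)
      fix z assume "z \<in> space (restrict_space D S)"
      then show "the (snd z) \<in> space (nu_of P')" unfolding spR by (auto simp: S_def spD topspace_bar P'.space_nu)
    next
      fix A assume A: "A \<in> sets (nu_of P')"
      then have "Some ` A \<in> sets (Yb P')" using Some_image_borel_of P'.sets_nu by blast
      then have "snd -` (Some ` A) \<inter> space D \<in> sets D" by measurable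
      moreover have "(\<lambda>z. the (snd z)) -` A \<inter> space (restrict_space D S) = S \<inter> (snd -` (Some ` A) \<inter> space D)"
        unfolding spR by (auto simp: S_def)
      ultimately show "(\<lambda>z. the (snd z)) -` A \<inter> space (restrict_space D S) \<in> sets (restrict_space D S)"
        by (auto simp: sets_restrict_space)
    qed
  qed
  define \<kappa> where "\<kappa> = distr (restrict_space D S) (nu_of P \<Otimes>\<^sub>M nu_of P') ?t"
  have s\<kappa>[measurable_cong]: "sets \<kappa> = sets (nu_of P \<Otimes>\<^sub>M nu_of P')" by (simp add: \<kappa>_def)
  note [measurable] = P.Some_nu P'.Some_nu
  let ?s = "\<lambda>z. (Some (fst z), Some (snd z))"
  have \<kappa>D: "distr \<kappa> (Yb P \<Otimes>\<^sub>M Yb P') ?s = D"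
  proof (rule measure_eqI)
    fix X assume "X \<in> sets (distr \<kappa> (Yb P \<Otimes>\<^sub>M Yb P') ?s)"
    then have X[measurable]: "X \<in> sets (Yb P \<Otimes>\<^sub>M Yb P')" by simp
    have "distr \<kappa> (Yb P \<Otimes>\<^sub>M Yb P') ?s = distr (restrict_space D S) (Yb P \<Otimes>\<^sub>M Yb P') (\<lambda>z. ?s (?t z))"
      unfolding \<kappa>_def by (subst distr_distr) (simp_all add: comp_def)
    then have "emeasure (distr \<kappa> (Yb P \<Otimes>\<^sub>M Yb P') ?s) X = emeasure (restrict_space D S) ((\<lambda>z. ?s (?t z)) -` X \<inter> S)"
      by (simp add: emeasure_distr spR)
    also have "(\<lambda>z. ?s (?t z)) -` X \<inter> S = X \<inter> S" by (auto simp: S_def)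
    also have "emeasure (restrict_space D S) (X \<inter> S) = emeasure D (X \<inter> S)"
      using S by (intro emeasure_restrict_space) auto
    also have "\<dots> = emeasure D X" by (rule DS) (simp add: sD)
    finally show "emeasure (distr \<kappa> (Yb P \<Otimes>\<^sub>M Yb P') ?s) X = emeasure D X" .
  qed (simp add: sD)
  show ?thesis
  proof (rule that[OF s\<kappa>])
    show "distr \<kappa> (nu_of P) fst = nu_of P"
    proof (rule measure_eqI)
      fix A assume "A \<in> sets (distr \<kappa> (nu_of P) fst)"
      then have A[measurable]: "A \<in> sets (nu_of P)" by simp
      then have A': "A \<in> sets (borel_of (Y_of P))" using P.sets_nu by simp
      have SA[measurable]: "Some ` A \<in> sets (Yb P)" by (rule Some_image_borel_of[OF A'])
      have "emeasure (distr \<kappa> (nu_of P) fst) A = emeasure \<kappa> (fst -` A \<inter> space \<kappa>)" by (rule emeasure_distr) simp_all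
      also have "fst -` A \<inter> space \<kappa> = ?s -` (fst -` (Some ` A) \<inter> space D) \<inter> space \<kappa>"
        using sets_eq_imp_space_eq[OF s\<kappa>] by (auto simp: spD space_pair_measure topspace_bar P.space_nu P'.space_nu)
      also have "emeasure \<kappa> \<dots> = emeasure (distr \<kappa> (Yb P \<Otimes>\<^sub>M Yb P') ?s) (fst -` (Some ` A) \<inter> space D)"
      proof (rule emeasure_distr[symmetric])
        have "fst -` (Some ` A) \<inter> space D \<in> sets D" by measurable
        then show "fst -` (Some ` A) \<inter> space D \<in> sets (Yb P \<Otimes>\<^sub>M Yb P')" by (simp add: sD)
      qed measurable
      also have "\<dots> = (\<integral>\<^sup>+ z. ennreal (1 / (am P (fst z))\<^sup>2) * indicator (fst -` (Some ` A) \<inter> space D) z \<partial>\<rho>)"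
      proof -
        have "fst -` (Some ` A) \<inter> space D \<in> sets D" by measurable
        then show ?thesis unfolding \<kappa>D unfolding D_def by (intro emeasure_density) simp_all
      qed
      also have "\<dots> = (\<integral>\<^sup>+ z. ennreal (1 / (am P (fst z))\<^sup>2) * indicator (Some ` A) (fst z) \<partial>\<rho>)"
        by (intro nn_integral_cong) (auto simp: indicator_def spD sp)
      also have "\<dots> = emeasure (nu_of P) A"
        by (rule P.inverse_weight_integral[OF _ d1 A']) simp
      finally show "emeasure (distr \<kappa> (nu_of P) fst) A = emeasure (nu_of P) A" .
    qed simp
    show "distr \<kappa> (nu_of P') snd = nu_of P'"
    proof (rule measure_eqI)
      fix A assume "A \<in> sets (distr \<kappa> (nu_of P') snd)"
      then have A[measurable]: "A \<in> sets (nu_of P')" by simp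
      then have A': "A \<in> sets (borel_of (Y_of P'))" using P'.sets_nu by simp
      have SA[measurable]: "Some ` A \<in> sets (Yb P')" by (rule Some_image_borel_of[OF A'])
      have "emeasure (distr \<kappa> (nu_of P') snd) A = emeasure \<kappa> (snd -` A \<inter> space \<kappa>)" by (rule emeasure_distr) simp_all
      also have "snd -` A \<inter> space \<kappa> = ?s -` (snd -` (Some ` A) \<inter> space D) \<inter> space \<kappa>"
        using sets_eq_imp_space_eq[OF s\<kappa>] by (auto simp: spD space_pair_measure topspace_bar P.space_nu P'.space_nu)
      also have "emeasure \<kappa> \<dots> = emeasure (distr \<kappa> (Yb P \<Otimes>\<^sub>M Yb P') ?s) (snd -` (Some ` A) \<inter> space D)"
      proof (rule emeasure_distr[symmetric])
        have "snd -` (Some ` A) \<inter> space D \<in> sets D" by measurable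
        then show "snd -` (Some ` A) \<inter> space D \<in> sets (Yb P \<Otimes>\<^sub>M Yb P')" by (simp add: sD)
      qed measurable
      also have "\<dots> = (\<integral>\<^sup>+ z. ennreal (1 / (am P' (snd z))\<^sup>2) * indicator (snd -` (Some ` A) \<inter> space D) z \<partial>\<rho>)"
      proof -
        have "snd -` (Some ` A) \<inter> space D \<in> sets D" by measurable
        then have "snd -` (Some ` A) \<inter> space D \<in> sets \<rho>" using sD s by simp
        then show ?thesis unfolding \<kappa>D by (subst (1) D') (intro emeasure_density, simp_all)
      qed
      also have "\<dots> = (\<integral>\<^sup>+ z. ennreal (1 / (am P' (snd z))\<^sup>2) * indicator (Some ` A) (snd z) \<partial>\<rho>)"
        by (intro nn_integral_cong) (auto simp: indicator_def spD sp)
      also have "\<dots> = emeasure (nu_of P') A"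
        by (rule P'.inverse_weight_integral[OF _ d2 A']) simp
      finally show "emeasure (distr \<kappa> (nu_of P') snd) A = emeasure (nu_of P') A" .
    qed simp
    show "distr \<kappa> (Yb P \<Otimes>\<^sub>M Yb P') ?s = density \<rho> (\<lambda>z. ennreal (1 / (am P (fst z))\<^sup>2))"
      unfolding \<kappa>D D_def ..
  qed
qed

end

section \<open>Distance zero forces weak isomorphism\<close>

text \<open>The vanishing cost is used twice: it forces agreement of the data in the limit, and
  through \<open>am_diff_integral_le\<close> it makes the two weights asymptotically equal, which
  determines the marginals of the weighted limit.\<close>

lemma d_zero_weak_iso:
  assumes n: "net P" "net P'" and p: "1 \<le> p" and d: "d_TpOT p P P' = 0"
  shows "weakly_isomorphic P P'"
proof -
  interpret net2 P P' using n by (simp add: net2_def)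
  interpret M: prob_space "mu_of P" by (rule P.prob_mu)
  interpret M': prob_space "mu_of P'" by (rule P'.prob_mu)
  have p0: "0 < p" using p by simp
  define \<epsilon> where "\<epsilon> n = 1 / real (Suc n)" for n
  have eps: "0 < \<epsilon> n" "\<epsilon> n \<le> 1" for n by (auto simp: \<epsilon>_def)
  have eps0: "\<epsilon> \<longlonglongrightarrow> 0" unfolding \<epsilon>_def by (rule LIMSEQ_Suc[OF lim_1_over_n])
  have "\<exists>v e. v \<in> couplings P P' \<and> adm e \<and> TpOT_cost p P P' v e \<le> ennreal (\<epsilon> n powr p)" for n
  proof -
    have "d_TpOT p P P' < ennreal (\<epsilon> n)" using eps d by simp
    from d_TpOT_less_obtain[OF n p0 eps(1) this] show ?thesis by blast
  qed
  then obtain v e where v: "\<And>n. v n \<in> couplings P P'" and e: "\<And>n. adm (e n)"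
    and cost: "\<And>n. TpOT_cost p P P' (v n) (e n) \<le> ennreal (\<epsilon> n powr p)" by metis
  have cost': "(\<integral>\<^sup>+ z. Phi p (v n) z \<partial>e n) + kcost p (v n) \<le> ennreal (\<epsilon> n powr p)" for n
    using cost[of n] cost_eq[OF v e] by simp
  \<comment> \<open>A bound by \<epsilon> itself suffices for agreement of the data; the p-th power
    is kept where \<open>am_diff_integral_le\<close> asks for it.\<close>
  have powr_eps: "\<epsilon> n powr p \<le> \<epsilon> n" for n
    using powr_mono'[of 1 p "\<epsilon> n"] eps[of n] p by simp
  have Phi_le: "(\<integral>\<^sup>+ z. Phi p (v n) z \<partial>e n) \<le> ennreal (\<epsilon> n powr p)" for n
    by (rule order_trans[OF _ cost']) simp
  have k_le: "kcost p (v n) \<le> ennreal (\<epsilon> n)" for n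
    by (rule order_trans[OF _ order_trans[OF cost' ennreal_leI[OF powr_eps]]]) simp
  have Phi_le': "(\<integral>\<^sup>+ z. Phi p (v n) z \<partial>e n) \<le> ennreal (\<epsilon> n)" for n
    by (rule order_trans[OF Phi_le ennreal_leI[OF powr_eps]])
  note sv[measurable_cong] = couplingsD(1)[OF v]
  have se[measurable_cong]: "sets (e n) = sets (Yb P \<Otimes>\<^sub>M Yb P')" for n using e[of n] by (simp add: adm_def)
  have sf_e: "sigma_finite_measure (e n)" for n by (rule adm_sigma_finite[OF e])
  define \<rho> where "\<rho> n = density (e n) (\<lambda>z. ennreal (wt z))" for n
  have saw: "sets (P.aw \<Otimes>\<^sub>M P'.aw) = sets (Yb P \<Otimes>\<^sub>M Yb P')"
    by (rule sets_pair_measure_cong) simp_all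
  have s\<rho>[measurable_cong]: "sets (\<rho> n) = sets (Yb P \<Otimes>\<^sub>M Yb P')" for n by (simp add: \<rho>_def se)
  obtain f1 g1 where c1: "coded (mu_of P) f1 g1" by (rule P.coded_mu)
  obtain f2 g2 where c2: "coded (mu_of P') f2 g2" by (rule P'.coded_mu)
  obtain f3 g3 where c3: "coded P.aw f3 g3" by (rule P.coded_aw)
  obtain f4 g4 where c4: "coded P'.aw f4 g4" by (rule P'.coded_aw)
  obtain r1 v0 where r1: "strict_mono r1" "rect_conv (mu_of P) (mu_of P') (\<lambda>n. v (r1 n)) v0"
  proof (rule rect_conv_subsequence[OF c1 c2 M.finite_measure_axioms M'.finite_measure_axioms, of v])
    show "sets (v n) = sets (mu_of P \<Otimes>\<^sub>M mu_of P')" for n by (rule sv)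
    show "emeasure (v n) (A \<times> space (mu_of P')) \<le> emeasure (mu_of P) A" if "A \<in> sets (mu_of P)" for n A
      using marginal_measures(1)[OF v that sets.top] by simp
    show "emeasure (v n) (space (mu_of P) \<times> B) \<le> emeasure (mu_of P') B" if "B \<in> sets (mu_of P')" for n B
      using marginal_measures(2)[OF v sets.top that] by simp
  qed blast
  \<comment> \<open>The edge subsequence is chosen within the vertex subsequence, so that both
    converge along \<open>r\<close>.\<close>
  obtain r2 \<rho>0 where r2: "strict_mono r2" "rect_conv P.aw P'.aw (\<lambda>n. \<rho> (r1 (r2 n))) \<rho>0"
  proof (rule rect_conv_subsequence[OF c3 c4 P.finite_aw P'.finite_aw, of "\<lambda>n. \<rho> (r1 n)"])
    show "sets (\<rho> (r1 n)) = sets (P.aw \<Otimes>\<^sub>M P'.aw)" for n by (simp only: s\<rho> saw)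
    show "emeasure (\<rho> (r1 n)) (A \<times> space P'.aw) \<le> emeasure P.aw A" if "A \<in> sets P.aw" for n A
      using wt_dominated(1)[OF e] that unfolding \<rho>_def P'.space_aw by simp
    show "emeasure (\<rho> (r1 n)) (space P.aw \<times> B) \<le> emeasure P'.aw B" if "B \<in> sets P'.aw" for n B
      using wt_dominated(2)[OF e] that unfolding \<rho>_def P.space_aw by simp
  qed blast
  define r where "r n = r1 (r2 n)" for n
  have r: "strict_mono r" unfolding r_def[abs_def] using strict_mono_o[OF r1(1) r2(1)] by (simp add: comp_def)
  have Vc: "rect_conv (mu_of P) (mu_of P') (\<lambda>n. v (r n)) v0"
    unfolding r_def by (rule rect_conv_subseq[OF r1(2) r2(1)])
  have Ec: "rect_conv P.aw P'.aw (\<lambda>n. \<rho> (r n)) \<rho>0" unfolding r_def by (rule r2(2))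
  have epsr: "(\<lambda>n. \<epsilon> (r n)) \<longlonglongrightarrow> 0" using LIMSEQ_subseq_LIMSEQ[OF eps0 r] by (simp add: comp_def)
  have eps_nn: "0 \<le> \<epsilon> n" for n using eps(1)[of n] by simp
  have v0: "v0 \<in> couplings P P'" by (rule coupling_limit[OF v Vc])
  note sv0[measurable_cong] = couplingsD(1)[OF v0]
  interpret V0: prob_space v0 by (rule couplingsD(2)[OF v0])
  have fin\<rho>0: "finite_measure \<rho>0" and s\<rho>0[measurable_cong]: "sets \<rho>0 = sets (Yb P \<Otimes>\<^sub>M Yb P')"
    and fin\<rho>: "\<And>n. finite_measure (\<rho> (r n))"
    and lim\<rho>: "\<And>A B. A \<in> sets (Yb P) \<Longrightarrow> B \<in> sets (Yb P') \<Longrightarrow> (\<lambda>n. measure (\<rho> (r n)) (A \<times> B)) \<longlonglongrightarrow> measure \<rho>0 (A \<times> B)"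
    using Ec saw unfolding rect_conv_def by auto
  interpret R0: finite_measure \<rho>0 by (rule fin\<rho>0)
  have sp\<rho>0: "space \<rho>0 = space (Yb P) \<times> space (Yb P')"
    using sets_eq_imp_space_eq[OF s\<rho>0] by (simp add: space_pair_measure)

  \<comment> \<open>Since \<open>k_of\<close> depends on two vertices, the vertex coupling is paired
    with itself.\<close>
  have kAE: "AE w in v0 \<Otimes>\<^sub>M v0. k_of P (fst (fst w)) (fst (snd w)) = k_of P' (snd (fst w)) (snd (snd w))"
  proof -
    let ?S = "(mu_of P \<Otimes>\<^sub>M mu_of P) \<Otimes>\<^sub>M (mu_of P' \<Otimes>\<^sub>M mu_of P')"
    let ?F = "\<lambda>z. k_of P (fst z) (snd z)" and ?F' = "\<lambda>z. k_of P' (fst z) (snd z)"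
    have "AE z in distr (v0 \<Otimes>\<^sub>M v0) ?S middle_swap. ?F (fst z) = ?F' (snd z)"
    proof (rule rect_conv_AE_eq[OF rect_conv_pair[OF Vc Vc] P.k_measurable P'.k_measurable p0 epsr eps_nn])
      fix n
      have "(\<integral>\<^sup>+ z. ennreal (\<bar>?F (fst z) - ?F' (snd z)\<bar> powr p) \<partial>distr (v (r n) \<Otimes>\<^sub>M v (r n)) ?S middle_swap)
        = (\<integral>\<^sup>+ z. ennreal (\<bar>?F (fst (middle_swap z)) - ?F' (snd (middle_swap z))\<bar> powr p) \<partial>(v (r n) \<Otimes>\<^sub>M v (r n)))"
        by (rule nn_integral_distr) measurable
      also have "\<dots> = kcost p (v (r n))" unfolding kcost_def by (simp add: middle_swap_def)
      also have "\<dots> \<le> ennreal (\<epsilon> (r n))" by (rule k_le)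
      finally show "(\<integral>\<^sup>+ z. ennreal (\<bar>?F (fst z) - ?F' (snd z)\<bar> powr p) \<partial>distr (v (r n) \<Otimes>\<^sub>M v (r n)) ?S middle_swap) \<le> ennreal (\<epsilon> (r n))" .
    qed
    from AE_of_distr[OF refl _ this] show ?thesis by (simp add: middle_swap_def)
  qed

  have Phi_m[measurable]: "Phi p (v n) \<in> borel_measurable (Yb P \<Otimes>\<^sub>M Yb P')" for n
    using couplingsD(1,2)[OF v] by (intro Phi_measurable)
  have \<rho>_int: "(\<integral>\<^sup>+ z. g z \<partial>\<rho> n) = (\<integral>\<^sup>+ z. ennreal (wt z) * g z \<partial>e n)" if "g \<in> borel_measurable (Yb P \<Otimes>\<^sub>M Yb P')" for g n
    using that unfolding \<rho>_def by (intro nn_integral_density) measurable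
  have wt_mult: "ennreal (wt z) * x \<le> x" for z x
    using mult_right_mono[of "ennreal (wt z)" 1 x] wt_bounds[of z] by simp

  \<comment> \<open>\<open>rect_conv_AE_eq\<close> compares real functions, so points of the plane
    are tested by functions \<open>h\<close> with Lipschitz constant 1. The value 0 at the diagonal
    point is harmless because the weight vanishes there.\<close>
  have ioAE: "AE z in \<rho>0. (case fst z of None \<Rightarrow> 0 | Some y \<Rightarrow> h (iota_of P y)) = (case snd z of None \<Rightarrow> 0 | Some y \<Rightarrow> h (iota_of P' y))"
    if h[measurable]: "h \<in> borel_measurable borel" and hl: "\<And>l l'. \<bar>h l - h l'\<bar> \<le> lp_norm p (l - l')" for h :: "real \<times> real \<Rightarrow> real"
  proof -
    let ?F = "\<lambda>y. case y of None \<Rightarrow> 0 | Some y \<Rightarrow> h (iota_of P y)" and ?F' = "\<lambda>y. case y of None \<Rightarrow> 0 | Some y \<Rightarrow> h (iota_of P' y)"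
    have mF: "?F \<in> borel_measurable P.aw" "?F' \<in> borel_measurable P'.aw"
      using P.bar_borel_measurable[OF h, of 0] P'.bar_borel_measurable[OF h, of 0]
        measurable_cong_sets[OF P.sets_aw refl] measurable_cong_sets[OF P'.sets_aw refl] by blast+
    have [measurable]: "?F \<in> borel_measurable (Yb P)" "?F' \<in> borel_measurable (Yb P')"
      by (rule P.bar_borel_measurable[OF h] P'.bar_borel_measurable[OF h])+
    show ?thesis
    proof (rule rect_conv_AE_eq[OF Ec mF p0 epsr eps_nn])
      fix n
      have "(\<integral>\<^sup>+ z. ennreal (\<bar>?F (fst z) - ?F' (snd z)\<bar> powr p) \<partial>\<rho> (r n))
        = (\<integral>\<^sup>+ z. ennreal (wt z) * ennreal (\<bar>?F (fst z) - ?F' (snd z)\<bar> powr p) \<partial>e (r n))"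
        by (rule \<rho>_int) measurable
      also have "\<dots> \<le> (\<integral>\<^sup>+ z. Phi p (v (r n)) z \<partial>e (r n))"
      proof (rule nn_integral_mono)
        fix z
        show "ennreal (wt z) * ennreal (\<bar>?F (fst z) - ?F' (snd z)\<bar> powr p) \<le> Phi p (v (r n)) z"
        proof (cases "fst z = None \<or> snd z = None")
          case True
          then have "wt z = 0" by (auto simp: wt_def)
          then show ?thesis by simp
        next
          case False
          then obtain y y' where y: "fst z = Some y" "snd z = Some y'" by auto
          have "ennreal (wt z) * ennreal (\<bar>?F (fst z) - ?F' (snd z)\<bar> powr p) \<le> ennreal (\<bar>?F (fst z) - ?F' (snd z)\<bar> powr p)"
            by (rule wt_mult)
          also have "\<dots> \<le> ennreal (lam_dist p (iota_bar P (fst z)) (iota_bar P' (snd z)) powr p)"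
            using hl p by (intro ennreal_leI powr_mono2) (auto simp: y iota_bar_def)
          also have "\<dots> \<le> Phi p (v (r n)) z" unfolding Phi_def by simp
          finally show ?thesis .
        qed
      qed
      also have "\<dots> \<le> ennreal (\<epsilon> (r n))" by (rule Phi_le')
      finally show "(\<integral>\<^sup>+ z. ennreal (\<bar>?F (fst z) - ?F' (snd z)\<bar> powr p) \<partial>\<rho> (r n)) \<le> ennreal (\<epsilon> (r n))" .
    qed
  qed
  have io1: "AE z in \<rho>0. (case fst z of None \<Rightarrow> 0 | Some y \<Rightarrow> fst (iota_of P y)) = (case snd z of None \<Rightarrow> 0 | Some y \<Rightarrow> fst (iota_of P' y))"
    using abs_fst_le_lp_norm[OF p] by (intro ioAE) (auto simp: borel_prod[symmetric] simp flip: fst_diff)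
  have io2: "AE z in \<rho>0. (case fst z of None \<Rightarrow> 0 | Some y \<Rightarrow> snd (iota_of P y)) = (case snd z of None \<Rightarrow> 0 | Some y \<Rightarrow> snd (iota_of P' y))"
    using abs_snd_le_lp_norm[OF p] by (intro ioAE) (auto simp: borel_prod[symmetric] simp flip: snd_diff)
  \<comment> \<open>Birth and death count as 0 at \<open>None\<close>, which agrees with the length
    0 there; equal births and deaths therefore give equal weights, on the diagonal as well.\<close>
  have am_eq: "AE z in \<rho>0. am P (fst z) = am P' (snd z)"
    using io1 io2 by eventually_elim (auto simp: am_def pers_def split: option.splits)

  \<comment> \<open>The vertex coupling is paired with the weighted edge coupling; as the weight is
    at most 1, weighting does not increase the cost.\<close>
  have omAE: "AE w in v0 \<Otimes>\<^sub>M \<rho>0. omega_bar P (fst (fst w)) (fst (snd w)) = omega_bar P' (snd (fst w)) (snd (snd w))"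
  proof -
    let ?S = "(mu_of P \<Otimes>\<^sub>M P.aw) \<Otimes>\<^sub>M (mu_of P' \<Otimes>\<^sub>M P'.aw)"
    let ?F = "\<lambda>z. omega_bar P (fst z) (snd z)" and ?F' = "\<lambda>z. omega_bar P' (fst z) (snd z)"
    have mF[measurable]: "?F \<in> borel_measurable (mu_of P \<Otimes>\<^sub>M P.aw)" "?F' \<in> borel_measurable (mu_of P' \<Otimes>\<^sub>M P'.aw)"
      using P.omega_bar_measurable P'.omega_bar_measurable
        measurable_cong_sets[OF sets_pair_measure_cong[OF refl P.sets_aw] refl]
        measurable_cong_sets[OF sets_pair_measure_cong[OF refl P'.sets_aw] refl] by blast+
    have ms: "middle_swap \<in> v' \<Otimes>\<^sub>M \<rho>' \<rightarrow>\<^sub>M ?S"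
      if s: "sets v' = sets (mu_of P \<Otimes>\<^sub>M mu_of P')" "sets \<rho>' = sets (Yb P \<Otimes>\<^sub>M Yb P')" for v' \<rho>'
    proof -
      have "sets (v' \<Otimes>\<^sub>M \<rho>') = sets ((mu_of P \<Otimes>\<^sub>M mu_of P') \<Otimes>\<^sub>M (P.aw \<Otimes>\<^sub>M P'.aw))"
        by (rule sets_pair_measure_cong[OF s(1)]) (simp only: s(2) saw)
      from measurable_cong_sets[OF this refl[of "sets ?S"]] show ?thesis
        using measurable_middle_swap by simp
    qed
    have "AE z in distr (v0 \<Otimes>\<^sub>M \<rho>0) ?S middle_swap. ?F (fst z) = ?F' (snd z)"
    proof (rule rect_conv_AE_eq[OF rect_conv_pair[OF Vc Ec] mF p0 epsr eps_nn])
      fix n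
      interpret V: prob_space "v (r n)" by (rule couplingsD(2)[OF v])
      interpret R: finite_measure "\<rho> (r n)" by (rule fin\<rho>)
      interpret VR: pair_sigma_finite "v (r n)" "\<rho> (r n)" ..
      let ?f = "\<lambda>w. ennreal (\<bar>omega_bar P (fst (fst w)) (fst (snd w)) - omega_bar P' (snd (fst w)) (snd (snd w))\<bar> powr p)"
      have f: "?f \<in> borel_measurable ((mu_of P \<Otimes>\<^sub>M mu_of P') \<Otimes>\<^sub>M (Yb P \<Otimes>\<^sub>M Yb P'))"
        by (intro measurable_compose[OF omega_diff_measurable, of "\<lambda>d. ennreal (\<bar>d\<bar> powr p)"]) measurable
      have f1: "?f \<in> borel_measurable (v (r n) \<Otimes>\<^sub>M \<rho> (r n))"
        using f measurable_cong_sets[OF sets_pair_measure_cong[OF sv s\<rho>] refl] by blast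
      have f2: "(\<lambda>z. \<integral>\<^sup>+ x. ?f (x, z) \<partial>v (r n)) \<in> borel_measurable (Yb P \<Otimes>\<^sub>M Yb P')"
      proof (rule V.borel_measurable_nn_integral)
        have "(\<lambda>w. (snd w, fst w)) \<in> (Yb P \<Otimes>\<^sub>M Yb P') \<Otimes>\<^sub>M v (r n) \<rightarrow>\<^sub>M (mu_of P \<Otimes>\<^sub>M mu_of P') \<Otimes>\<^sub>M (Yb P \<Otimes>\<^sub>M Yb P')"
          by measurable
        from measurable_compose[OF this f]
        show "(\<lambda>(z, x). ?f (x, z)) \<in> borel_measurable ((Yb P \<Otimes>\<^sub>M Yb P') \<Otimes>\<^sub>M v (r n))"
          unfolding case_prod_beta by simp
      qed
      have FF: "(\<lambda>z. ennreal (\<bar>?F (fst z) - ?F' (snd z)\<bar> powr p)) \<in> borel_measurable ?S"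
      proof -
        have "(\<lambda>z. ?F (fst z)) \<in> borel_measurable ?S" "(\<lambda>z. ?F' (snd z)) \<in> borel_measurable ?S"
          by (rule measurable_compose[OF measurable_fst mF(1)] measurable_compose[OF measurable_snd mF(2)])+
        then show ?thesis by measurable
      qed
      have "(\<integral>\<^sup>+ z. ennreal (\<bar>?F (fst z) - ?F' (snd z)\<bar> powr p) \<partial>distr (v (r n) \<Otimes>\<^sub>M \<rho> (r n)) ?S middle_swap)
        = (\<integral>\<^sup>+ z. ennreal (\<bar>?F (fst (middle_swap z)) - ?F' (snd (middle_swap z))\<bar> powr p) \<partial>(v (r n) \<Otimes>\<^sub>M \<rho> (r n)))"
        by (rule nn_integral_distr[OF ms[OF sv s\<rho>]]) (use FF in simp)
      also have "\<dots> = (\<integral>\<^sup>+ w. ?f w \<partial>(v (r n) \<Otimes>\<^sub>M \<rho> (r n)))" by (simp add: middle_swap_def)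
      also have "\<dots> = (\<integral>\<^sup>+ z. \<integral>\<^sup>+ x. ?f (x, z) \<partial>v (r n) \<partial>\<rho> (r n))"
        by (rule VR.nn_integral_snd[OF f1, symmetric])
      also have "\<dots> = (\<integral>\<^sup>+ z. ennreal (wt z) * (\<integral>\<^sup>+ x. ?f (x, z) \<partial>v (r n)) \<partial>e (r n))"
        by (rule \<rho>_int[OF f2])
      also have "\<dots> \<le> (\<integral>\<^sup>+ z. Phi p (v (r n)) z \<partial>e (r n))"
        by (intro nn_integral_mono order_trans[OF wt_mult]) (simp add: Phi_def)
      also have "\<dots> \<le> ennreal (\<epsilon> (r n))" by (rule Phi_le')
      finally show "(\<integral>\<^sup>+ z. ennreal (\<bar>?F (fst z) - ?F' (snd z)\<bar> powr p) \<partial>distr (v (r n) \<Otimes>\<^sub>M \<rho> (r n)) ?S middle_swap) \<le> ennreal (\<epsilon> (r n))" .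
    qed
    from AE_of_distr[OF refl ms[OF sv0 s\<rho>0] this] show ?thesis by (simp add: middle_swap_def)
  qed

  \<comment> \<open>Finite by integrability of the truncated persistence, so that \<open>J n\<close>
    is of order \<epsilon>.\<close>
  define W where "W = enn2real ((\<integral>\<^sup>+ y. ennreal (am P y) \<partial>P.nuh) + (\<integral>\<^sup>+ y. ennreal (am P' y) \<partial>P'.nuh) + 2)"
  define J where "J n = (\<integral>\<^sup>+ z. ennreal ((am P (fst z) + am P' (snd z)) * \<bar>am P (fst z) - am P' (snd z)\<bar>) \<partial>e n)" for n
  have J: "J n \<le> ennreal (2 * \<epsilon> n * W)" for n
  proof -
    have "(\<integral>\<^sup>+ z. ennreal (lam_dist p (iota_bar P (fst z)) (iota_bar P' (snd z)) powr p) \<partial>e n) \<le> (\<integral>\<^sup>+ z. Phi p (v n) z \<partial>e n)"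
      by (intro nn_integral_mono) (simp add: Phi_def)
    also have "\<dots> \<le> ennreal (\<epsilon> n powr p)" by (rule Phi_le)
    finally have "J n \<le> ennreal (2 * \<epsilon> n) * ((\<integral>\<^sup>+ y. ennreal (am P y) \<partial>P.nuh) + (\<integral>\<^sup>+ y. ennreal (am P' y) \<partial>P'.nuh) + 2)"
      unfolding J_def by (rule am_diff_integral_le[OF p e eps])
    also have "(\<integral>\<^sup>+ y. ennreal (am P y) \<partial>P.nuh) + (\<integral>\<^sup>+ y. ennreal (am P' y) \<partial>P'.nuh) + 2 = ennreal W"
      unfolding W_def using P.am_integrable P'.am_integrable by simp
    finally show ?thesis using eps_nn[of n] by (simp add: ennreal_mult W_def)
  qed
  define \<delta> where "\<delta> n = 2 * \<epsilon> (r n) * W" for n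
  have \<delta>: "\<delta> \<longlonglongrightarrow> 0" "0 \<le> \<delta> n" for n
  proof -
    have "(\<lambda>n. 2 * \<epsilon> (r n) * W) \<longlonglongrightarrow> 2 * 0 * W" by (intro tendsto_intros epsr)
    then show "\<delta> \<longlonglongrightarrow> 0" by (simp add: \<delta>_def[abs_def])
    show "0 \<le> \<delta> n" using eps_nn by (simp add: \<delta>_def W_def)
  qed
  define q where "q = density P.nuh (\<lambda>y. ennreal ((am P y)\<^sup>2))"
  define q' where "q' = density P'.nuh (\<lambda>y. ennreal ((am P' y)\<^sup>2))"
  \<comment> \<open>\<open>wt_marginals\<close> keeps the masses of a strip within
    \<open>J n\<close> of a fixed value \<open>I\<close>, so \<open>I\<close> is their
    limit.\<close>
  have marg: "measure \<rho>0 (A \<times> B) = enn2real I"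
    if A: "A \<in> sets (Yb P)" and B: "B \<in> sets (Yb P')"
      and le: "\<And>n. emeasure (\<rho> n) (A \<times> B) \<le> I + J n" "\<And>n. I \<le> emeasure (\<rho> n) (A \<times> B) + J n" for A B I
  proof (rule real_limit_unique)
    show x: "emeasure (\<rho> (r n)) (A \<times> B) \<noteq> top" for n
      using finite_measure.emeasure_finite[OF fin\<rho>] by simp
    have "I \<le> emeasure (\<rho> (r 0)) (A \<times> B) + ennreal (2 * \<epsilon> (r 0) * W)"
      by (rule order_trans[OF le(2) add_left_mono[OF J]])
    also have "\<dots> < top" using x[of 0] by (simp add: less_top)
    finally show "I \<noteq> top" by simp
    show "emeasure (\<rho> (r n)) (A \<times> B) \<le> I + ennreal (\<delta> n)" for n
      unfolding \<delta>_def by (rule order_trans[OF le(1) add_left_mono[OF J]])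
    show "I \<le> emeasure (\<rho> (r n)) (A \<times> B) + ennreal (\<delta> n)" for n
      unfolding \<delta>_def by (rule order_trans[OF le(2) add_left_mono[OF J]])
    show "(\<lambda>n. enn2real (emeasure (\<rho> (r n)) (A \<times> B))) \<longlonglongrightarrow> measure \<rho>0 (A \<times> B)"
      using lim\<rho>[OF A B] by (simp add: measure_def)
  qed (rule \<delta>)+
  have finq: "emeasure q A \<noteq> top" if A: "A \<in> sets (Yb P)" for A
  proof -
    have "emeasure q A \<le> emeasure (\<rho> (r 0)) (A \<times> space (Yb P')) + ennreal (2 * \<epsilon> (r 0) * W)"
      using wt_marginals(2)[OF e A] J order_trans[OF _ add_left_mono[OF J]] unfolding q_def \<rho>_def J_def by blast
    also have "\<dots> < top" using finite_measure.emeasure_finite[OF fin\<rho>] by (simp add: less_top)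
    finally show ?thesis by simp
  qed
  have finq': "emeasure q' B \<noteq> top" if B: "B \<in> sets (Yb P')" for B
  proof -
    have "emeasure q' B \<le> emeasure (\<rho> (r 0)) (space (Yb P) \<times> B) + ennreal (2 * \<epsilon> (r 0) * W)"
      using wt_marginals(4)[OF e B] J order_trans[OF _ add_left_mono[OF J]] unfolding q'_def \<rho>_def J_def by blast
    also have "\<dots> < top" using finite_measure.emeasure_finite[OF fin\<rho>] by (simp add: less_top)
    finally show ?thesis by simp
  qed
  have d1: "distr \<rho>0 (Yb P) fst = q"
  proof (rule measure_eqI)
    fix A assume "A \<in> sets (distr \<rho>0 (Yb P) fst)"
    then have A: "A \<in> sets (Yb P)" by simp
    have "measure \<rho>0 (A \<times> space (Yb P')) = enn2real (emeasure q A)"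
      unfolding q_def J_def using wt_marginals(1,2)[OF e A]
      by (intro marg[OF A sets.top]) (simp_all add: \<rho>_def J_def)
    then have "emeasure \<rho>0 (A \<times> space (Yb P')) = emeasure q A"
      using finq[OF A] by (simp add: R0.emeasure_eq_measure less_top)
    moreover have "fst -` A \<inter> space \<rho>0 = A \<times> space (Yb P')" using sets.sets_into_space[OF A] by (auto simp: sp\<rho>0)
    ultimately show "emeasure (distr \<rho>0 (Yb P) fst) A = emeasure q A"
      using A by (simp add: emeasure_distr)
  qed (simp add: q_def)
  have d2: "distr \<rho>0 (Yb P') snd = q'"
  proof (rule measure_eqI)
    fix B assume "B \<in> sets (distr \<rho>0 (Yb P') snd)"
    then have B: "B \<in> sets (Yb P')" by simp
    have "measure \<rho>0 (space (Yb P) \<times> B) = enn2real (emeasure q' B)"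
      unfolding q'_def J_def using wt_marginals(3,4)[OF e B]
      by (intro marg[OF sets.top B]) (simp_all add: \<rho>_def J_def)
    then have "emeasure \<rho>0 (space (Yb P) \<times> B) = emeasure q' B"
      using finq'[OF B] by (simp add: R0.emeasure_eq_measure less_top)
    moreover have "snd -` B \<inter> space \<rho>0 = space (Yb P) \<times> B" using sets.sets_into_space[OF B] by (auto simp: sp\<rho>0)
    ultimately show "emeasure (distr \<rho>0 (Yb P') snd) B = emeasure q' B"
      using B by (simp add: emeasure_distr)
  qed (simp add: q'_def)
  obtain \<kappa> where s\<kappa>[measurable_cong]: "sets \<kappa> = sets (nu_of P \<Otimes>\<^sub>M nu_of P')"
    and \<kappa>1: "distr \<kappa> (nu_of P) fst = nu_of P" and \<kappa>2: "distr \<kappa> (nu_of P') snd = nu_of P'"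
    and \<kappa>D: "distr \<kappa> (Yb P \<Otimes>\<^sub>M Yb P') (\<lambda>z. (Some (fst z), Some (snd z))) = density \<rho>0 (\<lambda>z. ennreal (1 / (am P (fst z))\<^sup>2))"
    by (rule unweight[OF s\<rho>0 fin\<rho>0 d1[unfolded q_def] d2[unfolded q'_def] am_eq])
  note [measurable] = P.Some_nu P'.Some_nu
  have Ss: "(\<lambda>z. (Some (fst z), Some (snd z))) \<in> \<kappa> \<rightarrow>\<^sub>M Yb P \<Otimes>\<^sub>M Yb P'" by measurable
  let ?u = "\<lambda>z. ennreal (1 / (am P (fst z))\<^sup>2)"
  have um[measurable]: "?u \<in> borel_measurable \<rho>0" by measurable
  \<comment> \<open>Dividing by the weight may produce infinite total mass, but the density takes
    finite values, so \<sigma>-finiteness remains.\<close>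
  have sfD: "sigma_finite_measure (density \<rho>0 ?u)"
    unfolding R0.sigma_finite_iff_density_finite[OF um] by simp
  have "AE z in \<kappa>. iota_of P (fst z) = iota_of P' (snd z)"
  proof -
    have "AE z in density \<rho>0 ?u. (case fst z of None \<Rightarrow> 0 | Some y \<Rightarrow> fst (iota_of P y)) = (case snd z of None \<Rightarrow> 0 | Some y \<Rightarrow> fst (iota_of P' y))
       \<and> (case fst z of None \<Rightarrow> 0 | Some y \<Rightarrow> snd (iota_of P y)) = (case snd z of None \<Rightarrow> 0 | Some y \<Rightarrow> snd (iota_of P' y))"
      unfolding AE_density[OF um] using io1 io2 by eventually_elim blast
    from AE_of_distr[OF \<kappa>D Ss this] show ?thesis by (simp add: prod_eq_iff)
  qed
  moreover have "AE w in v0 \<Otimes>\<^sub>M \<kappa>. omega_of P (fst (fst w)) (fst (snd w)) = omega_of P' (snd (fst w)) (snd (snd w))"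
  proof -
    \<comment> \<open>The almost everywhere statement passes from \<rho>0 to its density, and from
      there to \<kappa> along \<open>Some\<close>.\<close>
    have "v0 \<Otimes>\<^sub>M density \<rho>0 ?u = density v0 (\<lambda>_. 1) \<Otimes>\<^sub>M density \<rho>0 ?u" by (simp add: density_1)
    also have "\<dots> = density (v0 \<Otimes>\<^sub>M \<rho>0) (\<lambda>(x, y). 1 * ?u y)"
      using R0.sigma_finite_measure_axioms sfD by (intro pair_measure_density) simp_all
    finally have vd: "v0 \<Otimes>\<^sub>M density \<rho>0 ?u = density (v0 \<Otimes>\<^sub>M \<rho>0) (\<lambda>w. ?u (snd w))" by (simp add: case_prod_unfold)
    have "(\<lambda>w. ?u (snd w)) \<in> borel_measurable (v0 \<Otimes>\<^sub>M \<rho>0)" by measurable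
    from AE_density[OF this] omAE
    have aeD: "AE w in v0 \<Otimes>\<^sub>M density \<rho>0 ?u. omega_bar P (fst (fst w)) (fst (snd w)) = omega_bar P' (snd (fst w)) (snd (snd w))"
      unfolding vd by (auto elim: eventually_mono)
    have "distr v0 v0 (\<lambda>x. x) \<Otimes>\<^sub>M distr \<kappa> (Yb P \<Otimes>\<^sub>M Yb P') (\<lambda>z. (Some (fst z), Some (snd z)))
      = distr (v0 \<Otimes>\<^sub>M \<kappa>) (v0 \<Otimes>\<^sub>M (Yb P \<Otimes>\<^sub>M Yb P')) (\<lambda>(x, z). (x, (Some (fst z), Some (snd z))))"
      using sfD \<kappa>D by (intro pair_measure_distr) (simp_all add: Ss)
    then have "distr (v0 \<Otimes>\<^sub>M \<kappa>) (v0 \<Otimes>\<^sub>M (Yb P \<Otimes>\<^sub>M Yb P')) (\<lambda>(x, z). (x, (Some (fst z), Some (snd z)))) = v0 \<Otimes>\<^sub>M density \<rho>0 ?u"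
      by (simp add: distr_id2 \<kappa>D)
    from AE_of_distr[OF this _ aeD] show ?thesis by (simp add: case_prod_beta omega_bar_def)
  qed
  ultimately show ?thesis
    by (intro weakly_isomorphicI[OF n v0 s\<kappa> \<kappa>1 \<kappa>2 kAE])
qed

section \<open>The metric on the quotient\<close>

text \<open>Makes transitivity of weak isomorphism a consequence of the triangle inequality, in
  place of a direct composition of two intermediate networks.\<close>

lemma weakly_isomorphic_iff:
  assumes "net P" "net P'" "1 \<le> p"
  shows "weakly_isomorphic P P' \<longleftrightarrow> d_TpOT p P P' = 0"
  using d_zero_weak_iso[OF assms] weak_iso_d_zero[OF _ assms]
  unfolding weakly_isomorphic_def net_def by blast

text \<open>\<open>weak_iso_d_zero\<close> admits an intermediate network on any types, so
  \<open>P\<close> itself can play that role, whereas \<open>weakly_isomorphic\<close> asks for a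
  network on the reals.\<close>

lemma d_TpOT_self:
  assumes n: "net P" and p: "1 \<le> p"
  shows "d_TpOT p P P = 0"
proof (rule weak_iso_d_zero[OF n n n p])
  have "is_weak_iso P P (\<lambda>x. x) (\<lambda>y. y)"
    by (simp add: is_weak_iso_def measure_preserving_map_def distr_id2)
  then show "is_weak_iso P P (\<lambda>x. x) (\<lambda>y. y)" "is_weak_iso P P (\<lambda>x. x) (\<lambda>y. y)" by this+
qed

theorem theorem4:
  fixes p :: real
  assumes "1 \<le> p"
  shows "equiv (networks :: ('a, 'b) network set) weak_iso_rel \<and>
    (\<exists>D :: ('a, 'b) network set \<Rightarrow> ('a, 'b) network set \<Rightarrow> ennreal.
       (\<forall>P\<in>networks. \<forall>P'\<in>networks.
          D (weak_iso_rel `` {P}) (weak_iso_rel `` {P'}) = d_TpOT p P P') \<and>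
       extended_metric_on (networks // weak_iso_rel) D)"
proof -
  let ?N = "networks :: ('a, 'b) network set"
  let ?R = "weak_iso_rel :: (('a, 'b) network \<times> ('a, 'b) network) set"
  have rel: "(P, P') \<in> ?R \<longleftrightarrow> P \<in> ?N \<and> P' \<in> ?N \<and> d_TpOT p P P' = 0" for P P'
    unfolding weak_iso_rel_def using weakly_isomorphic_iff[OF net.intro net.intro assms] by blast
  have sym: "d_TpOT p P P' = d_TpOT p P' P" if "P \<in> ?N" "P' \<in> ?N" for P P'
    using that by (intro d_TpOT_commute assms net.intro)
  have tri: "d_TpOT p P Q \<le> d_TpOT p P P' + d_TpOT p P' Q" if "P \<in> ?N" "P' \<in> ?N" "Q \<in> ?N" for P P' Q
    using that by (intro d_TpOT_triangle assms net.intro)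
  have self: "d_TpOT p P P = 0" if "P \<in> ?N" for P
    using that by (intro d_TpOT_self assms net.intro)
  have eq: "equiv ?N ?R"
  proof (rule equivI)
    show "?R \<subseteq> ?N \<times> ?N" using rel by auto
    show "refl_on ?N ?R" unfolding refl_on_def using rel self by auto
    show "sym ?R" unfolding sym_def using rel sym by metis
    show "trans ?R"
    proof (rule transI)
      fix P P' Q assume "(P, P') \<in> ?R" "(P', Q) \<in> ?R"
      then show "(P, Q) \<in> ?R" using rel tri[of P P' Q] by simp
    qed
  qed
  have cong: "d_TpOT p P Q = d_TpOT p P' Q'" if "(P, P') \<in> ?R" "(Q, Q') \<in> ?R" for P P' Q Q'
  proof (rule antisym)
    have N: "P \<in> ?N" "P' \<in> ?N" "Q \<in> ?N" "Q' \<in> ?N" and 0: "d_TpOT p P P' = 0" "d_TpOT p P' P = 0" "d_TpOT p Q Q' = 0" "d_TpOT p Q' Q = 0"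
      using that rel sym by auto
    show "d_TpOT p P Q \<le> d_TpOT p P' Q'"
      using tri[of P P' Q] tri[of P' Q' Q] N 0 by simp
    show "d_TpOT p P' Q' \<le> d_TpOT p P Q"
      using tri[of P' P Q'] tri[of P Q Q'] N 0 by simp
  qed
  \<comment> \<open>Representatives are picked by choice; \<open>cong\<close> makes the value
    independent of them.\<close>
  define D where "D X Y = d_TpOT p (SOME P. P \<in> X) (SOME P. P \<in> Y)" for X Y :: "('a, 'b) network set"
  have D: "D (?R `` {P}) (?R `` {P'}) = d_TpOT p P P'" if "P \<in> ?N" "P' \<in> ?N" for P P'
  proof -
    have "(P, SOME Q. Q \<in> ?R `` {Q'}) \<in> ?R" if "P = Q'" "P \<in> ?N" for P Q'
      using someI[of "\<lambda>Q. Q \<in> ?R `` {Q'}" Q'] that rel self by auto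
    then show ?thesis unfolding D_def using that by (intro cong[symmetric]) blast+
  qed
  have "extended_metric_on (?N // ?R) D"
    unfolding extended_metric_on_def
  proof (intro conjI ballI)
    fix X Y assume "X \<in> ?N // ?R" "Y \<in> ?N // ?R"
    then obtain P Q where XY: "X = ?R `` {P}" "P \<in> ?N" "Y = ?R `` {Q}" "Q \<in> ?N"
      by (auto elim!: quotientE)
    show "D X Y = 0 \<longleftrightarrow> X = Y"
      using eq_equiv_class_iff[OF eq XY(2,4)] rel[of P Q] D[OF XY(2,4)] XY by simp
    show "D X Y = D Y X" using D[OF XY(2,4)] D[OF XY(4,2)] sym[OF XY(2,4)] XY by simp
  next
    fix X Y Z assume "X \<in> ?N // ?R" "Y \<in> ?N // ?R" "Z \<in> ?N // ?R"
    then obtain P Q S where XYZ: "X = ?R `` {P}" "P \<in> ?N" "Y = ?R `` {Q}" "Q \<in> ?N" "Z = ?R `` {S}" "S \<in> ?N"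
      by (auto elim!: quotientE)
    show "D X Z \<le> D X Y + D Y Z"
      using tri[OF XYZ(2,4,6)] D XYZ by simp
  qed
  with eq D show ?thesis by blast
qed

end
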